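(* Let $n\ge 1$ be an integer, $2\le b<n+1$, $\vartheta\in(0,\frac{\pi}{2})$, let $U\subset\mathbb R^{n+1}$ be a bounded domain containing the origin, and let $U_\vartheta=U\cap\mathcal C_\vartheta$. Put $D:=\sup_{z\in U_\vartheta}\Phi_0(z)$, $P_i=P_i(\Phi_0(z)/D)$ and $X_i=X_i(\Phi_0(z)/D)$. (i) For all $u\in C_0^\infty(U)$, $$K_\vartheta(n,b)\int_{\mathbb R^n}\frac{u^2(x,(\tan\vartheta)H_0(x))}{H_0(x)}\,dx+\frac{(b-2)^2}{4}\int_{U_\vartheta}\frac{u^2(z)}{\Phi_0^2(z)}\,dz+\frac14\sum_{i=1}^\infty\int_{U_\vartheta}\frac{P_i^2}{\Phi_0^2(z)}\,u^2(z)\,dz\le\int_{U_\vartheta}\Phi^2(\nabla u)\,dz .$$ (ii) For $k=1,2,\dots$ and $u\in C_0^\infty(U)$ set $$I_k[u]=\int_{U_\vartheta}\Phi^2(\nabla u)\,dz-K_\vartheta(n,b)\int_{\mathbb R^n}\frac{u^2(x,(\tan\vartheta)H_0(x))}{H_0(x)}\,dx-\frac{(b-2)^2}{4}\int_{U_\vartheta}\frac{u^2(z)}{\Phi_0^2(z)}\,dz-\frac14\sum_{i=1}^{k-1}\int_{U_\vartheta}\frac{P_i^2}{\Phi_0^2(z)}\,u^2(z)\,dz .$$ Then for every $k=1,2,\dots$ the constant $\frac14$ of the $k$-th remainder term is the best possible: $$\frac14=\inf_u\ \frac{I_k[u]}{\int_{U_\vartheta}\frac{P_k^2}{\Phi_0^2(z)}\,u^2(z)\,dz},$$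 the infimum being over all $u\in C_0^\infty(U)$ for which the denominator is nonzero. (iii) For each $k=1,2,\dots$ the logarithmic weight $X_k^2$ cannot be replaced by a smaller power of $X_k$: for every real $s<2$ and every $C>0$ the inequality $$C\int_{U_\vartheta}\frac{P_{k-1}^2X_k^{s}}{\Phi_0^2(z)}\,u^2(z)\,dz\le I_k[u]$$ fails for some $u\in C_0^\infty(U)$.
   Context: Points of $\mathbb R^{n+1}$ are written $z=(x,y)$, $x\in\mathbb R^n$, $y\in\mathbb R$. $\nabla u$ is the full gradient in $z=(x,y)$. $\Gamma$ is the Gamma function. $C_0^\infty(U)$ denotes real-valued smooth functions with compact support in $U$, extended by zero to $\mathbb R^{n+1}$. $H:\mathbb R^n\to[0,\infty)$ is a norm (in particular $H(\lambda\xi)=|\lambda|H(\xi)$) of class $C^2(\mathbb R^n\setminus\{0\})$ such that $H^2$ is strictly convex. Its dual norm is $H_0(x)=\sup_{\xi\in\mathbb R^n\setminus\{0\}}\frac{\langle x,\xi\rangle}{H(\xi)}$, with $\langle\cdot,\cdot\rangle$ the Euclidean inner product. On $\mathbb R^{n+1}$ one sets $\Phi(\xi,\mathrm y)=\sqrt{H^2(\xi)+\mathrm y^2}$ for $\xi\in\mathbb R^n,\ \mathrm y\in\mathbb R$, and $\Phi_0(x,y)=\sqrt{H_0^2(x)+y^2}$. The cone is $\mathcal C_\vartheta=\{(x,y)\in\mathbb R^{n+1}: y>(\tan\vartheta)H_0(x)\}$. For $0<\rho<1$ define recursively $X_1(\rho)=\frac{1}{1-\ln\rho}$, $X_k(\rho)=X_1(X_{k-1}(\rho))$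 for $k=2,3,\dots$, and $P_k(\rho)=X_1(\rho)X_2(\rho)\cdots X_k(\rho)$, with $P_0\equiv1$. For $k=1$ the sum $\sum_{i=1}^{k-1}$ is zero. $F(\mathrm a,\mathrm b;\mathrm c;\mathrm z)$ is the Gauss hypergeometric function, given by $\sum_{k\ge0}\frac{(\mathrm a)_k(\mathrm b)_k}{(\mathrm c)_k}\frac{\mathrm z^k}{k!}$ for $|\mathrm z|<1$ (with $(\mathrm a)_0=1$, $(\mathrm a)_k=\mathrm a(\mathrm a+1)\cdots(\mathrm a+k-1)$) and by analytic continuation on $\mathbb C\setminus[1,\infty)$. The constant $K_\vartheta(n,b)$ is defined as follows. Let $\beta=\frac{b-n-1}{2}$, $a_1=\frac{5-n-b}{4}$, $b_1=\frac{n+1-b}{4}$, $$C(n,b)=2\,\frac{\Gamma\left(\frac{n-b+3}{4}\right)\Gamma\left(\frac{n+b-1}{4}\right)}{\Gamma\left(\frac{n+1-b}{4}\right)\Gamma\left(\frac{n+b-3}{4}\right)},$$ $$\widetilde C=2(\cos\vartheta)^{-2}\Big[F\big(a_1,b_1;\tfrac12;-\tan^2\vartheta\big)-C(n,b)(\tan\vartheta)\,F\big(a_1+\tfrac12,b_1+\tfrac12;\tfrac32;-\tan^2\vartheta\big)\Big]^{-1}.$$ Then $$K_\vartheta(n,b)=\beta\tan\vartheta+\Big[2a_1b_1(\tan\vartheta)F\big(a_1+1,b_1+1;\tfrac32;-\tan^2\vartheta\big)+\tfrac{C(n,b)}{2}F\big(a_1+\tfrac12,b_1+\tfrac12;\tfrac32;-\tan^2\vartheta\big)$$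 $$\qquad-\tfrac{2C(n,b)}{3}\big(a_1+\tfrac12\big)\big(b_1+\tfrac12\big)(\tan^2\vartheta)F\big(a_1+\tfrac32,b_1+\tfrac32;\tfrac52;-\tan^2\vartheta\big)\Big]\,\widetilde C .$$ *)

theory Defs
  imports "HOL-Analysis.Analysis"
begin

section \<open>Smooth functions and gradients\<close>

text \<open>\<open>Ck_on k f S\<close>: \<open>f\<close> is of class \<open>C\<^sup>k\<close> on \<open>S\<close>. This is the intended notion only for open \<open>S\<close>,
  since derivatives are taken in the full space.\<close>

primrec Ck_on :: "nat \<Rightarrow> ('a::real_normed_vector \<Rightarrow> real) \<Rightarrow> 'a set \<Rightarrow> bool" where
  "Ck_on 0 f S \<longleftrightarrow> continuous_on S f"
| "Ck_on (Suc k) f S \<longleftrightarrow> (\<forall>x\<in>S. f differentiable (at x)) \<and>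
     (\<forall>v. Ck_on k (\<lambda>x. frechet_derivative f (at x) v) S)"

text \<open>\<open>C\<^sub>0\<^sup>\<infinity>(U)\<close>: as the functions are extended by zero, they are smooth on the whole space and their
  closed support is a compact subset of \<open>U\<close>.\<close>

definition test_functions :: "('a::real_normed_vector) set \<Rightarrow> ('a \<Rightarrow> real) set" where
  "test_functions U = {u. (\<forall>k. Ck_on k u UNIV) \<and>
     compact (closure {z. u z \<noteq> 0}) \<and> closure {z. u z \<noteq> 0} \<subseteq> U}"

definition grad :: "('a::real_inner \<Rightarrow> real) \<Rightarrow> 'a \<Rightarrow> 'a" where
  "grad u z = (THE D. GDERIV u z :> D)"

section \<open>Finsler norms and the cone\<close>

definition is_norm :: "('a::real_vector \<Rightarrow> real) \<Rightarrow> bool" where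
  "is_norm H \<longleftrightarrow> (\<forall>x. 0 \<le> H x) \<and> (\<forall>x. H x = 0 \<longleftrightarrow> x = 0) \<and>
     (\<forall>c x. H (c *\<^sub>R x) = \<bar>c\<bar> * H x) \<and> (\<forall>x y. H (x + y) \<le> H x + H y)"

definition strictly_convex :: "('a::real_vector \<Rightarrow> real) \<Rightarrow> bool" where
  "strictly_convex f \<longleftrightarrow> (\<forall>x y. \<forall>t\<in>{0<..<1}. x \<noteq> y \<longrightarrow>
     f ((1 - t) *\<^sub>R x + t *\<^sub>R y) < (1 - t) * f x + t * f y)"

definition dual_norm :: "('a::real_inner \<Rightarrow> real) \<Rightarrow> 'a \<Rightarrow> real" where
  "dual_norm H x = (SUP \<xi>\<in>- {0}. (x \<bullet> \<xi>) / H \<xi>)"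

definition Phi :: "('a \<Rightarrow> real) \<Rightarrow> 'a \<times> real \<Rightarrow> real" where
  "Phi H z = sqrt ((H (fst z))\<^sup>2 + (snd z)\<^sup>2)"

definition Phi0 :: "('a::real_inner \<Rightarrow> real) \<Rightarrow> 'a \<times> real \<Rightarrow> real" where
  "Phi0 H = Phi (dual_norm H)"

definition Finsler_cone :: "('a::real_inner \<Rightarrow> real) \<Rightarrow> real \<Rightarrow> ('a \<times> real) set" where
  "Finsler_cone H \<theta> = {(x, y). y > tan \<theta> * dual_norm H x}"

section \<open>Iterated logarithmic weights\<close>

text \<open>\<open>Xlog k\<close> is meant for \<open>k \<ge> 1\<close>; the convention \<open>Xlog 0 \<rho> = \<rho>\<close> only starts the recursion.\<close>

primrec Xlog :: "nat \<Rightarrow> real \<Rightarrow> real" where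
  "Xlog 0 \<rho> = \<rho>"
| "Xlog (Suc k) \<rho> = 1 / (1 - ln (Xlog k \<rho>))"

definition Plog :: "nat \<Rightarrow> real \<Rightarrow> real" where
  "Plog k \<rho> = (\<Prod>i=1..k. Xlog i \<rho>)"

section \<open>The Gauss hypergeometric function and the boundary constant\<close>

text \<open>The choice of \<open>f\<close> does not matter at points of \<open>\<complex> - [1,\<infinity>)\<close>: this set is connected, so two
  holomorphic continuations of the series agree on it.\<close>

definition hyp2F1 :: "complex \<Rightarrow> complex \<Rightarrow> complex \<Rightarrow> complex \<Rightarrow> complex" where
  "hyp2F1 a b c = (SOME f. f holomorphic_on (- (complex_of_real ` {1..})) \<and>
     (\<forall>z\<in>ball 0 1. (\<lambda>k. pochhammer a k * pochhammer b k / pochhammer c k * (z ^ k / fact k)) sums f z))"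

text \<open>For real parameters the values at real points of \<open>(-\<infinity>,1)\<close> are real, so taking the real part
  loses nothing there.\<close>

definition hyp2F1_real :: "real \<Rightarrow> real \<Rightarrow> real \<Rightarrow> real \<Rightarrow> real" where
  "hyp2F1_real a b c x =
     Re (hyp2F1 (complex_of_real a) (complex_of_real b) (complex_of_real c) (complex_of_real x))"

definition C_const :: "nat \<Rightarrow> real \<Rightarrow> real" where
  "C_const n b = 2 *
     (Gamma ((real n - b + 3) / 4) * Gamma ((real n + b - 1) / 4)) /
     (Gamma ((real n + 1 - b) / 4) * Gamma ((real n + b - 3) / 4))"

definition C_tilde :: "real \<Rightarrow> nat \<Rightarrow> real \<Rightarrow> real" where
  "C_tilde \<theta> n b =
    (let a1 = (5 - real n - b) / 4; b1 = (real n + 1 - b) / 4; \<tau> = tan \<theta> in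
     2 / (cos \<theta>)\<^sup>2 *
     inverse (hyp2F1_real a1 b1 (1/2) (- \<tau>\<^sup>2)
       - C_const n b * \<tau> * hyp2F1_real (a1 + 1/2) (b1 + 1/2) (3/2) (- \<tau>\<^sup>2)))"

definition K_const :: "real \<Rightarrow> nat \<Rightarrow> real \<Rightarrow> real" where
  "K_const \<theta> n b =
    (let \<beta> = (b - real n - 1) / 2; a1 = (5 - real n - b) / 4; b1 = (real n + 1 - b) / 4;
         \<tau> = tan \<theta> in
     \<beta> * \<tau> +
     (2 * a1 * b1 * \<tau> * hyp2F1_real (a1 + 1) (b1 + 1) (3/2) (- \<tau>\<^sup>2)
      + C_const n b / 2 * hyp2F1_real (a1 + 1/2) (b1 + 1/2) (3/2) (- \<tau>\<^sup>2)
      - 2 * C_const n b / 3 * (a1 + 1/2) * (b1 + 1/2) * \<tau>\<^sup>2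
          * hyp2F1_real (a1 + 3/2) (b1 + 3/2) (5/2) (- \<tau>\<^sup>2))
     * C_tilde \<theta> n b)"

section \<open>The functionals\<close>

definition energy ::
    "('a::euclidean_space \<Rightarrow> real) \<Rightarrow> ('a \<times> real) set \<Rightarrow> ('a \<times> real \<Rightarrow> real) \<Rightarrow> real" where
  "energy H A u = (LINT z:A|lborel. (Phi H (grad u z))\<^sup>2)"

definition boundary_term ::
    "('a::euclidean_space \<Rightarrow> real) \<Rightarrow> real \<Rightarrow> ('a \<times> real \<Rightarrow> real) \<Rightarrow> real" where
  "boundary_term H \<theta> u = (LINT x|lborel. (u (x, tan \<theta> * dual_norm H x))\<^sup>2 / dual_norm H x)"

definition outer_radius :: "('a::euclidean_space \<Rightarrow> real) \<Rightarrow> ('a \<times> real) set \<Rightarrow> real" where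
  "outer_radius H A = (SUP z\<in>A. Phi0 H z)"

definition hardy_term :: "('a::euclidean_space \<Rightarrow> real) \<Rightarrow> ('a \<times> real) set \<Rightarrow>
    (real \<Rightarrow> real) \<Rightarrow> ('a \<times> real \<Rightarrow> real) \<Rightarrow> real" where
  "hardy_term H A w u =
     (LINT z:A|lborel. w (Phi0 H z / outer_radius H A) / (Phi0 H z)\<^sup>2 * (u z)\<^sup>2)"

definition I_functional :: "('a::euclidean_space \<Rightarrow> real) \<Rightarrow> real \<Rightarrow> real \<Rightarrow> ('a \<times> real) set \<Rightarrow>
    nat \<Rightarrow> ('a \<times> real \<Rightarrow> real) \<Rightarrow> real" where
  "I_functional H \<theta> b A k u =
     energy H A u - K_const \<theta> DIM('a) b * boundary_term H \<theta> u
     - (b - 2)\<^sup>2 / 4 * hardy_term H A (\<lambda>_. 1) u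
     - 1/4 * (\<Sum>i=1..<k. hardy_term H A (\<lambda>\<rho>. (Plog i \<rho>)\<^sup>2) u)"

end

theory Submission
  imports Defs "HOL-Complex_Analysis.Complex_Analysis"
begin

text \<open>
  The inequality is a Hardy inequality proved with a vector field. Let \<open>F\<close> be a field on the cone. By the duality
  of \<open>\<Phi>\<close> and \<open>\<Phi>\<^sub>0\<close>, \<open>2 u F \<bullet> \<nabla>u - u\<^sup>2 \<Phi>\<^sub>0(F)\<^sup>2 \<le> \<Phi>(\<nabla>u)\<^sup>2\<close> at every point. Integrating the first term by parts
  produces \<open>- u\<^sup>2 div F\<close> and a flux through the boundary of the cone. So the energy is at least this flux plus the
  integral of \<open>u\<^sup>2 (- div F - \<Phi>\<^sub>0(F)\<^sup>2)\<close>, and \<open>F\<close> has to be chosen such that the last bracket is the Hardy potential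
  with the first \<open>m\<close> logarithmic terms.

  In the Euclidean case \<open>F\<close> is the logarithmic gradient of a ground state
  \<open>r\<^sup>-\<^sup>(\<^sup>n\<^sup>-\<^sup>1\<^sup>)\<^sup>/\<^sup>2 \<Psi>(y/r) (X\<^sub>1 \<cdots> X\<^sub>m)\<^sup>-\<^sup>1\<^sup>/\<^sup>2\<close>, where \<open>\<Psi>\<close> is the angular part of a superposition of Newton potentials
  with poles on the negative vertical axis. It is positive and explicit, and it satisfies an ordinary differential equation
  (\<open>Psi_ODE\<close>). In general, the gradient is replaced by a combination of the position vector and the vertical unit
  vector (\<open>F_rad\<close>, \<open>F_up\<close>) with \<open>r = \<Phi>\<^sub>0(z)\<close>. The divergence then consists of derivatives along dilations and
  along vertical lines only. Under dilations \<open>H\<^sub>0\<close> is homogeneous, on vertical lines it is constant, so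
  everything is as in the Euclidean case. The lemma \<open>Riccati\<close> is the pointwise
  identity and \<open>master_identity\<close> the integrated one. The flux is \<open>- cos \<theta> \<Psi>'/\<Psi>\<close> at \<open>sin \<theta>\<close>. That this is the
  given constant (\<open>K_const_eq\<close>) follows from uniqueness for the second order equation solved by both \<open>\<Psi>\<close> and
  the hypergeometric combination; the existence of the analytic continuation comes from Euler's integral.
  Letting \<open>m\<close> grow yields the series (\<open>hardy_series\<close>).

  For sharpness take the ground state with \<open>k\<close> logarithms times \<open>B(v)\<close>, where \<open>v\<close> is an affine function of
  \<open>1 / X\<^sub>k\<^sub>+\<^sub>1(r/D)\<close> that maps the support to an interval of length \<open>T\<close> in \<open>1 / X\<^sub>k\<^sub>+\<^sub>1\<close>. Equality in the master
  identity leaves only the square of the derivative of the extra factor (\<open>deficit_density\<close>), and the quotient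
  of the two integrals becomes \<open>1/4 + lam / T\<^sup>2\<close> with \<open>lam\<close> the Rayleigh quotient of \<open>B\<close> (\<open>deficit_total\<close>).
  Since \<open>1 / X\<^sub>k\<^sub>+\<^sub>1\<close> is unbounded at the vertex, \<open>T\<close> can be as large as desired, with support as close to the
  vertex as desired. The function is not smooth where \<open>H\<^sub>0\<close> is not; replacing \<open>H\<^sub>0\<close> by smooth approximations whose gradients
  have \<open>H\<close>-norm at most 1 (\<open>smooth_norm_approximation\<close>) gives test functions without raising the energy in the
  limit (\<open>near_optimal\<close>). Near the vertex a power \<open>X\<^sub>k\<^sup>s\<close> with \<open>s < 2\<close> is much larger than \<open>X\<^sub>k\<^sup>2\<close>, so the
  same functions refute the inequality with a smaller power (\<open>no_smaller_power\<close>).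
\<close>

section \<open>Smooth functions and gradients\<close>

lemma Ck_on_cong:
  assumes "open S" "\<And>x. x \<in> S \<Longrightarrow> f x = g x"
  shows "Ck_on k f S \<longleftrightarrow> Ck_on k g S"
  using assms(2)
proof (induction k arbitrary: f g)
  case 0
  then show ?case by (auto intro: continuous_on_cong)
next
  case (Suc k)
  have diff: "f' differentiable (at x) \<Longrightarrow> g' differentiable (at x)"
    if "x \<in> S" "\<And>x. x \<in> S \<Longrightarrow> f' x = g' x" for f' g' :: "'a \<Rightarrow> real" and x
    using has_derivative_transform_within_open[OF _ assms(1) that(1)] that(2)
    unfolding differentiable_def by metis
  have fd: "frechet_derivative f (at x) v = frechet_derivative g (at x) v"
    if "x \<in> S" "f differentiable (at x)" for x v
    using frechet_derivative_transform_within_open[OF that(2) assms(1) that(1)] Suc.prems by metis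
  have "(\<forall>v. Ck_on k (\<lambda>x. frechet_derivative f (at x) v) S) \<longleftrightarrow>
        (\<forall>v. Ck_on k (\<lambda>x. frechet_derivative g (at x) v) S)"
    if "\<forall>x\<in>S. f differentiable (at x)"
    using Suc.IH[of "\<lambda>x. frechet_derivative f (at x) v" "\<lambda>x. frechet_derivative g (at x) v" for v]
      fd that by blast
  moreover have "(\<forall>x\<in>S. f differentiable (at x)) \<longleftrightarrow> (\<forall>x\<in>S. g differentiable (at x))"
    using diff[of _ f g] diff[of _ g f] Suc.prems by metis
  ultimately show ?case by auto
qed

lemma Ck_on_SucI:
  assumes "open S" "\<And>x. x \<in> S \<Longrightarrow> (f has_derivative f' x) (at x)"
    "\<And>v. Ck_on k (\<lambda>x. f' x v) S"
  shows "Ck_on (Suc k) f S"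
proof -
  have "frechet_derivative f (at x) = f' x" if "x \<in> S" for x
    using assms(2)[OF that] frechet_derivative_at by metis
  then have "Ck_on k (\<lambda>x. frechet_derivative f (at x) v) S" for v
    using Ck_on_cong[OF assms(1), of "\<lambda>x. frechet_derivative f (at x) v" "\<lambda>x. f' x v"] assms(3)
    by auto
  then show ?thesis using assms(2) by (auto simp: differentiable_def)
qed

lemma Ck_on_subset: "Ck_on k f S \<Longrightarrow> T \<subseteq> S \<Longrightarrow> Ck_on k f T"
  by (induction k arbitrary: f) (auto intro: continuous_on_subset)

lemma Ck_on_Suc_imp: "Ck_on (Suc k) f S \<Longrightarrow> Ck_on k f S"
proof (induction k arbitrary: f)
  case 0
  then have "continuous (at x) f" if "x \<in> S" for x
    using that differentiable_imp_continuous_within by auto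
  then show ?case
    by (simp add: continuous_at_imp_continuous_on)
next
  case (Suc k)
  then show ?case by auto
qed

lemma Ck_on_Un:
  "open S \<Longrightarrow> open T \<Longrightarrow> Ck_on k f S \<Longrightarrow> Ck_on k f T \<Longrightarrow> Ck_on k f (S \<union> T)"
  by (induction k arbitrary: f) (auto intro: continuous_on_open_Un)

lemma Ck_on_const: "Ck_on k (\<lambda>x. c) (S :: 'a::real_normed_vector set)"
proof (induction k arbitrary: c)
  case (Suc k)
  have "frechet_derivative (\<lambda>x::'a. c) (at x) = (\<lambda>v. 0)" for x
    using frechet_derivative_at[of "\<lambda>x. c" "\<lambda>v. 0" x] by simp
  then show ?case using Suc by simp
qed simp

lemma Ck_on_bounded_linear:
  assumes "bounded_linear f" shows "Ck_on k f (S :: 'a::real_normed_vector set)"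
proof (cases k)
  case 0
  then show ?thesis using assms by (simp add: linear_continuous_on)
next
  case (Suc k')
  have "Ck_on (Suc k') f UNIV"
    using assms by (intro Ck_on_SucI[where f' = "\<lambda>x. f"] Ck_on_const)
      (auto intro: bounded_linear_imp_has_derivative)
  then show ?thesis using Suc Ck_on_subset by blast
qed

lemma Ck_on_add:
  assumes "open S" shows "Ck_on k f S \<Longrightarrow> Ck_on k g S \<Longrightarrow> Ck_on k (\<lambda>x. f x + g x) S"
proof (induction k arbitrary: f g)
  case 0
  then show ?case by (auto intro: continuous_on_add)
next
  case (Suc k)
  show ?case
  proof (rule Ck_on_SucI[OF assms])
    fix x assume "x \<in> S"
    then show "((\<lambda>x. f x + g x) has_derivative
        (\<lambda>v. frechet_derivative f (at x) v + frechet_derivative g (at x) v)) (at x)"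
      using Suc.prems by (auto intro!: has_derivative_add simp: frechet_derivative_works)
  qed (use Suc in auto)
qed

lemma Ck_on_mult:
  assumes "open S" shows "Ck_on k f S \<Longrightarrow> Ck_on k g S \<Longrightarrow> Ck_on k (\<lambda>x. f x * g x) S"
proof (induction k arbitrary: f g)
  case 0
  then show ?case by (auto intro: continuous_on_mult)
next
  case (Suc k)
  show ?case
  proof (rule Ck_on_SucI[OF assms])
    fix x assume "x \<in> S"
    then show "((\<lambda>x. f x * g x) has_derivative
        (\<lambda>v. f x * frechet_derivative g (at x) v + frechet_derivative f (at x) v * g x)) (at x)"
      using Suc.prems by (auto intro!: has_derivative_mult simp: frechet_derivative_works)
  next
    fix v
    have "Ck_on k f S" "Ck_on k g S" using Suc.prems Ck_on_Suc_imp by blast+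
    then show "Ck_on k (\<lambda>x. f x * frechet_derivative g (at x) v + frechet_derivative f (at x) v * g x) S"
      using Suc by (auto intro!: Ck_on_add assms)
  qed
qed

lemma Ck_on_sum:
  assumes "open S" "finite I" "\<And>i. i \<in> I \<Longrightarrow> Ck_on k (f i) S"
  shows "Ck_on k (\<lambda>x. \<Sum>i\<in>I. f i x) S"
  using assms(2,3) by (induction I rule: finite_induct) (auto intro!: Ck_on_const Ck_on_add assms(1))

text \<open>The chain rule, by induction on the order: each partial derivative of the outer function
  along \<open>f\<close> is again a composition with \<open>f\<close>.\<close>

lemma Ck_on_compose:
  fixes f :: "'a::real_normed_vector \<Rightarrow> 'b::euclidean_space"
  assumes S: "open S" and T: "open T" and fST: "f ` S \<subseteq> T"
  shows "Ck_on k h T \<Longrightarrow> (\<And>b. b \<in> Basis \<Longrightarrow> Ck_on k (\<lambda>x. f x \<bullet> b) S) \<Longrightarrow> Ck_on k (\<lambda>x. h (f x)) S"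
proof (induction k arbitrary: h)
  case 0
  then have "continuous_on S f"
    by (subst continuous_on_componentwise) auto
  then show ?case using 0 fST by (auto intro: continuous_on_compose2)
next
  case (Suc k)
  have df: "f differentiable (at x)" if "x \<in> S" for x
    using Suc.prems(2) that by (subst differentiable_componentwise_within) auto
  define f' where "f' = (\<lambda>x. frechet_derivative f (at x))"
  have f': "(f has_derivative f' x) (at x)" if "x \<in> S" for x
    using df[OF that] by (simp add: f'_def frechet_derivative_works)
  have f'b: "frechet_derivative (\<lambda>x. f x \<bullet> b) (at x) v = f' x v \<bullet> b" if "x \<in> S" for x v b
    using frechet_derivative_at[OF has_derivative_inner_left[OF f'[OF that], of b]] by metis
  show ?case
  proof (rule Ck_on_SucI[OF S])
    fix x assume x: "x \<in> S"
    then have "h differentiable (at (f x))" using Suc.prems(1) fST by auto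
    then have h': "(h has_derivative frechet_derivative h (at (f x))) (at (f x))"
      by (simp add: frechet_derivative_works)
    have eq: "frechet_derivative h (at (f x)) (f' x v) =
        (\<Sum>b\<in>Basis. frechet_derivative (\<lambda>x. f x \<bullet> b) (at x) v * frechet_derivative h (at (f x)) b)"
      (is "?L = _") for v
    proof -
      have l: "linear (frechet_derivative h (at (f x)))"
        using h' has_derivative_linear by blast
      have "?L = frechet_derivative h (at (f x)) (\<Sum>b\<in>Basis. (f' x v \<bullet> b) *\<^sub>R b)"
        by (simp add: euclidean_representation)
      also have "\<dots> = (\<Sum>b\<in>Basis. (f' x v \<bullet> b) * frechet_derivative h (at (f x)) b)"
        by (simp add: linear_sum[OF l] linear_cmul[OF l])
      finally show ?thesis using f'b[OF x] by simp
    qed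
    show "((\<lambda>x. h (f x)) has_derivative
       (\<lambda>v. \<Sum>b\<in>Basis. frechet_derivative (\<lambda>x. f x \<bullet> b) (at x) v * frechet_derivative h (at (f x)) b)) (at x)"
      using has_derivative_compose[OF f'[OF x] h'] by (simp add: eq[symmetric])
  next
    fix v
    have "Ck_on k (\<lambda>x. f x \<bullet> b) S" if "b \<in> Basis" for b
      using Suc.prems(2)[OF that] Ck_on_Suc_imp by blast
    moreover have h'k: "Ck_on k (\<lambda>y. frechet_derivative h (at y) b) T" for b
      using Suc.prems(1) by simp
    ultimately show "Ck_on k (\<lambda>x. \<Sum>b\<in>Basis. frechet_derivative (\<lambda>x. f x \<bullet> b) (at x) v *
          frechet_derivative h (at (f x)) b) S"
      using Suc.prems(2)
      by (intro Ck_on_sum Ck_on_mult S Suc.IH[OF h'k] finite_Basis) simp_all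
  qed
qed

definition smooth_on :: "'a::real_normed_vector set \<Rightarrow> ('a \<Rightarrow> real) \<Rightarrow> bool" where
  "smooth_on S f \<longleftrightarrow> (\<forall>k. Ck_on k f S)"

lemma smooth_on_const: "smooth_on S (\<lambda>x. c)"
  and smooth_on_bounded_linear: "bounded_linear f \<Longrightarrow> smooth_on S f"
  and smooth_on_subset: "smooth_on S f \<Longrightarrow> T \<subseteq> S \<Longrightarrow> smooth_on T f"
  and smooth_on_add: "open S \<Longrightarrow> smooth_on S f \<Longrightarrow> smooth_on S g \<Longrightarrow> smooth_on S (\<lambda>x. f x + g x)"
  and smooth_on_mult: "open S \<Longrightarrow> smooth_on S f \<Longrightarrow> smooth_on S g \<Longrightarrow> smooth_on S (\<lambda>x. f x * g x)"
  and smooth_on_sum: "open S \<Longrightarrow> finite I \<Longrightarrow> (\<And>i. i \<in> I \<Longrightarrow> smooth_on S (\<phi> i)) \<Longrightarrow>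
    smooth_on S (\<lambda>x. \<Sum>i\<in>I. \<phi> i x)"
  and smooth_on_Un: "open S \<Longrightarrow> open T \<Longrightarrow> smooth_on S f \<Longrightarrow> smooth_on T f \<Longrightarrow> smooth_on (S \<union> T) f"
  and smooth_on_cong: "open S \<Longrightarrow> (\<And>x. x \<in> S \<Longrightarrow> f x = g x) \<Longrightarrow> smooth_on S f \<longleftrightarrow> smooth_on S g"
  unfolding smooth_on_def
  subgoal by (simp add: Ck_on_const)
  subgoal by (simp add: Ck_on_bounded_linear)
  subgoal using Ck_on_subset by blast
  subgoal by (simp add: Ck_on_add)
  subgoal by (simp add: Ck_on_mult)
  subgoal by (simp add: Ck_on_sum)
  subgoal by (simp add: Ck_on_Un)
  subgoal using Ck_on_cong by blast
  done

lemma smooth_on_diff: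
  assumes "open S" "smooth_on S f" "smooth_on S g"
  shows "smooth_on S (\<lambda>x. f x - g x)"
proof -
  have "smooth_on S (\<lambda>x. f x + (-1) * g x)"
    by (rule smooth_on_add[OF assms(1,2) smooth_on_mult[OF assms(1) smooth_on_const assms(3)]])
  then show ?thesis by simp
qed

lemma smooth_on_compose:
  fixes h :: "real \<Rightarrow> real"
  assumes "open S" "open T" "f ` S \<subseteq> T" "smooth_on T h" "smooth_on S f"
  shows "smooth_on S (\<lambda>x. h (f x))"
  unfolding smooth_on_def
proof
  fix k
  show "Ck_on k (\<lambda>x. h (f x)) S"
  proof (rule Ck_on_compose[OF assms(1-3)])
    show "Ck_on k h T" using assms(4) by (simp add: smooth_on_def)
    show "Ck_on k (\<lambda>x. f x \<bullet> b) S" if "b \<in> Basis" for b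
      using assms(5) that by (simp add: smooth_on_def)
  qed
qed

lemma smooth_on_compose2:
  fixes h :: "real \<times> real \<Rightarrow> real"
  assumes "open S" "open T" "\<And>x. x \<in> S \<Longrightarrow> (f x, g x) \<in> T" "smooth_on T h" "smooth_on S f" "smooth_on S g"
  shows "smooth_on S (\<lambda>x. h (f x, g x))"
  unfolding smooth_on_def
proof
  fix k
  show "Ck_on k (\<lambda>x. h (f x, g x)) S"
  proof (rule Ck_on_compose[OF assms(1,2)])
    show "(\<lambda>x. (f x, g x)) ` S \<subseteq> T" using assms(3) by blast
    show "Ck_on k h T" using assms(4) by (simp add: smooth_on_def)
    show "Ck_on k (\<lambda>x. (f x, g x) \<bullet> b) S" if "b \<in> Basis" for b
      using assms(5,6) that by (auto simp: smooth_on_def Basis_prod_def)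
  qed
qed

text \<open>A family of functions of one variable that is closed under differentiation consists of smooth
  functions. This is how powers, logarithms and all the special functions below are seen to be smooth.\<close>

lemma smooth_on_real_family:
  fixes F :: "(real \<Rightarrow> real) set"
  assumes S: "open S" and "f \<in> F"
    and F: "\<And>f. f \<in> F \<Longrightarrow> \<exists>f'\<in>F. \<forall>x\<in>S. (f has_real_derivative f' x) (at x)"
  shows "smooth_on S f"
proof -
  have "Ck_on k f S" if "f \<in> F" for k f
    using that
  proof (induction k arbitrary: f)
    case 0
    then obtain f' where "\<forall>x\<in>S. (f has_real_derivative f' x) (at x)" using F by blast
    then show ?case
      by (auto intro!: continuous_at_imp_continuous_on DERIV_isCont)
  next
    case (Suc k)
    then obtain f' where f': "f' \<in> F" "\<forall>x\<in>S. (f has_real_derivative f' x) (at x)" using F by blast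
    show ?case
    proof (rule Ck_on_SucI[OF S])
      show "(f has_derivative (\<lambda>v. f' x * v)) (at x)" if "x \<in> S" for x
        using f'(2) that by (simp add: has_field_derivative_def)
    qed (use Suc f' in \<open>auto intro!: Ck_on_mult Ck_on_const S\<close>)
  qed
  with \<open>f \<in> F\<close> show ?thesis by (auto simp: smooth_on_def)
qed

lemma smooth_on_exp: "smooth_on S (exp :: real \<Rightarrow> real)"
  by (rule smooth_on_subset[OF smooth_on_real_family[of UNIV _ "{exp}"]])
     (auto intro!: derivative_eq_intros)

lemma smooth_on_powr: "smooth_on {0<..} (\<lambda>x::real. x powr a)"
proof (rule smooth_on_real_family[where F = "{\<lambda>x. c * x powr a | c a. True}"])
  fix f :: "real \<Rightarrow> real" assume "f \<in> {\<lambda>x. c * x powr a | c a. True}"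
  then obtain c a where f: "f = (\<lambda>x. c * x powr a)" by blast
  have "(f has_real_derivative (c * a) * x powr (a - 1)) (at x)" if "x > 0" for x
    unfolding f using that by (auto intro!: derivative_eq_intros)
  then show "\<exists>f'\<in>{\<lambda>x. c * x powr a | c a. True}. \<forall>x\<in>{0<..}. (f has_real_derivative f' x) (at x)"
    by (intro bexI[of _ "\<lambda>x. (c * a) * x powr (a - 1)"]) auto
next
  have "(\<lambda>x. x powr a) = (\<lambda>x. 1 * x powr a)" by simp
  then show "(\<lambda>x. x powr a) \<in> {\<lambda>x. c * x powr a | c a. True}" by blast
qed simp

lemma smooth_on_ln: "smooth_on {0<..} (ln :: real \<Rightarrow> real)"
proof (rule smooth_on_real_family[where F = "insert ln {\<lambda>x. c * x powr a | c a. True}"])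
  fix f :: "real \<Rightarrow> real" assume "f \<in> insert ln {\<lambda>x. c * x powr a | c a. True}"
  then show "\<exists>f'\<in>insert ln {\<lambda>x. c * x powr a | c a. True}. \<forall>x\<in>{0<..}. (f has_real_derivative f' x) (at x)"
  proof
    assume "f = ln"
    then have "(f has_real_derivative 1 * x powr (- 1)) (at x)" if "x > 0" for x
      using that by (auto intro!: derivative_eq_intros simp: powr_minus field_simps)
    then show ?thesis by (intro bexI[of _ "\<lambda>x. 1 * x powr (- 1)"]) blast+
  next
    assume "f \<in> {\<lambda>x. c * x powr a | c a. True}"
    then obtain c a where f: "f = (\<lambda>x. c * x powr a)" by blast
    have "(f has_real_derivative (c * a) * x powr (a - 1)) (at x)" if "x > 0" for x
      unfolding f using that by (auto intro!: derivative_eq_intros)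
    then show ?thesis by (intro bexI[of _ "\<lambda>x. (c * a) * x powr (a - 1)"]) auto
  qed
qed auto

lemma smooth_on_inverse:
  assumes "open S" "smooth_on S f" "\<And>x. x \<in> S \<Longrightarrow> f x > 0"
  shows "smooth_on S (\<lambda>x. 1 / f x)"
proof -
  have "smooth_on S (\<lambda>x. f x powr (-1))"
    using assms by (intro smooth_on_compose[OF _ open_greaterThan _ smooth_on_powr]) auto
  then show ?thesis
    by (rule smooth_on_cong[OF assms(1), THEN iffD1, rotated])
      (use assms(3) in \<open>simp add: powr_minus_divide less_imp_le\<close>)
qed

lemma smooth_on_sqrt:
  assumes "open S" "smooth_on S f" "\<And>x. x \<in> S \<Longrightarrow> f x > 0"
  shows "smooth_on S (\<lambda>x. sqrt (f x))"
proof -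
  have "smooth_on S (\<lambda>x. f x powr (1/2))"
    using assms by (intro smooth_on_compose[OF _ open_greaterThan _ smooth_on_powr]) auto
  then show ?thesis
    by (rule smooth_on_cong[OF assms(1), THEN iffD1, rotated])
      (use assms(3) in \<open>simp add: powr_half_sqrt less_imp_le\<close>)
qed

definition flat_exp :: "real \<Rightarrow> real" where
  "flat_exp x = (if x > 0 then exp (- (1 / x)) else 0)"

text \<open>The functions \<open>q (1/x) exp (-1/x)\<close>, extended by zero to \<open>x \<le> 0\<close>, with \<open>q\<close> a polynomial, are closed
  under differentiation, because \<open>exp (-1/x)\<close> beats every power of \<open>1/x\<close> at the origin.\<close>

lemma smooth_flat_exp: "smooth_on UNIV flat_exp"
proof -
  define F where "F = (\<lambda>p x. if x > 0 then poly p (1 / x) * exp (- (1 / x)) else (0::real))"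
  define q where "q = (\<lambda>p::real poly. [:0, 0, 1:] * (p - pderiv p))"
  have lim: "((\<lambda>t. poly p t * exp (- t)) \<longlongrightarrow> 0) at_top" for p :: "real poly"
  proof (induction p)
    case (pCons a p)
    have "((\<lambda>t::real. t ^ k / exp t) \<longlongrightarrow> 0) at_top" for k
      by (rule tendsto_power_div_exp_0)
    have *: "((\<lambda>t. poly (monom c k) t * exp (- t)) \<longlongrightarrow> 0) at_top" for c :: real and k
      using tendsto_mult_left[OF tendsto_power_div_exp_0[of k], of c]
      by (simp add: poly_monom exp_minus field_simps)
    have "((\<lambda>t. \<Sum>i\<le>degree (pCons a p). poly (monom (coeff (pCons a p) i) i) t * exp (- t)) \<longlongrightarrow>
       (\<Sum>i\<le>degree (pCons a p). 0)) at_top"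
      by (intro tendsto_sum *)
    moreover have "(\<Sum>i\<le>degree (pCons a p). poly (monom (coeff (pCons a p) i) i) t * exp (- t)) =
        poly (pCons a p) t * exp (- t)" for t
      unfolding sum_distrib_right[symmetric] poly_altdef[of "pCons a p"] by (simp only: poly_monom)
    ultimately show ?case by simp
  qed simp
  have "(F p has_real_derivative F (q p) x) (at x)" for p x
  proof (cases x "0::real" rule: linorder_cases)
    case less
    have "(F p has_real_derivative 0) (at x)"
      by (rule has_field_derivative_transform_within_open[of "\<lambda>_. 0" 0 x "{..<0}"])
        (use less in \<open>auto simp: F_def\<close>)
    then show ?thesis using less by (simp add: F_def)
  next
    case equal
    have "((\<lambda>h. F p h / h) \<longlongrightarrow> 0) (at_right 0)"
    proof (rule Lim_transform_eventually)
      show "((\<lambda>h. poly ([:0, 1:] * p) (inverse h) * exp (- inverse h)) \<longlongrightarrow> 0) (at_right 0)"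
        by (rule filterlim_compose[OF lim filterlim_inverse_at_top_right])
      show "\<forall>\<^sub>F h in at_right 0. poly ([:0, 1:] * p) (inverse h) * exp (- inverse h) = F p h / h"
        by (auto simp: F_def eventually_at_filter field_simps)
    qed
    moreover have "((\<lambda>h. F p h / h) \<longlongrightarrow> 0) (at_left 0)"
      by (rule Lim_transform_eventually[of "\<lambda>_. 0"]) (auto simp: F_def eventually_at_filter)
    ultimately have "((\<lambda>h. F p h / h) \<longlongrightarrow> 0) (at 0)"
      by (simp add: filterlim_split_at)
    then show ?thesis
      using equal by (simp add: has_field_derivative_iff F_def)
  next
    case greater
    have inv: "((\<lambda>x. 1 / x) has_real_derivative - 1 / x\<^sup>2) (at x)"
      using greater by (auto intro!: derivative_eq_intros simp: power2_eq_square)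
    have "((\<lambda>x. exp (- (1 / x))) has_real_derivative exp (- (1 / x)) * (1 / x\<^sup>2)) (at x)"
      using DERIV_fun_exp[OF DERIV_minus[OF inv]] by simp
    from DERIV_mult[OF DERIV_chain2[OF poly_DERIV[of p] inv] this]
    have "((\<lambda>x. poly p (1 / x) * exp (- (1 / x))) has_real_derivative
       poly (pderiv p) (1/x) * (- 1 / x\<^sup>2) * exp (- (1 / x)) + poly p (1 / x) * (exp (- (1 / x)) * (1 / x\<^sup>2))) (at x)"
      by (simp add: algebra_simps)
    then have "(F p has_real_derivative
       poly (pderiv p) (1/x) * (- 1 / x\<^sup>2) * exp (- (1 / x)) + poly p (1 / x) * (exp (- (1 / x)) * (1 / x\<^sup>2))) (at x)"
      apply (rule has_field_derivative_transform_within_open[where S = "{0<..}" and g = "F p"])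
      using greater by (auto simp: F_def)
    moreover have "F (q p) x = poly (pderiv p) (1/x) * (- 1 / x\<^sup>2) * exp (- (1 / x)) + poly p (1 / x) * (exp (- (1 / x)) * (1 / x\<^sup>2))"
      using greater by (simp add: F_def q_def power2_eq_square field_simps)
    ultimately show ?thesis by simp
  qed
  then have "smooth_on UNIV (F 1)"
    by (intro smooth_on_real_family[where F = "range F"]) auto
  moreover have "F 1 = flat_exp" by (auto simp: F_def flat_exp_def)
  ultimately show ?thesis by simp
qed

lemma GDERIV_unique:
  fixes u :: "'a::real_inner \<Rightarrow> real"
  assumes "GDERIV u z :> D" "GDERIV u z :> D'" shows "D = D'"
proof -
  have "(\<lambda>h. h \<bullet> D) = (\<lambda>h. h \<bullet> D')"
    using assms has_derivative_unique unfolding gderiv_def by blast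
  then have "(D - D') \<bullet> D = (D - D') \<bullet> D'" by (rule fun_cong)
  then have "(D - D') \<bullet> (D - D') = 0" by (simp add: inner_diff_right)
  then show ?thesis by simp
qed

lemma gderiv_grad:
  fixes u :: "'a::euclidean_space \<Rightarrow> real"
  assumes "u differentiable (at z)" shows "GDERIV u z :> grad u z"
proof -
  obtain u' where u': "(u has_derivative u') (at z)" using assms differentiable_def by blast
  then have l: "linear u'" by (rule has_derivative_linear)
  define D where "D = (\<Sum>b\<in>Basis. u' b *\<^sub>R b)"
  have u'D: "u' v = v \<bullet> D" for v
  proof -
    have "u' v = u' (\<Sum>b\<in>Basis. (v \<bullet> b) *\<^sub>R b)" by (simp add: euclidean_representation)
    also have "\<dots> = v \<bullet> D"
      by (simp add: linear_sum[OF l] linear_cmul[OF l] D_def inner_sum_right mult.commute)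
    finally show ?thesis .
  qed
  then have "u' = (\<lambda>v. v \<bullet> D)" by blast
  with u' have D: "GDERIV u z :> D" unfolding gderiv_def by simp
  show ?thesis unfolding grad_def
    by (rule theI[of "\<lambda>D. GDERIV u z :> D", OF D]) (rule GDERIV_unique[OF _ D])
qed

lemma grad_eq: "GDERIV u z :> D \<Longrightarrow> grad u z = D"
  unfolding grad_def by (rule the_equality) (auto intro: GDERIV_unique)

section \<open>Norms and dual norms\<close>

lemma is_norm_zero: "is_norm N \<Longrightarrow> N 0 = 0"
  and is_norm_nonneg: "is_norm N \<Longrightarrow> 0 \<le> N x"
  and is_norm_pos: "is_norm N \<Longrightarrow> x \<noteq> 0 \<Longrightarrow> 0 < N x"
  and is_norm_scale: "is_norm N \<Longrightarrow> N (c *\<^sub>R x) = \<bar>c\<bar> * N x"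
  and is_norm_triangle: "is_norm N \<Longrightarrow> N (x + y) \<le> N x + N y"
  by (auto simp: is_norm_def less_le)

lemma is_norm_minus: "is_norm N \<Longrightarrow> N (- x) = N x"
  using is_norm_scale[of N "-1" x] by simp

lemma is_norm_sum:
  assumes "is_norm N" "finite I"
  shows "N (\<Sum>i\<in>I. f i) \<le> (\<Sum>i\<in>I. N (f i))"
  using assms(2)
  by (induction I rule: finite_induct)
    (auto simp: is_norm_zero[OF assms(1)] intro: order_trans[OF is_norm_triangle[OF assms(1)]])

lemma is_norm_le_norm:
  fixes N :: "'a::euclidean_space \<Rightarrow> real"
  assumes "is_norm N"
  obtains C where "C > 0" "\<And>x. N x \<le> C * norm x"
proof
  show "1 + (\<Sum>b\<in>Basis. N b) > 0"
    using is_norm_nonneg[OF assms] by (simp add: add_pos_nonneg sum_nonneg)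
  fix x :: 'a
  have "N x = N (\<Sum>b\<in>Basis. (x \<bullet> b) *\<^sub>R b)" by (simp add: euclidean_representation)
  also have "\<dots> \<le> (\<Sum>b\<in>Basis. N ((x \<bullet> b) *\<^sub>R b))" by (intro is_norm_sum assms) auto
  also have "\<dots> \<le> (\<Sum>b\<in>Basis. norm x * N b)"
    by (intro sum_mono) (auto simp: is_norm_scale[OF assms] is_norm_nonneg[OF assms] Basis_le_norm mult_right_mono)
  also have "\<dots> = (\<Sum>b\<in>Basis. N b) * norm x"
    by (simp only: sum_distrib_right mult.commute[of "norm x"])
  also have "\<dots> \<le> (1 + (\<Sum>b\<in>Basis. N b)) * norm x"
    by (simp add: distrib_right)
  finally show "N x \<le> (1 + (\<Sum>b\<in>Basis. N b)) * norm x" .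
qed

lemma is_norm_diff_le:
  assumes "is_norm N" shows "\<bar>N x - N y\<bar> \<le> N (x - y)"
  using is_norm_triangle[OF assms, of y "x - y"] is_norm_triangle[OF assms, of x "y - x"]
    is_norm_minus[OF assms, of "x - y"] by simp

lemma is_norm_continuous:
  fixes N :: "'a::euclidean_space \<Rightarrow> real"
  assumes "is_norm N" shows "continuous_on S N"
proof -
  obtain C where C: "C > 0" "\<And>x. N x \<le> C * norm x" using is_norm_le_norm[OF assms] by blast
  have "C-lipschitz_on S N"
    using C is_norm_diff_le[OF assms]
    by (intro lipschitz_onI) (auto simp: dist_norm less_imp_le intro: order_trans)
  then show ?thesis by (rule lipschitz_on_continuous_on)
qed

lemma is_norm_ge_norm:
  fixes N :: "'a::euclidean_space \<Rightarrow> real"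
  assumes "is_norm N"
  obtains c where "c > 0" "\<And>x. c * norm x \<le> N x"
proof -
  have "sphere (0::'a) 1 \<noteq> {}" by (simp add: sphere_eq_empty)
  then obtain x0 where x0: "x0 \<in> sphere 0 1" "\<And>x. x \<in> sphere 0 1 \<Longrightarrow> N x0 \<le> N x"
    using continuous_attains_inf[OF compact_sphere _ is_norm_continuous[OF assms], of 0 1] by blast
  have "N x0 > 0" using x0(1) by (intro is_norm_pos assms) auto
  moreover have "N x0 * norm x \<le> N x" for x
  proof (cases "x = 0")
    case False
    then have "N x0 \<le> N ((1 / norm x) *\<^sub>R x)" by (intro x0(2)) simp
    then show ?thesis using False by (simp add: is_norm_scale[OF assms] field_simps)
  qed (simp add: is_norm_zero[OF assms])
  ultimately show thesis using that by blast
qed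

text \<open>All norms of a Euclidean space are comparable, so the supremum that defines the dual norm is finite.\<close>

lemma bdd_above_dual_norm:
  fixes H :: "'a::euclidean_space \<Rightarrow> real"
  assumes "is_norm H" shows "bdd_above ((\<lambda>\<xi>. (x \<bullet> \<xi>) / H \<xi>) ` (- {0}))"
proof -
  obtain c where c: "c > 0" "\<And>x. c * norm x \<le> H x" using is_norm_ge_norm[OF assms] by blast
  have "(x \<bullet> \<xi>) / H \<xi> \<le> norm x / c" if "\<xi> \<noteq> 0" for \<xi>
  proof -
    have "(x \<bullet> \<xi>) * c \<le> norm x * (c * norm \<xi>)"
      using norm_cauchy_schwarz[of x \<xi>] c(1) by (simp add: mult_ac)
    also have "\<dots> \<le> norm x * H \<xi>" by (intro mult_left_mono c) auto
    finally show ?thesis using c(1) is_norm_pos[OF assms that] by (simp add: field_simps)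
  qed
  then show ?thesis by (intro bdd_aboveI[of _ "norm x / c"]) auto
qed

lemma inner_le_dual_norm:
  fixes H :: "'a::euclidean_space \<Rightarrow> real"
  assumes "is_norm H" shows "x \<bullet> \<xi> \<le> dual_norm H x * H \<xi>"
proof (cases "\<xi> = 0")
  case False
  then have "(x \<bullet> \<xi>) / H \<xi> \<le> dual_norm H x"
    unfolding dual_norm_def by (intro cSUP_upper bdd_above_dual_norm assms) auto
  then show ?thesis using is_norm_pos[OF assms False] by (simp add: field_simps)
qed (simp add: is_norm_zero[OF assms])

lemma dual_norm_le:
  fixes H :: "'a::euclidean_space \<Rightarrow> real"
  assumes "is_norm H" "\<And>\<xi>. H \<xi> \<le> 1 \<Longrightarrow> x \<bullet> \<xi> \<le> d"
  shows "dual_norm H x \<le> d"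
  unfolding dual_norm_def
proof (rule cSUP_least)
  show "- {0::'a} \<noteq> {}" using nonzero_Basis nonempty_Basis by blast
  fix \<xi> :: 'a assume "\<xi> \<in> - {0}"
  then have "H \<xi> > 0" using is_norm_pos[OF assms(1)] by auto
  then have "x \<bullet> ((1 / H \<xi>) *\<^sub>R \<xi>) \<le> d"
    by (intro assms(2)) (simp add: is_norm_scale[OF assms(1)])
  then show "(x \<bullet> \<xi>) / H \<xi> \<le> d" by simp
qed

lemma is_norm_dual_norm:
  fixes H :: "'a::euclidean_space \<Rightarrow> real"
  assumes H: "is_norm H" shows "is_norm (dual_norm H)"
proof -
  have pos: "dual_norm H x > 0" if "x \<noteq> 0" for x
  proof -
    have "0 < x \<bullet> x" using that by simp
    also have "\<dots> \<le> dual_norm H x * H x" by (rule inner_le_dual_norm[OF H])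
    finally show ?thesis using is_norm_pos[OF H that] by (simp add: zero_less_mult_iff)
  qed
  have zero: "dual_norm H 0 = 0"
  proof -
    have "dual_norm H 0 \<le> 0" by (rule dual_norm_le[OF H]) simp
    moreover obtain e :: 'a where "e \<in> Basis" using nonempty_Basis by blast
    then have "e \<noteq> 0" using nonzero_Basis by blast
    from is_norm_pos[OF H this] inner_le_dual_norm[OF H, of 0 e] have "0 \<le> dual_norm H 0"
      by (simp add: zero_le_mult_iff)
    ultimately show ?thesis by simp
  qed
  have nn: "dual_norm H x \<ge> 0" for x using pos[of x] zero by (cases "x = 0") (auto simp: less_imp_le)
  have scale_le: "dual_norm H (c *\<^sub>R x) \<le> \<bar>c\<bar> * dual_norm H x" for c x
  proof (rule dual_norm_le[OF H])
    fix \<xi> assume \<xi>: "H \<xi> \<le> 1"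
    have "(c *\<^sub>R x) \<bullet> \<xi> = \<bar>c\<bar> * (x \<bullet> (sgn c *\<^sub>R \<xi>))" by (cases "c = 0") (simp_all add: abs_sgn mult_ac)
    also have "\<dots> \<le> \<bar>c\<bar> * (dual_norm H x * H (sgn c *\<^sub>R \<xi>))"
      by (intro mult_left_mono inner_le_dual_norm H) auto
    also have "\<dots> \<le> \<bar>c\<bar> * (dual_norm H x * 1)"
      using \<xi> nn by (intro mult_left_mono) (auto simp: is_norm_scale[OF H] abs_sgn_eq)
    finally show "(c *\<^sub>R x) \<bullet> \<xi> \<le> \<bar>c\<bar> * dual_norm H x" by simp
  qed
  have "dual_norm H (c *\<^sub>R x) = \<bar>c\<bar> * dual_norm H x" for c x
  proof (cases "c = 0")
    case False
    have "dual_norm H x \<le> \<bar>1 / c\<bar> * dual_norm H (c *\<^sub>R x)"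
      using scale_le[of "1 / c" "c *\<^sub>R x"] False by simp
    with scale_le[of c x] False show ?thesis by (simp add: field_simps)
  qed (simp add: zero)
  moreover have "dual_norm H (x + y) \<le> dual_norm H x + dual_norm H y" for x y
  proof (rule dual_norm_le[OF H])
    fix \<xi> assume \<xi>: "H \<xi> \<le> 1"
    have "x \<bullet> \<xi> \<le> dual_norm H x" for x
      using inner_le_dual_norm[OF H, of x \<xi>] mult_left_mono[OF \<xi> nn[of x]] by simp
    then show "(x + y) \<bullet> \<xi> \<le> dual_norm H x + dual_norm H y"
      by (simp add: inner_add_left add_mono)
  qed
  ultimately show ?thesis unfolding is_norm_def using nn zero pos by (metis less_irrefl)
qed

text \<open>The triangle inequality for \<open>N\<close>, followed by that of the Euclidean norm in the plane for the
  pairs \<open>(N x, y)\<close>.\<close>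

lemma is_norm_Phi:
  assumes N: "is_norm N" shows "is_norm (Phi N)"
proof -
  have "Phi N (z + w) \<le> Phi N z + Phi N w" for z w
  proof -
    have "Phi N (z + w) \<le> sqrt ((N (fst z) + N (fst w))\<^sup>2 + (snd z + snd w)\<^sup>2)"
      unfolding Phi_def using is_norm_triangle[OF N] is_norm_nonneg[OF N]
      by (intro real_sqrt_le_mono add_right_mono power_mono) auto
    also have "\<dots> \<le> sqrt ((N (fst z))\<^sup>2 + (snd z)\<^sup>2) + sqrt ((N (fst w))\<^sup>2 + (snd w)\<^sup>2)"
      by (rule real_sqrt_sum_squares_triangle_ineq)
    finally show ?thesis by (simp add: Phi_def)
  qed
  moreover have "Phi N (c *\<^sub>R z) = \<bar>c\<bar> * Phi N z" for c z
    by (simp add: Phi_def is_norm_scale[OF N] power_mult_distrib real_sqrt_mult flip: distrib_left)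
  moreover have "Phi N z = 0 \<longleftrightarrow> z = 0" for z
    using is_norm_zero[OF N] is_norm_pos[OF N, of "fst z"]
    by (cases "fst z = 0") (auto simp: Phi_def prod_eq_iff)
  ultimately show ?thesis unfolding is_norm_def by (simp add: Phi_def)
qed

text \<open>\<open>\<Phi>\<^sub>0\<close> is dual to \<open>\<Phi>\<close>: combine the duality of \<open>H\<^sub>0\<close> and \<open>H\<close> with the Cauchy-Schwarz inequality in
  the plane.\<close>

lemma inner_le_Phi:
  fixes H :: "'a::euclidean_space \<Rightarrow> real"
  assumes H: "is_norm H" shows "z \<bullet> \<zeta> \<le> Phi0 H z * Phi H \<zeta>"
proof -
  have "z \<bullet> \<zeta> \<le> dual_norm H (fst z) * H (fst \<zeta>) + snd z * snd \<zeta>"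
    using inner_le_dual_norm[OF H, of "fst z" "fst \<zeta>"] by (simp add: inner_prod_def)
  also have "\<dots> \<le> sqrt ((dual_norm H (fst z))\<^sup>2 + (snd z)\<^sup>2) * sqrt ((H (fst \<zeta>))\<^sup>2 + (snd \<zeta>)\<^sup>2)"
    using norm_cauchy_schwarz[of "(dual_norm H (fst z), snd z)" "(H (fst \<zeta>), snd \<zeta>)"]
    by (simp add: inner_prod_def norm_prod_def)
  finally show ?thesis by (simp add: Phi0_def Phi_def)
qed

section \<open>Iterated logarithms\<close>

lemma Xlog_pos_le: "0 < \<rho> \<Longrightarrow> \<rho> \<le> 1 \<Longrightarrow> 0 < Xlog k \<rho> \<and> Xlog k \<rho> \<le> 1"
proof (induction k)
  case (Suc k)
  then have "ln (Xlog k \<rho>) \<le> 0" by simp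
  then show ?case by (simp add: field_simps)
qed simp

lemma Xlog_pos: "0 < \<rho> \<Longrightarrow> \<rho> \<le> 1 \<Longrightarrow> 0 < Xlog k \<rho>"
  and Xlog_le_1: "0 < \<rho> \<Longrightarrow> \<rho> \<le> 1 \<Longrightarrow> Xlog k \<rho> \<le> 1"
  using Xlog_pos_le by auto

lemma Xlog_strict_mono: "0 < \<rho> \<Longrightarrow> \<rho> < \<rho>' \<Longrightarrow> \<rho>' \<le> 1 \<Longrightarrow> Xlog k \<rho> < Xlog k \<rho>'"
proof (induction k)
  case (Suc k)
  then have "ln (Xlog k \<rho>) < ln (Xlog k \<rho>')" "ln (Xlog k \<rho>') \<le> 0"
    using Xlog_pos[of \<rho> k] Xlog_pos[of \<rho>' k] Xlog_le_1[of \<rho>' k] by auto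
  then show ?case by (simp add: frac_less2)
qed simp

lemma Plog_0 [simp]: "Plog 0 \<rho> = 1"
  and Plog_Suc: "Plog (Suc k) \<rho> = Plog k \<rho> * Xlog (Suc k) \<rho>"
  by (simp_all add: Plog_def del: Xlog.simps)

lemma Plog_pos: "0 < \<rho> \<Longrightarrow> \<rho> \<le> 1 \<Longrightarrow> 0 < Plog k \<rho>"
  and Plog_le_1: "0 < \<rho> \<Longrightarrow> \<rho> \<le> 1 \<Longrightarrow> Plog k \<rho> \<le> 1"
  unfolding Plog_def by (auto intro!: prod_pos prod_le_1 simp: Xlog_pos Xlog_le_1 less_imp_le)

text \<open>Each step \<open>X \<mapsto> 1 / (1 - ln X)\<close> multiplies the logarithmic derivative by the new \<open>X\<close>, hence
  \<open>\<rho> X\<^sub>k' = X\<^sub>1 \<cdots> X\<^sub>k X\<^sub>k\<close>.\<close>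

lemma DERIV_Xlog:
  "0 < \<rho> \<Longrightarrow> \<rho> \<le> 1 \<Longrightarrow> (Xlog k has_real_derivative Plog k \<rho> * Xlog k \<rho> / \<rho>) (at \<rho>)"
proof (induction k)
  case 0
  have "(Xlog 0 has_real_derivative 1) (at \<rho>)"
    unfolding Xlog.simps(1)[abs_def] by (rule DERIV_ident)
  then show ?case using 0 by simp
next
  case (Suc k)
  have X: "0 < Xlog k \<rho>" "ln (Xlog k \<rho>) \<le> 0" "ln (Xlog k \<rho>) \<noteq> 1"
    using Xlog_pos_le[of \<rho> k] Suc.prems ln_le_zero_iff[of "Xlog k \<rho>"] by fastforce+
  have "((\<lambda>\<rho>. 1 / (1 - ln (Xlog k \<rho>))) has_real_derivative
     (Plog k \<rho> * Xlog k \<rho> / \<rho> / Xlog k \<rho>) / (1 - ln (Xlog k \<rho>))\<^sup>2) (at \<rho>)"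
    using X Suc.prems
    by (auto intro!: derivative_eq_intros Suc.IH simp: power2_eq_square field_simps)
  moreover have "Xlog (Suc k) = (\<lambda>\<rho>. 1 / (1 - ln (Xlog k \<rho>)))" by auto
  moreover have "(Plog k \<rho> * Xlog k \<rho> / \<rho> / Xlog k \<rho>) / (1 - ln (Xlog k \<rho>))\<^sup>2 =
      Plog (Suc k) \<rho> * Xlog (Suc k) \<rho> / \<rho>"
    using X by (simp add: Plog_Suc power2_eq_square)
  ultimately show ?case by metis
qed

lemma DERIV_Plog:
  assumes "0 < \<rho>" "\<rho> \<le> 1"
  shows "(Plog k has_real_derivative Plog k \<rho> * (\<Sum>j=1..k. Plog j \<rho>) / \<rho>) (at \<rho>)"
proof (induction k)
  case 0
  have "Plog 0 = (\<lambda>\<rho>. 1)" by auto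
  then show ?case by simp
next
  case (Suc k)
  have "Plog (Suc k) = (\<lambda>\<rho>. Plog k \<rho> * Xlog (Suc k) \<rho>)" by (auto simp: Plog_Suc)
  with DERIV_mult[OF Suc DERIV_Xlog[OF assms, of "Suc k"]] show ?case
    by (simp add: Plog_Suc algebra_simps add_divide_distrib del: Xlog.simps)
qed

lemma smooth_on_Xlog: "smooth_on {0<..<1} (Xlog k)"
proof (induction k)
  case 0
  have "Xlog 0 = (\<lambda>\<rho>. \<rho>)" by auto
  then show ?case by (simp add: smooth_on_bounded_linear)
next
  case (Suc k)
  have "smooth_on {0<..<1} (\<lambda>\<rho>. ln (Xlog k \<rho>))"
    by (rule smooth_on_compose[OF _ open_greaterThan _ smooth_on_ln Suc]) (auto simp: Xlog_pos)
  then have "smooth_on {0<..<1} (\<lambda>\<rho>. 1 - ln (Xlog k \<rho>))"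
    by (intro smooth_on_diff smooth_on_const) auto
  moreover have "1 - ln (Xlog k \<rho>) > 0" if "\<rho> \<in> {0<..<1}" for \<rho>
  proof -
    have "ln (Xlog k \<rho>) \<le> 0" using Xlog_pos_le[of \<rho> k] that by auto
    then show ?thesis by simp
  qed
  ultimately have "smooth_on {0<..<1} (\<lambda>\<rho>. 1 / (1 - ln (Xlog k \<rho>)))"
    by (intro smooth_on_inverse) auto
  then show ?case by simp
qed

lemma smooth_on_Plog: "smooth_on {0<..<1} (Plog k)"
proof (induction k)
  case 0
  have "Plog 0 = (\<lambda>\<rho>. 1)" by auto
  then show ?case by (simp add: smooth_on_const)
next
  case (Suc k)
  have "Plog (Suc k) = (\<lambda>\<rho>. Plog k \<rho> * Xlog (Suc k) \<rho>)" by (auto simp: Plog_Suc)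
  with smooth_on_mult[OF _ Suc smooth_on_Xlog] show ?case by (simp del: Xlog.simps)
qed

lemma Xlog_tendsto_0: "(Xlog k \<longlongrightarrow> 0) (at_right 0)"
proof (induction k)
  case 0
  have "Xlog 0 = (\<lambda>\<rho>. \<rho>)" by auto
  then show ?case by (simp add: tendsto_ident_at)
next
  case (Suc k)
  have "\<forall>\<^sub>F \<rho> in at_right 0. Xlog k \<rho> \<in> {0<..} \<and> Xlog k \<rho> \<noteq> 0"
    unfolding eventually_at_right_field by (intro exI[of _ 1])
      (auto simp: Xlog_pos Xlog_pos[THEN less_imp_neq, symmetric])
  with Suc have "filterlim (Xlog k) (at_right 0) (at_right 0)"
    by (simp add: filterlim_at)
  then have "filterlim (\<lambda>\<rho>. ln (Xlog k \<rho>)) at_bot (at_right 0)"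
    by (rule filterlim_compose[OF ln_at_0])
  then have "filterlim (\<lambda>\<rho>. - ln (Xlog k \<rho>)) at_top (at_right 0)"
    by (simp add: filterlim_uminus_at_bot)
  then have "filterlim (\<lambda>\<rho>. 1 + - ln (Xlog k \<rho>)) at_top (at_right 0)"
    by (rule filterlim_tendsto_add_at_top[OF tendsto_const])
  then have "((\<lambda>\<rho>. 1 / (1 + - ln (Xlog k \<rho>))) \<longlongrightarrow> 0) (at_right 0)"
    by (intro tendsto_divide_0[OF tendsto_const] filterlim_at_top_imp_at_infinity)
  then show ?case by simp
qed

section \<open>The angular ground state\<close>

text \<open>Differentiation under the integral sign, from dominated convergence of the difference quotients.\<close>

lemma has_real_derivative_integral:
  fixes f :: "real \<Rightarrow> 'a \<Rightarrow> real"
  assumes s0: "s0 \<in> {a<..<b}"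
    and int: "\<And>s. s \<in> {a<..<b} \<Longrightarrow> integrable M (f s)"
    and der: "\<And>s v. s \<in> {a<..<b} \<Longrightarrow> v \<in> space M \<Longrightarrow> ((\<lambda>s. f s v) has_real_derivative f' s v) (at s)"
    and bound: "\<And>s v. s \<in> {a<..<b} \<Longrightarrow> v \<in> space M \<Longrightarrow> \<bar>f' s v\<bar> \<le> g v"
    and g: "integrable M g" and meas: "f' s0 \<in> borel_measurable M"
  shows "((\<lambda>s. \<integral>v. f s v \<partial>M) has_real_derivative (\<integral>v. f' s0 v \<partial>M)) (at s0)"
proof -
  have "((\<lambda>s. ((\<integral>v. f s v \<partial>M) - (\<integral>v. f s0 v \<partial>M)) / (s - s0)) \<longlongrightarrow> (\<integral>v. f' s0 v \<partial>M)) (at s0)"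
    unfolding tendsto_at_iff_sequentially comp_def
  proof (intro allI impI)
    fix X :: "nat \<Rightarrow> real" assume X: "\<forall>i. X i \<in> UNIV - {s0}" and lim: "X \<longlonglongrightarrow> s0"
    have "\<forall>\<^sub>F i in sequentially. X i \<in> {a<..<b}"
      using topological_tendstoD[OF lim open_greaterThanLessThan s0] .
    then obtain N where N: "\<And>i. i \<ge> N \<Longrightarrow> X i \<in> {a<..<b}" by (auto simp: eventually_sequentially)
    define Y where "Y = (\<lambda>i. X (i + N))"
    have Y: "Y i \<in> {a<..<b}" "Y i \<noteq> s0" for i using N X by (auto simp: Y_def)
    have Ylim: "Y \<longlonglongrightarrow> s0" unfolding Y_def using lim by (rule LIMSEQ_ignore_initial_segment)
    have "(\<lambda>i. \<integral>v. (f (Y i) v - f s0 v) / (Y i - s0) \<partial>M) \<longlonglongrightarrow> (\<integral>v. f' s0 v \<partial>M)"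
    proof (rule integral_dominated_convergence[where w = g])
      show "AE v in M. (\<lambda>i. (f (Y i) v - f s0 v) / (Y i - s0)) \<longlonglongrightarrow> f' s0 v"
      proof (rule AE_I2)
        fix v assume "v \<in> space M"
        from der[OF s0 this] have "((\<lambda>s. (f s v - f s0 v) / (s - s0)) \<longlongrightarrow> f' s0 v) (at s0)"
          by (simp add: has_field_derivative_iff)
        moreover have "filterlim Y (at s0) sequentially"
          using Ylim Y(2) by (simp add: filterlim_at)
        ultimately show "(\<lambda>i. (f (Y i) v - f s0 v) / (Y i - s0)) \<longlonglongrightarrow> f' s0 v"
          by (rule filterlim_compose)
      qed
      show "AE v in M. norm ((f (Y i) v - f s0 v) / (Y i - s0)) \<le> g v" for i
      proof (rule AE_I2)
        fix v assume v: "v \<in> space M"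
        have "norm (f (Y i) v - f s0 v) \<le> g v * norm (Y i - s0)"
        proof (rule field_differentiable_bound[of "{a<..<b}" "\<lambda>s. f s v" "\<lambda>s. f' s v"])
          show "((\<lambda>s. f s v) has_field_derivative f' z v) (at z within {a<..<b})" if "z \<in> {a<..<b}" for z
            using der[OF that v] by (rule has_field_derivative_at_within)
        qed (use bound v Y s0 in auto)
        then show "norm ((f (Y i) v - f s0 v) / (Y i - s0)) \<le> g v"
          using Y(2)[of i] by (simp add: divide_le_eq)
      qed
      show "(\<lambda>v. (f (Y i) v - f s0 v) / (Y i - s0)) \<in> borel_measurable M" for i
        using int[OF Y(1)] int[OF s0] by (intro borel_measurable_divide borel_measurable_diff) auto
    qed (use g meas in auto)
    moreover have "(\<integral>v. (f (Y i) v - f s0 v) / (Y i - s0) \<partial>M) =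
        ((\<integral>v. f (Y i) v \<partial>M) - (\<integral>v. f s0 v \<partial>M)) / (Y i - s0)" for i
      by (simp only: integral_divide_zero Bochner_Integration.integral_diff[OF int[OF Y(1)] int[OF s0]])
    ultimately have "(\<lambda>i. ((\<integral>v. f (Y i) v \<partial>M) - (\<integral>v. f s0 v \<partial>M)) / (Y i - s0)) \<longlonglongrightarrow> (\<integral>v. f' s0 v \<partial>M)"
      by (simp only:)
    then show "(\<lambda>i. ((\<integral>v. f (X i) v \<partial>M) - (\<integral>v. f s0 v \<partial>M)) / (X i - s0)) \<longlonglongrightarrow> (\<integral>v. f' s0 v \<partial>M)"
      unfolding Y_def by (rule LIMSEQ_offset)
  qed
  then show ?thesis by (simp add: has_field_derivative_iff)
qed

text \<open>With \<open>v = t\<^sup>2 / (1 + t\<^sup>2)\<close> the integral of this kernel over \<open>(0,1)\<close> becomes twice the integral of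
  \<open>t powr (2 * p - 1) * (1 + 2 * s * t + t\<^sup>2) powr (- (p + c))\<close> over \<open>t > 0\<close>. If \<open>2 * (p + c) = n - 1\<close>, the
  last factor is \<open>\<bar>z + t e\<bar> powr (1 - n)\<close> for a unit vector \<open>z\<close> with last coordinate \<open>s\<close> and \<open>e\<close> the last unit vector: the Newton
  potential in dimension \<open>n + 1\<close> of a pole on the negative vertical axis. The integral is thus the angular
  part of a homogeneous positive function that is harmonic away from that half axis, and its decay is
  encoded in \<open>p\<close> and \<open>c\<close>. The form on \<open>(0,1)\<close> has Beta integrals at \<open>s = 0\<close>, and differentiation
  in \<open>s\<close> shifts both parameters by one half.\<close>

definition Psi_kernel :: "real \<Rightarrow> real \<Rightarrow> real \<Rightarrow> real \<Rightarrow> real" where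
  "Psi_kernel p c s v =
     v powr (p - 1) * (1 - v) powr (c - 1) * (1 + 2 * s * sqrt (v * (1 - v))) powr (- (p + c))"

definition Psi :: "real \<Rightarrow> real \<Rightarrow> real \<Rightarrow> real" where
  "Psi p c s = (LINT v:{0<..<1}|lborel. Psi_kernel p c s v)"

lemma sqrt_v_bounds:
  assumes "v \<in> {0<..<1::real}" shows "0 < sqrt (v * (1 - v))" "2 * sqrt (v * (1 - v)) \<le> 1"
proof -
  show "0 < sqrt (v * (1 - v))" using assms by simp
  have "v * (1 - v) \<le> (1/2)\<^sup>2" using zero_le_power2[of "v - 1/2"] by (simp add: power2_eq_square algebra_simps)
  then have "sqrt (v * (1 - v)) \<le> 1/2" by (intro real_le_lsqrt) auto
  then show "2 * sqrt (v * (1 - v)) \<le> 1" by simp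
qed

lemma Psi_base_lower:
  assumes "v \<in> {0<..<1::real}" "-1 < s0" "s0 \<le> s" "s0 \<le> 0"
  shows "1 + s0 \<le> 1 + 2 * s * sqrt (v * (1 - v))"
proof -
  have "s0 * 1 \<le> s0 * (2 * sqrt (v * (1 - v)))"
    using sqrt_v_bounds[OF assms(1)] assms(4) by (intro mult_left_mono_neg) auto
  also have "\<dots> \<le> s * (2 * sqrt (v * (1 - v)))"
    using sqrt_v_bounds[OF assms(1)] assms(3) by (intro mult_right_mono) auto
  finally show ?thesis by simp
qed

lemma Psi_base_pos: "v \<in> {0<..<1::real} \<Longrightarrow> s > -1 \<Longrightarrow> 0 < 1 + 2 * s * sqrt (v * (1 - v))"
  using Psi_base_lower[of v "min s 0" s] by auto

lemma set_integrable_Beta: "p > 0 \<Longrightarrow> c > 0 \<Longrightarrow>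
    set_integrable lborel {0<..<1::real} (\<lambda>v. v powr (p - 1) * (1 - v) powr (c - 1))"
  by (rule set_integrable_subset[OF integrable_Beta]) auto

lemma Psi_kernel_measurable [measurable]: "Psi_kernel p c s \<in> borel_measurable borel"
  unfolding Psi_kernel_def by measurable

text \<open>The kernel is uniformly bounded by a Beta density as long as \<open>s\<close> stays away from \<open>-1\<close>; this
  dominates every limit under the integral.\<close>

lemma Psi_kernel_bound:
  assumes "v \<in> {0<..<1::real}" "-1 < s0" "s0 \<le> s" "s0 \<le> 0" "p > 0" "c > 0"
  shows "Psi_kernel p c s v \<le> (1 + s0) powr (- (p + c)) * (v powr (p - 1) * (1 - v) powr (c - 1))"
  using Psi_base_lower[OF assms(1-4)] assms
  by (auto simp: Psi_kernel_def mult.commute intro!: mult_left_mono powr_mono2')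

lemma set_integrable_Psi_kernel:
  assumes "p > 0" "c > 0" "s > -1"
  shows "set_integrable lborel {0<..<1} (Psi_kernel p c s)"
proof (rule set_integrable_bound[where f = "\<lambda>v. (1 + min s 0) powr (- (p + c)) * (v powr (p - 1) * (1 - v) powr (c - 1))"])
  show "set_integrable lborel {0<..<1} (\<lambda>v. (1 + min s 0) powr (- (p + c)) * (v powr (p - 1) * (1 - v) powr (c - 1)))"
    by (intro set_integrable_mult_right set_integrable_Beta assms)
  show "AE v in lborel. v \<in> {0<..<1} \<longrightarrow> norm (Psi_kernel p c s v) \<le>
     norm ((1 + min s 0) powr (- (p + c)) * (v powr (p - 1) * (1 - v) powr (c - 1)))"
    using Psi_kernel_bound[of _ "min s 0" s p c] assms
    by (intro AE_I2 impI) (auto simp: Psi_kernel_def abs_mult)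
qed (auto simp: set_borel_measurable_def)

lemma DERIV_Psi_kernel:
  assumes "v \<in> {0<..<1}" "s > -1"
  shows "((\<lambda>s. Psi_kernel p c s v) has_real_derivative
    - 2 * (p + c) * Psi_kernel (p + 1/2) (c + 1/2) s v) (at s)"
proof -
  let ?m = "sqrt (v * (1 - v))"
  have pos: "0 < 1 + 2 * s * ?m" using Psi_base_pos assms by auto
  have m: "v powr (1/2) * (1 - v) powr (1/2) = ?m"
    using assms(1) by (simp add: powr_half_sqrt real_sqrt_mult)
  have "((\<lambda>s. Psi_kernel p c s v) has_real_derivative
    v powr (p - 1) * (1 - v) powr (c - 1) * (- (p + c) * (1 + 2 * s * ?m) powr (- (p + c) - 1) * (2 * ?m))) (at s)"
    unfolding Psi_kernel_def using pos by (auto intro!: derivative_eq_intros)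
  moreover have "v powr (p - 1) * (1 - v) powr (c - 1) * (- (p + c) * (1 + 2 * s * ?m) powr (- (p + c) - 1) * (2 * ?m))
    = - 2 * (p + c) * ((v powr (p - 1) * v powr (1/2)) * ((1 - v) powr (c - 1) * (1 - v) powr (1/2)) *
       (1 + 2 * s * ?m) powr (- (p + c) - 1))"
    unfolding m[symmetric] by (simp add: algebra_simps)
  moreover have "\<dots> = - 2 * (p + c) * Psi_kernel (p + 1/2) (c + 1/2) s v"
  proof -
    have e: "p - 1 + 1/2 = p + 1/2 - 1" "c - 1 + 1/2 = c + 1/2 - 1" "- (p + c) - 1 = - ((p + 1/2) + (c + 1/2))"
      by simp_all
    show ?thesis unfolding Psi_kernel_def powr_add[symmetric] e ..
  qed
  ultimately show ?thesis by (simp only:)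
qed

text \<open>The derivative in \<open>s\<close> lands in the same family, which gives smoothness and expresses the
  differential equation below by contiguous integrals.\<close>

lemma DERIV_Psi:
  assumes "p > 0" "c > 0" "s > -1"
  shows "(Psi p c has_real_derivative - 2 * (p + c) * Psi (p + 1/2) (c + 1/2) s) (at s)"
proof -
  define s0 where "s0 = (min s 0 - 1) / 2"
  have s0: "-1 < s0" "s0 < s" "s0 \<le> 0" using assms by (auto simp: s0_def)
  let ?I = "\<lambda>v. indicat_real {0<..<1} v"
  define g where "g = (\<lambda>v. ?I v * (2 * (p + c) * ((1 + s0) powr (- ((p + 1/2) + (c + 1/2))) *
      (v powr ((p + 1/2) - 1) * (1 - v) powr ((c + 1/2) - 1)))))"
  have "((\<lambda>s. \<integral>v. ?I v * Psi_kernel p c s v \<partial>lborel) has_real_derivative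
     (\<integral>v. ?I v * (- 2 * (p + c) * Psi_kernel (p + 1/2) (c + 1/2) s v) \<partial>lborel)) (at s)"
  proof (rule has_real_derivative_integral[where a = s0 and b = "s + 1" and g = g
        and f = "\<lambda>s v. ?I v * Psi_kernel p c s v"
        and f' = "\<lambda>s v. ?I v * (- 2 * (p + c) * Psi_kernel (p + 1/2) (c + 1/2) s v)"])
    show "integrable lborel (\<lambda>v. ?I v * Psi_kernel p c t v)" if "t \<in> {s0<..<s+1}" for t
      using set_integrable_Psi_kernel[of p c t] assms s0 that by (auto simp: set_integrable_def)
    show "((\<lambda>s. ?I v * Psi_kernel p c s v) has_real_derivative
        ?I v * (- 2 * (p + c) * Psi_kernel (p + 1/2) (c + 1/2) t v)) (at t)"
      if "t \<in> {s0<..<s+1}" for t v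
      using DERIV_Psi_kernel[of v t p c] that s0 by (cases "v \<in> {0<..<1}") (auto intro!: DERIV_cmult)
    show "\<bar>?I v * (- 2 * (p + c) * Psi_kernel (p + 1/2) (c + 1/2) t v)\<bar> \<le> g v"
      if "t \<in> {s0<..<s+1}" for t v
    proof (cases "v \<in> {0<..<1}")
      case True
      have "Psi_kernel (p + 1/2) (c + 1/2) t v \<le> (1 + s0) powr (- ((p + 1/2) + (c + 1/2))) *
          (v powr ((p + 1/2) - 1) * (1 - v) powr ((c + 1/2) - 1))"
        using True that s0 assms by (intro Psi_kernel_bound) auto
      then have "2 * (p + c) * Psi_kernel (p + 1/2) (c + 1/2) t v \<le> 2 * (p + c) *
          ((1 + s0) powr (- ((p + 1/2) + (c + 1/2))) * (v powr ((p + 1/2) - 1) * (1 - v) powr ((c + 1/2) - 1)))"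
        using assms by (intro mult_left_mono) auto
      moreover have "\<bar>- 2 * (p + c) * Psi_kernel (p + 1/2) (c + 1/2) t v\<bar> = 2 * (p + c) * Psi_kernel (p + 1/2) (c + 1/2) t v"
        using assms by (simp add: abs_mult Psi_kernel_def)
      ultimately show ?thesis using True by (simp only: g_def indicator_simps mult_1)
    qed (simp add: g_def)
    have "set_integrable lborel {0<..<1} (\<lambda>v. 2 * (p + c) * ((1 + s0) powr (- ((p + 1/2) + (c + 1/2))) *
        (v powr ((p + 1/2) - 1) * (1 - v) powr ((c + 1/2) - 1))))"
      using assms by (intro set_integrable_mult_right set_integrable_Beta) auto
    then show "integrable lborel g" by (simp only: g_def set_integrable_def real_scaleR_def)
  qed (use s0 in \<open>auto intro!: borel_measurable_times\<close>)
  moreover have "(\<integral>v. ?I v * (- 2 * (p + c) * Psi_kernel (p + 1/2) (c + 1/2) s v) \<partial>lborel) =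
     - 2 * (p + c) * Psi (p + 1/2) (c + 1/2) s"
    unfolding Psi_def set_lebesgue_integral_def by (subst integral_mult_right_zero[symmetric]) (simp add: mult_ac)
  ultimately show ?thesis
    by (simp add: Psi_def[abs_def] set_lebesgue_integral_def)
qed

lemma smooth_on_Psi:
  assumes "p > 0" "c > 0" shows "smooth_on {-1<..} (Psi p c)"
proof (rule smooth_on_real_family[where F = "{\<lambda>s. k * Psi p c s | k p c. p > 0 \<and> c > 0}"])
  have "Psi p c = (\<lambda>s. 1 * Psi p c s)" by simp
  then show "Psi p c \<in> {\<lambda>s. k * Psi p c s | k p c. p > 0 \<and> c > 0}" using assms by blast
  fix f assume "f \<in> {\<lambda>s. k * Psi p c s | k p c. p > 0 \<and> c > 0}"
  then obtain k p c where f: "f = (\<lambda>s. k * Psi p c s)" "p > 0" "c > 0" by blast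
  have "(f has_real_derivative (k * (- 2 * (p + c))) * Psi (p + 1/2) (c + 1/2) s) (at s)" if "s > -1" for s
    unfolding f(1) using DERIV_cmult[OF DERIV_Psi[OF f(2,3) that], of k] by (simp add: mult_ac)
  moreover have "(\<lambda>s. (k * (- 2 * (p + c))) * Psi (p + 1/2) (c + 1/2) s) \<in> {\<lambda>s. k * Psi p c s | k p c. p > 0 \<and> c > 0}"
  proof -
    have "p + 1/2 > 0" "c + 1/2 > 0" using f by auto
    then show ?thesis by blast
  qed
  ultimately show "\<exists>f'\<in>{\<lambda>s. k * Psi p c s | k p c. p > 0 \<and> c > 0}. \<forall>x\<in>{-1<..}. (f has_real_derivative f' x) (at x)"
    by (intro bexI) auto
qed simp

lemma LINT_Beta:
  assumes "p > 0" "c > (0::real)"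
  shows "(LINT v:{0<..<1}|lborel. v powr (p - 1) * (1 - v) powr (c - 1)) = Beta p c"
proof -
  have "(LINT v:{0<..<1}|lborel. v powr (p - 1) * (1 - v) powr (c - 1)) =
      integral {0<..<1} (\<lambda>v. v powr (p - 1) * (1 - v) powr (c - 1))"
    by (rule set_borel_integral_eq_integral(2)[OF set_integrable_Beta[OF assms]])
  also have "\<dots> = Beta p c"
    using has_integral_Beta_real[OF assms] by (simp add: has_integral_Icc_iff_Ioo integral_unique)
  finally show ?thesis .
qed

lemma Psi_0: "p > 0 \<Longrightarrow> c > 0 \<Longrightarrow> Psi p c 0 = Beta p c"
  unfolding Psi_def Psi_kernel_def by (simp add: LINT_Beta)

lemma Psi_pos:
  assumes "p > 0" "c > 0" "s > -1" shows "Psi p c s > 0"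
proof -
  have "0 < Beta p c" using assms by (simp add: Beta_def Gamma_real_pos)
  then have "0 < (1 + \<bar>s\<bar>) powr (- (p + c)) * Beta p c" by simp
  also have "\<dots> = (LINT v:{0<..<1}|lborel. (1 + \<bar>s\<bar>) powr (- (p + c)) * (v powr (p - 1) * (1 - v) powr (c - 1)))"
    using LINT_Beta[OF assms(1,2)] by simp
  also have "\<dots> \<le> Psi p c s"
    unfolding Psi_def
  proof (rule set_integral_mono)
    fix v :: real assume v: "v \<in> {0<..<1}"
    have "2 * s * sqrt (v * (1 - v)) \<le> \<bar>s\<bar> * (2 * sqrt (v * (1 - v)))"
      using sqrt_v_bounds[OF v] by (simp add: mult_right_mono)
    also have "\<dots> \<le> \<bar>s\<bar>" using sqrt_v_bounds[OF v] by (intro mult_left_le) auto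
    finally have "(1 + \<bar>s\<bar>) powr (- (p + c)) \<le> (1 + 2 * s * sqrt (v * (1 - v))) powr (- (p + c))"
      using Psi_base_pos[OF v assms(3)] assms by (intro powr_mono2') auto
    from mult_right_mono[OF this, of "v powr (p - 1) * (1 - v) powr (c - 1)"]
    show "(1 + \<bar>s\<bar>) powr (- (p + c)) * (v powr (p - 1) * (1 - v) powr (c - 1)) \<le> Psi_kernel p c s v"
      by (simp add: Psi_kernel_def mult_ac)
  qed (intro set_integrable_mult_right set_integrable_Beta set_integrable_Psi_kernel assms)+
  finally show ?thesis .
qed

text \<open>The equation for the angular part of a homogeneous harmonic function, of Gegenbauer type. It holds
  because the corresponding combination of the kernels is the derivative in \<open>v\<close> of the function \<open>T\<close> below, which vanishes
  at \<open>v = 0\<close> and \<open>v = 1\<close>.\<close>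

lemma Psi_ODE:
  assumes p: "p > 0" and c: "c > 0" and s: "s > -1"
  shows "(1 - s\<^sup>2) * (4 * (p + c) * (p + c + 1) * Psi (p + 1) (c + 1) s)
     - (2 * (p + c) + 1) * s * (- 2 * (p + c) * Psi (p + 1/2) (c + 1/2) s) = 4 * p * c * Psi p c s"
proof -
  define q where "q = p + c"
  define m where "m = (\<lambda>v::real. sqrt (v * (1 - v)))"
  define D where "D = (\<lambda>v. 1 + 2 * s * m v)"
  \<comment> \<open>The coefficients of \<open>R\<close> are found by matching the derivative of \<open>T\<close> with the three kernels.\<close>
  define R where "R = (\<lambda>v. - 4 * c * (1 - v) + 4 * s * (p - c) * m v + 4 * p * v)"
  define T where "T = (\<lambda>v. v powr p * (1 - v) powr c * D v powr (- (q + 1)) * R v)"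
  define T' where "T' = (\<lambda>v. (1 - s\<^sup>2) * (4 * q * (q + 1) * Psi_kernel (p + 1) (c + 1) s v)
     + (2 * q + 1) * s * (2 * q * Psi_kernel (p + 1/2) (c + 1/2) s v) - 4 * p * c * Psi_kernel p c s v)"
  have D: "D v > 0" if "v \<in> {0..1}" for v
    using Psi_base_pos[of v s] that s by (cases "v \<in> {0<..<1}") (auto simp: D_def m_def)
  have der: "(T has_real_derivative T' v) (at v)" if v: "v \<in> {0<..<1}" for v
  proof -
    have m2: "m v * m v = v * (1 - v)" and m0: "m v > 0" using v by (auto simp: m_def)
    have "(m has_real_derivative (1 - 2 * v) / (2 * m v)) (at v)"
      unfolding m_def using v by (auto intro!: derivative_eq_intros simp: field_simps)
    note dm = this
    have dD: "(D has_real_derivative 2 * s * ((1 - 2 * v) / (2 * m v))) (at v)"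
      unfolding D_def by (auto intro!: derivative_eq_intros dm)
    have dR: "(R has_real_derivative 4 * c + 4 * s * (p - c) * ((1 - 2 * v) / (2 * m v)) + 4 * p) (at v)"
      unfolding R_def by (auto intro!: derivative_eq_intros dm)
    have dDq: "((\<lambda>v. D v powr (- (q + 1))) has_real_derivative
        - (q + 1) * D v powr (- (q + 1) - 1) * (2 * s * ((1 - 2 * v) / (2 * m v)))) (at v)"
      using D[of v] v by (auto intro!: derivative_eq_intros dD)
    have d1: "((\<lambda>v. (1 - v) powr c) has_real_derivative - c * (1 - v) powr (c - 1)) (at v)"
      using v by (auto intro!: derivative_eq_intros)
    have d0: "((\<lambda>v. v powr p) has_real_derivative p * v powr (p - 1)) (at v)"
      using v by (auto intro!: derivative_eq_intros)
    define W where "W = v powr (p - 1) * (1 - v) powr (c - 1) * D v powr (- (q + 2))"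
    have vp: "v powr p = v * v powr (p - 1)" "(1 - v) powr c = (1 - v) * (1 - v) powr (c - 1)"
      "D v powr (- (q + 1)) = D v * D v powr (- (q + 2))" "D v powr (- (q + 1) - 1) = D v powr (- (q + 2))"
    proof -
      have e: "p = 1 + (p - 1)" "c = 1 + (c - 1)" "- (q + 1) = 1 + - (q + 2)" "- (q + 1) - 1 = - (q + 2)" by simp_all
      show "v powr p = v * v powr (p - 1)" using v powr_mult_base[of v "p - 1"] by simp
      show "(1 - v) powr c = (1 - v) * (1 - v) powr (c - 1)" using v powr_mult_base[of "1 - v" "c - 1"] by simp
      show "D v powr (- (q + 1)) = D v * D v powr (- (q + 2))"
        unfolding e(3) using D[of v] v powr_mult_base[of "D v" "- (q + 2)"] by simp
      show "D v powr (- (q + 1) - 1) = D v powr (- (q + 2))" unfolding e(4) ..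
    qed
    have "(T has_real_derivative
       ((p * v powr (p - 1) * (1 - v) powr c + (- c * (1 - v) powr (c - 1)) * v powr p) * D v powr (- (q + 1))
        + (- (q + 1) * D v powr (- (q + 1) - 1) * (2 * s * ((1 - 2 * v) / (2 * m v)))) * (v powr p * (1 - v) powr c)) * R v
        + (4 * c + 4 * s * (p - c) * ((1 - 2 * v) / (2 * m v)) + 4 * p) * (v powr p * (1 - v) powr c * D v powr (- (q + 1)))) (at v)"
      unfolding T_def by (intro DERIV_mult d0 d1 dDq dR)
    moreover have "((p * v powr (p - 1) * (1 - v) powr c + (- c * (1 - v) powr (c - 1)) * v powr p) * D v powr (- (q + 1))
        + (- (q + 1) * D v powr (- (q + 1) - 1) * (2 * s * ((1 - 2 * v) / (2 * m v)))) * (v powr p * (1 - v) powr c)) * R v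
        + (4 * c + 4 * s * (p - c) * ((1 - 2 * v) / (2 * m v)) + 4 * p) * (v powr p * (1 - v) powr c * D v powr (- (q + 1)))
       = W * (((p * (1 - v) - c * v) * D v - (q + 1) * (s * ((1 - 2 * v) * (v * (1 - v) / m v)))) * R v
         + ((4 * c + 4 * p) * (v * (1 - v)) + 2 * s * (p - c) * ((1 - 2 * v) * (v * (1 - v) / m v))) * D v)"
      unfolding vp W_def using m0 by (simp add: field_simps)
    moreover have "v * (1 - v) / m v = m v" using m0 m2 by (simp add: field_simps)
    moreover have "((p * (1 - v) - c * v) * D v - (q + 1) * (s * ((1 - 2 * v) * m v))) * R v
         + ((4 * c + 4 * p) * (v * (1 - v)) + 2 * s * (p - c) * ((1 - 2 * v) * m v)) * D v
       = (1 - s\<^sup>2) * (4 * q * (q + 1)) * (v * (1 - v)) + (2 * q + 1) * s * (2 * q) * m v * D v - 4 * p * c * (D v * D v)"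
      using m2 unfolding D_def R_def q_def by algebra
    moreover have "W * ((1 - s\<^sup>2) * (4 * q * (q + 1)) * (v * (1 - v)) + (2 * q + 1) * s * (2 * q) * m v * D v - 4 * p * c * (D v * D v)) = T' v"
    proof -
      have "Psi_kernel (p + 1) (c + 1) s v = W * (v * (1 - v))"
        using v vp(1,2) by (simp add: Psi_kernel_def W_def q_def D_def m_def add_ac)
      moreover have "Psi_kernel (p + 1/2) (c + 1/2) s v = W * (m v * D v)"
      proof -
        have "v powr (p - 1/2) = v powr (p - 1) * v powr (1/2)" "(1 - v) powr (c - 1/2) = (1 - v) powr (c - 1) * (1 - v) powr (1/2)"
          by (simp_all add: powr_add[symmetric])
        moreover have "v powr (1/2) * (1 - v) powr (1/2) = m v"
          using v by (simp add: powr_half_sqrt real_sqrt_mult m_def)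
        ultimately show ?thesis using vp(3)
          by (simp add: Psi_kernel_def W_def q_def D_def m_def add_ac mult_ac)
      qed
      moreover have "Psi_kernel p c s v = W * (D v * D v)"
      proof -
        have "D v powr (- q) = D v * D v powr (- (q + 1))" using D[of v] v by (simp add: powr_mult_base)
        then show ?thesis using vp(3) by (simp add: Psi_kernel_def W_def q_def D_def m_def)
      qed
      ultimately show ?thesis unfolding T'_def by algebra
    qed
    ultimately show ?thesis by metis
  qed
  have cm: "continuous_on {0..1} m" unfolding m_def by (intro continuous_intros)
  have cD: "continuous_on {0..1} D" unfolding D_def by (intro continuous_intros cm)
  have cR: "continuous_on {0..1} R" unfolding R_def by (intro continuous_intros cm)
  have "continuous_on {0..1} (\<lambda>v. D v powr (- (q + 1)))"
    using D by (intro continuous_on_powr[OF cD continuous_on_const]) force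
  moreover have "continuous_on {0..1::real} (\<lambda>v. v powr p)" "continuous_on {0..1::real} (\<lambda>v. (1 - v) powr c)"
    using p c by (intro continuous_on_powr' continuous_intros; simp)+
  ultimately have "continuous_on {0..1} T" unfolding T_def using cR by (intro continuous_on_mult)
  then have "(T' has_integral (T 1 - T 0)) {0..1}"
    by (rule fundamental_theorem_of_calculus_interior[OF zero_le_one])
      (use der in \<open>simp add: has_real_derivative_iff_has_vector_derivative\<close>)
  then have "integral {0<..<1} T' = 0"
    using p c by (simp add: has_integral_Icc_iff_Ioo integral_unique T_def)
  moreover have ints: "set_integrable lborel {0<..<1} (\<lambda>v. (1 - s\<^sup>2) * (4 * q * (q + 1) * Psi_kernel (p + 1) (c + 1) s v))"
    "set_integrable lborel {0<..<1} (\<lambda>v. (2 * q + 1) * s * (2 * q * Psi_kernel (p + 1/2) (c + 1/2) s v))"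
    "set_integrable lborel {0<..<1} (\<lambda>v. 4 * p * c * Psi_kernel p c s v)"
    using p c s by (auto intro!: set_integrable_mult_right set_integrable_Psi_kernel)
  then have "set_integrable lborel {0<..<1} T'"
    unfolding T'_def by (intro set_integral_diff set_integral_add)
  from set_borel_integral_eq_integral(2)[OF this]
  have "(LINT v:{0<..<1}|lborel. T' v) = integral {0<..<1} T'" .
  moreover have "(LINT v:{0<..<1}|lborel. T' v) = (1 - s\<^sup>2) * (4 * q * (q + 1) * Psi (p + 1) (c + 1) s)
     + (2 * q + 1) * s * (2 * q * Psi (p + 1/2) (c + 1/2) s) - 4 * p * c * Psi p c s"
    using ints unfolding T'_def Psi_def
    by (simp add: set_integral_add set_integral_diff)
  ultimately show ?thesis by (simp add: q_def algebra_simps)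
qed

section \<open>The hypergeometric function on the slit plane\<close>

definition hyp_coeff :: "complex \<Rightarrow> complex \<Rightarrow> complex \<Rightarrow> nat \<Rightarrow> complex" where
  "hyp_coeff a b c k = pochhammer a k * pochhammer b k / pochhammer c k / fact k"

definition slit_plane :: "complex set" where "slit_plane = - (complex_of_real ` {1..})"

text \<open>The description operator in the definition of the hypergeometric function picks some function with this
  property, so properties of its values need the existence of one and the identity theorem.\<close>

definition hyp_continuation :: "complex \<Rightarrow> complex \<Rightarrow> complex \<Rightarrow> (complex \<Rightarrow> complex) \<Rightarrow> bool" where
  "hyp_continuation a b c f \<longleftrightarrow> f holomorphic_on slit_plane \<and> (\<forall>z\<in>ball 0 1. (\<lambda>k. hyp_coeff a b c k * z ^ k) sums f z)"

lemma hyp2F1_eq: "hyp2F1 a b c = (SOME f. hyp_continuation a b c f)"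
  by (simp add: hyp2F1_def hyp_continuation_def hyp_coeff_def slit_plane_def)

lemma open_slit_plane: "open slit_plane"
proof -
  have "complex_of_real ` {1..} = \<real> \<inter> {z. Re z \<ge> 1}"
    by (auto simp: complex_is_Real_iff complex_eq_iff image_iff intro!: bexI[of _ "Re x" for x])
  then have "closed (complex_of_real ` {1..})"
    by (simp add: closed_Int closed_complex_Reals closed_halfspace_Re_ge)
  then show ?thesis by (simp add: slit_plane_def open_Compl)
qed

lemma slit_plane_iff: "z \<in> slit_plane \<longleftrightarrow> Im z \<noteq> 0 \<or> Re z < 1"
  by (auto simp: slit_plane_def complex_eq_iff image_iff not_le intro: exI[of _ "Re z"])

lemma slit_plane_nonpos:
  assumes "z \<in> slit_plane" "0 \<le> t" "t \<le> 1"
  shows "1 - of_real t * z \<notin> \<real>\<^sub>\<le>\<^sub>0"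
proof
  assume "1 - of_real t * z \<in> \<real>\<^sub>\<le>\<^sub>0"
  then have "t * Im z = 0" "1 \<le> t * Re z" by (auto simp: complex_nonpos_Reals_iff)
  then have "t \<noteq> 0" "Im z = 0" by auto
  then have "Re z < 1" using assms(1) by (simp add: slit_plane_iff)
  have "t * Re z < 1"
  proof (cases "Re z \<le> 0")
    case True
    then show ?thesis using assms mult_nonneg_nonpos[of t "Re z"] by simp
  next
    case False
    then have "t * Re z \<le> Re z" using assms by (intro mult_left_le_one_le) auto
    then show ?thesis using \<open>Re z < 1\<close> by simp
  qed
  with \<open>1 \<le> t * Re z\<close> show False by simp
qed

lemma connected_slit_plane: "connected slit_plane"
proof -
  have "starlike slit_plane"
    unfolding starlike_def
  proof (intro bexI ballI)
    show "0 \<in> slit_plane" by (simp add: slit_plane_iff)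
    fix z assume z: "z \<in> slit_plane"
    show "closed_segment 0 z \<subseteq> slit_plane"
    proof
      fix w assume "w \<in> closed_segment 0 z"
      then obtain t where t: "0 \<le> t" "t \<le> 1" "w = of_real t * z"
        by (auto simp: in_segment scaleR_conv_of_real)
      show "w \<in> slit_plane"
        using slit_plane_nonpos[OF z t(1,2)] by (auto simp: t(3) slit_plane_iff complex_nonpos_Reals_iff)
    qed
  qed
  then show ?thesis by (rule starlike_imp_connected)
qed

text \<open>The identity theorem. It transfers every identity between power series from the disc to the whole
  domain.\<close>

lemma slit_plane_eqI:
  assumes "f holomorphic_on slit_plane" "g holomorphic_on slit_plane"
    and "\<And>z. z \<in> ball 0 1 \<Longrightarrow> f z = g z" and "z \<in> slit_plane"
  shows "f z = g z"
proof (rule analytic_continuation_open[of "ball 0 1" slit_plane f g])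
  have "Re w < 1" if "w \<in> ball 0 1" for w
    using that complex_Re_le_cmod[of w] by (simp add: dist_norm)
  then show "ball 0 1 \<subseteq> slit_plane" by (auto simp: slit_plane_iff)
qed (use assms open_slit_plane connected_slit_plane in auto)

lemma ball_subset_slit_plane: "ball 0 1 \<subseteq> slit_plane"
proof -
  have "Re w < 1" if "w \<in> ball 0 1" for w
    using that complex_Re_le_cmod[of w] by (simp add: dist_norm)
  then show ?thesis by (auto simp: slit_plane_iff)
qed

lemma power_series_deriv:
  assumes hol: "f holomorphic_on slit_plane"
    and f: "\<And>z. z \<in> ball 0 1 \<Longrightarrow> (\<lambda>k. A k * z ^ k) sums f z" and z: "z \<in> ball 0 1"
  shows "(\<lambda>k. of_nat (Suc k) * A (Suc k) * z ^ k) sums deriv f z"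
    and "(\<lambda>k. of_nat k * A k * z ^ k) sums (z * deriv f z)"
proof -
  have "(f has_field_derivative deriv f z) (at z)"
    using holomorphic_derivI[OF hol open_slit_plane] ball_subset_slit_plane z by blast
  from termdiffs_sums_strong[of 1 A f, OF _ this]
  show *: "(\<lambda>k. of_nat (Suc k) * A (Suc k) * z ^ k) sums deriv f z"
    using f z by (simp add: diffs_def)
  have "(\<lambda>k. z * (of_nat (Suc k) * A (Suc k) * z ^ k)) sums (z * deriv f z)"
    by (rule sums_mult[OF *])
  then have "(\<lambda>k. of_nat (Suc k) * A (Suc k) * z ^ (Suc k)) sums (z * deriv f z)"
    by (simp add: mult_ac)
  then show "(\<lambda>k. of_nat k * A k * z ^ k) sums (z * deriv f z)"
    by (subst (asm) sums_Suc_iff) simp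
qed

lemma pochhammer_nz: "c > 0 \<Longrightarrow> pochhammer (complex_of_real c) k \<noteq> 0"
  using pochhammer_pos[of c k] by (simp add: pochhammer_of_real)

lemma hyp_coeff_Suc:
  assumes "c > 0"
  shows "of_nat (Suc k) * (of_real c + of_nat k) * hyp_coeff a b (of_real c) (Suc k) =
    (a + of_nat k) * (b + of_nat k) * hyp_coeff a b (of_real c) k"
proof -
  have "complex_of_real c + of_nat k \<noteq> 0"
    using assms by (metis of_real_add of_real_eq_0_iff of_real_of_nat_eq add_pos_nonneg less_irrefl of_nat_0_le_iff)
  moreover have "hyp_coeff a b (of_real c) (Suc k) =
      hyp_coeff a b (of_real c) k * ((a + of_nat k) * (b + of_nat k)) / ((of_real c + of_nat k) * of_nat (Suc k))"
    by (simp add: hyp_coeff_def pochhammer_Suc mult_ac del: of_nat_Suc)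
  moreover have "of_nat (Suc k) \<noteq> (0::complex)" by (simp del: of_nat_Suc)
  ultimately show ?thesis by (simp add: mult_ac del: of_nat_Suc)
qed

text \<open>The operator \<open>(z d/dz + c) / c\<close> multiplies the \<open>k\<close>-th coefficient by \<open>(c + k) / c\<close> and so turns the
  third parameter \<open>c + 1\<close> into \<open>c\<close>. Repeated use reduces the existence of the continuation to large \<open>c\<close>,
  where Euler's integral has no boundary singularity.\<close>

lemma hyp_continuation_lower:
  assumes f: "hyp_continuation a b (of_real (c + 1)) f" and c: "c > 0"
  shows "hyp_continuation a b (of_real c) (\<lambda>z. (z * deriv f z + of_real c * f z) / of_real c)"
proof -
  have hol: "f holomorphic_on slit_plane" and s: "\<And>z. z \<in> ball 0 1 \<Longrightarrow> (\<lambda>k. hyp_coeff a b (of_real (c + 1)) k * z ^ k) sums f z"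
    using f by (auto simp: hyp_continuation_def)
  have "(\<lambda>k. hyp_coeff a b (of_real c) k * z ^ k) sums ((z * deriv f z + of_real c * f z) / of_real c)"
    if z: "z \<in> ball 0 1" for z
  proof -
    have "(\<lambda>k. (of_nat k * hyp_coeff a b (of_real (c + 1)) k * z ^ k + of_real c * (hyp_coeff a b (of_real (c + 1)) k * z ^ k)) / of_real c)
      sums ((z * deriv f z + of_real c * f z) / of_real c)"
      by (intro sums_divide sums_add sums_mult power_series_deriv(2)[OF hol s z] s z)
    moreover have "(of_nat k * hyp_coeff a b (of_real (c + 1)) k * z ^ k + of_real c * (hyp_coeff a b (of_real (c + 1)) k * z ^ k)) / of_real c
        = hyp_coeff a b (of_real c) k * z ^ k" for k
    proof -
      have "complex_of_real c * pochhammer (of_real c + 1) k = pochhammer (of_real c) k * (of_real c + of_nat k)"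
        using pochhammer_rec[of "complex_of_real c" k] pochhammer_Suc[of "complex_of_real c" k] by simp
      then have "(of_real c + of_nat k) / pochhammer (of_real c + 1) k = complex_of_real c / pochhammer (of_real c) k"
        using pochhammer_nz[OF c, of k] pochhammer_nz[of "c + 1" k] c by (simp add: field_simps)
      then have "pochhammer a k * pochhammer b k / fact k * ((of_real c + of_nat k) / pochhammer (of_real c + 1) k) =
          pochhammer a k * pochhammer b k / fact k * (complex_of_real c / pochhammer (of_real c) k)"
        by (rule arg_cong)
      then have "hyp_coeff a b (of_real (c + 1)) k * (of_real c + of_nat k) = of_real c * hyp_coeff a b (of_real c) k"
        by (simp add: hyp_coeff_def mult_ac)
      then have "(of_nat k * hyp_coeff a b (of_real (c + 1)) k + of_real c * hyp_coeff a b (of_real (c + 1)) k) * z ^ k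
        = of_real c * (hyp_coeff a b (of_real c) k * z ^ k)"
        by (simp add: algebra_simps)
      then show ?thesis using c by (simp add: field_simps)
    qed
    ultimately show ?thesis by simp
  qed
  moreover have "(\<lambda>z. (z * deriv f z + of_real c * f z) / of_real c) holomorphic_on slit_plane"
    using c by (intro holomorphic_intros hol holomorphic_deriv[OF hol] open_slit_plane) auto
  ultimately show ?thesis by (simp add: hyp_continuation_def)
qed

lemma continuous_on_powr_Icc:
  assumes "\<kappa> > 0" shows "continuous_on {0..1::real} (\<lambda>x. x powr \<kappa>)"
  using assms by (intro continuous_on_powr'[OF continuous_on_id continuous_on_const, unfolded id_def]) simp

lemma continuous_on_euler_weight:
  assumes "\<kappa> > 0" "d > (0::real)"
  shows "continuous_on {0..1::real} (\<lambda>x. (1 - x powr \<kappa>) powr d)"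
  using assms
  by (intro continuous_on_powr'[OF continuous_on_diff[OF continuous_on_const continuous_on_powr_Icc] continuous_on_const])
    (simp_all add: powr_le1)

text \<open>The substitution \<open>t = x powr (2 / b)\<close> in Euler's integral
  \<open>\<integral> t powr (b - 1) * (1 - t) powr (c - b - 1) * (1 - z * t) powr (- a) dt\<close> removes the singularity at \<open>t = 0\<close>, so that
  with \<open>d = c - b - 1 > 0\<close> all integrands are continuous on the closed interval. The recursion of the moments,
  from integration by parts, is that of \<open>pochhammer b k / pochhammer c k\<close>.\<close>

lemma euler_moments:
  fixes b d :: real
  assumes b: "b > 0" and d: "d > 0"
  defines "\<kappa> \<equiv> 2 / b"
  defines "m \<equiv> \<lambda>k::nat. integral {0..1} (\<lambda>x. x * (1 - x powr \<kappa>) powr d * (x powr \<kappa>) ^ k)"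
  shows "m (Suc k) * (b + 1 + d + real k) = m k * (b + real k)" and "m 0 > 0"
proof -
  have \<kappa>: "\<kappa> > 0" using b by (simp add: \<kappa>_def)
  have cont: "continuous_on {0..1} (\<lambda>x. x * (1 - x powr \<kappa>) powr e * (x powr \<kappa>) ^ k)" if "e > 0" for k and e :: real
    by (intro continuous_on_mult continuous_on_power continuous_on_id[unfolded id_def] continuous_on_powr_Icc continuous_on_euler_weight \<kappa> that)
  have int: "(\<lambda>x. x * (1 - x powr \<kappa>) powr e * (x powr \<kappa>) ^ k) integrable_on {0..1}" if "e > 0" for k and e :: real
    by (rule integrable_continuous_real[OF cont[OF that]])
  define T where "T = (\<lambda>x. x\<^sup>2 * (1 - x powr \<kappa>) powr (d + 1) * (x powr \<kappa>) ^ k)"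
  define J where "J = (\<lambda>k x. x * (1 - x powr \<kappa>) powr d * (x powr \<kappa>) ^ k)"
  have der: "(T has_real_derivative (2 + \<kappa> * k) * (J k x - J (Suc k) x) - \<kappa> * (d + 1) * J (Suc k) x) (at x)"
    if x: "x \<in> {0<..<1}" for x
  proof -
    define y where "y = x powr \<kappa>"
    have "0 < y" "y < 1" using x \<kappa> powr_less_mono2[of \<kappa> x 1] by (auto simp: y_def)
    have dy: "((\<lambda>x. x powr \<kappa>) has_real_derivative \<kappa> * y / x) (at x)"
      using x by (auto intro!: derivative_eq_intros simp: y_def powr_diff)
    have d1: "((\<lambda>x. (1 - x powr \<kappa>) powr (d + 1)) has_real_derivative - (d + 1) * (1 - y) powr d * (\<kappa> * y / x)) (at x)"
    proof -
      have "((\<lambda>x. 1 - x powr \<kappa>) has_real_derivative 0 - \<kappa> * y / x) (at x)"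
        by (rule DERIV_diff[OF DERIV_const dy])
      from DERIV_fun_powr[OF this, of "d + 1"] show ?thesis
        using \<open>y < 1\<close> by (simp add: y_def algebra_simps)
    qed
    have d2: "((\<lambda>x. (x powr \<kappa>) ^ k) has_real_derivative k * y ^ k * (\<kappa> / x)) (at x)"
    proof -
      have "((\<lambda>x. (x powr \<kappa>) ^ k) has_real_derivative k * y ^ (k - 1) * (\<kappa> * y / x)) (at x)"
        using DERIV_power[OF dy, of k] by (simp add: y_def mult_ac)
      moreover have "k * y ^ (k - 1) * (\<kappa> * y / x) = k * y ^ k * (\<kappa> / x)" by (cases k) auto
      ultimately show ?thesis by (simp only:)
    qed
    have "((\<lambda>x. x\<^sup>2) has_real_derivative 2 * x) (at x)" by (auto intro!: derivative_eq_intros)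
    from DERIV_mult[OF DERIV_mult[OF this d1] d2]
    have "(T has_real_derivative (2 * x * (1 - y) powr (d + 1) + (- (d + 1) * (1 - y) powr d * (\<kappa> * y / x)) * x\<^sup>2) * y ^ k
       + k * y ^ k * (\<kappa> / x) * (x\<^sup>2 * (1 - y) powr (d + 1))) (at x)"
      by (simp add: T_def y_def)
    moreover have "(1 - y) powr (d + 1) = (1 - y) * (1 - y) powr d"
      using \<open>y < 1\<close> powr_mult_base[of "1 - y" d] by (simp add: add.commute)
    moreover have "(2 * x * ((1 - y) * (1 - y) powr d) + (- (d + 1) * (1 - y) powr d * (\<kappa> * y / x)) * x\<^sup>2) * y ^ k
       + k * y ^ k * (\<kappa> / x) * (x\<^sup>2 * ((1 - y) * (1 - y) powr d))
       = (2 + \<kappa> * k) * (J k x - J (Suc k) x) - \<kappa> * (d + 1) * J (Suc k) x"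
      using x by (simp add: J_def y_def[symmetric] field_simps power2_eq_square)
    ultimately show ?thesis by (simp only:)
  qed
  have "continuous_on {0..1} T"
    unfolding T_def using d by (intro continuous_on_mult continuous_on_power continuous_on_id[unfolded id_def] continuous_on_powr_Icc continuous_on_euler_weight \<kappa>) simp
  then have h1: "((\<lambda>x. (2 + \<kappa> * k) * (J k x - J (Suc k) x) - \<kappa> * (d + 1) * J (Suc k) x) has_integral (T 1 - T 0)) {0..1}"
    by (rule fundamental_theorem_of_calculus_interior[OF zero_le_one])
      (use der in \<open>simp add: has_real_derivative_iff_has_vector_derivative\<close>)
  have T01: "T 1 - T 0 = 0" using d by (simp add: T_def)
  have h2: "((\<lambda>x. (2 + \<kappa> * k) * (J k x - J (Suc k) x) - \<kappa> * (d + 1) * J (Suc k) x) has_integral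
     ((2 + \<kappa> * k) * (m k - m (Suc k)) - \<kappa> * (d + 1) * m (Suc k))) {0..1}"
    unfolding m_def J_def by (intro has_integral_diff has_integral_mult_right integrable_integral int d)
  have "(2 + \<kappa> * k) * (m k - m (Suc k)) - \<kappa> * (d + 1) * m (Suc k) = 0"
    using has_integral_unique[OF h2 h1] T01 by (simp only:)
  moreover have "(2 + \<kappa> * k) * (m k - m (Suc k)) - \<kappa> * (d + 1) * m (Suc k) =
      (2 / b) * (m k * (b + real k) - m (Suc k) * (b + 1 + d + real k))"
    using b by (simp add: \<kappa>_def field_simps)
  ultimately have "(2 / b) * (m k * (b + real k) - m (Suc k) * (b + 1 + d + real k)) = 0" by (simp only:)
  then show "m (Suc k) * (b + 1 + d + real k) = m k * (b + real k)"
    using b by simp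
  have "m 0 \<ge> 0" unfolding m_def by (intro integral_nonneg int d) auto
  moreover have "m 0 \<noteq> 0"
  proof
    assume "m 0 = 0"
    then have "((\<lambda>x. x * (1 - x powr \<kappa>) powr d * (x powr \<kappa>) ^ 0) has_integral 0) (cbox 0 1)"
      using integrable_integral[OF int[OF d, of 0]] by (simp add: m_def)
    from has_integral_0_cbox_imp_0[OF _ _ this, of "1/2"]
    have "(1/2) * (1 - (1/2) powr \<kappa>) powr d * ((1/2) powr \<kappa>) ^ 0 = (0::real)"
      using cont[OF d, of 0] by (simp add: box_real)
    moreover have "(1/2) powr \<kappa> < (1::real)" using \<kappa> powr_less_mono2[of \<kappa> "1/2" 1] by simp
    ultimately show False by simp
  qed
  ultimately show "m 0 > 0" by simp
qed

text \<open>Euler's integral defines a function on the whole slit plane, because \<open>1 - t z\<close> avoids the negative half axis for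
  \<open>0 \<le> t \<le> 1\<close>. On the disc the binomial series is integrated term by term, and the moments
  produce the hypergeometric coefficients.\<close>

lemma hyp_continuation_euler:
  fixes a :: complex and b c :: real
  assumes b: "b > 0" and c: "c > b + 1"
  shows "\<exists>f. hyp_continuation a (of_real b) (of_real c) f"
proof -
  define d where "d = c - b - 1"
  define \<kappa> where "\<kappa> = 2 / b"
  define w where "w = (\<lambda>x::real. x * (1 - x powr \<kappa>) powr d)"
  define m where "m = (\<lambda>k::nat. integral {0..1} (\<lambda>x. w x * (x powr \<kappa>) ^ k))"
  have d: "d > 0" using c by (simp add: d_def)
  have \<kappa>: "\<kappa> > 0" using b by (simp add: \<kappa>_def)
  have m_Suc: "m (Suc k) * (c + real k) = m k * (b + real k)" for k
    using euler_moments(1)[OF b d, of k] by (simp add: m_def w_def \<kappa>_def d_def)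
  have m0: "m 0 > 0" using euler_moments(2)[OF b d] by (simp add: m_def w_def \<kappa>_def)
  have m_poch: "complex_of_real (m k) / of_real (m 0) = pochhammer (of_real b) k / pochhammer (of_real c) k" for k
  proof (induction k)
    case (Suc k)
    have ck: "c + real k > 0" using b c by simp
    then have "m (Suc k) = m k * (b + real k) / (c + real k)" using m_Suc[of k] by (simp add: field_simps)
    then have "complex_of_real (m (Suc k)) / of_real (m 0) =
        (of_real (m k) / of_real (m 0)) * (of_real b + of_nat k) / (of_real c + of_nat k)"
      by (simp add: field_simps)
    then show ?case unfolding Suc.IH by (simp add: pochhammer_Suc)
  qed (use m0 in simp)
  have cont_w: "continuous_on {0..1} w"
    unfolding w_def by (intro continuous_on_mult continuous_on_power continuous_on_id[unfolded id_def] continuous_on_powr_Icc continuous_on_euler_weight \<kappa> d)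
  have cont_x: "continuous_on {0..1} (\<lambda>x::real. x powr \<kappa>)"
    by (rule continuous_on_powr_Icc[OF \<kappa>])
  have x01: "0 \<le> x powr \<kappa>" "x powr \<kappa> \<le> 1" if "x \<in> {0..1}" for x :: real
    using that \<kappa> by (auto simp: powr_le1)
  define g where "g = (\<lambda>z x. of_real (w x) * exp (- a * Ln (1 - of_real (x powr \<kappa>) * z)))"
  define f where "f = (\<lambda>z. integral (cbox 0 1) (g z) / of_real (m 0))"
  have cont_g: "continuous_on {0..1} (g z)" if "z \<in> slit_plane" for z
    unfolding g_def using slit_plane_nonpos[OF that] x01
    by (intro continuous_on_mult continuous_on_of_real continuous_on_exp continuous_on_const
        continuous_on_Ln' continuous_on_diff cont_w cont_x) auto
  have "f holomorphic_on slit_plane"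
  proof -
    have "(\<lambda>z. integral (cbox 0 1) (g z)) field_differentiable (at z)" if zs: "z \<in> slit_plane" for z
    proof -
      obtain e where e: "e > 0" "ball z e \<subseteq> slit_plane"
        using open_slit_plane zs unfolding open_contains_ball by blast
      define g' where "g' = (\<lambda>z x. of_real (w x) * (exp (- a * Ln (1 - of_real (x powr \<kappa>) * z)) *
        (- a * (- of_real (x powr \<kappa>) / (1 - of_real (x powr \<kappa>) * z)))))"
      have "(\<lambda>z. integral (cbox 0 1) (g z)) holomorphic_on ball z e"
      proof (rule leibniz_rule_holomorphic[where fx = g'])
        show "((\<lambda>z. g z x) has_field_derivative g' y x) (at y within ball z e)"
          if "y \<in> ball z e" "x \<in> cbox 0 1" for y x
        proof -
          have y: "1 - of_real (x powr \<kappa>) * y \<notin> \<real>\<^sub>\<le>\<^sub>0"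
            using slit_plane_nonpos[of y "x powr \<kappa>"] x01[of x] that e(2) by auto
          have "((\<lambda>z. Ln (1 - of_real (x powr \<kappa>) * z)) has_field_derivative
             - of_real (x powr \<kappa>) / (1 - of_real (x powr \<kappa>) * y)) (at y)"
            using y by (auto intro!: derivative_eq_intros simp: divide_inverse)
          then have "((\<lambda>z. exp (- a * Ln (1 - of_real (x powr \<kappa>) * z))) has_field_derivative
             exp (- a * Ln (1 - of_real (x powr \<kappa>) * y)) * (- a * (- of_real (x powr \<kappa>) / (1 - of_real (x powr \<kappa>) * y)))) (at y)"
            by (intro DERIV_fun_exp DERIV_cmult)
          from has_field_derivative_at_within[OF DERIV_cmult[OF this, of "of_real (w x)"]]
          show ?thesis unfolding g_def g'_def .
        qed
        show "g y integrable_on cbox 0 1" if "y \<in> ball z e" for y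
          using cont_g[of y] e(2) that by (intro integrable_continuous) auto
        have 1: "continuous_on (ball z e \<times> cbox 0 1) (\<lambda>p. w (snd p))"
          by (rule continuous_on_compose2[OF cont_w continuous_on_snd]) (auto intro: continuous_intros)
        have 2: "continuous_on (ball z e \<times> cbox 0 1) (\<lambda>p. snd p powr \<kappa>)"
          by (rule continuous_on_compose2[OF cont_x continuous_on_snd]) (auto intro: continuous_intros)
        have 3: "1 - of_real (snd p powr \<kappa>) * fst p \<notin> \<real>\<^sub>\<le>\<^sub>0" if "p \<in> ball z e \<times> cbox 0 1" for p
          using slit_plane_nonpos[of "fst p" "snd p powr \<kappa>"] x01[of "snd p"] that e(2) by auto
        then have 4: "1 - of_real (snd p powr \<kappa>) * fst p \<noteq> 0" if "p \<in> ball z e \<times> cbox 0 1" for p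
          using that by fastforce
        show "continuous_on (ball z e \<times> cbox 0 1) (\<lambda>(z, x). g' z x)"
          unfolding g'_def split_beta using 3 4
          by (intro continuous_on_mult continuous_on_of_real continuous_on_exp continuous_on_const continuous_on_minus
            continuous_on_Ln' continuous_on_diff continuous_on_divide continuous_on_fst continuous_on_id[unfolded id_def] 1 2) auto
      qed auto
      then show ?thesis
        using e(1) by (intro holomorphic_on_imp_differentiable_at[of _ "ball z e"]) auto
    qed
    then have "(\<lambda>z. integral (cbox 0 1) (g z)) holomorphic_on slit_plane"
      by (auto simp: holomorphic_on_def intro: field_differentiable_at_within)
    then show ?thesis unfolding f_def using m0 by (intro holomorphic_intros) auto
  qed
  moreover have "(\<lambda>k. hyp_coeff a (of_real b) (of_real c) k * z ^ k) sums f z" if z: "z \<in> ball 0 1" for z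
  proof -
    have nz: "norm z < 1" using z by simp
    define A where "A = (\<lambda>k. pochhammer a k / fact k)"
    have bc: "(- a gchoose k) * (- x) ^ k = A k * x ^ k" for k and x :: complex
    proof -
      have "(- a gchoose k) * (- x) ^ k = ((-1) ^ k * (-1) ^ k) * (pochhammer a k / fact k * x ^ k)"
        by (simp only: gbinomial_pochhammer power_minus[of x] minus_minus) (simp add: mult_ac)
      moreover have "(-1) ^ k * (-1) ^ k = (1::complex)" by (simp flip: power_mult_distrib)
      ultimately show ?thesis by (simp add: A_def)
    qed
    have binom: "(\<lambda>k. A k * (of_real t * z) ^ k) sums exp (- a * Ln (1 - of_real t * z))" if "0 \<le> t" "t \<le> 1" for t
    proof -
      have "norm (- (of_real t * z)) < 1"
        using nz that by (simp add: norm_mult) (meson le_less_trans mult_left_le_one_le norm_ge_zero)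
      from gen_binomial_complex[OF this, of "- a"]
      have "(\<lambda>k. A k * (of_real t * z) ^ k) sums (1 - of_real t * z) powr (- a)"
        unfolding bc by simp
      moreover have "1 - of_real t * z \<noteq> 0"
        using slit_plane_nonpos[of z t] ball_subset_slit_plane z that by force
      ultimately show ?thesis by (simp add: powr_def)
    qed
    have "summable (\<lambda>k. norm (A k * z ^ k))"
    proof -
      obtain r where r: "norm z < r" "r < 1" using nz dense by blast
      have r0: "0 < r" using order_le_less_trans[OF norm_ge_zero r(1)] .
      then have "norm (- complex_of_real r) < 1" using r by simp
      from gen_binomial_complex[OF this, of "- a"] have "summable (\<lambda>k. A k * (of_real r) ^ k)"
        unfolding bc by (rule sums_summable)
      then show ?thesis by (rule powser_insidea) (use r r0 in simp)
    qed
    note sumA = this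
    have "bounded (w ` {0..1})"
      by (rule compact_imp_bounded[OF compact_continuous_image[OF cont_w compact_Icc]])
    then obtain W where "\<forall>y\<in>w ` {0..1}. norm y \<le> W" unfolding bounded_iff by blast
    then have W: "norm (w x) \<le> W" if "x \<in> {0..1}" for x using that by blast
    have W0: "0 \<le> W" using order_trans[OF norm_ge_zero W[of 0]] by simp
    define S where "S = (\<lambda>x. \<Sum>k. of_real (w x) * (A k * (of_real (x powr \<kappa>) * z) ^ k))"
    have "uniform_limit {0..1} (\<lambda>n x. \<Sum>k<n. of_real (w x) * (A k * (of_real (x powr \<kappa>) * z) ^ k)) S sequentially"
      unfolding S_def
    proof (rule Weierstrass_m_test)
      fix n and x :: real assume x: "x \<in> {0..1}"
      have "norm (of_real (x powr \<kappa>) * z) \<le> norm z"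
        using x01[OF x] by (simp add: norm_mult mult_left_le_one_le)
      then have "norm ((of_real (x powr \<kappa>) * z) ^ n) \<le> norm (z ^ n)"
        unfolding norm_power by (rule power_mono) simp
      then have a1: "norm (A n * (of_real (x powr \<kappa>) * z) ^ n) \<le> norm (A n * z ^ n)"
        unfolding norm_mult[of "A n"] by (rule mult_left_mono) simp
      have a2: "norm (complex_of_real (w x)) \<le> W" using W[OF x] by simp
      show "norm (of_real (w x) * (A n * (of_real (x powr \<kappa>) * z) ^ n)) \<le> W * norm (A n * z ^ n)"
        unfolding norm_mult[of "of_real (w x)"] by (rule mult_mono[OF a2 a1 W0 norm_ge_zero])
    qed (rule summable_mult[OF sumA])
    then have ul: "uniform_limit (cbox 0 1) (\<lambda>n x. \<Sum>k<n. of_real (w x) * (A k * (of_real (x powr \<kappa>) * z) ^ k)) S sequentially"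
      by simp
    have Sg: "S x = g z x" if "x \<in> {0..1}" for x
      using sums_unique[OF sums_mult[OF binom[OF x01[OF that]], of "of_real (w x)"]] by (simp add: g_def S_def)
    have cont_k: "continuous_on {0..1} (\<lambda>x. w x * (x powr \<kappa>) ^ k)" for k
      by (intro continuous_on_mult continuous_on_power cont_w cont_x)
    have hk: "((\<lambda>x. of_real (w x) * (A k * (of_real (x powr \<kappa>) * z) ^ k)) has_integral (of_real (m k) * (A k * z ^ k))) {0..1}" for k
    proof -
      have "((\<lambda>x. w x * (x powr \<kappa>) ^ k) has_integral m k) {0..1}"
        unfolding m_def by (intro integrable_integral integrable_continuous_real cont_k)
      then have "((\<lambda>x. complex_of_real (w x * (x powr \<kappa>) ^ k)) has_integral of_real (m k)) {0..1}"
        by (rule has_integral_of_real)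
      from has_integral_mult_left[OF this, of "A k * z ^ k"] show ?thesis
        by (simp add: mult_ac power_mult_distrib)
    qed
    have contn: "continuous_on (cbox 0 1) (\<lambda>x. \<Sum>k<n. of_real (w x) * (A k * (of_real (x powr \<kappa>) * z) ^ k))" for n
      unfolding box_real
      by (intro continuous_on_sum continuous_on_mult continuous_on_of_real continuous_on_power
          continuous_on_const cont_w cont_x)
    obtain I J where IJ: "\<And>n. ((\<lambda>x. \<Sum>k<n. of_real (w x) * (A k * (of_real (x powr \<kappa>) * z) ^ k)) has_integral I n) (cbox 0 1)"
      "(S has_integral J) (cbox 0 1)" "(I \<longlongrightarrow> J) sequentially"
      by (rule uniform_limit_integral_cbox[OF ul contn sequentially_bot]) (rule that; assumption)
    have "I n = (\<Sum>k<n. of_real (m k) * (A k * z ^ k))" for n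
    proof (rule has_integral_unique)
      show "((\<lambda>x. \<Sum>k<n. of_real (w x) * (A k * (of_real (x powr \<kappa>) * z) ^ k)) has_integral I n) {0..1}"
        using IJ(1)[of n] by (simp only: box_real)
      show "((\<lambda>x. \<Sum>k<n. of_real (w x) * (A k * (of_real (x powr \<kappa>) * z) ^ k)) has_integral
          (\<Sum>k<n. of_real (m k) * (A k * z ^ k))) {0..1}"
        by (intro has_integral_sum finite_lessThan hk)
    qed
    then have "I = (\<lambda>n. \<Sum>k<n. of_real (m k) * (A k * z ^ k))" by (rule ext)
    with IJ(3) have "(\<lambda>k. of_real (m k) * (A k * z ^ k)) sums J"
      unfolding sums_def by (simp only:)
    moreover have "(g z has_integral J) (cbox 0 1)"
      by (rule has_integral_eq[OF _ IJ(2)]) (use Sg in simp)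
    ultimately have "(\<lambda>k. of_real (m k) * (A k * z ^ k)) sums integral (cbox 0 1) (g z)"
      by (simp only: integral_unique)
    from sums_divide[OF this, of "of_real (m 0)"]
    have "(\<lambda>k. (of_real (m k) / of_real (m 0)) * (A k * z ^ k)) sums f z"
      by (simp add: f_def)
    then show ?thesis unfolding m_poch by (simp add: hyp_coeff_def A_def mult_ac)
  qed
  ultimately show ?thesis unfolding hyp_continuation_def by blast
qed

lemma hyp_continuation_exists:
  assumes "b > 0" "c > 0" shows "\<exists>f. hyp_continuation a (of_real b) (of_real c) f"
proof -
  have "\<exists>f. hyp_continuation a (of_real b) (of_real c) f" if "c + real m > b + 1" "c > 0" for m c
    using that
  proof (induction m arbitrary: c)
    case 0
    then show ?case using hyp_continuation_euler[OF assms(1)] by simp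
  next
    case (Suc m)
    have "c + 1 + real m > b + 1" "c + 1 > 0" using Suc.prems by auto
    then obtain f where "hyp_continuation a (of_real b) (of_real (c + 1)) f" using Suc.IH by blast
    from hyp_continuation_lower[OF this Suc.prems(2)] show ?case by blast
  qed
  moreover obtain m :: nat where "b + 1 - c < real m" using reals_Archimedean2 by blast
  then have "c + real m > b + 1" by simp
  ultimately show ?thesis using assms(2) by blast
qed

lemma hyp2F1_continuation:
  assumes "b > 0" "c > 0" shows "hyp_continuation a (of_real b) (of_real c) (hyp2F1 a (of_real b) (of_real c))"
  unfolding hyp2F1_eq using someI_ex[OF hyp_continuation_exists[OF assms]] .

text \<open>Termwise differentiation on the disc gives, up to a constant factor, the coefficients of the function with all
  parameters raised by one.\<close>

lemma hyp2F1_deriv: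
  assumes b: "b > 0" and c: "c > 0" and z: "z \<in> slit_plane"
  shows "deriv (hyp2F1 a (of_real b) (of_real c)) z =
    a * of_real b / of_real c * hyp2F1 (a + 1) (of_real (b + 1)) (of_real (c + 1)) z"
proof (rule slit_plane_eqI[OF _ _ _ z])
  have h: "hyp_continuation a (of_real b) (of_real c) (hyp2F1 a (of_real b) (of_real c))"
    and h1: "hyp_continuation (a + 1) (of_real (b + 1)) (of_real (c + 1)) (hyp2F1 (a + 1) (of_real (b + 1)) (of_real (c + 1)))"
    using b c by (intro hyp2F1_continuation; simp)+
  then show "deriv (hyp2F1 a (of_real b) (of_real c)) holomorphic_on slit_plane"
    by (auto simp: hyp_continuation_def intro: holomorphic_deriv open_slit_plane)
  show "(\<lambda>z. a * of_real b / of_real c * hyp2F1 (a + 1) (of_real (b + 1)) (of_real (c + 1)) z) holomorphic_on slit_plane"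
    using h1 c by (auto simp: hyp_continuation_def intro!: holomorphic_intros)
  fix w :: complex assume w: "w \<in> ball 0 1"
  have "(\<lambda>k. of_nat (Suc k) * hyp_coeff a (of_real b) (of_real c) (Suc k) * w ^ k) sums deriv (hyp2F1 a (of_real b) (of_real c)) w"
    by (rule power_series_deriv(1)[OF _ _ w]) (use h in \<open>auto simp: hyp_continuation_def\<close>)
  moreover have "(\<lambda>k. a * of_real b / of_real c * (hyp_coeff (a + 1) (of_real (b + 1)) (of_real (c + 1)) k * w ^ k)) sums
     (a * of_real b / of_real c * hyp2F1 (a + 1) (of_real (b + 1)) (of_real (c + 1)) w)"
    using h1 w by (intro sums_mult) (auto simp: hyp_continuation_def)
  moreover have "a * of_real b / of_real c * (hyp_coeff (a + 1) (of_real (b + 1)) (of_real (c + 1)) k * w ^ k) =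
     of_nat (Suc k) * hyp_coeff a (of_real b) (of_real c) (Suc k) * w ^ k" for k
    using pochhammer_nz[of "c + 1" k] c
    by (simp add: hyp_coeff_def pochhammer_rec field_simps del: of_nat_Suc)
  ultimately show "deriv (hyp2F1 a (of_real b) (of_real c)) w =
     a * of_real b / of_real c * hyp2F1 (a + 1) (of_real (b + 1)) (of_real (c + 1)) w"
    by (simp add: sums_unique2)
qed

text \<open>On the disc the hypergeometric equation is the two-term recursion of the coefficients; by analyticity
  it persists on the slit plane, which contains the arguments \<open>- tan\<^sup>2 \<theta> \<le> -1\<close> outside the disc.\<close>

lemma hyp2F1_ODE:
  fixes a :: complex
  assumes b: "b > 0" and c: "c > 0" and z: "z \<in> slit_plane"
  defines "f \<equiv> hyp2F1 a (of_real b) (of_real c)"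
  shows "z * (1 - z) * deriv (deriv f) z + (of_real c - (a + of_real b + 1) * z) * deriv f z = a * of_real b * f z"
proof (rule slit_plane_eqI[OF _ _ _ z])
  have "hyp_continuation a (of_real b) (of_real c) f" unfolding f_def by (rule hyp2F1_continuation[OF b c])
  then have hol: "f holomorphic_on slit_plane"
    and s: "\<And>z. z \<in> ball 0 1 \<Longrightarrow> (\<lambda>k. hyp_coeff a (of_real b) (of_real c) k * z ^ k) sums f z"
    by (auto simp: hyp_continuation_def)
  have hol': "deriv f holomorphic_on slit_plane" by (rule holomorphic_deriv[OF hol open_slit_plane])
  show "(\<lambda>z. z * (1 - z) * deriv (deriv f) z + (of_real c - (a + of_real b + 1) * z) * deriv f z) holomorphic_on slit_plane"
    by (intro holomorphic_intros hol' holomorphic_deriv[OF hol'] open_slit_plane)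
  show "(\<lambda>z. a * of_real b * f z) holomorphic_on slit_plane" by (intro holomorphic_intros hol)
  fix z :: complex assume z: "z \<in> ball 0 1"
  let ?A = "hyp_coeff a (of_real b) (of_real c)"
  define G where "G = (\<lambda>z. z * deriv f z)"
  have Ghol: "G holomorphic_on slit_plane" unfolding G_def by (intro holomorphic_intros hol')
  have Gs: "(\<lambda>k. of_nat k * ?A k * z ^ k) sums G z" if "z \<in> ball 0 1" for z
    unfolding G_def by (rule power_series_deriv(2)[OF hol s that])
  have "(deriv f has_field_derivative deriv (deriv f) z) (at z)"
    using holomorphic_derivI[OF hol' open_slit_plane] ball_subset_slit_plane z by blast
  then have "(G has_field_derivative deriv f z + z * deriv (deriv f) z) (at z)"
    unfolding G_def by (auto intro!: derivative_eq_intros)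
  then have G': "deriv G z = deriv f z + z * deriv (deriv f) z" by (rule DERIV_imp_deriv)
  have 1: "(\<lambda>k. of_nat (Suc k) * (of_nat (Suc k) * ?A (Suc k)) * z ^ k) sums deriv G z"
    and 2: "(\<lambda>k. of_nat k * (of_nat k * ?A k) * z ^ k) sums (z * deriv G z)"
    using power_series_deriv[OF Ghol Gs z] by blast+
  have 3: "(\<lambda>k. of_nat (Suc k) * ?A (Suc k) * z ^ k) sums deriv f z"
    by (rule power_series_deriv(1)[OF hol s z])
  have "(\<lambda>k. of_nat (Suc k) * (of_nat (Suc k) * ?A (Suc k)) * z ^ k + (of_real c - 1) * (of_nat (Suc k) * ?A (Suc k) * z ^ k)
     - of_nat k * (of_nat k * ?A k) * z ^ k - (a + of_real b) * (of_nat k * ?A k * z ^ k)) sums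
     (deriv G z + (of_real c - 1) * deriv f z - z * deriv G z - (a + of_real b) * G z)"
    by (intro sums_add sums_diff sums_mult 1 2 3 Gs z)
  moreover have "of_nat (Suc k) * (of_nat (Suc k) * ?A (Suc k)) * z ^ k + (of_real c - 1) * (of_nat (Suc k) * ?A (Suc k) * z ^ k)
     - of_nat k * (of_nat k * ?A k) * z ^ k - (a + of_real b) * (of_nat k * ?A k * z ^ k) = a * of_real b * (?A k * z ^ k)" for k
  proof -
    have "of_nat (Suc k) * (of_nat (Suc k) * ?A (Suc k)) + (of_real c - 1) * (of_nat (Suc k) * ?A (Suc k))
      = of_nat (Suc k) * (of_real c + of_nat k) * ?A (Suc k)" by (simp add: algebra_simps)
    also have "\<dots> = (a + of_nat k) * (of_real b + of_nat k) * ?A k" by (rule hyp_coeff_Suc[OF c])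
    finally have "of_nat (Suc k) * (of_nat (Suc k) * ?A (Suc k)) + (of_real c - 1) * (of_nat (Suc k) * ?A (Suc k))
     - of_nat k * (of_nat k * ?A k) - (a + of_real b) * (of_nat k * ?A k) = a * of_real b * ?A k"
      by (simp add: algebra_simps)
    then have "(of_nat (Suc k) * (of_nat (Suc k) * ?A (Suc k)) + (of_real c - 1) * (of_nat (Suc k) * ?A (Suc k))
     - of_nat k * (of_nat k * ?A k) - (a + of_real b) * (of_nat k * ?A k)) * z ^ k = a * of_real b * ?A k * z ^ k"
      by simp
    then show ?thesis by (simp only: algebra_simps)
  qed
  ultimately have "(\<lambda>k. a * of_real b * (?A k * z ^ k)) sums
     (deriv G z + (of_real c - 1) * deriv f z - z * deriv G z - (a + of_real b) * G z)" by simp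
  moreover have "(\<lambda>k. a * of_real b * (?A k * z ^ k)) sums (a * of_real b * f z)"
    by (intro sums_mult s z)
  ultimately have "deriv G z + (of_real c - 1) * deriv f z - z * deriv G z - (a + of_real b) * G z = a * of_real b * f z"
    by (rule sums_unique2)
  then show "z * (1 - z) * deriv (deriv f) z + (of_real c - (a + of_real b + 1) * z) * deriv f z = a * of_real b * f z"
    unfolding G' by (simp add: G_def algebra_simps)
qed

lemma of_real_in_slit_plane: "x < 1 \<Longrightarrow> of_real x \<in> slit_plane"
  by (simp add: slit_plane_iff)

lemma DERIV_hyp2F1_real:
  assumes "b > 0" "c > 0" "x < 1"
  shows "(hyp2F1_real a b c has_real_derivative a * b / c * hyp2F1_real (a + 1) (b + 1) (c + 1) x) (at x)"
proof -
  let ?f = "hyp2F1 (of_real a) (of_real b) (of_real c)"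
  have hol: "?f holomorphic_on slit_plane"
    using hyp2F1_continuation[OF assms(1,2)] by (auto simp: hyp_continuation_def)
  have "(?f has_field_derivative deriv ?f (of_real x)) (at (of_real x))"
    by (rule holomorphic_derivI[OF hol open_slit_plane of_real_in_slit_plane[OF assms(3)]])
  then have "((\<lambda>t. ?f (of_real t)) has_vector_derivative deriv ?f (of_real x)) (at x)"
    by (rule has_vector_derivative_real_field)
  from bounded_linear.has_vector_derivative[OF bounded_linear_Re this]
  have "(hyp2F1_real a b c has_real_derivative Re (deriv ?f (of_real x))) (at x)"
    unfolding hyp2F1_real_def[abs_def] by (simp add: has_real_derivative_iff_has_vector_derivative)
  moreover have "deriv ?f (of_real x) = of_real (a * b / c) * hyp2F1 (of_real (a + 1)) (of_real (b + 1)) (of_real (c + 1)) (of_real x)"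
    using hyp2F1_deriv[OF assms(1,2) of_real_in_slit_plane[OF assms(3)], of "of_real a"] by simp
  ultimately show ?thesis
    by (simp add: hyp2F1_real_def del: of_real_mult of_real_divide of_real_add)
qed

lemma hyp2F1_real_0: assumes "b > 0" "c > 0" shows "hyp2F1_real a b c 0 = 1"
proof -
  have "\<forall>z\<in>ball 0 1. (\<lambda>k. hyp_coeff (of_real a) (of_real b) (of_real c) k * z ^ k) sums hyp2F1 (of_real a) (of_real b) (of_real c) z"
    using hyp2F1_continuation[OF assms, of "of_real a"] unfolding hyp_continuation_def by blast
  then have "(\<lambda>k. hyp_coeff (of_real a) (of_real b) (of_real c) k * 0 ^ k) sums hyp2F1 (of_real a) (of_real b) (of_real c) 0"
    by (rule bspec) simp
  moreover have "(\<lambda>k. hyp_coeff (of_real a) (of_real b) (of_real c) k * 0 ^ k) sums hyp_coeff (of_real a) (of_real b) (of_real c) 0"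
    by (rule powser_sums_zero)
  ultimately have "hyp2F1 (of_real a) (of_real b) (of_real c) 0 = hyp_coeff (of_real a) (of_real b) (of_real c) 0"
    by (rule sums_unique2)
  then have "hyp2F1 (of_real a) (of_real b) (of_real c) 0 = 1"
    by (simp add: hyp_coeff_def)
  then show ?thesis by (simp add: hyp2F1_real_def)
qed

lemma hyp2F1_real_ODE:
  assumes b: "b > 0" and c: "c > 0" and x: "x < 1"
  shows "x * (1 - x) * (a * b / c * ((a + 1) * (b + 1) / (c + 1) * hyp2F1_real (a + 2) (b + 2) (c + 2) x))
    + (c - (a + b + 1) * x) * (a * b / c * hyp2F1_real (a + 1) (b + 1) (c + 1) x) = a * b * hyp2F1_real a b c x"
proof -
  let ?f = "hyp2F1 (of_real a) (of_real b) (of_real c)"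
  let ?f1 = "hyp2F1 (of_real (a + 1)) (of_real (b + 1)) (of_real (c + 1))"
  let ?f2 = "hyp2F1 (of_real (a + 2)) (of_real (b + 2)) (of_real (c + 2))"
  have X: "complex_of_real x \<in> slit_plane" by (rule of_real_in_slit_plane[OF x])
  have d: "deriv ?f z = of_real (a * b / c) * ?f1 z" if "z \<in> slit_plane" for z
    using hyp2F1_deriv[OF b c that, of "of_real a"] by simp
  have "deriv (deriv ?f) (of_real x) = deriv (\<lambda>z. of_real (a * b / c) * ?f1 z) (of_real x)"
    by (rule deriv_cong_ev) (use d X open_slit_plane in \<open>auto intro!: eventually_nhds_in_open[THEN eventually_mono]\<close>)
  also have "\<dots> = of_real (a * b / c) * deriv ?f1 (of_real x)"
  proof -
    have "?f1 holomorphic_on slit_plane"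
      using hyp2F1_continuation[of "b + 1" "c + 1"] b c by (auto simp: hyp_continuation_def)
    then have "?f1 field_differentiable (at (of_real x))"
      using X open_slit_plane holomorphic_on_imp_differentiable_at by blast
    then show ?thesis by (rule deriv_cmult)
  qed
  also have "deriv ?f1 (of_real x) = of_real ((a + 1) * (b + 1) / (c + 1)) * ?f2 (of_real x)"
    using hyp2F1_deriv[of "b + 1" "c + 1" "of_real x" "of_real (a + 1)"] b c X by (simp add: add.assoc)
  finally have dd: "deriv (deriv ?f) (of_real x) = of_real (a * b / c) * (of_real ((a + 1) * (b + 1) / (c + 1)) * ?f2 (of_real x))" .
  have "of_real (x * (1 - x)) * (of_real (a * b / c) * (of_real ((a + 1) * (b + 1) / (c + 1)) * ?f2 (of_real x)))
     + of_real (c - (a + b + 1) * x) * (of_real (a * b / c) * ?f1 (of_real x)) = of_real (a * b) * ?f (of_real x)"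
    using hyp2F1_ODE[OF b c X, of "of_real a"] unfolding dd d[OF X] by simp
  from arg_cong[OF this, of Re] show ?thesis
    by (simp add: hyp2F1_real_def Re_complex_of_real del: of_real_mult of_real_divide of_real_add of_real_diff)
qed

section \<open>The boundary constant\<close>

text \<open>Up to the factor \<open>-2\<close>, the quotient of the slope and the value of \<open>\<Psi>\<close> at \<open>0\<close>. It is where the quotient of Gamma
  functions in \<open>C(n,b)\<close> comes from.\<close>

lemma Beta_quotient:
  assumes "p > 0" "c > (0::real)"
  shows "(p + c) * Beta (p + 1/2) (c + 1/2) =
    Gamma (p + 1/2) * Gamma (c + 1/2) / (Gamma p * Gamma c) * Beta p c"
proof -
  have "Gamma (p + 1/2 + (c + 1/2)) = (p + c) * Gamma (p + c)"
  proof -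
    have "p + c \<notin> \<int>\<^sub>\<le>\<^sub>0" using assms by (auto elim!: nonpos_Ints_cases)
    from Gamma_plus1[OF this] show ?thesis by (simp add: add_ac)
  qed
  note g = this
  have pos: "Gamma p > 0" "Gamma c > 0" "Gamma (p + c) > 0" using assms by (auto intro: Gamma_real_pos)
  have "(p + c) * (A * B / ((p + c) * G)) = A * B / (X * Y) * (X * Y / G)" if "X > 0" "Y > 0" "G > 0" for A B X Y G :: real
    using that assms by simp
  then show ?thesis unfolding Beta_def g using pos by blast
qed

lemma eq_divideI: "k > 0 \<Longrightarrow> k * x = y \<Longrightarrow> x = y / (k::real)"
  by auto

text \<open>The hypergeometric functions of the boundary constant assemble into the even and the odd solution of
  \<open>(1 + t\<^sup>2) u'' + (2 a + 2 p + 1) t u' + 4 a p u = 0\<close>, normalised at \<open>t = 0\<close> to \<open>(1, 0)\<close> and \<open>(0, 1)\<close>. The primed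
  names are their derivatives.\<close>

definition hyp_even :: "real \<Rightarrow> real \<Rightarrow> real \<Rightarrow> real" where
  "hyp_even a p t = hyp2F1_real a p (1/2) (- t\<^sup>2)"
definition hyp_odd :: "real \<Rightarrow> real \<Rightarrow> real \<Rightarrow> real" where
  "hyp_odd a p t = t * hyp2F1_real (a + 1/2) (p + 1/2) (3/2) (- t\<^sup>2)"
definition hyp_even' :: "real \<Rightarrow> real \<Rightarrow> real \<Rightarrow> real" where
  "hyp_even' a p t = - 4 * a * p * t * hyp2F1_real (a + 1) (p + 1) (3/2) (- t\<^sup>2)"
definition hyp_odd' :: "real \<Rightarrow> real \<Rightarrow> real \<Rightarrow> real" where
  "hyp_odd' a p t = hyp2F1_real (a + 1/2) (p + 1/2) (3/2) (- t\<^sup>2)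
     - 4/3 * (a + 1/2) * (p + 1/2) * t\<^sup>2 * hyp2F1_real (a + 3/2) (p + 3/2) (5/2) (- t\<^sup>2)"

lemma DERIV_hyp_square:
  assumes "b > 0" "c > 0"
  shows "((\<lambda>t. hyp2F1_real a b c (- t\<^sup>2)) has_real_derivative
    - 2 * t * (a * b / c * hyp2F1_real (a + 1) (b + 1) (c + 1) (- t\<^sup>2))) (at t)"
proof -
  have "((\<lambda>t::real. - t\<^sup>2) has_real_derivative - 2 * t) (at t)" by (auto intro!: derivative_eq_intros)
  moreover have "- t\<^sup>2 < 1" using zero_le_power2[of t] by linarith
  ultimately show ?thesis
    by (intro DERIV_cong[OF DERIV_chain2[where f = "hyp2F1_real a b c" and g = "\<lambda>t. - t\<^sup>2",
        OF DERIV_hyp2F1_real[OF assms]]]) (assumption | simp)+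
qed

context
  fixes a p :: real assumes p: "p > 0"
begin

lemma DERIV_hyp_even: "(hyp_even a p has_real_derivative hyp_even' a p t) (at t)"
  using DERIV_hyp_square[of p "1/2" a t] p by (simp add: hyp_even_def[abs_def] hyp_even'_def mult_ac)

lemma DERIV_hyp_odd: "(hyp_odd a p has_real_derivative hyp_odd' a p t) (at t)"
proof -
  define G where "G = hyp2F1_real (a + 3/2) (p + 3/2) (5/2) (- t\<^sup>2)"
  have e: "a + 1/2 + 1 = a + 3/2" "p + 1/2 + 1 = p + 3/2" "3/2 + 1 = (5/2::real)" by simp_all
  have "p + 1/2 > 0" "3/2 > (0::real)" using p by simp_all
  from DERIV_mult[OF DERIV_ident DERIV_hyp_square[OF this, of "a + 1/2" t]]
  have "(hyp_odd a p has_real_derivative 1 * hyp2F1_real (a + 1/2) (p + 1/2) (3/2) (- t\<^sup>2) +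
      (- 2 * t * ((a + 1/2) * (p + 1/2) / (3/2) * G)) * t) (at t)"
    unfolding e G_def hyp_odd_def[abs_def] .
  then show ?thesis
    by (rule DERIV_cong) (unfold hyp_odd'_def G_def[symmetric], simp add: field_simps power2_eq_square)
qed

lemma DERIV_hyp_even':
  "(hyp_even' a p has_real_derivative - ((2 * a + 2 * p + 1) * t * hyp_even' a p t + 4 * a * p * hyp_even a p t) / (1 + t\<^sup>2)) (at t)"
proof -
  define F0 where "F0 = hyp2F1_real a p (1/2) (- t\<^sup>2)"
  define F1 where "F1 = hyp2F1_real (a + 1) (p + 1) (3/2) (- t\<^sup>2)"
  define F2 where "F2 = hyp2F1_real (a + 2) (p + 2) (5/2) (- t\<^sup>2)"
  have F1': "((\<lambda>t. hyp2F1_real (a + 1) (p + 1) (3/2) (- t\<^sup>2)) has_real_derivative - 2 * t * ((a + 1) * (p + 1) / (3/2) * F2)) (at t)"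
    using DERIV_hyp_square[of "p + 1" "3/2" "a + 1" t] p by (simp add: F2_def add.assoc)
  have "((\<lambda>t. - 4 * a * p * t * hyp2F1_real (a + 1) (p + 1) (3/2) (- t\<^sup>2)) has_real_derivative
      - 4 * a * p * 1 * F1 + (- 2 * t * ((a + 1) * (p + 1) / (3/2) * F2)) * (- 4 * a * p * t)) (at t)"
    unfolding F1_def by (intro DERIV_mult DERIV_cmult DERIV_ident F1')
  note d = this
  have "- t\<^sup>2 < 1" using zero_le_power2[of t] by linarith
  then have ode: "- t\<^sup>2 * (1 + t\<^sup>2) * (2 * a * p * ((a + 1) * (p + 1) / (3/2) * F2)) + (1/2 + (a + p + 1) * t\<^sup>2) * (2 * a * p * F1)
      = a * p * F0"
    using hyp2F1_real_ODE[of p "1/2" "- t\<^sup>2" a] p by (simp add: F0_def F1_def F2_def)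
  have k: "1 + t\<^sup>2 > 0" using zero_le_power2[of t] by linarith
  have "(1 + t\<^sup>2) * (- 4 * a * p * 1 * F1 + (- 2 * t * ((a + 1) * (p + 1) / (3/2) * F2)) * (- 4 * a * p * t)) =
      - ((2 * a + 2 * p + 1) * t * (- 4 * a * p * t * F1) + 4 * a * p * F0)"
  proof -
    define Z where "Z = (a + 1) * (p + 1) / (3/2) * F2"
    have "- t\<^sup>2 * (1 + t\<^sup>2) * (2 * a * p * Z) + (1/2 + (a + p + 1) * t\<^sup>2) * (2 * a * p * F1) = a * p * F0"
      using ode unfolding Z_def .
    then show ?thesis unfolding Z_def[symmetric] by algebra
  qed
  then show ?thesis
    using DERIV_cong[OF d eq_divideI[OF k]]
    unfolding hyp_even'_def[abs_def] hyp_even_def F1_def F0_def by blast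
qed

lemma DERIV_hyp_odd':
  "(hyp_odd' a p has_real_derivative - ((2 * a + 2 * p + 1) * t * hyp_odd' a p t + 4 * a * p * hyp_odd a p t) / (1 + t\<^sup>2)) (at t)"
proof -
  define G0 where "G0 = hyp2F1_real (a + 1/2) (p + 1/2) (3/2) (- t\<^sup>2)"
  define G1 where "G1 = hyp2F1_real (a + 3/2) (p + 3/2) (5/2) (- t\<^sup>2)"
  define G2 where "G2 = hyp2F1_real (a + 5/2) (p + 5/2) (7/2) (- t\<^sup>2)"
  define \<alpha> where "\<alpha> = (a + 1/2) * (p + 1/2) / (3/2)"
  define Z where "Z = (a + 3/2) * (p + 3/2) / (5/2) * G2"
  have G0': "((\<lambda>t. hyp2F1_real (a + 1/2) (p + 1/2) (3/2) (- t\<^sup>2)) has_real_derivative - 2 * t * (\<alpha> * G1)) (at t)"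
  proof -
    have e: "a + 1/2 + 1 = a + 3/2" "p + 1/2 + 1 = p + 3/2" "3/2 + 1 = (5/2::real)" by simp_all
    have "p + 1/2 > 0" "3/2 > (0::real)" using p by simp_all
    from DERIV_hyp_square[OF this, of "a + 1/2" t] show ?thesis unfolding e G1_def \<alpha>_def .
  qed
  have G1': "((\<lambda>t. hyp2F1_real (a + 3/2) (p + 3/2) (5/2) (- t\<^sup>2)) has_real_derivative - 2 * t * Z) (at t)"
  proof -
    have e: "a + 3/2 + 1 = a + 5/2" "p + 3/2 + 1 = p + 5/2" "5/2 + 1 = (7/2::real)" by simp_all
    have "p + 3/2 > 0" "5/2 > (0::real)" using p by simp_all
    from DERIV_hyp_square[OF this, of "a + 3/2" t] show ?thesis unfolding e G2_def Z_def .
  qed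
  have sq: "((\<lambda>t::real. t\<^sup>2) has_real_derivative 2 * t) (at t)" by (auto intro!: derivative_eq_intros)
  have "((\<lambda>t. hyp2F1_real (a + 1/2) (p + 1/2) (3/2) (- t\<^sup>2) - 2 * \<alpha> * t\<^sup>2 * hyp2F1_real (a + 3/2) (p + 3/2) (5/2) (- t\<^sup>2)) has_real_derivative
      - 2 * t * (\<alpha> * G1) - (2 * \<alpha> * (2 * t) * G1 + (- 2 * t * Z) * (2 * \<alpha> * t\<^sup>2))) (at t)"
    using DERIV_diff[OF G0' DERIV_mult[OF DERIV_cmult[OF sq, of "2 * \<alpha>"] G1']] unfolding G1_def .
  note d = this
  have "- t\<^sup>2 < 1" using zero_le_power2[of t] by linarith
  then have ode: "- t\<^sup>2 * (1 + t\<^sup>2) * (\<alpha> * Z) + (3/2 + (a + p + 2) * t\<^sup>2) * (\<alpha> * G1) = (3/2) * \<alpha> * G0"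
  proof -
    have e: "a + 1/2 + 1 = a + 3/2" "p + 1/2 + 1 = p + 3/2" "3/2 + 1 = (5/2::real)"
      "a + 1/2 + 2 = a + 5/2" "p + 1/2 + 2 = p + 5/2" "3/2 + 2 = (7/2::real)" "1 - - t\<^sup>2 = 1 + t\<^sup>2"
      "3/2 - (a + 1/2 + (p + 1/2) + 1) * - t\<^sup>2 = 3/2 + (a + p + 2) * t\<^sup>2"
      by (simp_all add: algebra_simps)
    have "p + 1/2 > 0" "3/2 > (0::real)" using p by simp_all
    from hyp2F1_real_ODE[OF this \<open>- t\<^sup>2 < 1\<close>, of "a + 1/2"]
    have "- t\<^sup>2 * (1 + t\<^sup>2) * (\<alpha> * Z) + (3/2 + (a + p + 2) * t\<^sup>2) * (\<alpha> * G1) = (a + 1/2) * (p + 1/2) * G0"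
      unfolding e G0_def G1_def G2_def \<alpha>_def Z_def .
    then show ?thesis by (simp add: \<alpha>_def)
  qed
  have k: "1 + t\<^sup>2 > 0" using zero_le_power2[of t] by linarith
  have "(1 + t\<^sup>2) * (- 2 * t * (\<alpha> * G1) - (2 * \<alpha> * (2 * t) * G1 + (- 2 * t * Z) * (2 * \<alpha> * t\<^sup>2))) =
      - ((2 * a + 2 * p + 1) * t * (G0 - 2 * \<alpha> * t\<^sup>2 * G1) + 4 * a * p * (t * G0))"
  proof -
    have "3 * \<alpha> = 2 * ((a + 1/2) * (p + 1/2))" by (simp add: \<alpha>_def)
    then have "4 * a * p = 6 * \<alpha> - 2 * a - 2 * p - 1" by (simp add: algebra_simps)
    then show ?thesis using ode by algebra
  qed
  moreover have he: "hyp_odd' a p = (\<lambda>t. hyp2F1_real (a + 1/2) (p + 1/2) (3/2) (- t\<^sup>2) - 2 * \<alpha> * t\<^sup>2 * hyp2F1_real (a + 3/2) (p + 3/2) (5/2) (- t\<^sup>2))"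
    by (auto simp: hyp_odd'_def[abs_def] \<alpha>_def)
  ultimately show ?thesis
    using DERIV_cong[OF d eq_divideI[OF k]]
    unfolding he hyp_odd_def G1_def G0_def by blast
qed

end

text \<open>In the variable \<open>t = y / H\<^sub>0 x\<close>, the tangent of the latitude, and after
  removing a power of \<open>1 + t\<^sup>2\<close>, the ground state solves the same equation as \<open>hyp_even\<close> and \<open>hyp_odd\<close>,
  with \<open>a = 1/2 - c\<close>.\<close>

lemma DERIV_Psi_tan:
  fixes p c :: real
  assumes p: "p > 0" and c: "c > 0"
  defines "w \<equiv> \<lambda>t. (1 + t\<^sup>2) powr (- p) * Psi p c (t / sqrt (1 + t\<^sup>2))"
  defines "w' \<equiv> \<lambda>t. - 2 * p * t * (1 + t\<^sup>2) powr (- p - 1) * Psi p c (t / sqrt (1 + t\<^sup>2))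
      + (1 + t\<^sup>2) powr (- p - 3/2) * (- 2 * (p + c) * Psi (p + 1/2) (c + 1/2) (t / sqrt (1 + t\<^sup>2)))"
  shows "(w has_real_derivative w' t) (at t)"
    and "(w' has_real_derivative - ((2 * (1/2 - c) + 2 * p + 1) * t * w' t + 4 * (1/2 - c) * p * w t) / (1 + t\<^sup>2)) (at t)"
proof -
  define q where "q = p + c"
  define k where "k = 1 + t\<^sup>2"
  define s where "s = (\<lambda>t::real. t / sqrt (1 + t\<^sup>2))"
  have k: "k > 0" unfolding k_def using zero_le_power2[of t] by linarith
  have s1: "s t > -1"
  proof -
    have "\<bar>t\<bar> < sqrt k" using real_sqrt_less_mono[of "t\<^sup>2" k] by (simp add: k_def)
    then show ?thesis using k by (simp add: s_def k_def[symmetric] field_simps)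
  qed
  define P0 where "P0 = Psi p c (s t)"
  define P1 where "P1 = Psi (p + 1/2) (c + 1/2) (s t)"
  define P2 where "P2 = Psi (p + 1) (c + 1) (s t)"
  have kd: "((\<lambda>t. (1 + t\<^sup>2) powr e) has_real_derivative e * k powr (e - 1) * (2 * t)) (at t)" for e
    using k unfolding k_def by (auto intro!: derivative_eq_intros)
  have sd: "(s has_real_derivative k powr (- 3/2)) (at t)"
  proof -
    have s_eq: "s = (\<lambda>t. t * (1 + t\<^sup>2) powr (- 1/2))"
    proof
      fix t :: real
      have "1 + t\<^sup>2 > 0" using zero_le_power2[of t] by linarith
      then show "s t = t * (1 + t\<^sup>2) powr (- 1/2)"
        by (simp add: s_def powr_minus_divide powr_half_sqrt)
    qed
    have "(s has_real_derivative 1 * (1 + t\<^sup>2) powr (-1/2) + ((-1/2) * k powr (-1/2 - 1) * (2 * t)) * t) (at t)"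
      unfolding s_eq by (rule DERIV_mult[OF DERIV_ident kd])
    moreover have "(1 + t\<^sup>2) powr (-1/2) = k * k powr (-3/2)"
      using k powr_mult_base[of k "-3/2"] by (simp add: k_def)
    moreover have "k powr (-1/2 - 1) = k powr (-3/2)" by (rule arg_cong) simp
    ultimately have "(s has_real_derivative k * k powr (-3/2) - k powr (-3/2) * t\<^sup>2) (at t)"
      by (simp only:) (simp add: power2_eq_square mult_ac)
    then show ?thesis by (simp add: k_def algebra_simps)
  qed
  have P0d: "((\<lambda>t. Psi p c (s t)) has_real_derivative (- 2 * q * P1) * k powr (- 3/2)) (at t)"
    using DERIV_chain2[OF DERIV_Psi[OF p c s1] sd] by (simp add: q_def P1_def)
  have P1d: "((\<lambda>t. Psi (p + 1/2) (c + 1/2) (s t)) has_real_derivative (- 2 * (q + 1) * P2) * k powr (- 3/2)) (at t)"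
    using DERIV_chain2[OF DERIV_Psi[OF _ _ s1, of "p + 1/2" "c + 1/2"] sd] p c by (simp add: q_def P2_def add_ac)
  have weq: "w = (\<lambda>t. (1 + t\<^sup>2) powr (- p) * Psi p c (s t))" by (simp add: w_def s_def)
  have w'eq: "w' = (\<lambda>t. - 2 * p * t * (1 + t\<^sup>2) powr (- p - 1) * Psi p c (s t)
      + (1 + t\<^sup>2) powr (- p - 3/2) * (- 2 * q * Psi (p + 1/2) (c + 1/2) (s t)))"
    by (simp add: w'_def s_def q_def)
  have "(w has_real_derivative (- p * k powr (- p - 1) * (2 * t)) * P0 + ((- 2 * q * P1) * k powr (- 3/2)) * (1 + t\<^sup>2) powr (- p)) (at t)"
    unfolding weq P0_def by (rule DERIV_mult[OF kd P0d])
  moreover have "k powr (-3/2) * k powr (- p) = k powr (- p - 3/2)" 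
    unfolding powr_add[symmetric] by (rule arg_cong) simp
  ultimately show w1: "(w has_real_derivative w' t) (at t)"
    unfolding w'eq by (elim DERIV_cong) (simp add: P0_def P1_def k_def[symmetric] mult_ac)
  have td: "((\<lambda>t. - 2 * p * t) has_real_derivative - 2 * p) (at t)" by (auto intro!: derivative_eq_intros)
  have d2: "(w' has_real_derivative
     ((- 2 * p * k powr (- p - 1) + ((- p - 1) * k powr (- p - 1 - 1) * (2 * t)) * (- 2 * p * t)) * P0
        + ((- 2 * q * P1) * k powr (- 3/2)) * (- 2 * p * t * k powr (- p - 1)))
     + (((- p - 3/2) * k powr (- p - 3/2 - 1) * (2 * t)) * (- 2 * q * P1)
        + (- 2 * q * ((- 2 * (q + 1) * P2) * k powr (- 3/2))) * k powr (- p - 3/2))) (at t)"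
    unfolding w'eq P0_def P1_def k_def
    by (intro DERIV_add DERIV_mult DERIV_cmult td kd[unfolded k_def] P0d[unfolded P1_def k_def] P1d[unfolded k_def])
  have ss: "1 - (s t)\<^sup>2 = 1 / k" "s t * k powr (1/2) = t"
    using k by (simp_all add: s_def k_def[symmetric] power_divide powr_half_sqrt field_simps)
  have ode: "(1 / k) * (4 * q * (q + 1) * P2) - (2 * q + 1) * s t * (- 2 * q * P1) = 4 * p * c * P0"
    using Psi_ODE[OF p c s1] unfolding ss(1) by (simp add: q_def P0_def P1_def P2_def)
  define Y where "Y = k powr (- p - 2)"
  define h where "h = k powr (1/2)"
  have h2: "h * h = k" using k by (simp add: h_def powr_add[symmetric])
  have h0: "h > 0" using k by (simp add: h_def)
  have e: "- p - 1 = 1 + (- p - 2)" "- p - 1 - 1 = - p - 2" "- p = 2 + (- p - 2)"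
    "- 3/2 + (- p - 1) = - p - 2 - 1/2" "- p - 3/2 - 1 = - p - 2 - 1/2" "- 3/2 + (- p - 3/2) = - p - 2 - 1"
    "- p - 3/2 = - p - 2 + 1/2" by simp_all
  have pw1: "k powr (- p - 1) = k * Y" unfolding e(1) powr_add Y_def using k by simp
  have pw2: "k powr (- p - 1 - 1) = Y" unfolding e(2) Y_def ..
  have pw3: "k powr (- p) = k\<^sup>2 * Y"
    using powr_add[of k 2 "- p - 2"] k by (simp add: Y_def)
  have pw4: "k powr (- 3/2) * k powr (- p - 1) = Y / h"
    unfolding powr_add[symmetric] e(4) Y_def h_def by (rule powr_diff)
  have pw5: "k powr (- p - 3/2 - 1) = Y / h" unfolding e(5) Y_def h_def by (rule powr_diff)
  have pw6: "k powr (- 3/2) * k powr (- p - 3/2) = Y / k"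
    unfolding powr_add[symmetric] e(6) Y_def using powr_diff[of k "- p - 2" 1] k by simp
  have pw7: "k powr (- p - 3/2) = Y * h" unfolding e(7) Y_def h_def by (rule powr_add)
  note pw = pw4 pw6 pw2 pw5 pw7 pw1 pw3
  have "((- 2 * p * k powr (- p - 1) + ((- p - 1) * k powr (- p - 1 - 1) * (2 * t)) * (- 2 * p * t)) * P0
        + ((- 2 * q * P1) * k powr (- 3/2)) * (- 2 * p * t * k powr (- p - 1)))
     + (((- p - 3/2) * k powr (- p - 3/2 - 1) * (2 * t)) * (- 2 * q * P1)
        + (- 2 * q * ((- 2 * (q + 1) * P2) * k powr (- 3/2))) * k powr (- p - 3/2))
     = ((- 2 * p * k + 4 * p * (p + 1) * t\<^sup>2) * P0 + (4 * p * t * q * P1) / h + (2 * p + 3) * t * 2 * q * P1 / h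
        + 4 * q * (q + 1) * P2 / k) * Y"
  proof -
    have e1: "((- 2 * q * P1) * k powr (- 3/2)) * (- 2 * p * t * k powr (- p - 1)) = 4 * p * t * q * P1 * (Y / h)"
      unfolding pw4[symmetric] by algebra
    have e2: "(- 2 * q * ((- 2 * (q + 1) * P2) * k powr (- 3/2))) * k powr (- p - 3/2) = 4 * q * (q + 1) * P2 * (Y / k)"
      unfolding pw6[symmetric] by algebra
    show ?thesis unfolding e1 e2 unfolding pw1 pw2 pw5
      by (simp add: algebra_simps power2_eq_square add_divide_distrib)
  qed
  moreover have "- ((2 * (1/2 - c) + 2 * p + 1) * t * w' t + 4 * (1/2 - c) * p * w t) / (1 + t\<^sup>2) =
     - ((2 - 2 * c + 2 * p) * t * (- 2 * p * t * (k * Y) * P0 + (Y * h) * (- 2 * q * P1)) + (2 - 4 * c) * p * (k\<^sup>2 * Y * P0)) / k"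
    unfolding w'eq weq k_def[symmetric] P0_def[symmetric] P1_def[symmetric] pw
    by simp
  moreover have "((- 2 * p * k + 4 * p * (p + 1) * t\<^sup>2) * P0 + (4 * p * t * q * P1) / h + (2 * p + 3) * t * 2 * q * P1 / h
        + 4 * q * (q + 1) * P2 / k) * Y = - ((2 - 2 * c + 2 * p) * t * (- 2 * p * t * (k * Y) * P0 + (Y * h) * (- 2 * q * P1)) + (2 - 4 * c) * p * (k\<^sup>2 * Y * P0)) / k"
  proof -
    have T: "t\<^sup>2 = k - 1" by (simp add: k_def)
    have hk: "1 / h = h / k" using h0 h2 k by (simp add: field_simps)
    have "4 * q * (q + 1) * P2 / k = 4 * p * c * P0 - (2 * q + 1) * s t * (2 * q * P1)"
      using ode by simp
    moreover have "s t = t / h" using ss(2) h0 by (simp add: h_def field_simps)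
    ultimately have e: "4 * q * (q + 1) * P2 / k = 4 * p * c * P0 - (2 * q + 1) * (t / h) * (2 * q * P1)" by simp
    have X1: "((- 2 * p * k + 4 * p * (p + 1) * t\<^sup>2) * P0 + (4 * p * t * q * P1) / h + (2 * p + 3) * t * 2 * q * P1 / h
        + 4 * q * (q + 1) * P2 / k) = (- 2 * p * k + 4 * p * (p + 1) * (k - 1) + 4 * p * c) * P0
        + (4 * p + 2 * (2 * p + 3) - 2 * (2 * q + 1)) * (q * P1 * t / h)"
      unfolding e T by (simp add: algebra_simps add_divide_distrib diff_divide_distrib)
    have X2: "- ((2 - 2 * c + 2 * p) * t * (- 2 * p * t * (k * Y) * P0 + (Y * h) * (- 2 * q * P1)) + (2 - 4 * c) * p * (k\<^sup>2 * Y * P0)) / k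
      = (((2 - 2 * c + 2 * p) * 2 * p * (k - 1) - (2 - 4 * c) * p * k) * P0 + (2 - 2 * c + 2 * p) * 2 * (q * P1 * t / h)) * Y"
    proof -
      have "h / k = 1 / h" using hk by simp
      have "- ((2 - 2 * c + 2 * p) * t * (- 2 * p * t * (k * Y) * P0 + (Y * h) * (- 2 * q * P1)) + (2 - 4 * c) * p * (k\<^sup>2 * Y * P0)) / k
        = ((2 - 2 * c + 2 * p) * 2 * p * t\<^sup>2 * P0 + (2 - 2 * c + 2 * p) * 2 * (q * P1 * t * (h / k)) - (2 - 4 * c) * p * k * P0) * Y"
        using k by (simp add: field_simps power2_eq_square)
      then show ?thesis unfolding \<open>h / k = 1 / h\<close> T by (simp add: algebra_simps)
    qed
    have c1: "- 2 * p * k + 4 * p * (p + 1) * (k - 1) + 4 * p * c = (2 - 2 * c + 2 * p) * 2 * p * (k - 1) - (2 - 4 * c) * p * k"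
      by (simp add: algebra_simps)
    have c2: "4 * p + 2 * (2 * p + 3) - 2 * (2 * q + 1) = (2 - 2 * c + 2 * p) * 2"
      by (simp add: q_def algebra_simps)
    show ?thesis unfolding X1 X2 c1 c2 ..
  qed
  ultimately show "(w' has_real_derivative - ((2 * (1/2 - c) + 2 * p + 1) * t * w' t + 4 * (1/2 - c) * p * w t) / (1 + t\<^sup>2)) (at t)"
    using d2 by (simp only:)
qed

text \<open>The Wronskian times \<open>(1 + t\<^sup>2) powr (\<alpha> / 2)\<close> is constant, and the initial condition makes it
  zero.\<close>

lemma wronskian_proportional:
  fixes u u' v v' :: "real \<Rightarrow> real"
  assumes u: "\<And>t. (u has_real_derivative u' t) (at t)"
      "\<And>t. (u' has_real_derivative - (\<alpha> * t * u' t + \<beta> * u t) / (1 + t\<^sup>2)) (at t)"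
    and v: "\<And>t. (v has_real_derivative v' t) (at t)"
      "\<And>t. (v' has_real_derivative - (\<alpha> * t * v' t + \<beta> * v t) / (1 + t\<^sup>2)) (at t)"
    and init: "u 0 * v' 0 = u' 0 * v 0" and pos: "\<And>t. v t > 0"
  shows "u' t * v t = u t * v' t" and "u t = u 0 / v 0 * v t"
proof -
  define V where "V = (\<lambda>t. u t * v' t - u' t * v t)"
  have k: "1 + t\<^sup>2 > 0" for t :: real using zero_le_power2[of t] by linarith
  have V': "(V has_real_derivative - (\<alpha> * t / (1 + t\<^sup>2)) * V t) (at t)" for t
  proof -
    have "(V has_real_derivative (u' t * v' t + (- (\<alpha> * t * v' t + \<beta> * v t) / (1 + t\<^sup>2)) * u t)
       - ((- (\<alpha> * t * u' t + \<beta> * u t) / (1 + t\<^sup>2)) * v t + v' t * u' t)) (at t)"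
      unfolding V_def by (intro DERIV_diff DERIV_mult u v)
    moreover have "(u' t * v' t + (- (\<alpha> * t * v' t + \<beta> * v t) / (1 + t\<^sup>2)) * u t)
       - ((- (\<alpha> * t * u' t + \<beta> * u t) / (1 + t\<^sup>2)) * v t + v' t * u' t) = - (\<alpha> * t / (1 + t\<^sup>2)) * V t"
      unfolding divide_inverse by (simp add: V_def algebra_simps)
    ultimately show ?thesis by (simp only:)
  qed
  \<comment> \<open>By Abel's identity this is constant.\<close>
  define W where "W = (\<lambda>t. V t * (1 + t\<^sup>2) powr (\<alpha> / 2))"
  have "(W has_real_derivative 0) (at t)" for t
  proof -
    have "((\<lambda>t. (1 + t\<^sup>2) powr (\<alpha> / 2)) has_real_derivative \<alpha> / 2 * (1 + t\<^sup>2) powr (\<alpha> / 2 - 1) * (2 * t)) (at t)"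
      using k[of t] by (auto intro!: derivative_eq_intros)
    from DERIV_mult[OF V' this]
    have "(W has_real_derivative (- (\<alpha> * t / (1 + t\<^sup>2)) * V t) * (1 + t\<^sup>2) powr (\<alpha> / 2) +
        \<alpha> / 2 * (1 + t\<^sup>2) powr (\<alpha> / 2 - 1) * (2 * t) * V t) (at t)"
      unfolding W_def .
    moreover have "(1 + t\<^sup>2) powr (\<alpha> / 2) = (1 + t\<^sup>2) * (1 + t\<^sup>2) powr (\<alpha> / 2 - 1)"
      using k[of t] powr_mult_base[of "1 + t\<^sup>2" "\<alpha> / 2 - 1"] by simp
    ultimately show ?thesis using k[of t] by simp
  qed
  then have "W t = W 0" for t using DERIV_isconst_all by blast
  moreover have "1 + t\<^sup>2 \<noteq> 0" for t :: real using k[of t] by linarith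
  ultimately have "V t = 0" for t using init by (simp add: W_def V_def)
  then show *: "u' t * v t = u t * v' t" for t by (simp add: V_def)
  have "((\<lambda>t. u t / v t) has_real_derivative 0) (at t)" for t
    using DERIV_divide[OF u(1) v(1), of t] pos[of t] * [of t] by (simp add: mult.commute)
  then have "u t / v t = u 0 / v 0" using DERIV_isconst_all[of "\<lambda>t. u t / v t"] by blast
  then show "u t = u 0 / v 0 * v t" using pos[of t] by (simp add: field_simps)
qed

text \<open>The bracket in \<open>C\<close>-tilde is the solution with initial values \<open>(1, - C(n,b))\<close> at \<open>t = 0\<close>, evaluated at
  \<open>tan \<theta>\<close>, and the other bracket is a multiple of its derivative. That solution is a multiple of the positive
  ground state, so the bracket does not vanish and the constant is a logarithmic derivative of \<open>\<Psi>\<close>.\<close>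

lemma K_const_eq:
  fixes n :: nat and b \<theta> :: real
  assumes n: "n \<ge> 2" and b: "2 \<le> b" "b < real n + 1" and \<theta>: "0 < \<theta>" "\<theta> < pi / 2"
  defines "p \<equiv> (real n + 1 - b) / 4" and "c \<equiv> (real n + b - 3) / 4"
  shows "K_const \<theta> n b = - cos \<theta> * (- 2 * (p + c) * Psi (p + 1/2) (c + 1/2) (sin \<theta>)) / Psi p c (sin \<theta>)"
proof -
  have p: "p > 0" and c: "c > 0" using n b by (auto simp: p_def c_def)
  define a where "a = 1/2 - c"
  define C where "C = C_const n b"
  define t where "t = tan \<theta>"
  have cos: "cos \<theta> > 0" using \<theta> by (intro cos_gt_zero_pi) auto
  have kt: "1 + t\<^sup>2 = 1 / (cos \<theta>)\<^sup>2" and k0: "1 + t\<^sup>2 > 0"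
    using cos sin_cos_squared_add[of \<theta>] by (auto simp: t_def tan_def field_simps add_pos_nonneg)
  have sk: "sqrt (1 + t\<^sup>2) = 1 / cos \<theta>" using cos by (simp add: kt real_sqrt_divide)
  have ts: "t / sqrt (1 + t\<^sup>2) = sin \<theta>" unfolding sk using cos by (simp add: t_def tan_def)
  have C_eq: "C = 2 * (Gamma (p + 1/2) * Gamma (c + 1/2)) / (Gamma p * Gamma c)"
  proof -
    have e: "(real n - b + 3) / 4 = p + 1/2" "(real n + b - 1) / 4 = c + 1/2" "(real n + 1 - b) / 4 = p" "(real n + b - 3) / 4 = c"
      by (simp_all add: p_def c_def field_simps)
    show ?thesis unfolding C_def C_const_def e ..
  qed
  \<comment> \<open>\<open>u\<close> is the bracket of the boundary constant as a function of \<open>t = tan \<theta>\<close>, \<open>v\<close> the ground state.\<close>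
  define u where "u = (\<lambda>t. hyp_even a p t - C * hyp_odd a p t)"
  define u' where "u' = (\<lambda>t. hyp_even' a p t - C * hyp_odd' a p t)"
  define v where "v = (\<lambda>t. (1 + t\<^sup>2) powr (- p) * Psi p c (t / sqrt (1 + t\<^sup>2)))"
  define v' where "v' = (\<lambda>t. - 2 * p * t * (1 + t\<^sup>2) powr (- p - 1) * Psi p c (t / sqrt (1 + t\<^sup>2))
      + (1 + t\<^sup>2) powr (- p - 3/2) * (- 2 * (p + c) * Psi (p + 1/2) (c + 1/2) (t / sqrt (1 + t\<^sup>2))))"
  have u1: "(u has_real_derivative u' t) (at t)" for t
    unfolding u_def u'_def by (intro DERIV_diff DERIV_cmult DERIV_hyp_even DERIV_hyp_odd p)
  have u2: "(u' has_real_derivative - ((2 * a + 2 * p + 1) * t * u' t + (4 * a * p) * u t) / (1 + t\<^sup>2)) (at t)" for t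
  proof -
    have "1 + t\<^sup>2 > 0" using zero_le_power2[of t] by linarith
    then show ?thesis
      unfolding u_def u'_def
      by (intro DERIV_cong[OF DERIV_diff[OF DERIV_hyp_even'[OF p] DERIV_cmult[OF DERIV_hyp_odd'[OF p]]]])
        (unfold divide_inverse, simp add: algebra_simps)
  qed
  have v1: "(v has_real_derivative v' t) (at t)"
    and v2: "(v' has_real_derivative - ((2 * a + 2 * p + 1) * t * v' t + (4 * a * p) * v t) / (1 + t\<^sup>2)) (at t)" for t
    using DERIV_Psi_tan[OF p c, of t] unfolding v_def v'_def a_def by blast+
  have vpos: "v t > 0" for t
  proof -
    have k: "1 + t\<^sup>2 > 0" using zero_le_power2[of t] by linarith
    have "\<bar>t\<bar> < sqrt (1 + t\<^sup>2)" using real_sqrt_less_mono[of "t\<^sup>2" "1 + t\<^sup>2"] by simp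
    then have "t / sqrt (1 + t\<^sup>2) > -1" using k by (simp add: field_simps)
    then show ?thesis unfolding v_def using k Psi_pos[OF p c] by simp
  qed
  have u0: "u 0 = 1" using p by (simp add: u_def hyp_even_def hyp_odd_def hyp2F1_real_0)
  have u'0: "u' 0 = - C" using p by (simp add: u'_def hyp_even'_def hyp_odd'_def hyp2F1_real_0)
  have v0: "v 0 = Beta p c" using Psi_0[OF p c] by (simp add: v_def)
  have v'0: "v' 0 = - 2 * ((p + c) * Beta (p + 1/2) (c + 1/2))" using Psi_0[of "p + 1/2" "c + 1/2"] p c by (simp add: v'_def algebra_simps)
  have init: "u 0 * v' 0 = u' 0 * v 0"
    unfolding u0 u'0 v0 v'0 Beta_quotient[OF p c] C_eq by simp
  note W = wronskian_proportional[OF u1 u2 v1 v2 init vpos]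
  have "v 0 > 0" by (rule vpos)
  then have upos: "u t > 0" using W(2)[of t] vpos[of t] by (simp add: u0)
  have ratio: "u' t / u t = v' t / v t" using W(1)[of t] upos vpos[of t] by (simp add: field_simps)
  have K: "K_const \<theta> n b = - 2 * p * t + (- u' t / 2) * (2 / (cos \<theta>)\<^sup>2 * inverse (u t))"
  proof -
    have e: "(b - real n - 1) / 2 = - 2 * p" "(5 - real n - b) / 4 = a" "(real n + 1 - b) / 4 = p"
      by (simp_all add: p_def c_def a_def field_simps)
    show ?thesis
      unfolding K_const_def C_tilde_def Let_def e t_def[symmetric] C_def[symmetric]
      by (simp add: u_def u'_def hyp_even_def hyp_odd_def hyp_even'_def hyp_odd'_def) (simp add: algebra_simps)
  qed
  have r1: "v' t / v t = - 2 * p * t / (1 + t\<^sup>2) + (1 + t\<^sup>2) powr (- 3/2) * (- 2 * (p + c) * Psi (p + 1/2) (c + 1/2) (sin \<theta>)) / Psi p c (sin \<theta>)"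
  proof -
    define Y where "Y = (1 + t\<^sup>2) powr (- p)"
    have Y: "Y > 0" using k0 by (simp add: Y_def)
    have f1: "(1 + t\<^sup>2) powr (- p - 1) = Y / (1 + t\<^sup>2)" using k0 by (simp add: Y_def powr_diff)
    have f2: "(1 + t\<^sup>2) powr (- p - 3/2) = Y * (1 + t\<^sup>2) powr (- 3/2)"
      unfolding Y_def powr_add[symmetric] by (rule arg_cong) simp
    have f3: "Psi p c (sin \<theta>) > 0" using vpos[of t] Y by (simp add: v_def ts zero_less_mult_iff Y_def)
    have f4: "(- 2 * p * t * (y / k) * x + y * e * d) / (y * x) = - 2 * p * t / k + e * d / x"
      if "y > 0" "x > 0" "k > 0" for y x k e d :: real
    proof -
      have 1: "- 2 * p * t * (y / k) * x / (y * x) = - 2 * p * t / k" using that by simp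
      have 2: "y * e * d / (y * x) = e * d / x" using that by simp
      show ?thesis by (simp only: add_divide_distrib 1 2)
    qed
    show ?thesis unfolding v_def v'_def ts Y_def[symmetric] f1 f2 by (rule f4[OF Y f3 k0])
  qed
  have r2: "(1 + t\<^sup>2) powr (- 3/2) = (cos \<theta>) ^ 3"
  proof -
    have "(1 + t\<^sup>2) powr (- 3/2) = (cos \<theta> powr (- 2)) powr (- 3/2)"
      using cos by (simp add: kt powr_minus_divide)
    also have "\<dots> = cos \<theta> powr 3" by (simp add: powr_powr)
    finally show ?thesis using cos by simp
  qed
  have r3: "K_const \<theta> n b = - 2 * p * t - (1 / (cos \<theta>)\<^sup>2) * (v' t / v t)"
  proof -
    have "- 2 * p * t + (- x / 2) * (2 / d * inverse y) = - 2 * p * t - (1 / d) * (x / y)" for x y d :: real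
      unfolding inverse_eq_divide by simp
    then show ?thesis unfolding K ratio[symmetric] .
  qed
  have "K_const \<theta> n b = - 2 * p * t - (1 / (cos \<theta>)\<^sup>2) * (- 2 * p * t * (cos \<theta>)\<^sup>2
      + (cos \<theta>) ^ 3 * (- 2 * (p + c) * Psi (p + 1/2) (c + 1/2) (sin \<theta>)) / Psi p c (sin \<theta>))"
    unfolding r3 r1 r2 unfolding kt by simp
  moreover have "- 2 * p * t - (1 / k\<^sup>2) * (- 2 * p * t * k\<^sup>2 + k ^ 3 * x / y) = - k * x / y" if "k > 0" for k x y :: real
  proof -
    have "(1 / k\<^sup>2) * (- 2 * p * t * k\<^sup>2) = - 2 * p * t" "(1 / k\<^sup>2) * (k ^ 3 * x / y) = k * x / y"
      using that by (simp_all add: power3_eq_cube power2_eq_square)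
    then show ?thesis unfolding distrib_left by simp
  qed
  ultimately show ?thesis using cos by simp
qed

section \<open>Integration along dilations and along vertical fibres\<close>

lemma lborel_scaleR:
  fixes f :: "'a::euclidean_space \<Rightarrow> real"
  assumes f: "integrable lborel f" and c: "c > 0"
  shows integrable_scaleR: "integrable lborel (\<lambda>x. f (c *\<^sub>R x))"
    and integral_scaleR: "(\<integral>x. f (c *\<^sub>R x) \<partial>lborel) = (\<integral>x. f x \<partial>lborel) / c ^ DIM('a)"
proof -
  let ?T = "\<lambda>x::'a. c *\<^sub>R x"
  have T: "?T \<in> lborel \<rightarrow>\<^sub>M borel" by simp
  have fm: "f \<in> borel_measurable borel" using borel_measurable_integrable[OF f] by simp
  have eq: "lborel = density (distr lborel borel ?T) (\<lambda>_. ennreal (c ^ DIM('a)))"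
    using lborel_affine[of c 0] c by (simp add: ennreal_power)
  have "integrable (density (distr lborel borel ?T) (\<lambda>_. ennreal (c ^ DIM('a)))) f"
    using f eq by simp
  then have "integrable (distr lborel borel ?T) (\<lambda>x. c ^ DIM('a) * f x)"
    using fm c by (subst (asm) integrable_density) auto
  then have "integrable (distr lborel borel ?T) f" using c by simp
  then show "integrable lborel (\<lambda>x. f (c *\<^sub>R x))"
    using fm by (simp add: integrable_distr_eq)
  have "(\<integral>x. f x \<partial>lborel) = (\<integral>x. f x \<partial>density (distr lborel borel ?T) (\<lambda>_. ennreal (c ^ DIM('a))))"
    using eq by simp
  also have "\<dots> = (\<integral>x. c ^ DIM('a) * f x \<partial>distr lborel borel ?T)"
    using fm c by (subst integral_density) auto
  also have "\<dots> = (\<integral>x. c ^ DIM('a) * f (c *\<^sub>R x) \<partial>lborel)"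
    using fm by (intro integral_distr) auto
  finally show "(\<integral>x. f (c *\<^sub>R x) \<partial>lborel) = (\<integral>x. f x \<partial>lborel) / c ^ DIM('a)"
    using c by simp
qed

text \<open>The integral of the divergence of the field \<open>f(z) z\<close> is zero, with \<open>f\<close> differentiable only along rays.
  The integral of \<open>f (l z)\<close> scales like \<open>l\<close> to the power \<open>- DIM('a)\<close>, so the derivative in \<open>l\<close>
  of \<open>l ^ DIM('a) * f (l z)\<close>, integrated over \<open>z\<close> and over \<open>1 \<le> l \<le> 2\<close>, vanishes; it is a positive multiple of
  the integral of \<open>E\<close>.\<close>

lemma integral_Euler_eq_0:
  fixes f E :: "'a::euclidean_space \<Rightarrow> real"
  assumes f: "integrable lborel f" and E: "integrable lborel E"
    and der: "\<And>z l. z \<noteq> 0 \<Longrightarrow> l > 0 \<Longrightarrow>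
      ((\<lambda>l. f (l *\<^sub>R z)) has_real_derivative (E (l *\<^sub>R z) - real DIM('a) * f (l *\<^sub>R z)) / l) (at l)"
  shows "(\<integral>z. E z \<partial>lborel) = 0"
proof -
  define N where "N = DIM('a)"
  have N: "N > 0" by (simp add: N_def)
  define g where "g = (\<lambda>(l::real) z. indicator {1..2} l * (l ^ (N - 1) * E (l *\<^sub>R z)))"
  have Em [measurable]: "E \<in> borel_measurable borel" using borel_measurable_integrable[OF E] by simp
  have gl: "(\<integral>z. g l z \<partial>lborel) = indicator {1..2} l * (1 / l) * (\<integral>z. E z \<partial>lborel)"
    and gl': "(\<integral>z. norm (g l z) \<partial>lborel) = indicator {1..2} l * (1 / l) * (\<integral>z. norm (E z) \<partial>lborel)"
    and gli: "integrable lborel (g l)" for l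
  proof -
    have "l ^ N = l * l ^ (N - 1)" using N by (cases N) auto
    then have p: "l ^ (N - 1) * (x / l ^ N) = 1 / l * x" if "l > 0" for x using that by simp
    show "integrable lborel (g l)"
      using integrable_scaleR[OF E, of l] by (cases "l \<in> {1..2}") (auto simp: g_def)
    show "(\<integral>z. g l z \<partial>lborel) = indicator {1..2} l * (1 / l) * (\<integral>z. E z \<partial>lborel)"
      using integral_scaleR[OF E, of l] p[of "integral\<^sup>L lborel E"]
      by (cases "l \<in> {1..2}") (simp_all add: g_def N_def[symmetric])
    show "(\<integral>z. norm (g l z) \<partial>lborel) = indicator {1..2} l * (1 / l) * (\<integral>z. norm (E z) \<partial>lborel)"
      using integral_scaleR[OF integrable_norm[OF E], of l] p[of "\<integral>z. norm (E z) \<partial>lborel"]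
      by (cases "l \<in> {1..2}") (simp_all add: g_def N_def[symmetric] abs_mult)
  qed
  have inv: "set_integrable lborel {1..2} (\<lambda>l::real. 1 / l)"
    unfolding set_integrable_def by (rule borel_integrable_compact) (auto intro!: continuous_intros)
  have int: "integrable (lborel \<Otimes>\<^sub>M lborel) (\<lambda>(l, z). g l z)"
  proof (rule lborel_pair.Fubini_integrable)
    show "(\<lambda>(l, z). g l z) \<in> borel_measurable (lborel \<Otimes>\<^sub>M lborel)"
      unfolding g_def by measurable
    have "integrable lborel (\<lambda>l. indicator {1..2} l * (1 / l) * (\<integral>z. norm (E z) \<partial>lborel))"
      using inv by (intro integrable_mult_left) (auto simp: set_integrable_def)
    then show "integrable lborel (\<lambda>l. \<integral>z. norm (case (l, z) of (l, z) \<Rightarrow> g l z) \<partial>lborel)"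
      using gl' by simp
    show "AE l in lborel. integrable lborel (\<lambda>z. case (l, z) of (l, z) \<Rightarrow> g l z)"
      using gli by simp
  qed
  have "(\<integral>z. (\<integral>l. g l z \<partial>lborel) \<partial>lborel) = (\<integral>l. (\<integral>z. g l z \<partial>lborel) \<partial>lborel)"
    by (rule lborel_pair.Fubini_integral[OF int])
  also have "\<dots> = (\<integral>l. indicator {1..2} l * (1 / l) \<partial>lborel) * (\<integral>z. E z \<partial>lborel)"
    unfolding gl by (rule integral_mult_left_zero)
  also have "(\<integral>l. indicator {1..2} l * (1 / l) \<partial>lborel) = ln (2::real)"
  proof -
    have "((\<lambda>l::real. 1 / l) has_integral ln 2 - ln 1) {1..2}"
      by (intro fundamental_theorem_of_calculus)
        (auto intro!: derivative_eq_intros simp flip: has_real_derivative_iff_has_vector_derivative)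
    then show ?thesis using set_borel_integral_eq_integral(2)[OF inv]
      by (simp add: set_lebesgue_integral_def integral_unique)
  qed
  finally have lhs: "(\<integral>z. (\<integral>l. g l z \<partial>lborel) \<partial>lborel) = ln 2 * (\<integral>z. E z \<partial>lborel)" .
  have "AE z in lborel. (\<integral>l. g l z \<partial>lborel) = 2 ^ N * f (2 *\<^sub>R z) - f z"
  proof -
    have ae: "AE z in lborel. integrable lborel (\<lambda>l. g l z)"
      using lborel_pair.AE_integrable_snd[OF int] .
    show ?thesis using ae AE_lborel_singleton[of "0::'a"]
    proof eventually_elim
      case (elim z)
      have "((\<lambda>l. l ^ (N - 1) * E (l *\<^sub>R z)) has_integral 2 ^ N * f (2 *\<^sub>R z) - 1 ^ N * f (1 *\<^sub>R z)) {1..2}"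
      proof (rule fundamental_theorem_of_calculus)
        fix l :: real assume "l \<in> {1..2}"
        then have l: "l > 0" by simp
        have "((\<lambda>l. l ^ N * f (l *\<^sub>R z)) has_real_derivative
           (real N * l ^ (N - 1)) * f (l *\<^sub>R z) + (E (l *\<^sub>R z) - real N * f (l *\<^sub>R z)) / l * l ^ N) (at l)"
          using DERIV_mult[OF DERIV_pow[of N l] der[OF elim(2) l]] by (simp add: N_def)
        moreover have "l ^ N = l * l ^ (N - 1)" using N by (cases N) auto
        moreover have "(n * x) * y + (e - n * y) / l * (l * x) = x * e" for n x y e :: real
        proof -
          have "(e - n * y) / l * (l * x) = (e - n * y) * x" using l by simp
          then show ?thesis by (simp add: algebra_simps)
        qed
        ultimately have "((\<lambda>l. l ^ N * f (l *\<^sub>R z)) has_real_derivative l ^ (N - 1) * E (l *\<^sub>R z)) (at l)"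
          by (simp only:)
        then show "((\<lambda>l. l ^ N * f (l *\<^sub>R z)) has_vector_derivative l ^ (N - 1) * E (l *\<^sub>R z)) (at l within {1..2})"
          by (simp add: has_field_derivative_at_within flip: has_real_derivative_iff_has_vector_derivative)
      qed simp
      moreover have "set_integrable lborel {1..2} (\<lambda>l. l ^ (N - 1) * E (l *\<^sub>R z))"
        using elim(1) by (simp add: set_integrable_def g_def)
      from set_borel_integral_eq_integral(2)[OF this]
      have "(\<integral>l. g l z \<partial>lborel) = integral {1..2} (\<lambda>l. l ^ (N - 1) * E (l *\<^sub>R z))"
        by (simp add: set_lebesgue_integral_def g_def)
      ultimately show ?case by (simp add: integral_unique)
    qed
  qed
  then have "(\<integral>z. (\<integral>l. g l z \<partial>lborel) \<partial>lborel) = (\<integral>z. 2 ^ N * f (2 *\<^sub>R z) - f z \<partial>lborel)"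
    using borel_measurable_integrable[OF lborel_pair.integrable_snd[OF int]]
      borel_measurable_integrable[OF integrable_scaleR[OF f, of 2]] borel_measurable_integrable[OF f]
    by (intro integral_cong_AE) (auto intro!: borel_measurable_diff borel_measurable_times)
  also have "\<dots> = 2 ^ N * (\<integral>z. f (2 *\<^sub>R z) \<partial>lborel) - (\<integral>z. f z \<partial>lborel)"
    using integrable_scaleR[OF f, of 2] f by simp
  also have "\<dots> = 0" using integral_scaleR[OF f, of 2] by (simp add: N_def)
  finally show ?thesis using lhs by simp
qed

text \<open>Fubini and the fundamental theorem of calculus on each vertical half line. The fibre over \<open>x = 0\<close> is
  exempted: it is a null set and contains the singular point.\<close>

lemma integral_vertical_derivative:
  fixes q q' :: "'a::euclidean_space \<times> real \<Rightarrow> real" and T :: "'a \<Rightarrow> real"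
  assumes int: "set_integrable lborel {(x, y). T x < y} q'"
    and der: "\<And>x y. x \<noteq> 0 \<Longrightarrow> T x \<le> y \<Longrightarrow> ((\<lambda>y. q (x, y)) has_real_derivative q' (x, y)) (at y)"
    and van: "\<And>x. \<exists>Y. \<forall>y\<ge>Y. q (x, y) = 0"
    and qm: "(\<lambda>x. q (x, T x)) \<in> borel_measurable borel"
  shows "(LINT z:{(x, y). T x < y}|lborel. q' z) = - (\<integral>x. q (x, T x) \<partial>lborel)"
proof -
  define g where "g = (\<lambda>z. indicator {(x, y). T x < y} z * q' z)"
  have gint: "integrable (lborel \<Otimes>\<^sub>M lborel) g"
    using int by (simp add: set_integrable_def g_def lborel_prod)
  have "(LINT z:{(x, y). T x < y}|lborel. q' z) = integral\<^sup>L (lborel \<Otimes>\<^sub>M lborel) g"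
    by (simp add: set_lebesgue_integral_def g_def lborel_prod)
  also have "\<dots> = (\<integral>x. (\<integral>y. g (x, y) \<partial>lborel) \<partial>lborel)"
    by (rule lborel_pair.integral_fst'[OF gint, symmetric])
  also have "\<dots> = (\<integral>x. - q (x, T x) \<partial>lborel)"
  proof (rule integral_cong_AE)
    show "(\<lambda>x. \<integral>y. g (x, y) \<partial>lborel) \<in> borel_measurable lborel"
      using lborel_pair.integrable_fst'[OF gint] by simp
    show "(\<lambda>x. - q (x, T x)) \<in> borel_measurable lborel" using qm by simp
    show "AE x in lborel. (\<integral>y. g (x, y) \<partial>lborel) = - q (x, T x)"
      using lborel_pair.AE_integrable_fst'[OF gint] AE_lborel_singleton[of "0::'a"]
    proof eventually_elim
      case (elim x)
      obtain Y0 where Y0: "\<forall>y\<ge>Y0. q (x, y) = 0" using van by blast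
      define Y where "Y = max Y0 (T x)"
      have Y: "T x \<le> Y" "\<And>y. Y \<le> y \<Longrightarrow> q (x, y) = 0" using Y0 by (auto simp: Y_def)
      have q'0: "q' (x, y) = 0" if "y > Y" for y
      proof -
        have "((\<lambda>y. q (x, y)) has_real_derivative 0) (at y)"
          by (rule has_field_derivative_transform_within_open[of "\<lambda>_. 0" 0 y "{Y<..}"]) (use Y that in auto)
        moreover have "((\<lambda>y. q (x, y)) has_real_derivative q' (x, y)) (at y)"
          using der elim(2) Y(1) that by simp
        ultimately show ?thesis using DERIV_unique by blast
      qed
      have ae: "AE y in lborel. indicator {T x..Y} y * q' (x, y) = g (x, y)"
        using AE_lborel_singleton[of "T x"]
      proof eventually_elim
        case (elim y)
        then show ?case using q'0[of y] Y(1) by (auto simp: g_def indicator_def)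
      qed
      have hi: "((\<lambda>y. q' (x, y)) has_integral q (x, Y) - q (x, T x)) {T x..Y}"
      proof (rule fundamental_theorem_of_calculus[OF Y(1)])
        fix y assume "y \<in> {T x..Y}"
        then show "((\<lambda>y. q (x, y)) has_vector_derivative q' (x, y)) (at y within {T x..Y})"
          using der[OF elim(2), of y]
          by (simp add: has_field_derivative_at_within flip: has_real_derivative_iff_has_vector_derivative)
      qed
      have gm: "(\<lambda>y. g (x, y)) \<in> borel_measurable lborel" using elim(1) by auto
      have eq: "indicator {T x..Y} y * q' (x, y) = (if y = T x then indicator {T x..Y} y * q' (x, y) else g (x, y))" for y
        using q'0[of y] Y(1) by (auto simp: g_def indicator_def)
      have meas: "(\<lambda>y. indicator {T x..Y} y * q' (x, y)) \<in> borel_measurable lborel"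
      proof -
        have "(\<lambda>y. if y = T x then indicator {T x..Y} (T x) * q' (x, T x) else g (x, y)) \<in> borel_measurable lborel"
          using gm by measurable
        moreover have "(\<lambda>y. if y = T x then indicator {T x..Y} (T x) * q' (x, T x) else g (x, y)) = (\<lambda>y. indicator {T x..Y} y * q' (x, y))"
        proof
          fix y
          show "(if y = T x then indicator {T x..Y} (T x) * q' (x, T x) else g (x, y)) = indicator {T x..Y} y * q' (x, y)"
            using eq[of y] by (cases "y = T x") simp_all
        qed
        ultimately show ?thesis by simp
      qed
      have "integrable lborel (\<lambda>y. indicator {T x..Y} y * q' (x, y))"
        using elim(1) ae meas gm by (subst integrable_cong_AE[OF _ _ ae]) auto
      then have "set_integrable lborel {T x..Y} (\<lambda>y. q' (x, y))"
        by (simp add: set_integrable_def)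
      from set_borel_integral_eq_integral(2)[OF this]
      have "(\<integral>y. indicator {T x..Y} y * q' (x, y) \<partial>lborel) = q (x, Y) - q (x, T x)"
        using hi by (simp add: set_lebesgue_integral_def integral_unique)
      moreover have "(\<integral>y. indicator {T x..Y} y * q' (x, y) \<partial>lborel) = (\<integral>y. g (x, y) \<partial>lborel)"
        by (rule integral_cong_AE[OF meas gm ae])
      ultimately show ?case using Y(2)[of Y] by simp
    qed
  qed
  finally show ?thesis by simp
qed

text \<open>The power is dominated by a sum of multiples of indicators of dyadic balls, whose integrals form a geometric
  series.\<close>

lemma set_integrable_inverse_norm_power:
  assumes a: "a < DIM('a::euclidean_space)" and R: "R > 0"
  shows "set_integrable lborel (ball (0::'a) R) (\<lambda>z. 1 / norm z ^ a)"
proof -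
  define N where "N = DIM('a)"
  define V where "V = measure lborel (ball (0::'a) 1)"
  define B where "B = (\<lambda>j::nat. ball (0::'a) (R / 2 ^ j))"
  define k where "k = (\<lambda>j::nat. (2 ^ (j + 1) / R) ^ a)"
  have k0: "k j \<ge> 0" for j using R by (simp add: k_def)
  have emB: "emeasure lborel (B j) = ennreal ((R / 2 ^ j) ^ N * V)" for j
  proof -
    have "emeasure lborel (B j) = ennreal (measure lborel (B j))"
      using emeasure_lborel_ball_finite[of "0::'a" "R / 2 ^ j"]
      by (intro emeasure_eq_ennreal_measure) (auto simp: B_def)
    then show ?thesis
      using content_ball_conv_unit_ball[of "R / 2 ^ j" "0::'a"] R by (simp add: B_def V_def N_def)
  qed
  have dom: "ennreal (norm (indicator (ball 0 R) z *\<^sub>R (1 / norm z ^ a))) \<le> (\<Sum>j. ennreal (k j) * indicator (B j) z)"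
    if "z \<noteq> 0" for z :: 'a
  proof (cases "z \<in> ball 0 R")
    case True
    have nz: "norm z > 0" using that by simp
    have "\<exists>j. R / 2 ^ (j + 1) \<le> norm z"
    proof -
      obtain j where "R / norm z < 2 ^ j" using real_arch_pow[of 2 "R / norm z"] by auto
      then have "R < 2 ^ j * norm z" using nz by (simp add: pos_divide_less_eq)
      also have "\<dots> \<le> 2 ^ (j + 1) * norm z" by (intro mult_right_mono) auto
      finally show ?thesis by (intro exI[of _ j]) (simp add: pos_divide_le_eq mult_ac)
    qed
    then obtain j where j: "R / 2 ^ (j + 1) \<le> norm z" "\<And>i. i < j \<Longrightarrow> norm z < R / 2 ^ (i + 1)"
      using exists_least_iff[of "\<lambda>j. R / 2 ^ (j + 1) \<le> norm z"] by (auto simp: not_le)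
    have "norm z < R / 2 ^ j" using j(2)[of "j - 1"] True by (cases j) auto
    then have zB: "z \<in> B j" by (simp add: B_def)
    have "1 / norm z \<le> 2 ^ (j + 1) / R" using j(1) nz R by (simp add: field_simps)
    then have "1 / norm z ^ a \<le> k j"
      unfolding k_def power_one_over[symmetric] by (intro power_mono) auto
    then have "ennreal (norm (indicator (ball 0 R) z *\<^sub>R (1 / norm z ^ a))) \<le> ennreal (k j) * indicator (B j) z"
      using True zB by (simp add: ennreal_leI)
    also have "\<dots> = (\<Sum>i\<in>{j}. ennreal (k i) * indicator (B i) z)"
      by (simp only: sum.insert[OF finite.emptyI] empty_iff not_False_eq_True sum.empty add_0_right simp_thms)
    also have "\<dots> \<le> (\<Sum>j. ennreal (k j) * indicator (B j) z)" by (rule sum_le_suminf) auto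
    finally show ?thesis .
  qed simp
  have "(\<integral>\<^sup>+z. ennreal (norm (indicator (ball 0 R) z *\<^sub>R (1 / norm (z::'a) ^ a))) \<partial>lborel) \<le>
      (\<integral>\<^sup>+z. (\<Sum>j. ennreal (k j) * indicator (B j) z) \<partial>lborel)"
    by (intro nn_integral_mono_AE) (use dom AE_lborel_singleton[of "0::'a"] in \<open>auto elim!: eventually_mono\<close>)
  also have "\<dots> = (\<Sum>j. \<integral>\<^sup>+z. ennreal (k j) * indicator (B j) z \<partial>lborel)"
    by (intro nn_integral_suminf borel_measurable_times_ennreal borel_measurable_const borel_measurable_indicator)
      (simp add: B_def)
  also have "\<dots> = (\<Sum>j. ennreal (k j * ((R / 2 ^ j) ^ N * V)))"
    using k0 emB by (simp add: nn_integral_cmult_indicator B_def ennreal_mult')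
  also have "\<dots> < \<infinity>"
  proof -
    have "k j * ((R / 2 ^ j) ^ N * V) \<le> (2 / R) ^ a * R ^ N * V * (1/2) ^ j" for j
    proof -
      have "k j * ((R / 2 ^ j) ^ N * V) = (2 / R) ^ a * R ^ N * V * ((2 ^ j) ^ a / (2 ^ j) ^ N)"
        by (simp add: k_def power_mult_distrib power_divide)
      also have "(2 ^ j) ^ a / (2 ^ j) ^ N = (1 / 2 ^ j :: real) ^ (N - a)"
        using a by (simp add: N_def power_diff power_divide field_simps)
      also have "\<dots> \<le> (1 / 2 ^ j) ^ 1"
        using a by (intro power_decreasing) (auto simp: N_def)
      finally show ?thesis using R
        by (simp add: V_def power_one_over mult_left_mono)
    qed
    note le = this
    have nn: "k j * ((R / 2 ^ j) ^ N * V) \<ge> 0" for j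
      by (intro mult_nonneg_nonneg k0 zero_le_power) (use R in \<open>simp_all add: V_def\<close>)
    have "summable (\<lambda>j. (2 / R) ^ a * R ^ N * V * (1/2) ^ j)"
      by (intro summable_mult summable_geometric) simp
    then have "summable (\<lambda>j. k j * ((R / 2 ^ j) ^ N * V))"
      by (rule summable_comparison_test'[where N = 0]) (use le nn in simp)
    from suminf_ennreal_eq[OF nn summable_sums[OF this]] show ?thesis by simp
  qed
  finally have fin: "(\<integral>\<^sup>+z. ennreal (norm (indicator (ball 0 R) z *\<^sub>R (1 / norm (z::'a) ^ a))) \<partial>lborel) < \<infinity>" .
  have "ball (0::'a) R \<in> sets lborel" by simp
  then have "(\<lambda>z::'a. indicator (ball 0 R) z *\<^sub>R (1 / norm z ^ a)) \<in> borel_measurable lborel"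
    by (intro borel_measurable_scaleR borel_measurable_indicator borel_measurable_divide borel_measurable_power) auto
  from integrableI_bounded[OF this fin] show ?thesis unfolding set_integrable_def .
qed

lemma set_integrable_singular:
  fixes f :: "'a::euclidean_space \<Rightarrow> real"
  assumes N: "is_norm N" and a: "a < DIM('a)" and A: "A \<in> sets borel" "bounded A"
    and f: "set_borel_measurable lborel A f" and bound: "\<And>z. z \<in> A \<Longrightarrow> z \<noteq> 0 \<Longrightarrow> \<bar>f z\<bar> \<le> C / N z ^ a"
  shows "set_integrable lborel A f"
proof -
  obtain c where c: "c > 0" "\<And>z. c * norm z \<le> N z" using is_norm_ge_norm[OF N] by blast
  obtain R where R: "R > 0" "A \<subseteq> ball 0 R" using bounded_subset_ballD[OF A(2), of 0] by blast
  have "set_integrable lborel (ball 0 R) (\<lambda>z::'a. (\<bar>C\<bar> / c ^ a) * (1 / norm z ^ a))"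
    by (intro set_integrable_mult_right set_integrable_inverse_norm_power a R)
  then have "set_integrable lborel A (\<lambda>z. (\<bar>C\<bar> / c ^ a) * (1 / norm z ^ a))"
    by (rule set_integrable_subset) (use A R in auto)
  then show ?thesis
  proof (rule set_integrable_bound[OF _ f])
    show "AE z in lborel. z \<in> A \<longrightarrow> norm (f z) \<le> norm ((\<bar>C\<bar> / c ^ a) * (1 / norm z ^ a))"
      using AE_lborel_singleton[of "0::'a"]
    proof eventually_elim
      case (elim z)
      show ?case
      proof
        assume z: "z \<in> A"
        have "\<bar>f z\<bar> \<le> \<bar>C\<bar> / N z ^ a"
          using bound[OF z elim] is_norm_nonneg[OF N, of z]
          by (smt (verit) divide_right_mono zero_le_power)
        also have "\<dots> \<le> \<bar>C\<bar> / (c * norm z) ^ a"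
          by (intro divide_left_mono power_mono mult_pos_pos zero_less_power)
            (use is_norm_pos[OF N elim] c elim in auto)
        finally show "norm (f z) \<le> norm ((\<bar>C\<bar> / c ^ a) * (1 / norm z ^ a))"
          using c by (simp add: power_mult_distrib)
      qed
    qed
  qed
qed

section \<open>The Hardy field on the cone\<close>

text \<open>Each unordered pair of factors occurs once on the left, and each square once: expand the square on the
  right.\<close>

lemma Plog_sum_square:
  "(\<Sum>i=1..m. Plog i \<rho> * (\<Sum>j=1..i. Plog j \<rho>)) = ((\<Sum>i=1..m. Plog i \<rho>)\<^sup>2 + (\<Sum>i=1..m. (Plog i \<rho>)\<^sup>2)) / 2"
  by (induction m) (auto simp: power2_eq_square algebra_simps)

lemma DERIV_scaleR_rescale:
  fixes f :: "'a::real_vector \<Rightarrow> real"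
  assumes "((\<lambda>l. f (l *\<^sub>R (t *\<^sub>R z))) has_real_derivative d) (at 1)" "t > 0"
  shows "((\<lambda>l. f (l *\<^sub>R z)) has_real_derivative d / t) (at t)"
proof -
  have "((\<lambda>l. l / t) has_real_derivative 1 / t) (at t)" using assms(2) by (auto intro!: derivative_eq_intros)
  moreover have "((\<lambda>l. f (l *\<^sub>R (t *\<^sub>R z))) has_real_derivative d) (at (t / t))" using assms by simp
  ultimately have "((\<lambda>l. f ((l / t) *\<^sub>R (t *\<^sub>R z))) has_real_derivative d * (1 / t)) (at t)"
    by (rule DERIV_chain2[rotated])
  then show ?thesis using assms(2) by simp
qed

lemma set_integral_indicator: "(LINT z:A|M. f z) = (\<integral>z. indicator A z * f z \<partial>M)" for f :: "_ \<Rightarrow> real"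
  by (simp add: set_lebesgue_integral_def)

locale hardy_setting =
  fixes H :: "'a::euclidean_space \<Rightarrow> real" and b \<theta> :: real and U :: "('a \<times> real) set"
  assumes H: "is_norm H" and b2: "2 \<le> b" and bn: "b < real DIM('a) + 1"
    and th0: "0 < \<theta>" and th1: "\<theta> < pi / 2"
    and U_open: "open U" and U_bounded: "bounded U" and U0: "0 \<in> U"
begin

abbreviation "H0 \<equiv> dual_norm H"
abbreviation "rad \<equiv> Phi0 H"
definition "A = U \<inter> Finsler_cone H \<theta>"
definition "D = outer_radius H A"
text \<open>The sine of the latitude, the angular variable of the ground state.\<close>

definition "sn z = snd z / rad z"
text \<open>For these parameters \<open>2 * (p + c) = n - 1\<close> and \<open>16 * p * c = (n - 1)\<^sup>2 - (b - 2)\<^sup>2\<close>. The second identity puts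
  the constant \<open>(b - 2)\<^sup>2 / 4\<close> into the equation of \<open>rad powr (- (n - 1) / 2) * Psi p c (sn z)\<close>.\<close>

definition "p = (real DIM('a) + 1 - b) / 4"
definition "c = (real DIM('a) + b - 3) / 4"
definition "Psi1 \<sigma> = - 2 * (p + c) * Psi (p + 1/2) (c + 1/2) \<sigma>"
definition "Psi2 \<sigma> = 4 * (p + c) * (p + c + 1) * Psi (p + 1) (c + 1) \<sigma>"
definition "L \<sigma> = Psi1 \<sigma> / Psi p c \<sigma>"
definition "L1 \<sigma> = Psi2 \<sigma> / Psi p c \<sigma> - (L \<sigma>)\<^sup>2"
text \<open>\<open>G m\<close> is \<open>r d/dr\<close> applied to the logarithm of \<open>Plog m (r / D) powr (- 1/2)\<close>, and \<open>G1 m\<close> is \<open>r d/dr\<close> applied to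
  \<open>G m\<close>.\<close>

definition "G m r = - (1/2) * (\<Sum>i=1..m. Plog i (r / D))"
definition "G1 m r = - (1/2) * (\<Sum>i=1..m. Plog i (r / D) * (\<Sum>j=1..i. Plog j (r / D)))"
text \<open>The Hardy field is \<open>F_rad m z\<close> times the position \<open>z\<close> plus \<open>F_up z\<close> times the upward unit vector. For the
  Euclidean norm it is the gradient of the logarithm of
  \<open>rad powr (- (n - 1) / 2) * Psi p c (sn z) * Plog m (rad z / D) powr (- 1/2)\<close>. Written with these two directions it
  is differentiated along dilations and vertical lines only, and along both \<open>H\<^sub>0\<close> is harmless: it is
  scaled, respectively constant.\<close>

definition "F_rad m z = (G m (rad z) - (real DIM('a) - 1) / 2 - sn z * L (sn z)) / (rad z)\<^sup>2"
definition "F_up z = L (sn z) / rad z"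

lemma DIM_ge_2: "DIM('a) \<ge> 2" using b2 bn by linarith

lemma p_pos: "p > 0" and c_pos: "c > 0"
  using b2 bn DIM_ge_2 by (auto simp: p_def c_def)

lemma pc: "2 * (p + c) = real DIM('a) - 1" "16 * p * c = (real DIM('a) - 1)\<^sup>2 - (b - 2)\<^sup>2"
  by (auto simp: p_def c_def power2_eq_square field_simps)

lemma H0_norm: "is_norm H0" and rad_norm: "is_norm rad"
  using is_norm_dual_norm[OF H] is_norm_Phi[OF is_norm_dual_norm[OF H]] by (auto simp: Phi0_def)

lemma rad_sq: "(rad z)\<^sup>2 = (H0 (fst z))\<^sup>2 + (snd z)\<^sup>2"
  by (simp add: Phi0_def Phi_def)

lemma rad_eq: "rad (x, y) = sqrt ((H0 x)\<^sup>2 + y\<^sup>2)"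
  by (simp add: Phi0_def Phi_def)

lemma tan_pos: "tan \<theta> > 0" and sin_pos: "sin \<theta> > 0" and cos_pos: "cos \<theta> > 0"
  using th0 th1 tan_gt_zero sin_gt_zero cos_gt_zero by auto

lemma cone_iff: "(x, y) \<in> Finsler_cone H \<theta> \<longleftrightarrow> tan \<theta> * H0 x < y"
  by (simp add: Finsler_cone_def)

lemma open_cone: "open (Finsler_cone H \<theta>)"
proof -
  have "Finsler_cone H \<theta> = {z. tan \<theta> * H0 (fst z) < snd z}" by (auto simp: Finsler_cone_def)
  moreover have "continuous_on UNIV (\<lambda>z::'a \<times> real. H0 (fst z))"
    by (rule continuous_on_compose2[OF is_norm_continuous[OF H0_norm, of UNIV]]) (auto intro: continuous_intros)
  ultimately show ?thesis by (simp add: open_Collect_less continuous_intros)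
qed

lemma cone_scale: "l > 0 \<Longrightarrow> l *\<^sub>R z \<in> Finsler_cone H \<theta> \<longleftrightarrow> z \<in> Finsler_cone H \<theta>"
  by (cases z) (simp add: Finsler_cone_def is_norm_scale[OF H0_norm] mult.left_commute)

lemma open_A: "open A" unfolding A_def by (intro open_Int U_open open_cone)

lemma bounded_A: "bounded A" unfolding A_def using U_bounded by (rule bounded_subset) auto

lemma cone_snd_pos: "z \<in> Finsler_cone H \<theta> \<Longrightarrow> snd z > 0"
  using tan_pos is_norm_nonneg[OF H0_norm, of "fst z"]
  by (cases z) (auto simp: Finsler_cone_def intro: le_less_trans[rotated])

lemma cone_rad_pos: "z \<in> Finsler_cone H \<theta> \<Longrightarrow> rad z > 0"
  using cone_snd_pos[of z] is_norm_pos[OF rad_norm, of z] by (cases "z = 0") auto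

lemma abs_snd_le_rad: "\<bar>snd z\<bar> \<le> rad z"
  by (rule abs_le_square_iff[THEN iffD2, of "snd z" "rad z", unfolded abs_of_nonneg[OF is_norm_nonneg[OF rad_norm]]])
    (simp add: rad_sq)

lemma cone_sn: assumes z: "z \<in> Finsler_cone H \<theta>" shows "sin \<theta> < sn z" "sn z \<le> 1"
proof -
  have y: "snd z > 0" and r: "rad z > 0" using z cone_snd_pos cone_rad_pos by auto
  have "sin \<theta> * H0 (fst z) < cos \<theta> * snd z"
    using z cos_pos by (cases z) (simp add: cone_iff tan_def field_simps)
  then have "(sin \<theta> * H0 (fst z))\<^sup>2 < (cos \<theta> * snd z)\<^sup>2"
    using sin_pos is_norm_nonneg[OF H0_norm, of "fst z"] by (intro power_strict_mono) auto
  moreover have "(cos \<theta>)\<^sup>2 = 1 - (sin \<theta>)\<^sup>2" by (simp add: cos_squared_eq)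
  ultimately have "(sin \<theta> * rad z)\<^sup>2 < (snd z)\<^sup>2"
    by (simp add: power_mult_distrib rad_sq algebra_simps)
  from power_less_imp_less_base[OF this] have "sin \<theta> * rad z < snd z" using y by simp
  then show "sin \<theta> < sn z" using r by (simp add: sn_def field_simps)
  show "sn z \<le> 1" using r abs_snd_le_rad[of z] y by (simp add: sn_def)
qed

lemma A_cone: "z \<in> A \<Longrightarrow> z \<in> Finsler_cone H \<theta>" by (simp add: A_def)

text \<open>The supremum is not attained, because \<open>A\<close> is open and \<open>rad\<close> increases along rays. So the logarithmic
  weights are smooth at every point of \<open>A\<close>.\<close>

lemma rad_lt_D: assumes z: "z \<in> A" shows "rad z < D"
proof -
  obtain C where C: "C > 0" "\<And>z. rad z \<le> C * norm z" using is_norm_le_norm[OF rad_norm] by blast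
  obtain B where B: "\<And>z. z \<in> A \<Longrightarrow> norm z \<le> B" using bounded_A by (auto simp: bounded_iff)
  have bdd: "bdd_above (rad ` A)"
  proof (rule bdd_aboveI2)
    fix w assume "w \<in> A"
    have "rad w \<le> C * norm w" by (rule C(2))
    also have "\<dots> \<le> C * B" using B[OF \<open>w \<in> A\<close>] C(1) by (intro mult_left_mono) auto
    finally show "rad w \<le> C * B" .
  qed
  have "continuous_on UNIV (\<lambda>t::real. (1 + t) *\<^sub>R z)" by (intro continuous_intros)
  then have "open ((\<lambda>t. (1 + t) *\<^sub>R z) -` A)" using open_A by (simp add: open_vimage)
  moreover have "0 \<in> (\<lambda>t. (1 + t) *\<^sub>R z) -` A" using z by simp
  ultimately obtain e where e: "e > 0" "ball 0 e \<subseteq> (\<lambda>t. (1 + t) *\<^sub>R z) -` A"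
    unfolding open_contains_ball by blast
  have "e / 2 \<in> ball 0 e" using e(1) by simp
  with e(2) have "(1 + e / 2) *\<^sub>R z \<in> A" by blast
  then have "rad ((1 + e / 2) *\<^sub>R z) \<le> D"
    unfolding D_def outer_radius_def by (rule cSUP_upper[OF _ bdd])
  moreover have "rad ((1 + e / 2) *\<^sub>R z) = (1 + e / 2) * rad z" using e by (simp add: is_norm_scale[OF rad_norm])
  moreover have "rad z > 0" using z by (simp add: A_def cone_rad_pos)
  ultimately show ?thesis using e(1) by (smt (verit) half_gt_zero_iff mult_less_cancel_right1)
qed

lemma A_nonempty: "A \<noteq> {}"
proof -
  have "continuous_on UNIV (\<lambda>t::real. (0::'a, t))" by (intro continuous_intros)
  then have "open ((\<lambda>t. (0::'a, t)) -` U)" using U_open by (simp add: open_vimage)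
  moreover have "0 \<in> (\<lambda>t. (0::'a, t)) -` U" using U0 by (simp add: zero_prod_def)
  ultimately obtain e where e: "e > 0" "ball 0 e \<subseteq> (\<lambda>t. (0::'a, t)) -` U"
    unfolding open_contains_ball by blast
  have "e / 2 \<in> ball 0 e" using e(1) by simp
  with e(2) have "(0, e / 2) \<in> U" by blast
  moreover have "(0, e / 2) \<in> Finsler_cone H \<theta>" using e(1) by (simp add: cone_iff is_norm_zero[OF H0_norm])
  ultimately show ?thesis by (auto simp: A_def)
qed

lemma D_pos: "D > 0"
  using A_nonempty rad_lt_D cone_rad_pos A_cone by (meson all_not_in_conv less_trans)

lemma rho_bounds: "z \<in> A \<Longrightarrow> 0 < rad z / D" "z \<in> A \<Longrightarrow> rad z / D < 1"
  using rad_lt_D[of z] cone_rad_pos[of z] A_cone[of z] D_pos by auto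

lemma sn_gt: "z \<in> A \<Longrightarrow> sn z > -1"
  using cone_sn[of z] A_cone[of z] sin_pos by fastforce

text \<open>Integrands are compared with \<open>1 / rad\<^sup>2\<close>, which is integrable near the vertex since the dimension
  \<open>n + 1\<close> exceeds 2; bounded continuous factors are then free.\<close>

definition BC :: "('a \<times> real \<Rightarrow> real) \<Rightarrow> bool" where
  "BC g \<longleftrightarrow> continuous_on A g \<and> (\<exists>B. \<forall>z\<in>A. \<bar>g z\<bar> \<le> B)"

lemma BC_I: "continuous_on A g \<Longrightarrow> (\<And>z. z \<in> A \<Longrightarrow> \<bar>g z\<bar> \<le> B) \<Longrightarrow> BC g"
  unfolding BC_def by blast

lemma BC_cont: "BC g \<Longrightarrow> continuous_on A g"
  unfolding BC_def by blast

lemma BC_const: "BC (\<lambda>z. k)"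
  by (rule BC_I[where B = "\<bar>k\<bar>"]) auto

lemma BC_cong: "(\<And>z. z \<in> A \<Longrightarrow> f z = g z) \<Longrightarrow> BC g \<Longrightarrow> BC f"
  unfolding BC_def by (metis (no_types, lifting) continuous_on_cong)

lemma BC_add: assumes "BC f" "BC g" shows "BC (\<lambda>z. f z + g z)"
proof -
  obtain B B' where "\<And>z. z \<in> A \<Longrightarrow> \<bar>f z\<bar> \<le> B" "\<And>z. z \<in> A \<Longrightarrow> \<bar>g z\<bar> \<le> B'"
    using assms unfolding BC_def by blast
  then have "\<bar>f z + g z\<bar> \<le> B + B'" if "z \<in> A" for z using that by (smt (verit))
  then show ?thesis by (rule BC_I[OF continuous_on_add[OF BC_cont[OF assms(1)] BC_cont[OF assms(2)]]])
qed

lemma BC_mult: assumes "BC f" "BC g" shows "BC (\<lambda>z. f z * g z)"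
proof -
  obtain B B' where B: "\<And>z. z \<in> A \<Longrightarrow> \<bar>f z\<bar> \<le> B" "\<And>z. z \<in> A \<Longrightarrow> \<bar>g z\<bar> \<le> B'"
    using assms unfolding BC_def by blast
  have "\<bar>f z * g z\<bar> \<le> B * B'" if "z \<in> A" for z
    unfolding abs_mult using B[OF that] abs_ge_zero[of "f z"] by (intro mult_mono) auto
  then show ?thesis by (rule BC_I[OF continuous_on_mult[OF BC_cont[OF assms(1)] BC_cont[OF assms(2)]]])
qed

lemma BC_diff: assumes "BC f" "BC g" shows "BC (\<lambda>z. f z - g z)"
  using BC_add[OF assms(1) BC_mult[OF BC_const[of "-1"] assms(2)]] by simp

lemma BC_sum: "finite I \<Longrightarrow> (\<And>i. i \<in> I \<Longrightarrow> BC (f i)) \<Longrightarrow> BC (\<lambda>z. \<Sum>i\<in>I. f i z)"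
  by (induction I rule: finite_induct) (auto intro: BC_const BC_add)

lemma BC_power: "BC f \<Longrightarrow> BC (\<lambda>z. f z ^ k)"
  by (induction k) (auto intro: BC_const BC_mult)

lemma BC_rad: "BC rad"
  by (rule BC_I[where B = D]) (use rad_lt_D is_norm_nonneg[OF rad_norm] is_norm_continuous[OF rad_norm] in \<open>auto simp: less_imp_le\<close>)

lemma BC_sn: "BC sn"
proof -
  have "continuous_on A sn"
    unfolding sn_def using cone_rad_pos A_cone
    by (intro continuous_on_divide continuous_on_snd continuous_on_id is_norm_continuous rad_norm) force
  moreover have "\<bar>sn z\<bar> \<le> 1" if "z \<in> A" for z using cone_sn[of z] A_cone[OF that] sin_pos by auto
  ultimately show ?thesis by (rule BC_I)
qed

lemma BC_compose_sn: assumes "continuous_on {0..1} h" shows "BC (\<lambda>z. h (sn z))"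
proof -
  have img: "sn ` A \<subseteq> {0..1}"
  proof (rule image_subsetI)
    fix z assume "z \<in> A"
    then show "sn z \<in> {0..1}" using cone_sn[of z] A_cone[of z] sin_pos by simp
  qed
  have "bounded (h ` {0..1})" by (rule compact_imp_bounded[OF compact_continuous_image[OF assms compact_Icc]])
  then obtain B where "\<forall>y\<in>h ` {0..1}. norm y \<le> B" unfolding bounded_iff by blast
  then have *: "\<bar>h (sn z)\<bar> \<le> B" if "z \<in> A" for z using that img by auto
  have "continuous_on A (\<lambda>z. h (sn z))"
    by (rule continuous_on_compose2[OF assms BC_cont[OF BC_sn] img])
  then show ?thesis using * by (rule BC_I)
qed

lemma BC_Plog: "BC (\<lambda>z. Plog k (rad z / D))"
proof -
  have "continuous_on {0<..<1} (Plog k)" using smooth_on_Plog[of k] by (auto simp: smooth_on_def dest: spec[of _ 0])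
  moreover have "continuous_on A (\<lambda>z. rad z / D)"
    using D_pos by (intro continuous_on_divide continuous_on_const BC_cont[OF BC_rad]) auto
  ultimately have "continuous_on A (\<lambda>z. Plog k (rad z / D))"
    by (rule continuous_on_compose2) (use rho_bounds in auto)
  moreover have "\<bar>Plog k (rad z / D)\<bar> \<le> 1" if "z \<in> A" for z
    using Plog_pos[of "rad z / D" k] Plog_le_1[of "rad z / D" k] rho_bounds[OF that] by auto
  ultimately show ?thesis by (rule BC_I)
qed

lemma Psi_cont: "p' > 0 \<Longrightarrow> c' > 0 \<Longrightarrow> continuous_on {0..1} (Psi p' c')"
  by (rule continuous_at_imp_continuous_on) (auto intro!: DERIV_isCont[OF DERIV_Psi])

lemma L_cont: "continuous_on {0..1} L" and L1_cont: "continuous_on {0..1} L1"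
proof -
  have pos: "Psi p c \<sigma> \<noteq> 0" if "\<sigma> \<in> {0..1}" for \<sigma>
    using Psi_pos[OF p_pos c_pos, of \<sigma>] that by auto
  show *: "continuous_on {0..1} L"
    unfolding L_def Psi1_def using p_pos c_pos pos by (intro continuous_intros Psi_cont) auto
  show "continuous_on {0..1} L1"
    unfolding L1_def Psi2_def using p_pos c_pos pos by (intro continuous_intros * Psi_cont) auto
qed

lemma BC_L: "BC (\<lambda>z. L (sn z))" and BC_L1: "BC (\<lambda>z. L1 (sn z))"
  by (intro BC_compose_sn L_cont L1_cont)+

lemma BC_G: "BC (\<lambda>z. G m (rad z))" and BC_G1: "BC (\<lambda>z. G1 m (rad z))"
  unfolding G_def G1_def by (intro BC_mult BC_const BC_sum BC_Plog; simp)+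

lemma integrable_over_rad_sq: assumes "BC g" shows "set_integrable lborel A (\<lambda>z. g z / (rad z)\<^sup>2)"
proof -
  obtain B where B: "\<And>z. z \<in> A \<Longrightarrow> \<bar>g z\<bar> \<le> B" using assms unfolding BC_def by blast
  show ?thesis
  proof (rule set_integrable_singular[OF rad_norm, where a = 2 and C = B])
    show "2 < DIM('a \<times> real)" using DIM_ge_2 by simp
    show "A \<in> sets borel" using open_A by simp
    show "bounded A" by (rule bounded_A)
    have "continuous_on A (\<lambda>z. g z / (rad z)\<^sup>2)"
      using assms cone_rad_pos A_cone
      by (intro continuous_on_divide continuous_on_power is_norm_continuous rad_norm BC_cont) force+
    then have "(\<lambda>z. indicator A z *\<^sub>R (g z / (rad z)\<^sup>2)) \<in> borel_measurable borel"
      by (rule borel_measurable_continuous_on_indicator[rotated]) (use open_A in simp)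
    then show "set_borel_measurable lborel A (\<lambda>z. g z / (rad z)\<^sup>2)"
      unfolding set_borel_measurable_def measurable_cong_sets[OF sets_lborel refl] .
    show "\<bar>g z / (rad z)\<^sup>2\<bar> \<le> B / (rad z) ^ 2" if "z \<in> A" for z
      using B[OF that] by (simp add: divide_right_mono)
  qed
qed

text \<open>The identities below need a function only through its derivatives \<open>uz\<close> along rays and \<open>uy\<close> along vertical
  lines. They then apply to test functions, and also to functions of \<open>H\<^sub>0 x\<close> and \<open>y\<close>, which need not be
  differentiable.\<close>

definition admissible :: "('a \<times> real \<Rightarrow> real) \<Rightarrow> ('a \<times> real \<Rightarrow> real) \<Rightarrow> ('a \<times> real \<Rightarrow> real) \<Rightarrow> bool" where
  "admissible u uz uy \<longleftrightarrow> continuous_on UNIV u \<and> continuous_on UNIV uz \<and> continuous_on UNIV uy \<and>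
    (\<exists>K. compact K \<and> K \<subseteq> U \<and> (\<forall>z. z \<notin> K \<longrightarrow> u z = 0 \<and> uz z = 0 \<and> uy z = 0)) \<and>
    (\<forall>z. ((\<lambda>l. u (l *\<^sub>R z)) has_real_derivative uz z) (at 1)) \<and>
    (\<forall>x y. ((\<lambda>y. u (x, y)) has_real_derivative uy (x, y)) (at y))"

lemma compact_support_bounded:
  fixes f :: "'a \<times> real \<Rightarrow> real"
  assumes "continuous_on UNIV f" "compact K" "\<And>z. z \<notin> K \<Longrightarrow> f z = 0"
  shows "\<exists>B. \<forall>z. \<bar>f z\<bar> \<le> B"
proof -
  have "bounded (f ` K)"
    using assms by (intro compact_imp_bounded compact_continuous_image) (auto intro: continuous_on_subset)
  then obtain B where B: "\<forall>y\<in>f ` K. norm y \<le> B" unfolding bounded_iff by blast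
  then have "\<bar>f z\<bar> \<le> max B 0" for z using assms(3)[of z] by (cases "z \<in> K") auto
  then show ?thesis by blast
qed

lemma BC_compact_support:
  assumes "continuous_on UNIV f" "compact K" "\<And>z. z \<notin> K \<Longrightarrow> f z = 0" shows "BC f"
  using compact_support_bounded[OF assms] continuous_on_subset[OF assms(1) subset_UNIV] BC_I by blast

lemma admissible_BC: assumes "admissible u uz uy" shows "BC u" "BC uz" "BC uy"
proof -
  obtain K where K: "compact K" "\<And>z. z \<notin> K \<Longrightarrow> u z = 0" "\<And>z. z \<notin> K \<Longrightarrow> uz z = 0" "\<And>z. z \<notin> K \<Longrightarrow> uy z = 0"
    using assms unfolding admissible_def by blast
  have c: "continuous_on UNIV u" "continuous_on UNIV uz" "continuous_on UNIV uy"
    using assms unfolding admissible_def by blast+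
  show "BC u" by (rule BC_compact_support[OF c(1) K(1,2)])
  show "BC uz" by (rule BC_compact_support[OF c(2) K(1,3)])
  show "BC uy" by (rule BC_compact_support[OF c(3) K(1,4)])
qed

text \<open>Twice the Hardy field paired with \<open>u \<nabla>u\<close>, minus \<open>u\<^sup>2\<close> times the square of its \<open>\<Phi>\<^sub>0\<close>-norm: the lower bound for the
  energy density that duality gives.\<close>

definition S :: "nat \<Rightarrow> ('a \<times> real \<Rightarrow> real) \<Rightarrow> ('a \<times> real \<Rightarrow> real) \<Rightarrow> ('a \<times> real \<Rightarrow> real) \<Rightarrow> 'a \<times> real \<Rightarrow> real" where
  "S m u uz uy z = 2 * u z * (F_rad m z * uz z + F_up z * uy z)
     - (u z)\<^sup>2 * ((F_rad m z)\<^sup>2 * (rad z)\<^sup>2 + 2 * F_rad m z * F_up z * snd z + (F_up z)\<^sup>2)"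

lemma DERIV_L: assumes "\<sigma> > -1" shows "(L has_real_derivative L1 \<sigma>) (at \<sigma>)"
proof -
  have 0: "(Psi p c has_real_derivative Psi1 \<sigma>) (at \<sigma>)"
    unfolding Psi1_def by (rule DERIV_Psi[OF p_pos c_pos assms])
  have 1: "(Psi1 has_real_derivative Psi2 \<sigma>) (at \<sigma>)"
  proof -
    have "(Psi (p + 1/2) (c + 1/2) has_real_derivative - 2 * (p + 1/2 + (c + 1/2)) * Psi (p + 1/2 + 1/2) (c + 1/2 + 1/2) \<sigma>) (at \<sigma>)"
      using p_pos c_pos assms by (intro DERIV_Psi) auto
    from DERIV_cmult[OF this, of "- 2 * (p + c)"] show ?thesis
      unfolding Psi1_def[abs_def] Psi2_def by (simp add: algebra_simps)
  qed
  have "Psi p c \<sigma> \<noteq> 0" using Psi_pos[OF p_pos c_pos assms] by simp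
  from DERIV_divide[OF 1 0 this] show ?thesis
    unfolding L_def[abs_def] L1_def using \<open>Psi p c \<sigma> \<noteq> 0\<close>
    by (elim DERIV_cong) (simp add: L_def field_simps power2_eq_square)
qed

text \<open>The Riccati form of the equation of the ground state.\<close>

lemma L_ODE: assumes "\<sigma> > -1"
  shows "(L1 \<sigma> + (L \<sigma>)\<^sup>2) * (1 - \<sigma>\<^sup>2) - real DIM('a) * \<sigma> * L \<sigma> = ((real DIM('a) - 1)\<^sup>2 - (b - 2)\<^sup>2) / 4"
proof -
  have "Psi p c \<sigma> > 0" by (rule Psi_pos[OF p_pos c_pos assms])
  moreover have "(1 - \<sigma>\<^sup>2) * Psi2 \<sigma> - real DIM('a) * \<sigma> * Psi1 \<sigma> = ((real DIM('a) - 1)\<^sup>2 - (b - 2)\<^sup>2) / 4 * Psi p c \<sigma>"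
  proof -
    have "2 * (p + c) + 1 = real DIM('a)" "4 * p * c = ((real DIM('a) - 1)\<^sup>2 - (b - 2)\<^sup>2) / 4"
      using pc by auto
    with Psi_ODE[OF p_pos c_pos assms] show ?thesis unfolding Psi1_def Psi2_def by metis
  qed
  ultimately have "((1 - \<sigma>\<^sup>2) * Psi2 \<sigma> - real DIM('a) * \<sigma> * Psi1 \<sigma>) / Psi p c \<sigma> = ((real DIM('a) - 1)\<^sup>2 - (b - 2)\<^sup>2) / 4"
    by simp
  moreover have "L1 \<sigma> + (L \<sigma>)\<^sup>2 = Psi2 \<sigma> / Psi p c \<sigma>" by (simp add: L1_def)
  ultimately show ?thesis by (simp add: L_def diff_divide_distrib mult.commute)
qed

lemma DERIV_G: assumes "0 < r" "r < D" shows "(G m has_real_derivative G1 m r / r) (at r)"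
proof -
  have "((\<lambda>r. Plog i (r / D)) has_real_derivative Plog i (r / D) * (\<Sum>j=1..i. Plog j (r / D)) / r) (at r)" for i
  proof -
    have "((\<lambda>r. r / D) has_real_derivative 1 / D) (at r)" using D_pos by (auto intro!: derivative_eq_intros)
    moreover have "0 < r / D" "r / D \<le> 1" using assms D_pos by auto
    ultimately show ?thesis
      using DERIV_chain2[OF DERIV_Plog] D_pos assms by (fastforce elim!: DERIV_cong)
  qed
  then have "((\<lambda>r. \<Sum>i=1..m. Plog i (r / D)) has_real_derivative
      (\<Sum>i=1..m. Plog i (r / D) * (\<Sum>j=1..i. Plog j (r / D)) / r)) (at r)"
    by (rule DERIV_sum)
  from DERIV_cmult[OF this, of "- (1/2)"] show ?thesis
    unfolding G_def[abs_def] G1_def by (rule DERIV_cong) (simp add: sum_divide_distrib mult.commute)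
qed

text \<open>The logarithmic weights enter through this identity: the field with \<open>m\<close> logarithms gains exactly the
  first \<open>m\<close> remainder terms.\<close>

lemma G_identity: "G1 m r + (G m r)\<^sup>2 = - (1/4) * (\<Sum>i=1..m. (Plog i (r / D))\<^sup>2)"
  unfolding G1_def G_def Plog_sum_square by (simp add: power_mult_distrib power2_eq_square field_simps)

lemma sn_scale: "l > 0 \<Longrightarrow> sn (l *\<^sub>R z) = sn z"
  by (simp add: sn_def is_norm_scale[OF rad_norm])

lemma DERIV_F_rad:
  assumes z: "z \<in> A"
  shows "((\<lambda>l. F_rad m (l *\<^sub>R z)) has_real_derivative (G1 m (rad z) / (rad z)\<^sup>2 - 2 * F_rad m z)) (at 1)"
proof -
  define k where "k = (real DIM('a) - 1) / 2 + sn z * L (sn z)"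
  have r: "rad z > 0" "rad z < D" using z A_cone cone_rad_pos rad_lt_D by auto
  have "((\<lambda>l. l * rad z) has_real_derivative rad z) (at 1)" by (auto intro!: derivative_eq_intros)
  moreover have "(G m has_real_derivative G1 m (rad z) / rad z) (at (1 * rad z))" using DERIV_G[OF r] by simp
  ultimately have "((\<lambda>l. G m (l * rad z)) has_real_derivative G1 m (rad z) / rad z * rad z) (at 1)"
    by (rule DERIV_chain2[rotated])
  then have "((\<lambda>l. (G m (l * rad z) - k) / (l * rad z)\<^sup>2) has_real_derivative
      (G1 m (rad z) / (rad z)\<^sup>2 - 2 * ((G m (rad z) - k) / (rad z)\<^sup>2))) (at 1)"
    using r by (auto intro!: derivative_eq_intros simp: field_simps power2_eq_square)
  moreover have "(G m (rad z) - k) / (rad z)\<^sup>2 = F_rad m z" by (simp add: F_rad_def k_def)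
  moreover have "(G m (l * rad z) - k) / (l * rad z)\<^sup>2 = F_rad m (l *\<^sub>R z)" if "l > 0" for l
    using that by (simp add: F_rad_def k_def sn_scale is_norm_scale[OF rad_norm])
  ultimately show ?thesis
    using has_field_derivative_transform_within_open[of "\<lambda>l. (G m (l * rad z) - k) / (l * rad z)\<^sup>2" _ 1 "{0<..}" "\<lambda>l. F_rad m (l *\<^sub>R z)"]
    by simp
qed

lemma DERIV_rad_up:
  assumes "rad (x, y) > 0"
  shows "((\<lambda>y. rad (x, y)) has_real_derivative sn (x, y)) (at y)"
    and "((\<lambda>y. sn (x, y)) has_real_derivative (1 - (sn (x, y))\<^sup>2) / rad (x, y)) (at y)"
proof -
  have k: "(H0 x)\<^sup>2 + y\<^sup>2 > 0" using assms by (simp add: rad_eq)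
  show 1: "((\<lambda>y. rad (x, y)) has_real_derivative sn (x, y)) (at y)"
    unfolding rad_eq sn_def snd_conv using k by (auto intro!: derivative_eq_intros simp: field_simps)
  have "((\<lambda>y. y / rad (x, y)) has_real_derivative (1 * rad (x, y) - y * sn (x, y)) / (rad (x, y) * rad (x, y))) (at y)"
    using assms by (intro DERIV_divide DERIV_ident 1) auto
  then show "((\<lambda>y. sn (x, y)) has_real_derivative (1 - (sn (x, y))\<^sup>2) / rad (x, y)) (at y)"
    unfolding sn_def snd_conv using assms by (elim DERIV_cong) (simp add: sn_def field_simps power2_eq_square)
qed

definition "F_up1 z = (L1 (sn z) * (1 - (sn z)\<^sup>2) - sn z * L (sn z)) / (rad z)\<^sup>2"

lemma DERIV_F_up:
  assumes "rad (x, y) > 0" "sn (x, y) > -1"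
  shows "((\<lambda>y. F_up (x, y)) has_real_derivative F_up1 (x, y)) (at y)"
proof -
  have "((\<lambda>y. L (sn (x, y))) has_real_derivative L1 (sn (x, y)) * ((1 - (sn (x, y))\<^sup>2) / rad (x, y))) (at y)"
    by (rule DERIV_chain2[OF DERIV_L[OF assms(2)] DERIV_rad_up(2)[OF assms(1)]])
  from DERIV_divide[OF this DERIV_rad_up(1)[OF assms(1)]] have
    "((\<lambda>y. L (sn (x, y)) / rad (x, y)) has_real_derivative
       (L1 (sn (x, y)) * ((1 - (sn (x, y))\<^sup>2) / rad (x, y)) * rad (x, y) - L (sn (x, y)) * sn (x, y)) / (rad (x, y) * rad (x, y))) (at y)"
    using assms(1) by simp
  then show ?thesis unfolding F_up_def F_up1_def
    by (rule DERIV_cong) (use assms(1) in \<open>simp add: power2_eq_square mult.commute\<close>)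
qed

text \<open>The divergence of the Hardy field plus the square of its \<open>\<Phi>\<^sub>0\<close>-norm is minus the Hardy potential. The radial part
  comes from \<open>G_identity\<close>, the angular part from \<open>L_ODE\<close>; the cross terms cancel.\<close>

lemma Riccati:
  assumes z: "z \<in> A"
  shows "(real DIM('a) - 1) * F_rad m z + G1 m (rad z) / (rad z)\<^sup>2 + F_up1 z
     + ((F_rad m z)\<^sup>2 * (rad z)\<^sup>2 + 2 * F_rad m z * F_up z * snd z + (F_up z)\<^sup>2)
   = - ((b - 2)\<^sup>2 / 4 + 1/4 * (\<Sum>i=1..m. (Plog i (rad z / D))\<^sup>2)) / (rad z)\<^sup>2"
proof -
  define r where "r = rad z"
  define s where "s = sn z"
  define g where "g = G m r"
  define l where "l = L s"
  define l1 where "l1 = L1 s"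
  define n where "n = real DIM('a)"
  have r: "r > 0" using z A_cone cone_rad_pos by (auto simp: r_def)
  have y: "snd z = s * r" using r by (simp add: s_def r_def sn_def)
  have ode: "(l1 + l\<^sup>2) * (1 - s\<^sup>2) - n * s * l = ((n - 1)\<^sup>2 - (b - 2)\<^sup>2) / 4"
    using L_ODE[OF sn_gt[OF z]] by (simp add: l_def l1_def s_def n_def)
  have gi: "G1 m r + g\<^sup>2 = - (1/4) * (\<Sum>i=1..m. (Plog i (r / D))\<^sup>2)"
    using G_identity by (simp add: r_def g_def)
  have "(n - 1) * ((g - (n - 1) / 2 - s * l) / r\<^sup>2) + G1 m r / r\<^sup>2 + (l1 * (1 - s\<^sup>2) - s * l) / r\<^sup>2
     + (((g - (n - 1) / 2 - s * l) / r\<^sup>2)\<^sup>2 * r\<^sup>2 + 2 * ((g - (n - 1) / 2 - s * l) / r\<^sup>2) * (l / r) * (s * r) + (l / r)\<^sup>2)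
     = ((n - 1) * (g - (n - 1) / 2 - s * l) + G1 m r + (l1 * (1 - s\<^sup>2) - s * l)
     + ((g - (n - 1) / 2 - s * l)\<^sup>2 + 2 * (g - (n - 1) / 2 - s * l) * l * s + l\<^sup>2)) / r\<^sup>2"
    using r by (simp add: add_divide_distrib power_divide power2_eq_square)
  also have "(n - 1) * (g - (n - 1) / 2 - s * l) + G1 m r + (l1 * (1 - s\<^sup>2) - s * l)
     + ((g - (n - 1) / 2 - s * l)\<^sup>2 + 2 * (g - (n - 1) / 2 - s * l) * l * s + l\<^sup>2)
     = (G1 m r + g\<^sup>2) + ((l1 + l\<^sup>2) * (1 - s\<^sup>2) - n * s * l) - (n - 1)\<^sup>2 / 4"
    by (simp add: power2_eq_square field_simps)
  also have "\<dots> = - ((b - 2)\<^sup>2 / 4 + 1/4 * (\<Sum>i=1..m. (Plog i (r / D))\<^sup>2))"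
    unfolding ode gi by (simp add: field_simps)
  finally show ?thesis
    unfolding F_rad_def F_up_def F_up1_def y unfolding r_def[symmetric] s_def[symmetric]
    unfolding g_def[symmetric] l_def[symmetric] l1_def[symmetric] n_def[symmetric] .
qed

lemma BC_P: "BC (\<lambda>z. F_rad m z * (rad z)\<^sup>2)"
proof -
  have "BC (\<lambda>z. G m (rad z) - (real DIM('a) - 1) / 2 - sn z * L (sn z))"
    by (intro BC_diff BC_mult BC_const BC_G BC_sn BC_L)
  moreover have "F_rad m z * (rad z)\<^sup>2 = G m (rad z) - (real DIM('a) - 1) / 2 - sn z * L (sn z)" if "z \<in> A" for z
    using cone_rad_pos[OF A_cone[OF that]] by (simp add: F_rad_def)
  ultimately show ?thesis by (rule BC_cong[rotated])
qed

lemma BC_Q: "BC (\<lambda>z. F_up z * rad z)"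
proof -
  have "F_up z * rad z = L (sn z)" if "z \<in> A" for z
    using cone_rad_pos[OF A_cone[OF that]] by (simp add: F_up_def)
  then show ?thesis using BC_L by (rule BC_cong)
qed

lemma BC_Q1: "BC (\<lambda>z. F_up1 z * (rad z)\<^sup>2)"
proof -
  have "BC (\<lambda>z. L1 (sn z) * (1 - (sn z)\<^sup>2) - sn z * L (sn z))"
    by (intro BC_diff BC_mult BC_power BC_const BC_L1 BC_sn BC_L)
  moreover have "F_up1 z * (rad z)\<^sup>2 = L1 (sn z) * (1 - (sn z)\<^sup>2) - sn z * L (sn z)" if "z \<in> A" for z
    using cone_rad_pos[OF A_cone[OF that]] by (simp add: F_up1_def)
  ultimately show ?thesis by (rule BC_cong[rotated])
qed

lemma integrable_of_BC:
  assumes "BC (\<lambda>z. f z * (rad z)\<^sup>2)" shows "set_integrable lborel A f"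
proof -
  have "set_integrable lborel A (\<lambda>z. f z * (rad z)\<^sup>2 / (rad z)\<^sup>2)" by (rule integrable_over_rad_sq[OF assms])
  moreover have "f z * (rad z)\<^sup>2 / (rad z)\<^sup>2 = f z" if "z \<in> A" for z
    using cone_rad_pos[OF A_cone[OF that]] by simp
  ultimately show ?thesis by (simp cong: set_integrable_cong)
qed

end

section \<open>The Hardy inequality\<close>

context hardy_setting begin

lemma eventually_scaleR_open:
  fixes W :: "('a \<times> real) set"
  assumes "open W" "w \<in> W" obtains V where "open V" "(1::real) \<in> V" "\<And>t. t \<in> V \<Longrightarrow> t *\<^sub>R w \<in> W"
proof
  show "open ((\<lambda>t. t *\<^sub>R w) -` W)" by (intro open_vimage assms(1) continuous_intros)
qed (use assms(2) in auto)

lemma set_integrable_eq_indicator: "set_integrable lborel A f = integrable lborel (\<lambda>z. indicator A z * (f z :: real))"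
  by (simp add: set_integrable_def)

text \<open>On \<open>K\<close>, outside of which \<open>f\<close> vanishes, the set \<open>A\<close> coincides with the cone, and the cone is invariant under dilations. So
  cutting \<open>f\<close> off outside \<open>A\<close> preserves its differentiability along rays.\<close>

lemma integral_Euler_cone:
  fixes f e :: "'a \<times> real \<Rightarrow> real"
  assumes K: "compact K" "K \<subseteq> U" and f: "set_integrable lborel A f" and e: "set_integrable lborel A e"
    and K0: "\<And>z. z \<notin> K \<Longrightarrow> f z = 0"
    and der: "\<And>w. w \<in> A \<Longrightarrow>
      ((\<lambda>t. f (t *\<^sub>R w)) has_real_derivative e w - (real DIM('a) + 1) * f w) (at 1)"
  shows "(LINT z:A|lborel. e z) = 0"
proof -
  let ?n = "real DIM('a)"
  define fA where "fA = (\<lambda>z. indicator A z * f z)"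
  have fi: "integrable lborel fA" and ei: "integrable lborel (\<lambda>z. indicator A z * e z)"
    using f e by (simp_all only: fA_def set_integrable_eq_indicator)
  have "(\<integral>z. indicator A z * e z \<partial>lborel) = 0"
  proof (rule integral_Euler_eq_0[OF fi ei])
    fix z :: "'a \<times> real" and l :: real assume "z \<noteq> 0" and l: "l > 0"
    define w where "w = l *\<^sub>R z"
    have "((\<lambda>t. fA (t *\<^sub>R w)) has_real_derivative (indicator A w * e w - (?n + 1) * fA w)) (at 1)"
    proof (cases "w \<in> A")
      case True
      obtain V where V: "open V" "(1::real) \<in> V" "\<And>t. t \<in> V \<Longrightarrow> t *\<^sub>R w \<in> A"
        using eventually_scaleR_open[OF open_A True] by blast
      have "((\<lambda>t. fA (t *\<^sub>R w)) has_real_derivative e w - (?n + 1) * f w) (at 1)"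
        by (rule has_field_derivative_transform_within_open[OF der[OF True] V(1,2)]) (use V(3) in \<open>simp add: fA_def\<close>)
      then show ?thesis using True by (simp add: fA_def)
    next
      case False
      obtain V where V: "open V" "(1::real) \<in> V" "\<And>t. t \<in> V \<Longrightarrow> fA (t *\<^sub>R w) = 0"
      proof (cases "w \<in> Finsler_cone H \<theta>")
        case True
        then have "w \<in> - K" using False K(2) by (auto simp: A_def)
        then obtain V where V: "open V" "(1::real) \<in> V" "\<And>t. t \<in> V \<Longrightarrow> t *\<^sub>R w \<in> - K"
          using eventually_scaleR_open[OF open_Compl[OF compact_imp_closed[OF K(1)]] \<open>w \<in> - K\<close>] by blast
        show ?thesis by (rule that[OF V(1,2)]) (use V(3) K0 in \<open>auto simp: fA_def\<close>)
      next
        case False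
        have "fA (t *\<^sub>R w) = 0" if "t \<in> {0<..}" for t
        proof -
          have "t *\<^sub>R w \<notin> A" using False cone_scale[of t w] A_cone[of "t *\<^sub>R w"] that by auto
          then show ?thesis by (simp add: fA_def)
        qed
        then show ?thesis by (rule that[of "{0<..}", rotated 2]) simp_all
      qed
      have "((\<lambda>t. fA (t *\<^sub>R w)) has_real_derivative 0) (at 1)"
        by (rule has_field_derivative_transform_within_open[of "\<lambda>_. 0", OF _ V(1,2)]) (use V(3) in simp_all)
      then show ?thesis using False by (simp add: fA_def)
    qed
    from DERIV_scaleR_rescale[OF this[unfolded w_def] l]
    show "((\<lambda>l. fA (l *\<^sub>R z)) has_real_derivative
       (indicator A (l *\<^sub>R z) * e (l *\<^sub>R z) - real DIM('a \<times> real) * fA (l *\<^sub>R z)) / l) (at l)"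
      by (simp add: add.commute)
  qed
  then show ?thesis by (simp add: set_integral_indicator)
qed

text \<open>Integration by parts for the radial component of the field. The position is tangent to the boundary of the cone,
  so no boundary term appears.\<close>

lemma radial_identity:
  assumes adm: "admissible u uz uy"
  shows "(LINT z:A|lborel. 2 * u z * (F_rad m z * uz z)) =
    - (LINT z:A|lborel. (u z)\<^sup>2 * ((real DIM('a) - 1) * F_rad m z + G1 m (rad z) / (rad z)\<^sup>2))"
    and "set_integrable lborel A (\<lambda>z. 2 * u z * (F_rad m z * uz z))"
    and "set_integrable lborel A (\<lambda>z. (u z)\<^sup>2 * ((real DIM('a) - 1) * F_rad m z + G1 m (rad z) / (rad z)\<^sup>2))"
proof -
  let ?n = "real DIM('a)"
  obtain K where K: "compact K" "K \<subseteq> U" "\<And>z. z \<notin> K \<Longrightarrow> u z = 0"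
    using adm unfolding admissible_def by blast
  have du: "((\<lambda>l. u (l *\<^sub>R z)) has_real_derivative uz z) (at 1)" for z
    using adm unfolding admissible_def by blast
  note bc = admissible_BC[OF adm]
  have r: "rad z \<noteq> 0" if "z \<in> A" for z using cone_rad_pos[OF A_cone[OF that]] by simp
  define e1 where "e1 = (\<lambda>z. 2 * u z * (F_rad m z * uz z))"
  define e2 where "e2 = (\<lambda>z. (u z)\<^sup>2 * ((?n - 1) * F_rad m z + G1 m (rad z) / (rad z)\<^sup>2))"
  have fi: "set_integrable lborel A (\<lambda>z. (u z)\<^sup>2 * F_rad m z)"
  proof (rule integrable_of_BC, rule BC_cong)
    show "BC (\<lambda>z. (u z)\<^sup>2 * (F_rad m z * (rad z)\<^sup>2))" by (intro BC_mult BC_power bc BC_P)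
  qed simp
  show e1i: "set_integrable lborel A (\<lambda>z. 2 * u z * (F_rad m z * uz z))"
  proof (rule integrable_of_BC, rule BC_cong)
    show "BC (\<lambda>z. 2 * u z * ((F_rad m z * (rad z)\<^sup>2) * uz z))" by (intro BC_mult BC_const bc BC_P)
  qed simp
  show e2i: "set_integrable lborel A (\<lambda>z. (u z)\<^sup>2 * ((?n - 1) * F_rad m z + G1 m (rad z) / (rad z)\<^sup>2))"
  proof (rule integrable_of_BC, rule BC_cong)
    show "BC (\<lambda>z. (u z)\<^sup>2 * ((?n - 1) * (F_rad m z * (rad z)\<^sup>2) + G1 m (rad z)))"
      by (intro BC_mult BC_power BC_add BC_const bc BC_P BC_G1)
  qed (use r in \<open>simp add: algebra_simps\<close>)
  have E: "integrable lborel (\<lambda>z. indicator A z * (e1 z + e2 z))"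
    using set_integral_add(1)[OF e1i e2i] by (simp only: e1_def e2_def set_integrable_eq_indicator)
  have "(LINT z:A|lborel. e1 z + e2 z) = 0"
  proof (rule integral_Euler_cone[OF K(1,2)])
    show "set_integrable lborel A (\<lambda>z. (u z)\<^sup>2 * F_rad m z)" by (rule fi)
    show "set_integrable lborel A (\<lambda>z. e1 z + e2 z)" by (simp only: E set_integrable_eq_indicator)
    show "(u z)\<^sup>2 * F_rad m z = 0" if "z \<notin> K" for z using K(3)[OF that] by simp
    fix w assume w: "w \<in> A"
    have "((\<lambda>t. (u (t *\<^sub>R w))\<^sup>2) has_real_derivative 2 * u w * uz w) (at 1)"
      using DERIV_power[OF du[of w], of 2] by (simp add: mult_ac)
    from DERIV_mult[OF this DERIV_F_rad[OF w, of m]]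
    have "((\<lambda>t. (u (t *\<^sub>R w))\<^sup>2 * F_rad m (t *\<^sub>R w)) has_real_derivative
       2 * u w * uz w * F_rad m w + (G1 m (rad w) / (rad w)\<^sup>2 - 2 * F_rad m w) * (u w)\<^sup>2) (at 1)"
      by simp
    then show "((\<lambda>t. (u (t *\<^sub>R w))\<^sup>2 * F_rad m (t *\<^sub>R w)) has_real_derivative
       e1 w + e2 w - (?n + 1) * ((u w)\<^sup>2 * F_rad m w)) (at 1)"
      by (rule DERIV_cong) (simp add: e1_def e2_def algebra_simps)
  qed
  moreover have "(LINT z:A|lborel. e1 z + e2 z) = (LINT z:A|lborel. e1 z) + (LINT z:A|lborel. e2 z)"
    unfolding e1_def e2_def by (rule set_integral_add(2)[OF e1i e2i])
  ultimately show "(LINT z:A|lborel. 2 * u z * (F_rad m z * uz z)) =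
    - (LINT z:A|lborel. (u z)\<^sup>2 * ((?n - 1) * F_rad m z + G1 m (rad z) / (rad z)\<^sup>2))"
    by (simp add: e1_def e2_def)
qed

lemma K_const_L: "K_const \<theta> DIM('a) b = - cos \<theta> * L (sin \<theta>)"
  using K_const_eq[OF DIM_ge_2 b2 bn th0 th1]
  unfolding p_def[symmetric] c_def[symmetric] by (simp add: L_def Psi1_def)

text \<open>On the boundary of the cone the latitude is \<open>\<theta>\<close>, so the vertical component of the field is \<open>L (sin \<theta>)\<close> over
  \<open>rad\<close>; up to the factor \<open>1 / H\<^sub>0 x\<close> of the boundary term this is minus the boundary constant.\<close>

lemma F_up_boundary: "F_up (x, tan \<theta> * H0 x) = - K_const \<theta> DIM('a) b / H0 x"
proof (cases "x = 0")
  case True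
  then show ?thesis by (simp add: F_up_def rad_eq is_norm_zero[OF H0_norm])
next
  case False
  then have x: "H0 x > 0" by (rule is_norm_pos[OF H0_norm])
  have "(H0 x)\<^sup>2 + (tan \<theta> * H0 x)\<^sup>2 = (H0 x / cos \<theta>)\<^sup>2"
  proof -
    have "1 + (tan \<theta>)\<^sup>2 = 1 / (cos \<theta>)\<^sup>2"
      using cos_pos sin_cos_squared_add[of \<theta>] by (simp add: tan_def field_simps)
    then have "(H0 x)\<^sup>2 * (1 + (tan \<theta>)\<^sup>2) = (H0 x)\<^sup>2 * (1 / (cos \<theta>)\<^sup>2)" by simp
    then show ?thesis by (simp add: power_mult_distrib power_divide algebra_simps)
  qed
  then have r: "rad (x, tan \<theta> * H0 x) = H0 x / cos \<theta>" using x cos_pos by (simp add: rad_eq)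
  then have "sn (x, tan \<theta> * H0 x) = sin \<theta>" using x cos_pos by (simp add: sn_def tan_def)
  then show ?thesis using r by (simp add: F_up_def K_const_L)
qed

text \<open>Integration by parts for the vertical component of the field; the boundary term comes from here.\<close>

lemma vertical_identity:
  assumes adm: "admissible u uz uy"
  shows "(LINT z:A|lborel. 2 * u z * (F_up z * uy z)) =
    K_const \<theta> DIM('a) b * boundary_term H \<theta> u - (LINT z:A|lborel. (u z)\<^sup>2 * F_up1 z)"
    and "set_integrable lborel A (\<lambda>z. 2 * u z * (F_up z * uy z))"
    and "set_integrable lborel A (\<lambda>z. (u z)\<^sup>2 * F_up1 z)"
proof -
  obtain K where K: "compact K" "K \<subseteq> U" "\<And>z. z \<notin> K \<Longrightarrow> u z = 0" "\<And>z. z \<notin> K \<Longrightarrow> uy z = 0"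
    using adm unfolding admissible_def by blast
  have du: "((\<lambda>y. u (x, y)) has_real_derivative uy (x, y)) (at y)" for x y
    using adm unfolding admissible_def by blast
  have cu: "continuous_on UNIV u" using adm unfolding admissible_def by blast
  note bc = admissible_BC[OF adm]
  define T where "T = (\<lambda>x. tan \<theta> * H0 x)"
  have cone_eq: "{(x, y). T x < y} = Finsler_cone H \<theta>" by (auto simp: T_def Finsler_cone_def)
  define q' where "q' = (\<lambda>z. 2 * u z * (F_up z * uy z) + (u z)\<^sup>2 * F_up1 z)"
  show i1: "set_integrable lborel A (\<lambda>z. 2 * u z * (F_up z * uy z))"
  proof (rule integrable_of_BC, rule BC_cong)
    show "BC (\<lambda>z. 2 * u z * ((F_up z * rad z) * (rad z * uy z)))" by (intro BC_mult BC_const bc BC_Q BC_rad)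
  qed (simp add: power2_eq_square)
  show i2: "set_integrable lborel A (\<lambda>z. (u z)\<^sup>2 * F_up1 z)"
  proof (rule integrable_of_BC, rule BC_cong)
    show "BC (\<lambda>z. (u z)\<^sup>2 * (F_up1 z * (rad z)\<^sup>2))" by (intro BC_mult BC_power bc BC_Q1)
  qed simp
  have q'i: "set_integrable lborel A q'" unfolding q'_def by (rule set_integral_add(1)[OF i1 i2])
  have ind: "indicator {(x, y). T x < y} z *\<^sub>R q' z = indicator A z *\<^sub>R q' z" for z
  proof (cases "z \<in> U")
    case False
    then have "u z = 0" using K by blast
    then show ?thesis by (simp add: q'_def)
  qed (simp add: cone_eq A_def indicator_def)
  have "(LINT z:{(x, y). T x < y}|lborel. q' z) = - (\<integral>x. (u (x, T x))\<^sup>2 * F_up (x, T x) \<partial>lborel)"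
  proof (rule integral_vertical_derivative[where q = "\<lambda>z. (u z)\<^sup>2 * F_up z"])
    show "set_integrable lborel {(x, y). T x < y} q'"
      using q'i unfolding set_integrable_def ind .
    show "((\<lambda>y. (u (x, y))\<^sup>2 * F_up (x, y)) has_real_derivative q' (x, y)) (at y)" if "x \<noteq> 0" "T x \<le> y" for x y
    proof -
      have "T x > 0" using that(1) tan_pos is_norm_pos[OF H0_norm] by (simp add: T_def)
      then have y: "y > 0" using that(2) by simp
      then have "(x, y) \<noteq> 0" by (simp add: zero_prod_def)
      then have r: "rad (x, y) > 0" by (rule is_norm_pos[OF rad_norm])
      then have "sn (x, y) > 0" using y by (simp add: sn_def)
      then have "sn (x, y) > -1" by simp
      from DERIV_mult[OF DERIV_power[OF du[of x y], of 2] DERIV_F_up[OF r this]]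
      show ?thesis by (rule DERIV_cong) (simp add: q'_def algebra_simps)
    qed
    show "\<exists>Y. \<forall>y\<ge>Y. (u (x, y))\<^sup>2 * F_up (x, y) = 0" for x
    proof -
      obtain B where B: "\<And>z. z \<in> K \<Longrightarrow> norm z \<le> B" using compact_imp_bounded[OF K(1)] by (auto simp: bounded_iff)
      have "u (x, y) = 0" if "y \<ge> \<bar>B\<bar> + 1" for y
      proof (rule K(3), rule notI)
        assume "(x, y) \<in> K"
        then have "norm (x, y) \<le> B" by (rule B)
        moreover have "\<bar>y\<bar> \<le> norm (x, y)" using norm_snd_le[of y x] by simp
        ultimately show False using that by simp
      qed
      then show ?thesis by (intro exI[of _ "\<bar>B\<bar> + 1"]) simp
    qed
    have "continuous_on UNIV (\<lambda>x. u (x, T x))"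
      unfolding T_def
      by (intro continuous_on_compose2[OF cu] continuous_intros is_norm_continuous H0_norm) auto
    then have m1: "(\<lambda>x. u (x, T x)) \<in> borel_measurable borel" by (rule borel_measurable_continuous_onI)
    have m2: "H0 \<in> borel_measurable borel"
      by (rule borel_measurable_continuous_onI) (rule is_norm_continuous[OF H0_norm])
    show "(\<lambda>x. (u (x, T x))\<^sup>2 * F_up (x, T x)) \<in> borel_measurable borel"
      unfolding T_def F_up_boundary using m1[unfolded T_def] m2 by measurable
  qed
  also have "(\<integral>x. (u (x, T x))\<^sup>2 * F_up (x, T x) \<partial>lborel) = (\<integral>x. - K_const \<theta> DIM('a) b * ((u (x, T x))\<^sup>2 / H0 x) \<partial>lborel)"
    unfolding T_def F_up_boundary by (simp add: mult.commute)
  also have "\<dots> = - K_const \<theta> DIM('a) b * boundary_term H \<theta> u"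
    unfolding boundary_term_def T_def by (rule integral_mult_right_zero)
  also have "(LINT z:{(x, y). T x < y}|lborel. q' z) = (LINT z:A|lborel. q' z)"
    unfolding set_lebesgue_integral_def ind ..
  also have "\<dots> = (LINT z:A|lborel. 2 * u z * (F_up z * uy z)) + (LINT z:A|lborel. (u z)\<^sup>2 * F_up1 z)"
    unfolding q'_def by (rule set_integral_add(2)[OF i1 i2])
  finally show "(LINT z:A|lborel. 2 * u z * (F_up z * uy z)) =
    K_const \<theta> DIM('a) b * boundary_term H \<theta> u - (LINT z:A|lborel. (u z)\<^sup>2 * F_up1 z)" by simp
qed

lemma hardy_term_integrable:
  assumes "BC u" "BC (\<lambda>z. w (rad z / D))"
  shows "set_integrable lborel A (\<lambda>z. w (rad z / D) / (rad z)\<^sup>2 * (u z)\<^sup>2)"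
proof -
  have "set_integrable lborel A (\<lambda>z. (w (rad z / D) * (u z)\<^sup>2) / (rad z)\<^sup>2)"
    by (intro integrable_over_rad_sq BC_mult BC_power assms)
  then show ?thesis by simp
qed

lemma hardy_term_eq: "hardy_term H A w u = (LINT z:A|lborel. w (rad z / D) / (rad z)\<^sup>2 * (u z)\<^sup>2)"
  by (simp add: hardy_term_def D_def)

text \<open>The two integrations by parts replace the terms with derivatives by the divergence of the field and the flux
  through the boundary; the Riccati identity evaluates what remains.\<close>

lemma master_identity:
  assumes adm: "admissible u uz uy"
  shows "set_integrable lborel A (S m u uz uy)"
    and "(LINT z:A|lborel. S m u uz uy z) = K_const \<theta> DIM('a) b * boundary_term H \<theta> u
      + (b - 2)\<^sup>2 / 4 * hardy_term H A (\<lambda>_. 1) u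
      + 1/4 * (\<Sum>i=1..m. hardy_term H A (\<lambda>\<rho>. (Plog i \<rho>)\<^sup>2) u)"
proof -
  let ?n = "real DIM('a)"
  note R = radial_identity[OF adm, of m] and V = vertical_identity[OF adm]
  note bc = admissible_BC[OF adm]
  have r: "rad z \<noteq> 0" if "z \<in> A" for z using cone_rad_pos[OF A_cone[OF that]] by simp
  define W where "W = (\<lambda>z. (F_rad m z)\<^sup>2 * (rad z)\<^sup>2 + 2 * F_rad m z * F_up z * snd z + (F_up z)\<^sup>2)"
  have Wi: "set_integrable lborel A (\<lambda>z. (u z)\<^sup>2 * W z)"
  proof (rule integrable_of_BC, rule BC_cong)
    show "BC (\<lambda>z. (u z)\<^sup>2 * ((F_rad m z * (rad z)\<^sup>2)\<^sup>2 + 2 * (F_rad m z * (rad z)\<^sup>2) * (F_up z * rad z) * sn z + (F_up z * rad z)\<^sup>2))"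
      by (intro BC_mult BC_power BC_add BC_const bc BC_P BC_Q BC_sn)
    fix z assume "z \<in> A"
    then have "snd z = sn z * rad z" using r by (simp add: sn_def)
    then show "(u z)\<^sup>2 * W z * (rad z)\<^sup>2 = (u z)\<^sup>2 * ((F_rad m z * (rad z)\<^sup>2)\<^sup>2 + 2 * (F_rad m z * (rad z)\<^sup>2) * (F_up z * rad z) * sn z + (F_up z * rad z)\<^sup>2)"
      unfolding W_def by (simp add: power2_eq_square algebra_simps)
  qed
  have S_eq: "S m u uz uy = (\<lambda>z. (2 * u z * (F_rad m z * uz z) + 2 * u z * (F_up z * uy z)) - (u z)\<^sup>2 * W z)"
    by (auto simp: S_def W_def algebra_simps)
  have RV: "set_integrable lborel A (\<lambda>z. 2 * u z * (F_rad m z * uz z) + 2 * u z * (F_up z * uy z))"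
    by (rule set_integral_add(1)[OF R(2) V(2)])
  show "set_integrable lborel A (S m u uz uy)" unfolding S_eq by (rule set_integral_diff(1)[OF RV Wi])
  have "(LINT z:A|lborel. S m u uz uy z) =
      (LINT z:A|lborel. 2 * u z * (F_rad m z * uz z)) + (LINT z:A|lborel. 2 * u z * (F_up z * uy z)) - (LINT z:A|lborel. (u z)\<^sup>2 * W z)"
    unfolding S_eq set_integral_diff(2)[OF RV Wi] set_integral_add(2)[OF R(2) V(2)] ..
  also have "\<dots> = K_const \<theta> DIM('a) b * boundary_term H \<theta> u
     - ((LINT z:A|lborel. (u z)\<^sup>2 * ((?n - 1) * F_rad m z + G1 m (rad z) / (rad z)\<^sup>2)) + (LINT z:A|lborel. (u z)\<^sup>2 * F_up1 z)
        + (LINT z:A|lborel. (u z)\<^sup>2 * W z))"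
    unfolding R(1) V(1) by simp
  also have "(LINT z:A|lborel. (u z)\<^sup>2 * ((?n - 1) * F_rad m z + G1 m (rad z) / (rad z)\<^sup>2)) + (LINT z:A|lborel. (u z)\<^sup>2 * F_up1 z)
        + (LINT z:A|lborel. (u z)\<^sup>2 * W z) =
     (LINT z:A|lborel. (u z)\<^sup>2 * ((?n - 1) * F_rad m z + G1 m (rad z) / (rad z)\<^sup>2) + (u z)\<^sup>2 * F_up1 z + (u z)\<^sup>2 * W z)"
    unfolding set_integral_add(2)[OF set_integral_add(1)[OF R(3) V(3)] Wi] set_integral_add(2)[OF R(3) V(3)] ..
  also have "\<dots> = (LINT z:A|lborel. - ((b - 2)\<^sup>2 / 4 * (1 / (rad z)\<^sup>2 * (u z)\<^sup>2)
      + 1/4 * (\<Sum>i=1..m. (Plog i (rad z / D))\<^sup>2 / (rad z)\<^sup>2 * (u z)\<^sup>2)))"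
  proof (rule set_lebesgue_integral_cong)
    show "\<forall>z. z \<in> A \<longrightarrow> (u z)\<^sup>2 * ((?n - 1) * F_rad m z + G1 m (rad z) / (rad z)\<^sup>2) + (u z)\<^sup>2 * F_up1 z + (u z)\<^sup>2 * W z =
       - ((b - 2)\<^sup>2 / 4 * (1 / (rad z)\<^sup>2 * (u z)\<^sup>2) + 1/4 * (\<Sum>i=1..m. (Plog i (rad z / D))\<^sup>2 / (rad z)\<^sup>2 * (u z)\<^sup>2))"
    proof (intro allI impI)
      fix z assume z: "z \<in> A"
      have "(u z)\<^sup>2 * ((?n - 1) * F_rad m z + G1 m (rad z) / (rad z)\<^sup>2) + (u z)\<^sup>2 * F_up1 z + (u z)\<^sup>2 * W z
        = (u z)\<^sup>2 * ((?n - 1) * F_rad m z + G1 m (rad z) / (rad z)\<^sup>2 + F_up1 z + W z)" by (simp add: algebra_simps)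
      also have "\<dots> = (u z)\<^sup>2 * (- ((b - 2)\<^sup>2 / 4 + 1/4 * (\<Sum>i=1..m. (Plog i (rad z / D))\<^sup>2)) / (rad z)\<^sup>2)"
        unfolding W_def Riccati[OF z] ..
      also have "(\<Sum>i=1..m. (Plog i (rad z / D))\<^sup>2 / (rad z)\<^sup>2 * (u z)\<^sup>2) = (\<Sum>i=1..m. (Plog i (rad z / D))\<^sup>2) * ((u z)\<^sup>2 / (rad z)\<^sup>2)"
        unfolding sum_distrib_right by (rule sum.cong) simp_all
      then have "(u z)\<^sup>2 * (- ((b - 2)\<^sup>2 / 4 + 1/4 * (\<Sum>i=1..m. (Plog i (rad z / D))\<^sup>2)) / (rad z)\<^sup>2) =
         - ((b - 2)\<^sup>2 / 4 * (1 / (rad z)\<^sup>2 * (u z)\<^sup>2) + 1/4 * (\<Sum>i=1..m. (Plog i (rad z / D))\<^sup>2 / (rad z)\<^sup>2 * (u z)\<^sup>2))"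
        using r[OF z] by (simp add: field_simps)
      finally show "(u z)\<^sup>2 * ((?n - 1) * F_rad m z + G1 m (rad z) / (rad z)\<^sup>2) + (u z)\<^sup>2 * F_up1 z + (u z)\<^sup>2 * W z =
       - ((b - 2)\<^sup>2 / 4 * (1 / (rad z)\<^sup>2 * (u z)\<^sup>2) + 1/4 * (\<Sum>i=1..m. (Plog i (rad z / D))\<^sup>2 / (rad z)\<^sup>2 * (u z)\<^sup>2))" .
    qed
  qed (use open_A in simp)
  also have "\<dots> = - ((b - 2)\<^sup>2 / 4 * hardy_term H A (\<lambda>_. 1) u + 1/4 * (\<Sum>i=1..m. hardy_term H A (\<lambda>\<rho>. (Plog i \<rho>)\<^sup>2) u))"
  proof -
    have h1: "set_integrable lborel A (\<lambda>z. 1 / (rad z)\<^sup>2 * (u z)\<^sup>2)"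
      using hardy_term_integrable[OF bc(1) BC_const[of 1]] .
    have hi: "set_integrable lborel A (\<lambda>z. (Plog i (rad z / D))\<^sup>2 / (rad z)\<^sup>2 * (u z)\<^sup>2)" for i
      using hardy_term_integrable[OF bc(1), of "\<lambda>\<rho>. (Plog i \<rho>)\<^sup>2"] BC_power[OF BC_Plog] by blast
    have hs: "set_integrable lborel A (\<lambda>z. \<Sum>i=1..m. (Plog i (rad z / D))\<^sup>2 / (rad z)\<^sup>2 * (u z)\<^sup>2)"
      using hi by (simp add: set_integrable_def sum_distrib_left)
    have "(LINT z:A|lborel. (\<Sum>i=1..m. (Plog i (rad z / D))\<^sup>2 / (rad z)\<^sup>2 * (u z)\<^sup>2)) = (\<Sum>i=1..m. hardy_term H A (\<lambda>\<rho>. (Plog i \<rho>)\<^sup>2) u)"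
      unfolding hardy_term_eq set_lebesgue_integral_def scaleR_sum_right
      using hi by (intro Bochner_Integration.integral_sum) (simp add: set_integrable_def)
    moreover have "(LINT z:A|lborel. 1 / (rad z)\<^sup>2 * (u z)\<^sup>2) = hardy_term H A (\<lambda>_. 1) u"
      by (simp add: hardy_term_eq)
    moreover have "(LINT z:A|lborel. - ((b - 2)\<^sup>2 / 4 * (1 / (rad z)\<^sup>2 * (u z)\<^sup>2)
      + 1/4 * (\<Sum>i=1..m. (Plog i (rad z / D))\<^sup>2 / (rad z)\<^sup>2 * (u z)\<^sup>2))) =
      - ((b - 2)\<^sup>2 / 4 * (LINT z:A|lborel. 1 / (rad z)\<^sup>2 * (u z)\<^sup>2)
      + 1/4 * (LINT z:A|lborel. (\<Sum>i=1..m. (Plog i (rad z / D))\<^sup>2 / (rad z)\<^sup>2 * (u z)\<^sup>2)))"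
    proof -
      have a: "set_integrable lborel A (\<lambda>z. (b - 2)\<^sup>2 / 4 * (1 / (rad z)\<^sup>2 * (u z)\<^sup>2))"
        by (rule set_integrable_mult_right) (rule h1)
      have c: "set_integrable lborel A (\<lambda>z. 1/4 * (\<Sum>i=1..m. (Plog i (rad z / D))\<^sup>2 / (rad z)\<^sup>2 * (u z)\<^sup>2))"
        by (rule set_integrable_mult_right) (rule hs)
      show ?thesis
        unfolding set_integral_uminus[OF set_integral_add(1)[OF a c]] set_integral_add(2)[OF a c] set_integral_mult_right ..
    qed
    ultimately show ?thesis by simp
  qed
  finally show "(LINT z:A|lborel. S m u uz uy z) = K_const \<theta> DIM('a) b * boundary_term H \<theta> u
      + (b - 2)\<^sup>2 / 4 * hardy_term H A (\<lambda>_. 1) u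
      + 1/4 * (\<Sum>i=1..m. hardy_term H A (\<lambda>\<rho>. (Plog i \<rho>)\<^sup>2) u)" by simp
qed

lemma test_function_grad:
  assumes u: "u \<in> test_functions U"
  shows "GDERIV u z :> grad u z" "continuous_on UNIV (grad u)" "continuous_on UNIV u"
    "z \<notin> closure {z. u z \<noteq> 0} \<Longrightarrow> u z = 0 \<and> grad u z = 0"
proof -
  have ck: "Ck_on k u UNIV" for k using u by (simp add: test_functions_def)
  have diff: "u differentiable (at z)" for z using ck[of "Suc 0"] unfolding Ck_on.simps by blast
  show g: "GDERIV u z :> grad u z" for z by (rule gderiv_grad[OF diff])
  show "continuous_on UNIV u" using ck[of 0] by simp
  have fd: "frechet_derivative u (at z) v = v \<bullet> grad u z" for z v
    using g[of z] unfolding gderiv_def by (metis frechet_derivative_at)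
  have "continuous_on UNIV (\<lambda>z. frechet_derivative u (at z) v)" for v using ck[of "Suc 0"] unfolding Ck_on.simps by blast
  then have "continuous_on UNIV (\<lambda>z. v \<bullet> grad u z)" for v unfolding fd .
  then have "continuous_on UNIV (\<lambda>z. \<Sum>v\<in>Basis. (v \<bullet> grad u z) *\<^sub>R v)"
    by (intro continuous_on_sum continuous_on_scaleR continuous_on_const)
  then show "continuous_on UNIV (grad u)" by (simp add: inner_commute[of _ "grad u _"] euclidean_representation)
  assume z: "z \<notin> closure {z. u z \<noteq> 0}"
  then have uz: "u z = 0" using closure_subset[of "{z. u z \<noteq> 0}"] by auto
  have "(u has_derivative (\<lambda>h. 0)) (at z)"
  proof (rule has_derivative_transform_within_open[of "\<lambda>_. 0"])
    show "open (- closure {z. u z \<noteq> 0})" by (rule open_Compl[OF closed_closure])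
    show "z \<in> - closure {z. u z \<noteq> 0}" using z by simp
    show "0 = u y" if "y \<in> - closure {z. u z \<noteq> 0}" for y
      using that closure_subset[of "{z. u z \<noteq> 0}"] by auto
  qed simp
  then have "GDERIV u z :> 0" by (simp add: gderiv_def)
  then show "u z = 0 \<and> grad u z = 0" using uz grad_eq by blast
qed

lemma test_function_admissible:
  assumes u: "u \<in> test_functions U"
  shows "admissible u (\<lambda>z. z \<bullet> grad u z) (\<lambda>z. (0, 1) \<bullet> grad u z)"
  unfolding admissible_def
proof (intro conjI)
  note g = test_function_grad[OF u]
  show "continuous_on UNIV u" by (rule g(3))
  show "continuous_on UNIV (\<lambda>z. z \<bullet> grad u z)" "continuous_on UNIV (\<lambda>z. (0, 1) \<bullet> grad u z)"
    by (intro continuous_intros g(2))+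
  show "\<exists>K. compact K \<and> K \<subseteq> U \<and> (\<forall>z. z \<notin> K \<longrightarrow> u z = 0 \<and> z \<bullet> grad u z = 0 \<and> (0, 1) \<bullet> grad u z = 0)"
  proof -
    have "compact (closure {z. u z \<noteq> 0})" "closure {z. u z \<noteq> 0} \<subseteq> U"
      using u by (simp_all add: test_functions_def)
    moreover have "u z = 0 \<and> z \<bullet> grad u z = 0 \<and> (0, 1) \<bullet> grad u z = 0" if "z \<notin> closure {z. u z \<noteq> 0}" for z
      using g(4)[OF that] by simp
    ultimately show ?thesis by blast
  qed
  show "\<forall>z. ((\<lambda>l. u (l *\<^sub>R z)) has_real_derivative z \<bullet> grad u z) (at 1)"
  proof
    fix z :: "'a \<times> real"
    have 1: "((\<lambda>l::real. l *\<^sub>R z) has_derivative (\<lambda>h. h *\<^sub>R z)) (at 1)" by (auto intro!: derivative_eq_intros)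
    have "(u has_derivative (\<lambda>h. h \<bullet> grad u (1 *\<^sub>R z))) (at (1 *\<^sub>R z))" using g(1) by (simp add: gderiv_def)
    note 2 = has_derivative_compose[OF 1 this]
    show "((\<lambda>l. u (l *\<^sub>R z)) has_real_derivative z \<bullet> grad u z) (at 1)"
      unfolding has_field_derivative_def
      by (rule has_derivative_eq_rhs[OF 2]) (simp add: fun_eq_iff mult.commute)
  qed
  show "\<forall>x y. ((\<lambda>y. u (x, y)) has_real_derivative (0, 1) \<bullet> grad u (x, y)) (at y)"
  proof (intro allI)
    fix x :: 'a and y :: real
    have 1: "((\<lambda>y::real. (x, y)) has_derivative (\<lambda>h. (0, h))) (at y)" by (auto intro!: derivative_eq_intros)
    have "(u has_derivative (\<lambda>h. h \<bullet> grad u (x, y))) (at (x, y))" using g(1) by (simp add: gderiv_def)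
    note 2 = has_derivative_compose[OF 1 this]
    show "((\<lambda>y. u (x, y)) has_real_derivative (0, 1) \<bullet> grad u (x, y)) (at y)"
      unfolding has_field_derivative_def
      by (rule has_derivative_eq_rhs[OF 2]) (simp add: fun_eq_iff inner_prod_def mult.commute)
  qed
qed

text \<open>Duality of \<open>\<Phi>\<^sub>0\<close> and \<open>\<Phi>\<close>, and \<open>2 s t \<le> s\<^sup>2 + t\<^sup>2\<close>.\<close>

lemma S_le_energy_density:
  "S m u (\<lambda>z. z \<bullet> grad u z) (\<lambda>z. (0, 1) \<bullet> grad u z) z \<le> (Phi H (grad u z))\<^sup>2"
proof -
  define F where "F = F_rad m z *\<^sub>R z + F_up z *\<^sub>R (0, 1)"
  have rF: "(rad F)\<^sup>2 = (F_rad m z)\<^sup>2 * (rad z)\<^sup>2 + 2 * F_rad m z * F_up z * snd z + (F_up z)\<^sup>2"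
  proof -
    have F: "fst F = F_rad m z *\<^sub>R fst z" "snd F = F_rad m z * snd z + F_up z" by (simp_all add: F_def)
    show ?thesis unfolding rad_sq F is_norm_scale[OF H0_norm]
      by (simp add: power_mult_distrib power2_sum algebra_simps)
  qed
  have "u z * (F \<bullet> grad u z) = (u z *\<^sub>R F) \<bullet> grad u z" by simp
  also have "\<dots> \<le> rad (u z *\<^sub>R F) * Phi H (grad u z)" by (rule inner_le_Phi[OF H])
  also have "\<dots> = \<bar>u z\<bar> * rad F * Phi H (grad u z)" by (simp add: is_norm_scale[OF rad_norm])
  finally have 1: "u z * (F \<bullet> grad u z) \<le> \<bar>u z\<bar> * rad F * Phi H (grad u z)" .
  have "2 * (\<bar>u z\<bar> * rad F) * Phi H (grad u z) \<le> (\<bar>u z\<bar> * rad F)\<^sup>2 + (Phi H (grad u z))\<^sup>2"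
    by (rule sum_squares_bound)
  then have "2 * u z * (F \<bullet> grad u z) - (u z)\<^sup>2 * (rad F)\<^sup>2 \<le> (Phi H (grad u z))\<^sup>2"
    using 1 by (simp add: power_mult_distrib mult_ac)
  moreover have "F \<bullet> grad u z = F_rad m z * (z \<bullet> grad u z) + F_up z * ((0, 1) \<bullet> grad u z)"
    unfolding F_def inner_add_left inner_scaleR_left ..
  ultimately show ?thesis unfolding S_def rF[symmetric] by simp
qed

lemma energy_integrable:
  assumes u: "u \<in> test_functions U" shows "set_integrable lborel A (\<lambda>z. (Phi H (grad u z))\<^sup>2)"
proof -
  note g = test_function_grad[OF u]
  have P: "is_norm (Phi H)" by (rule is_norm_Phi[OF H])
  have "BC (\<lambda>z. Phi H (grad u z))"
  proof (rule BC_compact_support)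
    show "continuous_on UNIV (\<lambda>z. Phi H (grad u z))"
      by (rule continuous_on_compose2[OF is_norm_continuous[OF P, of UNIV] g(2)]) auto
    show "compact (closure {z. u z \<noteq> 0})" using u by (simp add: test_functions_def)
    show "Phi H (grad u z) = 0" if "z \<notin> closure {z. u z \<noteq> 0}" for z
      using g(4)[OF that] is_norm_zero[OF P] by simp
  qed
  then show ?thesis by (intro integrable_of_BC BC_mult BC_power BC_rad)
qed

lemma hardy_inequality:
  assumes u: "u \<in> test_functions U"
  shows "K_const \<theta> DIM('a) b * boundary_term H \<theta> u + (b - 2)\<^sup>2 / 4 * hardy_term H A (\<lambda>_. 1) u
      + 1/4 * (\<Sum>i=1..m. hardy_term H A (\<lambda>\<rho>. (Plog i \<rho>)\<^sup>2) u) \<le> energy H A u"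
  unfolding master_identity(2)[OF test_function_admissible[OF u], symmetric] energy_def
  by (rule set_integral_mono[OF master_identity(1)[OF test_function_admissible[OF u]] energy_integrable[OF u]])
    (rule S_le_energy_density)

lemma hardy_term_nonneg: "(\<And>\<rho>. 0 \<le> w \<rho>) \<Longrightarrow> 0 \<le> hardy_term H A w u"
  unfolding hardy_term_eq set_lebesgue_integral_def
  by (intro Bochner_Integration.integral_nonneg) (simp add: indicator_def)

text \<open>The finite inequalities bound all partial sums of a series with nonnegative terms.\<close>

lemma hardy_series:
  assumes u: "u \<in> test_functions U"
  shows "summable (\<lambda>i. hardy_term H A (\<lambda>\<rho>. (Plog (Suc i) \<rho>)\<^sup>2) u)"
    and "K_const \<theta> DIM('a) b * boundary_term H \<theta> u + (b - 2)\<^sup>2 / 4 * hardy_term H A (\<lambda>_. 1) u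
      + 1/4 * (\<Sum>i. hardy_term H A (\<lambda>\<rho>. (Plog (Suc i) \<rho>)\<^sup>2) u) \<le> energy H A u"
proof -
  define h where "h = (\<lambda>i. hardy_term H A (\<lambda>\<rho>. (Plog (Suc i) \<rho>)\<^sup>2) u)"
  define M where "M = 4 * (energy H A u - K_const \<theta> DIM('a) b * boundary_term H \<theta> u - (b - 2)\<^sup>2 / 4 * hardy_term H A (\<lambda>_. 1) u)"
  have le: "(\<Sum>i<m. h i) \<le> M" for m
  proof -
    have "(\<Sum>i<m. h i) = (\<Sum>i=1..m. hardy_term H A (\<lambda>\<rho>. (Plog i \<rho>)\<^sup>2) u)"
      by (rule sum.reindex_bij_witness[of _ "\<lambda>i. i - 1" Suc]) (auto simp: h_def)
    then show ?thesis using hardy_inequality[OF u, of m] by (simp add: M_def)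
  qed
  have s: "summable h"
    by (rule summableI_nonneg_bounded[OF _ le]) (auto simp: h_def intro: hardy_term_nonneg)
  then show "summable (\<lambda>i. hardy_term H A (\<lambda>\<rho>. (Plog (Suc i) \<rho>)\<^sup>2) u)" by (simp add: h_def)
  have "suminf h \<le> M" by (rule suminf_le_const[OF s le])
  then show "K_const \<theta> DIM('a) b * boundary_term H \<theta> u + (b - 2)\<^sup>2 / 4 * hardy_term H A (\<lambda>_. 1) u
      + 1/4 * (\<Sum>i. hardy_term H A (\<lambda>\<rho>. (Plog (Suc i) \<rho>)\<^sup>2) u) \<le> energy H A u"
    by (simp add: M_def h_def)
qed

end

section \<open>Cutoffs, bumps and smooth approximation of a dual norm\<close>

lemma smooth_on_real_DERIV:
  fixes f :: "real \<Rightarrow> real"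
  assumes "smooth_on UNIV f"
  obtains f' where "\<And>x. (f has_real_derivative f' x) (at x)" "continuous_on UNIV f'"
proof
  have 1: "Ck_on (Suc 0) f UNIV" using assms unfolding smooth_on_def by blast
  show "(f has_real_derivative frechet_derivative f (at x) 1) (at x)" for x
  proof -
    have "f differentiable (at x)" using 1 by simp
    then have d: "(f has_derivative frechet_derivative f (at x)) (at x)" by (simp add: frechet_derivative_works)
    then have l: "linear (frechet_derivative f (at x))" by (rule has_derivative_linear)
    have "frechet_derivative f (at x) h = frechet_derivative f (at x) 1 * h" for h
      using linear_cmul[OF l, of h 1] by simp
    then have "frechet_derivative f (at x) = (*) (frechet_derivative f (at x) 1)" by (rule ext)
    with d show ?thesis by (simp add: has_field_derivative_def)
  qed
  show "continuous_on UNIV (\<lambda>x. frechet_derivative f (at x) 1)" using 1 by simp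
qed

lemma flat_exp_pos: "x > 0 \<Longrightarrow> flat_exp x > 0" and flat_exp_zero: "x \<le> 0 \<Longrightarrow> flat_exp x = 0"
  by (auto simp: flat_exp_def)

lemma flat_exp_nonneg: "flat_exp x \<ge> 0"
  by (auto simp: flat_exp_def)

lemma smooth_flat_exp_affine: "smooth_on UNIV (\<lambda>x. flat_exp (a + c * x))"
proof (rule smooth_on_compose[OF open_UNIV open_UNIV _ smooth_flat_exp])
  show "smooth_on UNIV (\<lambda>x::real. a + c * x)"
    by (intro smooth_on_add smooth_on_const smooth_on_bounded_linear bounded_linear_mult_right) auto
qed simp

lemma smooth_step:
  assumes e: "(e::real) > 0"
  obtains cut where "smooth_on UNIV cut" "\<And>y. y \<le> e \<Longrightarrow> cut y = 0" "\<And>y. y \<ge> 2 * e \<Longrightarrow> cut y = (1::real)"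
proof
  define N where "N = (\<lambda>y::real. flat_exp (- e + 1 * y))"
  define M where "M = (\<lambda>y::real. flat_exp (2 * e + (-1) * y))"
  have pos: "N y + M y > 0" for y
    using flat_exp_pos[of "y - e"] flat_exp_pos[of "2 * e - y"] flat_exp_nonneg[of "y - e"] flat_exp_nonneg[of "2 * e - y"] e
    by (cases "y > e") (auto simp: N_def M_def add_pos_nonneg add_nonneg_pos)
  have sm: "smooth_on UNIV N" "smooth_on UNIV M" unfolding N_def M_def by (rule smooth_flat_exp_affine)+
  show "smooth_on UNIV (\<lambda>y. N y * (1 / (N y + M y)))"
    by (intro smooth_on_mult smooth_on_inverse smooth_on_add sm pos) auto
  show "N y * (1 / (N y + M y)) = 0" if "y \<le> e" for y
    using that by (simp add: N_def flat_exp_zero)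
  show "N y * (1 / (N y + M y)) = 1" if "y \<ge> 2 * e" for y
    using that pos[of y] by (simp add: M_def flat_exp_zero)
qed

lemma HK_integral_zero: "(\<And>x. x \<in> S \<Longrightarrow> f x = 0) \<Longrightarrow> integral S f = (0::real)"
  using Henstock_Kurzweil_Integration.integral_cong[of S f "\<lambda>_. 0"] by simp

lemma antiderivative_compact_support:
  fixes f :: "real \<Rightarrow> real"
  assumes cont: "continuous_on UNIV f" and supp: "\<And>x. x \<notin> {0<..<1} \<Longrightarrow> f x = 0"
    and int: "integral {0..1} f = 0"
  obtains F where "\<And>x. (F has_real_derivative f x) (at x)" "\<And>x. x \<notin> {0<..<1} \<Longrightarrow> F x = 0"
proof
  define F where "F = (\<lambda>x. integral {-1..x} f)"
  have ii: "f integrable_on {a..b}" for a b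
    by (rule integrable_continuous_real) (rule continuous_on_subset[OF cont], simp)
  have neg: "F x = 0" if "x \<le> 0" for x
    unfolding F_def by (rule HK_integral_zero) (use supp that in auto)
  have pos: "F x = 0" if "x \<ge> 1" for x
  proof -
    have "F x = integral {-1..0} f + integral {0..x} f"
      unfolding F_def using that by (intro Henstock_Kurzweil_Integration.integral_combine[symmetric] ii) auto
    also have "integral {0..x} f = integral {0..1} f + integral {1..x} f"
      using that by (intro Henstock_Kurzweil_Integration.integral_combine[symmetric] ii) auto
    also have "integral {1..x} f = 0" by (rule HK_integral_zero) (use supp in auto)
    also have "integral {-1..0} f = 0" by (rule HK_integral_zero) (use supp in auto)
    finally show ?thesis using int by simp
  qed
  show "F x = 0" if "x \<notin> {0<..<1}" for x using neg[of x] pos[of x] that by auto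
  show "(F has_real_derivative f x) (at x)" for x
  proof (cases "x < 0")
    case True
    have "(F has_real_derivative 0) (at x)"
      by (rule has_field_derivative_transform_within_open[of "\<lambda>_. 0" 0 x "{..<0}"]) (use True neg in auto)
    then show ?thesis using supp[of x] True by simp
  next
    case False
    have "(F has_real_derivative f x) (at x within {-1..x + 1})"
      unfolding F_def using False
      by (intro integral_has_real_derivative continuous_on_subset[OF cont]) auto
    then have "(F has_real_derivative f x) (at x within {-1<..<x + 1})"
      by (rule has_field_derivative_subset) auto
    then show ?thesis using False by (simp add: at_within_open[of x "{-1<..<x+1}"])
  qed
qed

text \<open>\<open>lam\<close> is the Rayleigh quotient of \<open>B\<close> on the unit interval. Its choice makes the integral of
  \<open>B'\<^sup>2 - lam B\<^sup>2\<close> zero, so the antiderivative \<open>F\<close> vanishes on both sides of the interval.\<close>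

lemma bump_exists:
  obtains B B' F :: "real \<Rightarrow> real" and lam :: real
  where "smooth_on UNIV B" "\<And>x. (B has_real_derivative B' x) (at x)" "continuous_on UNIV B'"
    "\<And>x. x \<in> {0<..<1} \<Longrightarrow> B x > 0" "\<And>x. x \<notin> {0<..<1} \<Longrightarrow> B x = 0" "\<And>x. x \<notin> {0<..<1} \<Longrightarrow> B' x = 0"
    "\<And>x. (F has_real_derivative (B' x)\<^sup>2 - lam * (B x)\<^sup>2) (at x)" "\<And>x. x \<notin> {0<..<1} \<Longrightarrow> F x = 0"
proof -
  define B where "B = (\<lambda>x. flat_exp (0 + 1 * x) * flat_exp (1 + (-1) * x))"
  have sm: "smooth_on UNIV B" unfolding B_def by (intro smooth_on_mult smooth_flat_exp_affine) simp
  obtain B' where B': "\<And>x. (B has_real_derivative B' x) (at x)" "continuous_on UNIV B'"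
    using smooth_on_real_DERIV[OF sm] by blast
  have Bpos: "B x > 0" if "x \<in> {0<..<1}" for x using that by (simp add: B_def flat_exp_pos)
  have Bz: "B x = 0" if "x \<notin> {0<..<1}" for x
    using that by (cases "x \<le> 0") (auto simp: B_def flat_exp_zero)
  have Bcont: "continuous_on UNIV B" using B'(1) by (intro continuous_at_imp_continuous_on) (auto intro: DERIV_isCont)
  have B'z: "B' x = 0" if x: "x \<notin> {0<..<1}" for x
  proof -
    have "B x \<le> B y" for y using Bz[OF x] Bpos[of y] Bz[of y] by (cases "y \<in> {0<..<1}") auto
    then show ?thesis using DERIV_local_min[OF B'(1)[of x], of 1] by simp
  qed
  define lam where "lam = integral {0..1} (\<lambda>x. (B' x)\<^sup>2) / integral {0..1} (\<lambda>x. (B x)\<^sup>2)"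
  have ci: "continuous_on UNIV (\<lambda>x. (B' x)\<^sup>2)" "continuous_on UNIV (\<lambda>x. (B x)\<^sup>2)"
    using B'(2) Bcont by (auto intro: continuous_intros)
  have ii: "(\<lambda>x. (B' x)\<^sup>2) integrable_on {0..1}" "(\<lambda>x. (B x)\<^sup>2) integrable_on {0..1}"
    by (intro integrable_continuous_real continuous_on_subset[OF ci(1)] continuous_on_subset[OF ci(2)]; simp)+
  have nz: "integral {0..1} (\<lambda>x. (B x)\<^sup>2) \<noteq> 0"
  proof
    assume 0: "integral {0..1} (\<lambda>x. (B x)\<^sup>2) = 0"
    have "((\<lambda>x. (B x)\<^sup>2) has_integral 0) (cbox 0 1)"
      using integrable_integral[OF ii(2)] 0 by simp
    from has_integral_0_cbox_imp_0[OF _ _ this, of "1/2"]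
    have "(B (1/2))\<^sup>2 = 0" using continuous_on_subset[OF ci(2)] by (simp add: box_real)
    then show False using Bpos[of "1/2"] by simp
  qed
  have i0: "integral {0..1} (\<lambda>x. (B' x)\<^sup>2 - lam * (B x)\<^sup>2) = 0"
  proof -
    have "integral {0..1} (\<lambda>x. (B' x)\<^sup>2 - lam * (B x)\<^sup>2) = integral {0..1} (\<lambda>x. (B' x)\<^sup>2) - lam * integral {0..1} (\<lambda>x. (B x)\<^sup>2)"
      using Henstock_Kurzweil_Integration.integral_diff[OF ii(1)
          has_integral_integrable[OF has_integral_mult_right[OF integrable_integral[OF ii(2)]]]]
      by simp
    then show ?thesis using nz by (simp add: lam_def)
  qed
  have cf: "continuous_on UNIV (\<lambda>x. (B' x)\<^sup>2 - lam * (B x)\<^sup>2)"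
    by (intro continuous_on_diff continuous_on_mult continuous_on_const ci)
  have z: "(B' x)\<^sup>2 - lam * (B x)\<^sup>2 = 0" if "x \<notin> {0<..<1}" for x using Bz[OF that] B'z[OF that] by simp
  obtain F where "\<And>x. (F has_real_derivative (B' x)\<^sup>2 - lam * (B x)\<^sup>2) (at x)" "\<And>x. x \<notin> {0<..<1} \<Longrightarrow> F x = 0"
    using antiderivative_compact_support[OF cf z i0] by blast
  then show thesis using that sm B' Bpos Bz B'z by blast
qed

text \<open>The dual norm is the maximum of \<open>x \<bullet> \<xi>\<close> over the unit ball of \<open>H\<close>. Replacing the ball by a fine finite net \<open>S\<close> and
  the maximum by a logarithm of a sum of exponentials gives a smooth function. Its gradient is a convex
  combination of points of \<open>S\<close>, so its \<open>H\<close>-norm is at most 1: this is what keeps the energy under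
  control.\<close>

lemma smooth_norm_approximation:
  fixes H :: "'a::euclidean_space \<Rightarrow> real"
  assumes H: "is_norm H" and \<eta>: "0 < \<eta>"
  obtains M where "smooth_on UNIV M" "\<And>x. (1 - \<eta>) * dual_norm H x - \<eta> \<le> M x" "\<And>x. M x \<le> dual_norm H x"
    "\<And>x. \<exists>d. GDERIV M x :> d \<and> H d \<le> 1"
proof -
  let ?N = "dual_norm H"
  have N: "is_norm ?N" by (rule is_norm_dual_norm[OF H])
  obtain c0 where c0: "c0 > 0" "\<And>x. c0 * norm x \<le> ?N x" using is_norm_ge_norm[OF N] by blast
  obtain c1 where c1: "c1 > 0" "\<And>x. c1 * norm x \<le> H x" using is_norm_ge_norm[OF H] by blast
  define Bd where "Bd = {\<xi>. H \<xi> \<le> 1}"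
  have "closed Bd" unfolding Bd_def using is_norm_continuous[OF H, of UNIV]
    by (intro closed_Collect_le continuous_on_const)
  moreover have "bounded Bd"
  proof -
    have "norm \<xi> \<le> 1 / c1" if "\<xi> \<in> Bd" for \<xi>
      using that c1(1) order_trans[OF c1(2)[of \<xi>], of 1] by (simp add: Bd_def field_simps)
    then show ?thesis unfolding bounded_iff by blast
  qed
  ultimately have "compact Bd" by (simp add: compact_eq_bounded_closed)
  then obtain S where S: "S \<subseteq> Bd" "finite S" "Bd \<subseteq> (\<Union>\<xi>\<in>S. ball \<xi> (\<eta> * c0))"
  proof (rule compactE_image)
    show "Bd \<subseteq> (\<Union>\<xi>\<in>Bd. ball \<xi> (\<eta> * c0))" using \<eta> c0(1) by auto
  qed auto
  have "0 \<in> Bd" by (simp add: Bd_def is_norm_zero[OF H])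
  then have Sne: "S \<noteq> {}" using S(3) by auto
  have card: "card S \<ge> 1" using Sne S(2) by (simp add: Suc_le_eq card_gt_0_iff)
  define q where "q = ln (real (card S))"
  have q: "q \<ge> 0" using card by (simp add: q_def)
  \<comment> \<open>The smoothed maximum of \<open>N\<close> terms exceeds the maximum by at most \<open>ln N / \<Lambda>\<close>; \<open>M\<close> is shifted down by it.\<close>
  define \<Lambda> where "\<Lambda> = (q + 1) / \<eta>"
  have \<Lambda>: "\<Lambda> > 0" "q / \<Lambda> \<le> \<eta>" using q \<eta> by (auto simp: \<Lambda>_def field_simps)
  define Z where "Z = (\<lambda>x. \<Sum>\<xi>\<in>S. exp (\<Lambda> * (x \<bullet> \<xi>)))"
  have Z: "Z x > 0" for x unfolding Z_def using S(2) Sne by (intro sum_pos) auto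
  define M where "M = (\<lambda>x. (1 / \<Lambda>) * (ln (Z x) - q))"
  show thesis
  proof
    show "smooth_on UNIV M"
    proof -
      have 1: "smooth_on UNIV (\<lambda>x. exp (\<Lambda> * (x \<bullet> \<xi>)))" for \<xi> :: 'a
      proof (rule smooth_on_compose[OF open_UNIV open_UNIV _ smooth_on_exp])
        show "smooth_on UNIV (\<lambda>x. \<Lambda> * (x \<bullet> \<xi>))"
          by (intro smooth_on_bounded_linear bounded_linear_const_mult bounded_linear_inner_left)
      qed simp
      have 2: "smooth_on UNIV Z" unfolding Z_def by (intro smooth_on_sum open_UNIV S(2) 1)
      have "smooth_on UNIV (\<lambda>x. ln (Z x))"
        by (rule smooth_on_compose[OF open_UNIV open_greaterThan _ smooth_on_ln 2]) (use Z in auto)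
      then show ?thesis unfolding M_def by (intro smooth_on_mult smooth_on_diff smooth_on_const open_UNIV)
    qed
    show "M x \<le> ?N x" for x
    proof -
      have "Z x \<le> (\<Sum>\<xi>\<in>S. exp (\<Lambda> * ?N x))"
        unfolding Z_def
      proof (rule sum_mono)
        fix \<xi> assume "\<xi> \<in> S"
        then have "H \<xi> \<le> 1" using S(1) by (auto simp: Bd_def)
        then have "x \<bullet> \<xi> \<le> ?N x"
          using inner_le_dual_norm[OF H, of x \<xi>] mult_left_mono[of "H \<xi>" 1 "?N x"] is_norm_nonneg[OF N, of x] by simp
        then show "exp (\<Lambda> * (x \<bullet> \<xi>)) \<le> exp (\<Lambda> * ?N x)" using \<Lambda>(1) by simp
      qed
      then have "Z x \<le> real (card S) * exp (\<Lambda> * ?N x)" by simp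
      then have "ln (Z x) \<le> ln (real (card S) * exp (\<Lambda> * ?N x))" using Z[of x] by (intro ln_mono) auto
      also have "\<dots> = q + \<Lambda> * ?N x" using card by (simp add: q_def ln_mult)
      finally show ?thesis using \<Lambda>(1) by (simp add: M_def field_simps)
    qed
    show "(1 - \<eta>) * ?N x - \<eta> \<le> M x" for x
    proof -
      define m where "m = Max ((\<lambda>\<xi>. x \<bullet> \<xi>) ` S)"
      have m: "x \<bullet> \<xi> \<le> m" if "\<xi> \<in> S" for \<xi> unfolding m_def using S(2) that by (intro Max_ge) auto
      have "m \<in> (\<lambda>\<xi>. x \<bullet> \<xi>) ` S" unfolding m_def by (rule Max_in) (use S(2) Sne in auto)
      then obtain \<xi>0 where \<xi>0: "\<xi>0 \<in> S" "x \<bullet> \<xi>0 = m" by auto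
      have "?N x \<le> m + \<eta> * ?N x"
      proof (rule dual_norm_le[OF H])
        fix \<xi> assume "H \<xi> \<le> 1"
        then obtain \<zeta> where \<zeta>: "\<zeta> \<in> S" "dist \<zeta> \<xi> < \<eta> * c0" using S(3) by (auto simp: Bd_def)
        have "x \<bullet> \<xi> = x \<bullet> \<zeta> + x \<bullet> (\<xi> - \<zeta>)" by (simp add: inner_diff_right)
        also have "x \<bullet> (\<xi> - \<zeta>) \<le> norm x * norm (\<xi> - \<zeta>)" by (rule norm_cauchy_schwarz)
        also have "\<dots> \<le> norm x * (\<eta> * c0)"
          using \<zeta>(2) by (intro mult_left_mono) (auto simp: dist_norm norm_minus_commute)
        also have "\<dots> = \<eta> * (c0 * norm x)" by simp
        also have "\<dots> \<le> \<eta> * ?N x" using c0(2) \<eta> by (intro mult_left_mono) auto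
        finally show "x \<bullet> \<xi> \<le> m + \<eta> * ?N x" using m[OF \<zeta>(1)] by simp
      qed
      moreover have "\<Lambda> * m \<le> ln (Z x)"
      proof -
        have "exp (\<Lambda> * (x \<bullet> \<xi>0)) \<le> Z x"
          unfolding Z_def using S(2) \<xi>0(1) by (intro member_le_sum) auto
        then show ?thesis using \<xi>0(2) ln_mono[of "exp (\<Lambda> * m)" "Z x"] by simp
      qed
      then have "m - q / \<Lambda> \<le> M x" using \<Lambda>(1) by (simp add: M_def field_simps)
      ultimately show ?thesis using \<Lambda>(2) by (simp add: algebra_simps)
    qed
    show "\<exists>d. GDERIV M x :> d \<and> H d \<le> 1" for x
    proof -
      define w where "w = (\<lambda>\<xi>. exp (\<Lambda> * (x \<bullet> \<xi>)) / Z x)"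
      have w1: "w \<xi> \<ge> 0" for \<xi> using Z[of x] by (simp add: w_def)
      have "(\<Sum>\<xi>\<in>S. w \<xi>) = Z x / Z x" unfolding w_def by (simp only: Z_def sum_divide_distrib)
      then have w2: "(\<Sum>\<xi>\<in>S. w \<xi>) = 1" using Z[of x] by simp
      define d where "d = (\<Sum>\<xi>\<in>S. w \<xi> *\<^sub>R \<xi>)"
      have "(Z has_derivative (\<lambda>h. \<Sum>\<xi>\<in>S. exp (\<Lambda> * (x \<bullet> \<xi>)) * (\<Lambda> * (h \<bullet> \<xi>)))) (at x)"
        unfolding Z_def by (auto intro!: derivative_eq_intros simp: mult_ac)
      from has_derivative_ln[OF Z this]
      have "((\<lambda>x. ln (Z x)) has_derivative (\<lambda>h. (\<Sum>\<xi>\<in>S. exp (\<Lambda> * (x \<bullet> \<xi>)) * (\<Lambda> * (h \<bullet> \<xi>))) * inverse (Z x))) (at x)"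
        by (simp add: mult.commute divide_inverse)
      then have "(M has_derivative (\<lambda>h. (1 / \<Lambda>) * ((\<Sum>\<xi>\<in>S. exp (\<Lambda> * (x \<bullet> \<xi>)) * (\<Lambda> * (h \<bullet> \<xi>))) * inverse (Z x) - 0))) (at x)"
        unfolding M_def by (intro has_derivative_mult_right has_derivative_diff has_derivative_const)
      moreover have "(1 / \<Lambda>) * ((\<Sum>\<xi>\<in>S. exp (\<Lambda> * (x \<bullet> \<xi>)) * (\<Lambda> * (h \<bullet> \<xi>))) * inverse (Z x) - 0) = h \<bullet> d" for h
        unfolding d_def inner_sum_right sum_distrib_left sum_distrib_right diff_0_right
        using \<Lambda>(1) by (intro sum.cong) (simp_all add: w_def divide_inverse)
      ultimately have "GDERIV M x :> d" by (simp add: gderiv_def)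
      moreover have "H d \<le> 1"
      proof -
        have "H d \<le> (\<Sum>\<xi>\<in>S. H (w \<xi> *\<^sub>R \<xi>))" unfolding d_def by (rule is_norm_sum[OF H S(2)])
        also have "\<dots> \<le> (\<Sum>\<xi>\<in>S. w \<xi> * 1)"
        proof (rule sum_mono)
          fix \<xi> assume "\<xi> \<in> S"
          then have "H \<xi> \<le> 1" using S(1) by (auto simp: Bd_def)
          then show "H (w \<xi> *\<^sub>R \<xi>) \<le> w \<xi> * 1" using w1[of \<xi>] by (simp add: is_norm_scale[OF H] mult_left_le)
        qed
        finally show ?thesis using w2 by simp
      qed
      ultimately show ?thesis by blast
    qed
  qed
qed

section \<open>A near-optimal profile\<close>

lemma smooth_on_zero:
  assumes "open S" "\<And>x. x \<in> S \<Longrightarrow> f x = (0::real)" shows "smooth_on S f"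
  using smooth_on_cong[of S f "\<lambda>_. 0"] assms smooth_on_const by blast

lemma smooth_on_DERIV_pair:
  fixes g :: "real \<times> real \<Rightarrow> real"
  assumes "smooth_on UNIV g"
  shows "continuous_on UNIV (\<lambda>z. frechet_derivative g (at z) (1, 0))"
    and "continuous_on UNIV (\<lambda>z. frechet_derivative g (at z) (0, 1))"
    and "(g has_derivative (\<lambda>h. fst h * frechet_derivative g (at z) (1, 0) + snd h * frechet_derivative g (at z) (0, 1))) (at z)"
proof -
  have 1: "Ck_on (Suc 0) g UNIV" using assms unfolding smooth_on_def by blast
  show "continuous_on UNIV (\<lambda>z. frechet_derivative g (at z) (1, 0))"
    "continuous_on UNIV (\<lambda>z. frechet_derivative g (at z) (0, 1))" using 1 by simp_all
  show "(g has_derivative (\<lambda>h. fst h * frechet_derivative g (at z) (1, 0) + snd h * frechet_derivative g (at z) (0, 1))) (at z)"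
  proof -
    have "g differentiable (at z)" using 1 unfolding Ck_on.simps by blast
    then have d: "(g has_derivative frechet_derivative g (at z)) (at z)" by (simp add: frechet_derivative_works)
    then have l: "linear (frechet_derivative g (at z))" by (rule has_derivative_linear)
    have "frechet_derivative g (at z) h = fst h * frechet_derivative g (at z) (1, 0) + snd h * frechet_derivative g (at z) (0, 1)" for h
    proof -
      have "h = fst h *\<^sub>R (1, 0) + snd h *\<^sub>R (0, 1)" by (simp add: prod_eq_iff)
      then have "frechet_derivative g (at z) h = frechet_derivative g (at z) (fst h *\<^sub>R (1, 0) + snd h *\<^sub>R (0, 1))" by simp
      then show ?thesis by (simp only: linear_add[OF l] linear_cmul[OF l] real_scaleR_def)
    qed
    then have "frechet_derivative g (at z) = (\<lambda>h. fst h * frechet_derivative g (at z) (1, 0) + snd h * frechet_derivative g (at z) (0, 1))"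
      by (rule ext)
    with d show ?thesis by simp
  qed
qed

text \<open>Parameters of the extremal construction: in the variable \<open>v\<close> below, an affine function of \<open>1 / X\<^sub>k\<^sub>+\<^sub>1\<close>,
  the support of the bump becomes \<open>r1 < rad z < r2\<close>, and the excess over the constant \<open>1/4\<close> becomes \<open>lam / T\<^sup>2\<close>. The
  function \<open>cut\<close> removes the part \<open>y \<le> e\<close>: inside the cone the profile vanishes there anyway, and outside the cone \<open>\<Psi>\<close>
  becomes singular at the latitude \<open>s = -1\<close>.\<close>

locale near_optimizer = hardy_setting H b \<theta> U
  for H :: "'a::euclidean_space \<Rightarrow> real" and b \<theta> :: real and U :: "('a \<times> real) set" +
  fixes k :: nat and r1 r2 T l0 lam e :: real and B B' F cut :: "real \<Rightarrow> real"
  assumes r1: "0 < r1" and r12: "r1 < r2" and r2D: "r2 < D"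
    and ball_U: "\<And>z. rad z \<le> 3 * r2 \<Longrightarrow> z \<in> U"
    and T0: "T > 0" and v_r1: "1 / Xlog (Suc k) (r1 / D) \<ge> l0 + T" and v_r2: "1 / Xlog (Suc k) (r2 / D) = l0"
    and B_smooth: "smooth_on UNIV B" and B_DERIV: "\<And>x. (B has_real_derivative B' x) (at x)"
    and B'_cont: "continuous_on UNIV B'"
    and B_pos: "\<And>x. x \<in> {0<..<1} \<Longrightarrow> B x > 0" and B_zero: "\<And>x. x \<notin> {0<..<1} \<Longrightarrow> B x = 0"
    and B'_zero: "\<And>x. x \<notin> {0<..<1} \<Longrightarrow> B' x = 0"
    and F_DERIV: "\<And>x. (F has_real_derivative (B' x)\<^sup>2 - lam * (B x)\<^sup>2) (at x)"
    and F_zero: "\<And>x. x \<notin> {0<..<1} \<Longrightarrow> F x = 0"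
    and e0: "e > 0" and e_le: "2 * e \<le> sin \<theta> * r1"
    and cut_smooth: "smooth_on UNIV cut" and cut0: "\<And>y. y \<le> e \<Longrightarrow> cut y = 0" and cut1: "\<And>y. y \<ge> 2 * e \<Longrightarrow> cut y = 1"
begin

definition "al = (real DIM('a) - 1) / 2"
definition "v r = (1 / Xlog (Suc k) (r / D) - l0) / T"
text \<open>The radial part of the approximate ground state with \<open>k\<close> logarithms; multiplying it by a slowly varying function
  of \<open>v\<close> costs little energy.\<close>

definition "ph r = r powr (- al) * Plog k (r / D) powr (- (1/2))"
definition "h r = (if 0 < r \<and> r < D then ph r * B (v r) else 0)"
definition "h1 r = (if 0 < r \<and> r < D
   then ph r * ((G k r - al) * B (v r) - Plog k (r / D) / T * B' (v r)) / r else 0)"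
text \<open>The common factor of the excess energy density and of the \<open>k\<close>-th Hardy density. In the variable \<open>v\<close> the
  measure \<open>q r * r ^ n dr\<close> is a multiple of \<open>dv\<close>, which makes the problem one-dimensional.\<close>

definition "q r = r powr (- (real DIM('a) + 1)) * Plog k (r / D)"

lemma rho: "0 < r \<Longrightarrow> r < D \<Longrightarrow> 0 < r / D \<and> r / D < 1"
  using D_pos by (simp add: field_simps)

lemma r2_pos: "r2 > 0" using r1 r12 by simp

lemma v_ge_1: assumes "0 < r" "r \<le> r1" shows "v r \<ge> 1"
proof -
  have D: "0 < r1 / D" "r1 / D < 1" using rho[of r1] r1 r12 r2D by auto
  have rr: "0 < r / D" "r / D < 1" using rho[of r] assms r12 r2D by auto
  have "Xlog (Suc k) (r / D) \<le> Xlog (Suc k) (r1 / D)"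
  proof (cases "r = r1")
    case False
    have "r / D < r1 / D" using assms False D_pos by (simp add: divide_strict_right_mono)
    from Xlog_strict_mono[OF rr(1) this, of "Suc k"] show ?thesis using D by simp
  qed simp
  then have "1 / Xlog (Suc k) (r1 / D) \<le> 1 / Xlog (Suc k) (r / D)"
    using Xlog_pos[of "r / D" "Suc k"] rr by (intro divide_left_mono mult_pos_pos Xlog_pos) (use D in auto)
  then have "1 / Xlog (Suc k) (r / D) - l0 \<ge> T" using v_r1 by linarith
  then show ?thesis using T0 by (simp add: v_def)
qed

lemma v_le_0: assumes "r2 \<le> r" "r < D" shows "v r \<le> 0"
proof -
  have D: "0 < r2 / D" "r2 / D < 1" using rho[of r2] r1 r12 r2D by auto
  have rr: "0 < r / D" "r / D < 1" using rho[of r] assms r12 r1 by auto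
  have "Xlog (Suc k) (r2 / D) \<le> Xlog (Suc k) (r / D)"
  proof (cases "r = r2")
    case False
    have "r2 / D < r / D" using assms False D_pos by (simp add: divide_strict_right_mono)
    from Xlog_strict_mono[OF D(1) this, of "Suc k"] show ?thesis using rr by simp
  qed simp
  then have "1 / Xlog (Suc k) (r / D) \<le> 1 / Xlog (Suc k) (r2 / D)"
    by (intro divide_left_mono mult_pos_pos Xlog_pos) (use D rr in auto)
  then show ?thesis using v_r2 T0 by (simp add: v_def divide_le_0_iff)
qed

lemma v_out: "0 < r \<Longrightarrow> r < D \<Longrightarrow> r \<le> r1 \<or> r2 \<le> r \<Longrightarrow> v r \<notin> {0<..<1}"
  using v_ge_1[of r] v_le_0[of r] by auto

lemma h_zero: "r \<le> r1 \<or> r2 \<le> r \<Longrightarrow> h r = 0"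
  using v_out[of r] B_zero[of "v r"] by (auto simp: h_def)

text \<open>Iterated logarithms satisfy \<open>r d/dr (1 / X\<^sub>k\<^sub>+\<^sub>1) = - X\<^sub>1 \<cdots> X\<^sub>k\<close>.\<close>

lemma DERIV_v: assumes "0 < r" "r < D" shows "(v has_real_derivative - Plog k (r / D) / T / r) (at r)"
proof -
  note rr = rho[OF assms]
  have X: "Xlog (Suc k) (r / D) > 0" using rr by (intro Xlog_pos) auto
  have "((\<lambda>r. r / D) has_real_derivative 1 / D) (at r)"
    using DERIV_cdivide[OF DERIV_ident, of D r UNIV] by simp
  from DERIV_chain2[OF DERIV_Xlog[of "r / D" "Suc k"] this]
  have dX: "((\<lambda>r. Xlog (Suc k) (r / D)) has_real_derivative
     Plog (Suc k) (r / D) * Xlog (Suc k) (r / D) / (r / D) * (1 / D)) (at r)" using rr by simp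
  have "((\<lambda>r. inverse (Xlog (Suc k) (r / D))) has_real_derivative
     - (Plog (Suc k) (r / D) * Xlog (Suc k) (r / D) / (r / D) * (1 / D) * inverse ((Xlog (Suc k) (r / D)) ^ Suc (Suc 0)))) (at r)"
    by (rule DERIV_inverse_fun[OF dX]) (use X in simp)
  then have "((\<lambda>r. inverse (Xlog (Suc k) (r / D))) has_real_derivative - Plog k (r / D) / r) (at r)"
    by (rule DERIV_cong) (use X assms D_pos in \<open>simp add: Plog_Suc field_simps del: Xlog.simps\<close>)
  from DERIV_cdivide[OF DERIV_diff[OF this DERIV_const[of l0]], of T]
  show ?thesis unfolding v_def by (simp add: inverse_eq_divide mult.commute)
qed

lemma DERIV_ph: assumes "0 < r" "r < D" shows "(ph has_real_derivative ph r * (G k r - al) / r) (at r)"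
proof -
  note rr = rho[OF assms]
  have P: "Plog k (r / D) > 0" using rr by (intro Plog_pos) auto
  have "((\<lambda>r. r / D) has_real_derivative 1 / D) (at r)"
    using DERIV_cdivide[OF DERIV_ident, of D r UNIV] by simp
  from DERIV_chain2[OF DERIV_Plog[of "r / D" k] this]
  have dP: "((\<lambda>r. Plog k (r / D)) has_real_derivative
     Plog k (r / D) * (\<Sum>j=1..k. Plog j (r / D)) / (r / D) * (1 / D)) (at r)" using rr by simp
  have d1: "((\<lambda>r. r powr (- al)) has_real_derivative - al * r powr (- al) / r) (at r)"
    using has_real_derivative_powr[OF assms(1), of "- al"] assms(1) by (simp add: powr_diff)
  have "((\<lambda>r. Plog k (r / D) powr (- (1/2))) has_real_derivative
     (- (1/2)) * Plog k (r / D) powr (- (1/2) - 1) * (Plog k (r / D) * (\<Sum>j=1..k. Plog j (r / D)) / (r / D) * (1 / D))) (at r)"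
    using DERIV_chain2[OF has_real_derivative_powr[OF P, of "- (1/2)"] dP] by simp
  then have d2: "((\<lambda>r. Plog k (r / D) powr (- (1/2))) has_real_derivative Plog k (r / D) powr (- (1/2)) * G k r / r) (at r)"
  proof (rule DERIV_cong)
    have "Plog k (r / D) powr (- (1/2) - 1) = Plog k (r / D) powr (- (1/2)) / Plog k (r / D)"
      using P powr_diff[of "Plog k (r / D)" "- (1/2)" 1] by simp
    then show "(- (1/2)) * Plog k (r / D) powr (- (1/2) - 1) * (Plog k (r / D) * (\<Sum>j=1..k. Plog j (r / D)) / (r / D) * (1 / D))
      = Plog k (r / D) powr (- (1/2)) * G k r / r"
      using P D_pos assms by (simp add: G_def field_simps)
  qed
  show ?thesis unfolding ph_def
    by (rule DERIV_cong[OF DERIV_mult[OF d1 d2]]) (use assms in \<open>simp add: field_simps\<close>)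
qed

lemma DERIV_h: assumes r: "0 < r" "r < D" shows "(h has_real_derivative h1 r) (at r)"
proof -
  have dB: "((\<lambda>r. B (v r)) has_real_derivative B' (v r) * (- Plog k (r / D) / T / r)) (at r)"
    by (rule DERIV_chain2[OF B_DERIV DERIV_v[OF r]])
  have "((\<lambda>r. ph r * B (v r)) has_real_derivative h1 r) (at r)"
    by (rule DERIV_cong[OF DERIV_mult[OF DERIV_ph[OF r] dB]]) (use r T0 in \<open>simp add: h1_def field_simps\<close>)
  then show ?thesis
    by (rule has_field_derivative_transform_within_open[of _ _ _ "{0<..<D}"]) (use r in \<open>auto simp: h_def\<close>)
qed

lemma smooth_h: "smooth_on UNIV h"
proof -
  have img: "(\<lambda>r. r / D) ` {0<..<D} \<subseteq> {0<..<1}" using D_pos by auto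
  have lin: "smooth_on {0<..<D} (\<lambda>r. r / D)" by (intro smooth_on_bounded_linear bounded_linear_divide)
  have X: "smooth_on {0<..<D} (\<lambda>r. Xlog (Suc k) (r / D))"
    by (rule smooth_on_compose[OF _ _ img smooth_on_Xlog lin]) auto
  have P: "smooth_on {0<..<D} (\<lambda>r. Plog k (r / D))"
    by (rule smooth_on_compose[OF _ _ img smooth_on_Plog lin]) auto
  have V: "smooth_on {0<..<D} (\<lambda>r. (1 / T) * (1 / Xlog (Suc k) (r / D) - l0))"
    by (intro smooth_on_mult smooth_on_const smooth_on_diff smooth_on_inverse X open_greaterThanLessThan Xlog_pos)
       (use D_pos in auto)
  then have V: "smooth_on {0<..<D} v"
    by (rule iffD1[OF smooth_on_cong[OF open_greaterThanLessThan], rotated]) (simp add: v_def)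
  have BV: "smooth_on {0<..<D} (\<lambda>r. B (v r))"
    by (rule smooth_on_compose[OF _ open_UNIV _ B_smooth V]) auto
  have pw: "smooth_on {0<..<D} (\<lambda>r. r powr (- al))"
    by (rule smooth_on_subset[OF smooth_on_powr]) auto
  have PP: "smooth_on {0<..<D} (\<lambda>r. Plog k (r / D) powr (- (1/2)))"
  proof (rule smooth_on_compose[OF _ open_greaterThan _ smooth_on_powr P])
    show "(\<lambda>r. Plog k (r / D)) ` {0<..<D} \<subseteq> {0<..}" using rho Plog_pos[of _ k] by force
  qed simp
  have "smooth_on {0<..<D} (\<lambda>r. (r powr (- al) * Plog k (r / D) powr (- (1/2))) * B (v r))"
    by (intro smooth_on_mult open_greaterThanLessThan pw PP BV)
  then have 1: "smooth_on {0<..<D} h"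
    by (rule iffD1[OF smooth_on_cong[OF open_greaterThanLessThan], rotated]) (simp add: h_def ph_def)
  have 2: "smooth_on {..<r1} h" "smooth_on {r2<..} h"
    by (rule smooth_on_zero; use h_zero in simp)+
  have "smooth_on (({0<..<D} \<union> {..<r1}) \<union> {r2<..}) h"
    by (intro smooth_on_Un open_Un open_greaterThanLessThan open_lessThan open_greaterThan 1 2)
  moreover have "({0<..<D} \<union> {..<r1}) \<union> {r2<..} = UNIV" using r1 r2D by auto
  ultimately show ?thesis by simp
qed

text \<open>The profile in the half plane of \<open>(H\<^sub>0 x, y)\<close>, extended smoothly to the plane so that \<open>H\<^sub>0 x\<close> can be replaced by
  a smooth function of \<open>x\<close>.\<close>

definition g :: "real \<times> real \<Rightarrow> real" where
  "g z = cut (snd z) * (Psi p c (snd z / sqrt ((fst z)\<^sup>2 + (snd z)\<^sup>2)) * h (sqrt ((fst z)\<^sup>2 + (snd z)\<^sup>2)))"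

lemma smooth_g: "smooth_on UNIV g"
proof -
  let ?W = "{z::real \<times> real. snd z > 0}"
  have W: "open ?W" by (intro open_Collect_less continuous_intros)
  have f: "smooth_on ?W (\<lambda>z. fst z)" and s: "smooth_on ?W (\<lambda>z. snd z)"
    by (intro smooth_on_bounded_linear bounded_linear_fst bounded_linear_snd)+
  have "smooth_on ?W (\<lambda>z. fst z * fst z + snd z * snd z)" by (intro smooth_on_add smooth_on_mult f s W)
  then have 0: "smooth_on ?W (\<lambda>z. (fst z)\<^sup>2 + (snd z)\<^sup>2)" by (simp only: power2_eq_square)
  have R: "smooth_on ?W (\<lambda>z. sqrt ((fst z)\<^sup>2 + (snd z)\<^sup>2))"
    by (rule smooth_on_sqrt[OF W 0]) (auto intro: add_nonneg_pos)
  have Rp: "sqrt ((fst z)\<^sup>2 + (snd z)\<^sup>2) > 0" if "z \<in> ?W" for z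
    using that by (simp add: add_nonneg_pos)
  have "smooth_on ?W (\<lambda>z. snd z * (1 / sqrt ((fst z)\<^sup>2 + (snd z)\<^sup>2)))"
    by (intro smooth_on_mult smooth_on_inverse s R W Rp)
  then have sg: "smooth_on ?W (\<lambda>z. snd z / sqrt ((fst z)\<^sup>2 + (snd z)\<^sup>2))" by simp
  have Ps: "smooth_on ?W (\<lambda>z. Psi p c (snd z / sqrt ((fst z)\<^sup>2 + (snd z)\<^sup>2)))"
  proof (rule smooth_on_compose[OF W open_greaterThan _ smooth_on_Psi[OF p_pos c_pos] sg])
    show "(\<lambda>z. snd z / sqrt ((fst z)\<^sup>2 + (snd z)\<^sup>2)) ` ?W \<subseteq> {-1<..}"
    proof (rule image_subsetI)
      fix z assume z: "z \<in> ?W"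
      have "snd z / sqrt ((fst z)\<^sup>2 + (snd z)\<^sup>2) > 0" using z Rp[OF z] by (intro divide_pos_pos) auto
      then show "snd z / sqrt ((fst z)\<^sup>2 + (snd z)\<^sup>2) \<in> {-1<..}" by simp
    qed
  qed
  have hR: "smooth_on ?W (\<lambda>z. h (sqrt ((fst z)\<^sup>2 + (snd z)\<^sup>2)))"
    by (rule smooth_on_compose[OF W open_UNIV _ smooth_h R]) simp
  have cs: "smooth_on ?W (\<lambda>z. cut (snd z))"
    by (rule smooth_on_compose[OF W open_UNIV _ cut_smooth s]) simp
  have 1: "smooth_on ?W g" unfolding g_def by (intro smooth_on_mult W cs Ps hR)
  let ?V = "{z::real \<times> real. snd z < e}"
  have V: "open ?V" by (intro open_Collect_less continuous_intros)
  have 2: "smooth_on ?V g" by (rule smooth_on_zero[OF V]) (simp add: g_def cut0)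
  have "smooth_on (?W \<union> ?V) g" by (rule smooth_on_Un[OF W V 1 2])
  moreover have "?W \<union> ?V = UNIV" using e0 by auto
  ultimately show ?thesis by simp
qed

lemma g_zero: "(fst z)\<^sup>2 + (snd z)\<^sup>2 \<ge> r2\<^sup>2 \<Longrightarrow> g z = 0" "snd z \<le> e \<Longrightarrow> g z = 0"
proof -
  assume "(fst z)\<^sup>2 + (snd z)\<^sup>2 \<ge> r2\<^sup>2"
  then have "sqrt ((fst z)\<^sup>2 + (snd z)\<^sup>2) \<ge> r2" using r2_pos by (simp add: real_le_rsqrt)
  then show "g z = 0" by (simp add: g_def h_zero)
qed (simp add: g_def cut0)

text \<open>In the cone the cutoff is invisible: where it is not 1, one has \<open>rad z \<le> r1\<close> and \<open>h\<close> vanishes.\<close>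

lemma g_cone:
  assumes "y > sin \<theta> * sqrt (r\<^sup>2 + y\<^sup>2)"
  shows "g (r, y) = Psi p c (y / sqrt (r\<^sup>2 + y\<^sup>2)) * h (sqrt (r\<^sup>2 + y\<^sup>2))"
proof (cases "sqrt (r\<^sup>2 + y\<^sup>2) \<le> r1")
  case True
  then show ?thesis by (simp add: g_def h_zero)
next
  case False
  then have "sin \<theta> * r1 \<le> sin \<theta> * sqrt (r\<^sup>2 + y\<^sup>2)" using sin_pos by (intro mult_left_mono) auto
  then have "cut y = 1" using assms e_le by (intro cut1) linarith
  then show ?thesis by (simp add: g_def)
qed

end

section \<open>The excess of the profile\<close>

context near_optimizer begin

definition "gr z = frechet_derivative g (at z) (1, 0)"
definition "gy z = frechet_derivative g (at z) (0, 1)"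

lemma gr_cont: "continuous_on UNIV gr" and gy_cont: "continuous_on UNIV gy"
  and g_has_derivative: "(g has_derivative (\<lambda>h. fst h * gr z + snd h * gy z)) (at z)"
  unfolding gr_def gy_def using smooth_on_DERIV_pair[OF smooth_g] by blast+

lemma g_cont: "continuous_on UNIV g"
  using g_has_derivative by (intro continuous_at_imp_continuous_on ballI has_derivative_continuous)

lemma g_chain:
  assumes "(f1 has_real_derivative d1) (at t)" "(f2 has_real_derivative d2) (at t)"
  shows "((\<lambda>t. g (f1 t, f2 t)) has_real_derivative d1 * gr (f1 t, f2 t) + d2 * gy (f1 t, f2 t)) (at t)"
proof -
  have "((\<lambda>t. (f1 t, f2 t)) has_derivative (\<lambda>h. (d1 * h, d2 * h))) (at t)"
    using assms unfolding has_field_derivative_def by (rule has_derivative_Pair)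
  from has_derivative_compose[OF this g_has_derivative]
  have "((\<lambda>t. g (f1 t, f2 t)) has_derivative
     (\<lambda>h. d1 * h * gr (f1 t, f2 t) + d2 * h * gy (f1 t, f2 t))) (at t)" by simp
  moreover have "(\<lambda>h. d1 * h * gr (f1 t, f2 t) + d2 * h * gy (f1 t, f2 t)) = (*) (d1 * gr (f1 t, f2 t) + d2 * gy (f1 t, f2 t))"
    by (rule ext) (simp add: algebra_simps)
  ultimately show ?thesis by (simp add: has_field_derivative_def)
qed

lemma gr_gy_zero:
  assumes z: "(fst z)\<^sup>2 + (snd z)\<^sup>2 > r2\<^sup>2 \<or> snd z < e"
  shows "gr z = 0" "gy z = 0"
proof -
  let ?O = "{z::real \<times> real. (fst z)\<^sup>2 + (snd z)\<^sup>2 > r2\<^sup>2} \<union> {z. snd z < e}"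
  have O: "open ?O" by (intro open_Un open_Collect_less continuous_intros)
  have "(g has_derivative (\<lambda>h. 0)) (at z)"
  proof (rule has_derivative_transform_within_open[OF has_derivative_const O])
    show "z \<in> ?O" using z by auto
    show "0 = g w" if "w \<in> ?O" for w using that g_zero[of w] by auto
  qed
  from has_derivative_unique[OF this g_has_derivative]
  have eq: "(\<lambda>h. 0) = (\<lambda>h. fst h * gr z + snd h * gy z)" .
  show "gr z = 0" using fun_cong[OF eq, of "(1, 0)"] by simp
  show "gy z = 0" using fun_cong[OF eq, of "(0, 1)"] by simp
qed

lemma Psi_DERIV: "s > -1 \<Longrightarrow> (Psi p c has_real_derivative Psi1 s) (at s)"
  using DERIV_Psi[OF p_pos c_pos] by (simp add: Psi1_def)

lemma gr_gy_cone:
  fixes r y :: real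
  defines "R \<equiv> sqrt (r\<^sup>2 + y\<^sup>2)" and "s \<equiv> y / sqrt (r\<^sup>2 + y\<^sup>2)"
  assumes y: "y > sin \<theta> * R" and RD: "R < D"
  shows "gr (r, y) = - Psi1 s * s * r / R\<^sup>2 * h R + Psi p c s * h1 R * r / R"
    and "gy (r, y) = Psi1 s * (1 - s\<^sup>2) / R * h R + Psi p c s * h1 R * s"
proof -
  have R0: "R \<ge> 0" by (simp add: R_def)
  have y0: "y > 0" using y mult_nonneg_nonneg[OF less_imp_le[OF sin_pos] R0] by linarith
  have pos: "r\<^sup>2 + y\<^sup>2 > 0" using y0 by (simp add: add_nonneg_pos)
  then have Rp: "R > 0" by (simp add: R_def)
  have R2: "R\<^sup>2 = r\<^sup>2 + y\<^sup>2" using pos by (simp add: R_def)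
  have sR: "s = y / R" by (simp add: s_def R_def)
  have s0: "s > -1" using divide_pos_pos[OF y0 Rp] unfolding sR by linarith
  let ?W = "{z::real \<times> real. sin \<theta> * sqrt ((fst z)\<^sup>2 + (snd z)\<^sup>2) < snd z}"
  have W: "open ?W" by (intro open_Collect_less continuous_intros)
  have inW: "(r, y) \<in> ?W" using y by (simp add: R_def)
  have key: "((\<lambda>t. g (f1 t, f2 t)) has_real_derivative
      Psi1 s * ds * h R + Psi p c s * (h1 R * dR)) (at t0)"
    if f: "f1 t0 = r" "f2 t0 = y" "(f1 has_real_derivative d1) (at t0)" "(f2 has_real_derivative d2) (at t0)"
      and dR: "((\<lambda>t. sqrt ((f1 t)\<^sup>2 + (f2 t)\<^sup>2)) has_real_derivative dR) (at t0)"
      and ds: "((\<lambda>t. f2 t / sqrt ((f1 t)\<^sup>2 + (f2 t)\<^sup>2)) has_real_derivative ds) (at t0)"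
    for f1 f2 t0 d1 d2 dR ds
  proof -
    have 1: "((\<lambda>t. Psi p c (f2 t / sqrt ((f1 t)\<^sup>2 + (f2 t)\<^sup>2))) has_real_derivative Psi1 s * ds) (at t0)"
      by (rule DERIV_chain2[OF _ ds]) (use Psi_DERIV[OF s0] f in \<open>simp add: s_def\<close>)
    have 2: "((\<lambda>t. h (sqrt ((f1 t)\<^sup>2 + (f2 t)\<^sup>2))) has_real_derivative h1 R * dR) (at t0)"
      by (rule DERIV_chain2[OF _ dR]) (use DERIV_h[OF Rp RD] f in \<open>simp add: R_def\<close>)
    have 3: "((\<lambda>t. Psi p c (f2 t / sqrt ((f1 t)\<^sup>2 + (f2 t)\<^sup>2)) * h (sqrt ((f1 t)\<^sup>2 + (f2 t)\<^sup>2)))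
      has_real_derivative Psi1 s * ds * h R + Psi p c s * (h1 R * dR)) (at t0)"
      by (rule DERIV_cong[OF DERIV_mult[OF 1 2]]) (use f in \<open>simp add: R_def s_def\<close>)
    have c: "isCont (\<lambda>t. (f1 t, f2 t)) t0" using DERIV_isCont[OF f(3)] DERIV_isCont[OF f(4)] by (rule isCont_Pair)
    have "\<forall>\<^sub>F t in at t0. (f1 t, f2 t) \<in> ?W"
      using c[unfolded isCont_def] W inW f(1,2) by (intro topological_tendstoD) auto
    then have ev: "\<forall>\<^sub>F t in nhds t0. (f1 t, f2 t) \<in> ?W"
      using inW f(1,2) by (simp only: eventually_nhds_conv_at)
    have "\<forall>\<^sub>F t in nhds t0. g (f1 t, f2 t) =
       Psi p c (f2 t / sqrt ((f1 t)\<^sup>2 + (f2 t)\<^sup>2)) * h (sqrt ((f1 t)\<^sup>2 + (f2 t)\<^sup>2))"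
      by (rule eventually_mono[OF ev]) (simp add: g_cone)
    from DERIV_cong_ev[OF refl this refl] 3 show ?thesis by simp
  qed
  have dRr: "((\<lambda>t. sqrt (t\<^sup>2 + y\<^sup>2)) has_real_derivative r / R) (at r)"
  proof -
    have "((\<lambda>t. t\<^sup>2 + y\<^sup>2) has_real_derivative 2 * r) (at r)" by (auto intro!: derivative_eq_intros)
    from DERIV_chain2[OF DERIV_real_sqrt[OF pos] this] show ?thesis
      by (rule DERIV_cong) (simp add: R_def inverse_eq_divide)
  qed
  have dRy: "((\<lambda>t. sqrt (r\<^sup>2 + t\<^sup>2)) has_real_derivative y / R) (at y)"
  proof -
    have "((\<lambda>t. r\<^sup>2 + t\<^sup>2) has_real_derivative 2 * y) (at y)" by (auto intro!: derivative_eq_intros)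
    from DERIV_chain2[OF DERIV_real_sqrt[OF pos] this] show ?thesis
      by (rule DERIV_cong) (simp add: R_def inverse_eq_divide)
  qed
  have Rn: "sqrt (r\<^sup>2 + y\<^sup>2) \<noteq> 0" using less_imp_neq[OF Rp] unfolding R_def by (rule not_sym)
  have dsr: "((\<lambda>t. y / sqrt (t\<^sup>2 + y\<^sup>2)) has_real_derivative - s * r / R\<^sup>2) (at r)"
    by (rule DERIV_cong[OF DERIV_divide[OF DERIV_const dRr Rn]])
       (use Rp in \<open>unfold R_def[symmetric], simp add: sR field_simps power2_eq_square\<close>)
  have dsy: "((\<lambda>t. t / sqrt (r\<^sup>2 + t\<^sup>2)) has_real_derivative (1 - s\<^sup>2) / R) (at y)"
    by (rule DERIV_cong[OF DERIV_divide[OF DERIV_ident dRy Rn]])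
       (use Rp in \<open>unfold R_def[symmetric], simp add: sR field_simps power2_eq_square\<close>)
  have "((\<lambda>t. g (t, y)) has_real_derivative gr (r, y)) (at r)"
    using g_chain[where t=r, OF DERIV_ident DERIV_const[of y]] by simp
  from DERIV_unique[OF this key[OF refl refl DERIV_ident DERIV_const dRr dsr]]
  show "gr (r, y) = - Psi1 s * s * r / R\<^sup>2 * h R + Psi p c s * h1 R * r / R" by simp
  have "((\<lambda>t. g (r, t)) has_real_derivative gy (r, y)) (at y)"
    using g_chain[where t=y, OF DERIV_const[of r] DERIV_ident] by simp
  from DERIV_unique[OF this key[OF refl refl DERIV_const DERIV_ident dRy dsy]]
  show "gy (r, y) = Psi1 s * (1 - s\<^sup>2) / R * h R + Psi p c s * h1 R * s" by (simp add: sR)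
qed

text \<open>The nonsmooth extremal candidate, its derivatives along rays and along vertical lines, and its energy density
  under the convention that \<open>H\<^sub>0\<close> has gradient of \<open>H\<close>-norm 1.\<close>

definition "u0 z = g (H0 (fst z), snd z)"
definition "uz z = H0 (fst z) * gr (H0 (fst z), snd z) + snd z * gy (H0 (fst z), snd z)"
definition "uy z = gy (H0 (fst z), snd z)"
definition "E0 z = (gr (H0 (fst z), snd z))\<^sup>2 + (gy (H0 (fst z), snd z))\<^sup>2"

lemma compose_H0_cont:
  assumes "continuous_on UNIV f" shows "continuous_on UNIV (\<lambda>z::'a \<times> real. f (H0 (fst z), snd z) :: real)"
  by (rule continuous_on_compose2[OF assms])
     (auto intro!: continuous_intros continuous_on_compose2[OF is_norm_continuous[OF H0_norm, of UNIV]])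

lemma compact_rad_le: "compact {z. rad z \<le> R}"
proof -
  obtain c0 where c0: "c0 > 0" "\<And>z. c0 * norm z \<le> rad z" using is_norm_ge_norm[OF rad_norm] by blast
  have "norm z \<le> R / c0" if "rad z \<le> R" for z
    using order_trans[OF c0(2) that] c0(1) by (simp add: field_simps)
  then have "bounded {z. rad z \<le> R}" unfolding bounded_iff by blast
  moreover have "closed {z. rad z \<le> R}"
    by (intro closed_Collect_le continuous_on_const is_norm_continuous[OF rad_norm])
  ultimately show ?thesis by (simp add: compact_eq_bounded_closed)
qed

lemma u0_outside: assumes "rad z > r2" shows "g (H0 (fst z), snd z) = 0 \<and> gr (H0 (fst z), snd z) = 0 \<and> gy (H0 (fst z), snd z) = 0"
proof -
  have "(rad z)\<^sup>2 > r2\<^sup>2" using assms r2_pos by (intro power_strict_mono) auto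
  then have "(H0 (fst z))\<^sup>2 + (snd z)\<^sup>2 > r2\<^sup>2" by (simp only: rad_sq)
  then show ?thesis using g_zero(1)[of "(H0 (fst z), snd z)"] gr_gy_zero[of "(H0 (fst z), snd z)"] by simp
qed

lemma u0_admissible: "admissible u0 uz uy"
  unfolding admissible_def
proof (intro conjI allI)
  show "continuous_on UNIV u0" unfolding u0_def by (rule compose_H0_cont[OF g_cont])
  show "continuous_on UNIV uy" unfolding uy_def by (rule compose_H0_cont[OF gy_cont])
  show "continuous_on UNIV uz" unfolding uz_def
    by (intro continuous_on_add continuous_on_mult compose_H0_cont gr_cont gy_cont continuous_on_snd continuous_on_id
        continuous_on_compose2[OF is_norm_continuous[OF H0_norm, of UNIV]] continuous_on_fst) auto
  show "\<exists>K. compact K \<and> K \<subseteq> U \<and> (\<forall>z. z \<notin> K \<longrightarrow> u0 z = 0 \<and> uz z = 0 \<and> uy z = 0)"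
  proof (intro exI[of _ "{z. rad z \<le> r2}"] conjI compact_rad_le allI impI)
    show "{z. rad z \<le> r2} \<subseteq> U" using ball_U r2_pos by auto
    fix z :: "'a \<times> real" assume "z \<notin> {z. rad z \<le> r2}"
    then have "rad z > r2" by simp
    from u0_outside[OF this] show "u0 z = 0" "uz z = 0" "uy z = 0" by (simp_all add: u0_def uz_def uy_def)
  qed
  show "((\<lambda>l. u0 (l *\<^sub>R z)) has_real_derivative uz z) (at 1)" for z
  proof -
    have "((\<lambda>l. g (l * H0 (fst z), l * snd z)) has_real_derivative uz z) (at 1)"
      by (rule DERIV_cong[OF g_chain[OF DERIV_cmult_right[OF DERIV_ident] DERIV_cmult_right[OF DERIV_ident]]])
         (simp add: uz_def)
    then show ?thesis
      by (rule has_field_derivative_transform_within_open[of _ _ _ "{0<..}"])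
         (simp_all add: u0_def is_norm_scale[OF H0_norm])
  qed
  show "((\<lambda>y. u0 (x, y)) has_real_derivative uy (x, y)) (at y)" for x y
    unfolding u0_def uy_def using g_chain[where t=y, OF DERIV_const[of "H0 x"] DERIV_ident] by simp
qed

lemma q_eq: assumes "0 < r" "r < D" shows "(ph r)\<^sup>2 * (Plog k (r / D))\<^sup>2 / r\<^sup>2 = q r"
proof -
  have P: "Plog k (r / D) > 0" using rho[OF assms] by (intro Plog_pos) auto
  have 1: "(r powr (- al))\<^sup>2 / r\<^sup>2 = r powr (- (real DIM('a) + 1))"
  proof -
    have "(r powr (- al))\<^sup>2 = r powr (2 * (- al))" using assms by (simp add: power2_eq_square flip: powr_add)
    moreover have "r\<^sup>2 = r powr 2" using assms by simp
    ultimately have "(r powr (- al))\<^sup>2 / r\<^sup>2 = r powr (2 * (- al) - 2)" by (simp only: powr_diff)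
    also have "2 * (- al) - 2 = - (real DIM('a) + 1)" by (simp add: al_def field_simps)
    finally show ?thesis .
  qed
  have 2: "(Plog k (r / D) powr (- (1/2)))\<^sup>2 * (Plog k (r / D))\<^sup>2 = Plog k (r / D)"
  proof -
    have "(Plog k (r / D) powr (- (1/2)))\<^sup>2 = Plog k (r / D) powr (-1)" by (simp add: power2_eq_square flip: powr_add)
    also have "\<dots> = 1 / Plog k (r / D)" using P by (simp add: powr_minus divide_inverse)
    finally show ?thesis using P by (simp add: power2_eq_square)
  qed
  have "(ph r)\<^sup>2 * (Plog k (r / D))\<^sup>2 / r\<^sup>2
     = ((r powr (- al))\<^sup>2 / r\<^sup>2) * ((Plog k (r / D) powr (- (1/2)))\<^sup>2 * (Plog k (r / D))\<^sup>2)"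
    by (simp add: ph_def power_mult_distrib)
  then show ?thesis unfolding 1 2 by (simp only: q_def)
qed

lemma on_cone:
  assumes z: "z \<in> A"
  shows "0 < rad z" "rad z < D" "g (H0 (fst z), snd z) = Psi p c (sn z) * h (rad z)"
    "gr (H0 (fst z), snd z) = - Psi1 (sn z) * sn z * H0 (fst z) / (rad z)\<^sup>2 * h (rad z) + Psi p c (sn z) * h1 (rad z) * H0 (fst z) / rad z"
    "gy (H0 (fst z), snd z) = Psi1 (sn z) * (1 - (sn z)\<^sup>2) / rad z * h (rad z) + Psi p c (sn z) * h1 (rad z) * sn z"
proof -
  show r: "0 < rad z" "rad z < D" using cone_rad_pos[OF A_cone[OF z]] rad_lt_D[OF z] .
  have R: "sqrt ((H0 (fst z))\<^sup>2 + (snd z)\<^sup>2) = rad z" using rad_eq[of "fst z" "snd z"] by simp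
  have y: "sin \<theta> * rad z < snd z" using cone_sn(1)[OF A_cone[OF z]] r by (simp add: sn_def field_simps)
  show "g (H0 (fst z), snd z) = Psi p c (sn z) * h (rad z)"
    using g_cone[of "H0 (fst z)" "snd z"] y by (simp add: R sn_def)
  show "gr (H0 (fst z), snd z) = - Psi1 (sn z) * sn z * H0 (fst z) / (rad z)\<^sup>2 * h (rad z) + Psi p c (sn z) * h1 (rad z) * H0 (fst z) / rad z"
    "gy (H0 (fst z), snd z) = Psi1 (sn z) * (1 - (sn z)\<^sup>2) / rad z * h (rad z) + Psi p c (sn z) * h1 (rad z) * sn z"
    using gr_gy_cone[of "H0 (fst z)" "snd z", unfolded R, folded sn_def, OF y r(2)] by simp_all
qed

text \<open>Completing the square: the energy density exceeds the lower bound \<open>S\<close> by the square of the radial derivative of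
  the quotient of the function and the ground state, times the squared ground state. The angular parts
  agree.\<close>

lemma deficit_density:
  assumes z: "z \<in> A"
  shows "E0 z = S k u0 uz uy z + (1 / T\<^sup>2) * ((Psi p c (sn z))\<^sup>2 * (q (rad z) * (B' (v (rad z)))\<^sup>2))"
proof -
  note oc = on_cone[OF z]
  define R where "R = rad z"
  define s where "s = sn z"
  define a0 where "a0 = H0 (fst z)"
  define y where "y = snd z"
  define P0 where "P0 = Psi p c s"
  define P1 where "P1 = Psi1 s"
  define \<alpha> where "\<alpha> = G k R - al"
  define hh where "hh = h R"
  define hd where "hd = h1 R"
  note ds = R_def s_def a0_def y_def P0_def P1_def \<alpha>_def hh_def hd_def
  have R: "R > 0" using oc(1) by (simp add: ds)
  have y: "y = s * R" using R by (simp add: ds sn_def)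
  have a0: "a0\<^sup>2 = R\<^sup>2 * (1 - s\<^sup>2)"
    using rad_sq[of z] y by (simp add: ds(1,3,4) [symmetric] power_mult_distrib algebra_simps)
  have P0: "P0 > 0" using Psi_pos[OF p_pos c_pos sn_gt[OF z]] by (simp add: ds)
  have gz: "g (H0 (fst z), snd z) = P0 * hh" using oc(3) by (simp add: ds)
  have grz: "gr (H0 (fst z), snd z) = a0 * (P0 * hd / R - P1 * s * hh / R\<^sup>2)"
    unfolding oc(4) unfolding ds[symmetric] using R by (simp add: field_simps power2_eq_square)
  have gyz: "gy (H0 (fst z), snd z) = P1 * (1 - s\<^sup>2) / R * hh + P0 * hd * s"
    unfolding oc(5) unfolding ds[symmetric] by simp
  have uzz: "uz z = P0 * R * hd"
  proof -
    have "uz z = a0\<^sup>2 * (P0 * hd / R - P1 * s * hh / R\<^sup>2) + s * R * (P1 * (1 - s\<^sup>2) / R * hh + P0 * hd * s)"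
      unfolding uz_def grz gyz unfolding ds(3,4)[symmetric] unfolding y by (simp add: power2_eq_square)
    also have "\<dots> = P0 * R * hd" unfolding a0 using R by (simp add: field_simps power2_eq_square)
    finally show ?thesis .
  qed
  have EE: "E0 z = (1 - s\<^sup>2) * (P0 * hd - P1 * s * hh / R)\<^sup>2 + (P1 * (1 - s\<^sup>2) / R * hh + P0 * hd * s)\<^sup>2"
  proof -
    have "E0 z = a0\<^sup>2 * (P0 * hd / R - P1 * s * hh / R\<^sup>2)\<^sup>2 + (P1 * (1 - s\<^sup>2) / R * hh + P0 * hd * s)\<^sup>2"
      unfolding E0_def grz gyz by (simp only: power_mult_distrib)
    also have "a0\<^sup>2 * (P0 * hd / R - P1 * s * hh / R\<^sup>2)\<^sup>2 = (1 - s\<^sup>2) * (R * (P0 * hd / R - P1 * s * hh / R\<^sup>2))\<^sup>2"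
      unfolding a0 by (simp add: power_mult_distrib)
    also have "R * (P0 * hd / R - P1 * s * hh / R\<^sup>2) = P0 * hd - P1 * s * hh / R"
      using R by (simp add: field_simps power2_eq_square)
    finally show ?thesis .
  qed
  have Fr: "F_rad k z = (\<alpha> - s * P1 / P0) / R\<^sup>2" and Fu: "F_up z = P1 / P0 / R"
    by (simp_all add: F_rad_def F_up_def L_def ds al_def)
  have Sz: "S k u0 uz uy z = 2 * (P0 * hh) * ((\<alpha> - s * P1 / P0) / R\<^sup>2 * (P0 * R * hd) + P1 / P0 / R * (P1 * (1 - s\<^sup>2) / R * hh + P0 * hd * s))
     - (P0 * hh)\<^sup>2 * (((\<alpha> - s * P1 / P0) / R\<^sup>2)\<^sup>2 * R\<^sup>2 + 2 * ((\<alpha> - s * P1 / P0) / R\<^sup>2) * (P1 / P0 / R) * (s * R) + (P1 / P0 / R)\<^sup>2)"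
    unfolding S_def Fr Fu uzz u0_def uy_def gz gyz unfolding ds(1,4)[symmetric] unfolding y by (rule refl)
  \<comment> \<open>In \<open>x\<close> and \<open>l\<close> both sides are polynomials.\<close>
  define x where "x = hh / R"
  define l where "l = P1 / P0"
  have hh: "hh = x * R" and P1: "P1 = P0 * l" using R P0 by (simp_all add: x_def l_def)
  have t1: "2 * (P0 * hh) * ((\<alpha> - s * P1 / P0) / R\<^sup>2 * (P0 * R * hd) + P1 / P0 / R * (P1 * (1 - s\<^sup>2) / R * hh + P0 * hd * s))
    = 2 * P0 * x * ((\<alpha> - s * l) * P0 * hd + l * (P0 * l * (1 - s\<^sup>2) * x + P0 * hd * s))"
  proof -
    have m1: "(\<alpha> - s * P1 / P0) / R\<^sup>2 * (P0 * R * hd) = ((\<alpha> - s * l) * P0 * hd) / R"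
      unfolding l_def using R by (simp add: power2_eq_square)
    have m2: "P1 / P0 / R * (P1 * (1 - s\<^sup>2) / R * hh + P0 * hd * s) = l * (P0 * l * (1 - s\<^sup>2) * x + P0 * hd * s) / R"
      unfolding hh P1 using R P0 by simp
    show ?thesis unfolding m1 m2 unfolding hh using R by (simp add: add_divide_distrib[symmetric])
  qed
  have t2: "(P0 * hh)\<^sup>2 * (((\<alpha> - s * P1 / P0) / R\<^sup>2)\<^sup>2 * R\<^sup>2 + 2 * ((\<alpha> - s * P1 / P0) / R\<^sup>2) * (P1 / P0 / R) * (s * R) + (P1 / P0 / R)\<^sup>2)
    = P0\<^sup>2 * x\<^sup>2 * ((\<alpha> - s * l)\<^sup>2 + 2 * (\<alpha> - s * l) * l * s + l\<^sup>2)"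
  proof -
    have sl: "s * P1 / P0 = s * l" "P1 / P0 = l" by (simp_all add: l_def)
    have "((\<alpha> - s * l) / R\<^sup>2)\<^sup>2 * R\<^sup>2 + 2 * ((\<alpha> - s * l) / R\<^sup>2) * (l / R) * (s * R) + (l / R)\<^sup>2
      = ((\<alpha> - s * l)\<^sup>2 + 2 * (\<alpha> - s * l) * l * s + l\<^sup>2) / R\<^sup>2"
      using R by (simp add: add_divide_distrib power_divide power2_eq_square)
    then show ?thesis unfolding sl hh using R by (simp add: power_mult_distrib)
  qed
  have t3: "P1 * (1 - s\<^sup>2) / R * hh = P0 * l * (1 - s\<^sup>2) * x" "P1 * s * hh / R = P0 * l * s * x" "\<alpha> * hh / R = \<alpha> * x"
    unfolding hh P1 using R by simp_all
  have "E0 z = S k u0 uz uy z + P0\<^sup>2 * (hd - \<alpha> * hh / R)\<^sup>2"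
    unfolding EE unfolding Sz unfolding t1 t2 unfolding t3 by (simp add: algebra_simps power2_eq_square)
  moreover have "(hd - \<alpha> * hh / R)\<^sup>2 = (1 / T\<^sup>2) * (q (rad z) * (B' (v (rad z)))\<^sup>2)"
  proof -
    have "hd - \<alpha> * hh / R = - (ph (rad z) * Plog k (rad z / D) / rad z) * B' (v (rad z)) / T"
      using oc(1,2) T0 by (simp add: ds h_def h1_def field_simps)
    then have "(hd - \<alpha> * hh / R)\<^sup>2 = (1 / T\<^sup>2) * (((ph (rad z))\<^sup>2 * (Plog k (rad z / D))\<^sup>2 / (rad z)\<^sup>2) * (B' (v (rad z)))\<^sup>2)"
      by (simp add: power_mult_distrib power_divide)
    then show ?thesis using q_eq[OF oc(1,2)] by simp
  qed
  ultimately show ?thesis by (simp add: P0_def s_def)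
qed

lemma hardy_density:
  assumes z: "z \<in> A"
  shows "(Plog k (rad z / D))\<^sup>2 / (rad z)\<^sup>2 * (u0 z)\<^sup>2 = (Psi p c (sn z))\<^sup>2 * (q (rad z) * (B (v (rad z)))\<^sup>2)"
proof -
  note oc = on_cone[OF z]
  have "u0 z = Psi p c (sn z) * (ph (rad z) * B (v (rad z)))" using oc by (simp add: u0_def h_def)
  then have "(Plog k (rad z / D))\<^sup>2 / (rad z)\<^sup>2 * (u0 z)\<^sup>2
    = (Psi p c (sn z))\<^sup>2 * (((ph (rad z))\<^sup>2 * (Plog k (rad z / D))\<^sup>2 / (rad z)\<^sup>2) * (B (v (rad z)))\<^sup>2)"
    by (simp add: power_mult_distrib)
  then show ?thesis using q_eq[OF oc(1,2)] by simp
qed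

lemma v_cont: "continuous_on {0<..<D} v"
  by (intro continuous_at_imp_continuous_on ballI) (auto intro!: DERIV_isCont DERIV_v)

lemma BC_profile:
  assumes X: "continuous_on {0<..<D} X" and f: "continuous_on UNIV f" and f0: "\<And>x. x \<notin> {0<..<1} \<Longrightarrow> f x = 0"
  shows "BC (\<lambda>z. (Psi p c (sn z))\<^sup>2 * (X (rad z) * f (v (rad z))))"
proof -
  have cont: "continuous_on {0<..<D} (\<lambda>r. X r * f (v r))"
    by (intro continuous_on_mult X continuous_on_compose2[OF f v_cont]) auto
  have "compact ((\<lambda>r. X r * f (v r)) ` {r1..r2})"
    by (rule compact_continuous_image[OF continuous_on_subset[OF cont]]) (use r1 r2D in auto)
  from compact_imp_bounded[OF this] obtain M where M': "\<forall>y\<in>(\<lambda>r. X r * f (v r)) ` {r1..r2}. norm y \<le> M"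
    unfolding bounded_iff by (elim exE)
  have M: "\<bar>X r * f (v r)\<bar> \<le> M" if "r \<in> {r1..r2}" for r
    using bspec[OF M' imageI[OF that]] by simp
  have "BC (\<lambda>z. X (rad z) * f (v (rad z)))"
  proof (rule BC_I)
    show "continuous_on A (\<lambda>z. X (rad z) * f (v (rad z)))"
      by (rule continuous_on_compose2[OF cont BC_cont[OF BC_rad]]) (use on_cone(1,2) in auto)
    fix z assume z: "z \<in> A"
    show "\<bar>X (rad z) * f (v (rad z))\<bar> \<le> max M 0"
    proof (cases "rad z \<in> {r1..r2}")
      case True
      then show ?thesis using M[OF True] by linarith
    next
      case False
      then show ?thesis using f0[OF v_out[of "rad z"]] on_cone(1,2)[OF z] by auto
    qed
  qed
  then show ?thesis by (rule BC_mult[rotated]) (intro BC_power BC_compose_sn Psi_cont p_pos c_pos)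
qed

lemma q_cont: "continuous_on {0<..<D} q"
proof -
  have "continuous_on {0<..<D} (\<lambda>r. Plog k (r / D))"
  proof (intro continuous_at_imp_continuous_on ballI)
    fix r assume "r \<in> {0<..<D}"
    then have r: "0 < r / D" "r / D \<le> 1" using rho[of r] by auto
    show "isCont (\<lambda>r. Plog k (r / D)) r"
      by (rule isCont_o2[where f="\<lambda>r. r / D" and g="Plog k", OF _ DERIV_isCont[OF DERIV_Plog[OF r]]]) (intro continuous_intros, use D_pos in auto)
  qed
  moreover have "continuous_on {0<..<D} (\<lambda>r. r powr (- (real DIM('a) + 1)))" by (intro continuous_intros) auto
  ultimately show ?thesis unfolding q_def by (intro continuous_on_mult)
qed

lemma profile_integrable:
  assumes f: "continuous_on UNIV f" "\<And>x. x \<notin> {0<..<1} \<Longrightarrow> f x = 0"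
    and X: "continuous_on {0<..<D} X"
  shows "set_integrable lborel A (\<lambda>z. (Psi p c (sn z))\<^sup>2 * (X (rad z) * f (v (rad z))))"
  by (rule integrable_of_BC, rule BC_mult[OF BC_profile[OF X f] BC_power[OF BC_rad]])

text \<open>The Rayleigh quotient of the profile on the cone is the one of the bump on the interval. The function \<open>f\<close> is
  homogeneous of degree \<open>- (n + 1)\<close> apart from the factor \<open>F (v (rad z))\<close>, so its Euler derivative only sees
  \<open>F\<close>; no polar coordinates are needed.\<close>

lemma Euler_profile:
  "(LINT z:A|lborel. (Psi p c (sn z))\<^sup>2 * (q (rad z) * ((B' (v (rad z)))\<^sup>2 - lam * (B (v (rad z)))\<^sup>2))) = 0"
proof -
  let ?n = "real DIM('a)"
  define f where "f z = (if rad z \<le> r2 then (Psi p c (sn z))\<^sup>2 * (rad z powr (- (?n + 1)) * F (v (rad z))) else 0)" for z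
  define ff where "ff z = (Psi p c (sn z))\<^sup>2 * (rad z powr (- (?n + 1)) * F (v (rad z)))" for z
  define E where "E z = (Psi p c (sn z))\<^sup>2 * (q (rad z) * ((B' (v (rad z)))\<^sup>2 - lam * (B (v (rad z)))\<^sup>2))" for z
  have Bc: "continuous_on UNIV B" using B_DERIV by (intro continuous_at_imp_continuous_on) (auto intro: DERIV_isCont)
  have Fc: "continuous_on UNIV F" using F_DERIV by (intro continuous_at_imp_continuous_on) (auto intro: DERIV_isCont)
  have ei: "set_integrable lborel A E" unfolding E_def
  proof (rule profile_integrable[OF _ _ q_cont])
    show "continuous_on UNIV (\<lambda>x. (B' x)\<^sup>2 - lam * (B x)\<^sup>2)"
      by (intro continuous_on_diff continuous_on_mult continuous_on_const continuous_on_power B'_cont Bc)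
  qed (simp add: B_zero B'_zero)
  have f_ff: "f z = ff z" if "z \<in> A" for z
    using F_zero[OF v_out[of "rad z"]] on_cone(1,2)[OF that] by (auto simp: f_def ff_def)
  have ffi: "set_integrable lborel A ff" unfolding ff_def
    by (intro profile_integrable Fc F_zero continuous_intros) auto
  have fi: "set_integrable lborel A f"
    using ffi by (rule iffD1[OF set_integrable_cong[OF refl refl], rotated]) (simp add: f_ff)
  have "(LINT z:A|lborel. - (1 / T) * E z) = 0"
  proof (rule integral_Euler_cone[OF compact_rad_le[of r2] _ fi])
    show "{z. rad z \<le> r2} \<subseteq> U" using ball_U r2_pos by auto
    show "set_integrable lborel A (\<lambda>z. - (1 / T) * E z)" by (rule set_integrable_mult_right) (rule ei) 
    show "f z = 0" if "z \<notin> {z. rad z \<le> r2}" for z using that by (simp add: f_def)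
    fix w assume w: "w \<in> A"
    note oc = on_cone[OF w]
    obtain V where V: "open V" "(1::real) \<in> V" "\<And>t. t \<in> V \<Longrightarrow> t *\<^sub>R w \<in> A"
      using eventually_scaleR_open[OF open_A w] by blast
    have dr: "((\<lambda>t. t * rad w) has_real_derivative rad w) (at 1)"
      using DERIV_cmult_right[OF DERIV_ident, of "rad w" 1 UNIV] by simp
    have dF: "((\<lambda>t. F (v (t * rad w))) has_real_derivative
       ((B' (v (rad w)))\<^sup>2 - lam * (B (v (rad w)))\<^sup>2) * (- Plog k (rad w / D) / T)) (at 1)"
    proof -
      have "((\<lambda>t. v (t * rad w)) has_real_derivative (- Plog k (rad w / D) / T / rad w) * rad w) (at 1)"
        by (rule DERIV_chain2[OF _ dr]) (use DERIV_v[OF oc(1,2)] in simp)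
      then have dv: "((\<lambda>t. v (t * rad w)) has_real_derivative (- Plog k (rad w / D) / T)) (at 1)" using oc(1) by simp
      show ?thesis by (rule DERIV_chain2[OF _ dv]) (use F_DERIV[of "v (rad w)"] in simp)
    qed
    have dp: "((\<lambda>t. (t * rad w) powr (- (?n + 1))) has_real_derivative - (?n + 1) * rad w powr (- (?n + 1))) (at 1)"
    proof -
      have "((\<lambda>t. (t * rad w) powr (- (?n + 1))) has_real_derivative
         (- (?n + 1)) * rad w powr (- (?n + 1) - 1) * rad w) (at 1)"
        by (rule DERIV_chain2[OF _ dr]) (use has_real_derivative_powr[OF oc(1), of "- (?n + 1)"] in simp)
      moreover have "rad w powr (- (?n + 1) - 1) * rad w = rad w powr (- (?n + 1))"
      proof -
        have "rad w powr (- (?n + 1) - 1) * rad w powr 1 = rad w powr ((- (?n + 1) - 1) + 1)" by (simp only: powr_add)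
        also have "(- (?n + 1) - 1) + 1 = - (?n + 1)" by simp
        finally show ?thesis using oc(1) by simp
      qed
      ultimately show ?thesis by (simp only: mult.assoc)
    qed
    have 1: "((\<lambda>t. (Psi p c (sn w))\<^sup>2 * ((t * rad w) powr (- (?n + 1)) * F (v (t * rad w)))) has_real_derivative
       - (1 / T) * E w - (?n + 1) * f w) (at 1)"
      by (rule DERIV_cong[OF DERIV_cmult[OF DERIV_mult[OF dp dF]]])
         (simp add: f_ff[OF w] ff_def E_def q_def algebra_simps)
    have eq: "(Psi p c (sn w))\<^sup>2 * ((t * rad w) powr (- (?n + 1)) * F (v (t * rad w))) = f (t *\<^sub>R w)"
      if "t \<in> V \<inter> {0<..}" for t
    proof -
      have t: "t > 0" "t *\<^sub>R w \<in> A" using that V(3) by auto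
      show ?thesis unfolding f_ff[OF t(2)] ff_def using t(1) by (simp add: sn_scale is_norm_scale[OF rad_norm])
    qed
    show "((\<lambda>t. f (t *\<^sub>R w)) has_real_derivative - (1 / T) * E w - (?n + 1) * f w) (at 1)"
      by (rule has_field_derivative_transform_within_open[OF 1 open_Int[OF V(1) open_greaterThan[of 0]] _ eq])
         (use V(2) in simp)
  qed
  moreover have "(LINT z:A|lborel. - (1 / T) * E z) = - (1 / T) * (LINT z:A|lborel. E z)"
    by (rule set_integral_mult_right)
  ultimately show ?thesis using T0 by (simp add: E_def)
qed

end

section \<open>Approximation by test functions\<close>

lemma set_integral_pos:
  fixes f :: "'b::euclidean_space \<Rightarrow> real"
  assumes A: "open A" and f: "set_integrable lborel A f" and cont: "continuous_on A f"
    and nonneg: "\<And>z. z \<in> A \<Longrightarrow> f z \<ge> 0" and z0: "z0 \<in> A" "f z0 > 0"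
  shows "(LINT z:A|lborel. f z) > 0"
proof -
  have "open (A \<inter> f -` {f z0 / 2<..})" using cont A by (simp add: continuous_on_open_vimage Int_commute)
  then obtain r where r: "r > 0" "ball z0 r \<subseteq> A \<inter> f -` {f z0 / 2<..}"
    by (rule openE[of _ z0]) (use z0 in auto)
  have bi: "integrable lborel (\<lambda>z. indicator (ball z0 r) z * (f z0 / 2))"
    by (intro integrable_mult_left integrable_real_indicator emeasure_bounded_finite) auto
  have "0 < measure lborel (ball z0 r) * (f z0 / 2)" using content_ball_pos[OF r(1), of z0] z0 by simp
  also have "\<dots> = (\<integral>z. indicator (ball z0 r) z * (f z0 / 2) \<partial>lborel)" by simp
  also have "\<dots> \<le> (\<integral>z. indicator A z * f z \<partial>lborel)"
  proof (rule integral_mono[OF bi])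
    show "integrable lborel (\<lambda>z. indicator A z * f z)" using f by (simp add: set_integrable_def)
    show "indicator (ball z0 r) z * (f z0 / 2) \<le> indicator A z * f z" for z
    proof (cases "z \<in> ball z0 r")
      case True
      then have "z \<in> A" "f z0 / 2 < f z" using r(2) by auto
      then show ?thesis using True by simp
    next
      case False
      then show ?thesis using nonneg[of z] by (auto simp: indicator_def)
    qed
  qed
  finally show ?thesis by (simp add: set_integral_indicator)
qed

lemma set_integral_tendsto_bounded:
  fixes f :: "nat \<Rightarrow> 'b::euclidean_space \<Rightarrow> real"
  assumes A: "A \<in> sets borel" "bounded A"
    and f: "\<And>j. set_borel_measurable lborel A (f j)"
    and f0: "set_borel_measurable lborel A f0"
    and lim: "\<And>z. z \<in> A \<Longrightarrow> (\<lambda>j. f j z) \<longlonglongrightarrow> f0 z"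
    and bound: "\<And>j z. z \<in> A \<Longrightarrow> \<bar>f j z\<bar> \<le> C"
  shows "(\<lambda>j. LINT z:A|lborel. f j z) \<longlonglongrightarrow> (LINT z:A|lborel. f0 z)"
  unfolding set_lebesgue_integral_def
proof (rule integral_dominated_convergence[where w="\<lambda>z. indicator A z * C"])
  show "(\<lambda>z. indicator A z *\<^sub>R f0 z) \<in> borel_measurable lborel" "(\<lambda>z. indicator A z *\<^sub>R f j z) \<in> borel_measurable lborel" for j
    using f[of j] f0 by (simp_all add: set_borel_measurable_def)
  have "emeasure lborel A < \<infinity>" using A(2) by (rule emeasure_bounded_finite)
  then show "integrable lborel (\<lambda>z. indicator A z * C)" using A(1) by (intro integrable_mult_left) simp
  show "AE z in lborel. (\<lambda>j. indicator A z *\<^sub>R f j z) \<longlonglongrightarrow> indicator A z *\<^sub>R f0 z"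
    using lim by (intro AE_I2) (auto simp: indicator_def)
  show "AE z in lborel. norm (indicator A z *\<^sub>R f j z) \<le> indicator A z * C" for j
    using bound by (intro AE_I2) (auto simp: indicator_def)
qed

context hardy_setting begin

text \<open>All functions vanish for \<open>rad z < e\<close>, so the singularity of the weight is harmless and bounded
  convergence applies.\<close>

lemma hardy_term_tendsto:
  assumes u: "\<And>j. continuous_on UNIV (u j)" "continuous_on UNIV u'" and w: "BC (\<lambda>z. w (rad z / D))"
    and e: "e > 0" and away: "\<And>j z. u j z \<noteq> 0 \<Longrightarrow> e \<le> rad z"
    and bound: "\<And>j z. \<bar>u j z\<bar> \<le> C" and lim: "\<And>z. (\<lambda>j. u j z) \<longlonglongrightarrow> u' z"
  shows "(\<lambda>j. hardy_term H A w (u j)) \<longlonglongrightarrow> hardy_term H A w u'"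
proof -
  obtain W where W: "\<And>z. z \<in> A \<Longrightarrow> \<bar>w (rad z / D)\<bar> \<le> W" using w unfolding BC_def by blast
  have m: "set_borel_measurable lborel A (\<lambda>z. w (rad z / D) / (rad z)\<^sup>2 * (v z)\<^sup>2)" if "continuous_on UNIV v" for v
  proof -
    have "continuous_on A (\<lambda>z. w (rad z / D) / (rad z)\<^sup>2 * (v z)\<^sup>2)"
      by (intro continuous_on_mult continuous_on_divide BC_cont[OF w] continuous_on_power BC_cont[OF BC_rad]
          continuous_on_subset[OF that]) (use cone_rad_pos[OF A_cone] in force)+
    then have "(\<lambda>z. indicator A z *\<^sub>R (w (rad z / D) / (rad z)\<^sup>2 * (v z)\<^sup>2)) \<in> borel_measurable borel"
      by (rule borel_measurable_continuous_on_indicator[rotated]) (use open_A in simp)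
    then show ?thesis unfolding set_borel_measurable_def by (simp only: measurable_cong_sets[OF sets_lborel refl])
  qed
  show ?thesis unfolding hardy_term_eq
  proof (rule set_integral_tendsto_bounded[OF _ bounded_A m[OF u(1)] m[OF u(2)]])
    show "A \<in> sets borel" using open_A by simp
    show "(\<lambda>j. w (rad z / D) / (rad z)\<^sup>2 * (u j z)\<^sup>2) \<longlonglongrightarrow> w (rad z / D) / (rad z)\<^sup>2 * (u' z)\<^sup>2" for z
      by (intro tendsto_intros lim)
    fix j z assume z: "z \<in> A"
    have Wp: "0 \<le> W" using W[OF z] by linarith
    show "\<bar>w (rad z / D) / (rad z)\<^sup>2 * (u j z)\<^sup>2\<bar> \<le> W / e\<^sup>2 * C\<^sup>2"
    proof (cases "u j z = 0")
      case True
      then show ?thesis using Wp by simp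
    next
      case False
      have r: "e \<le> rad z" by (rule away[OF False])
      have "\<bar>w (rad z / D) / (rad z)\<^sup>2\<bar> \<le> W / e\<^sup>2"
        unfolding abs_divide using W[OF z] Wp e r by (intro frac_le) (auto intro: power_mono)
      moreover have "(u j z)\<^sup>2 \<le> C\<^sup>2" using power_mono[OF bound abs_ge_zero, of j z 2] by simp
      ultimately show ?thesis unfolding abs_mult by (intro mult_mono) (use Wp in auto)
    qed
  qed
qed

end

context near_optimizer begin

lemma k_sum: assumes "k \<ge> 1" shows "(\<Sum>i=1..k. f i :: real) = (\<Sum>i=1..<k. f i) + f k"
proof -
  have "{1..k} = insert k {1..<k}" using assms by auto
  then show ?thesis by simp
qed

lemma E0_cont: "continuous_on UNIV E0"
  unfolding E0_def by (intro continuous_on_add continuous_on_power compose_H0_cont gr_cont gy_cont)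

lemma B_cont: "continuous_on UNIV B"
  using B_DERIV by (intro continuous_at_imp_continuous_on) (auto intro: DERIV_isCont)

lemma hardy_u0: "hardy_term H A (\<lambda>\<rho>. (Plog k \<rho>)\<^sup>2) u0
    = (LINT z:A|lborel. (Psi p c (sn z))\<^sup>2 * (q (rad z) * (B (v (rad z)))\<^sup>2))"
  unfolding hardy_term_eq
  by (rule set_lebesgue_integral_cong) (use open_A hardy_density in auto)

lemma profile_B_integrable:
  "set_integrable lborel A (\<lambda>z. (Psi p c (sn z))\<^sup>2 * (q (rad z) * (B (v (rad z)))\<^sup>2))"
  "set_integrable lborel A (\<lambda>z. (Psi p c (sn z))\<^sup>2 * (q (rad z) * (B' (v (rad z)))\<^sup>2))"
proof -
  show "set_integrable lborel A (\<lambda>z. (Psi p c (sn z))\<^sup>2 * (q (rad z) * (B (v (rad z)))\<^sup>2))"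
    by (rule profile_integrable[where f="\<lambda>x. (B x)\<^sup>2", OF _ _ q_cont])
       (auto intro!: continuous_on_power B_cont simp: B_zero)
  show "set_integrable lborel A (\<lambda>z. (Psi p c (sn z))\<^sup>2 * (q (rad z) * (B' (v (rad z)))\<^sup>2))"
    by (rule profile_integrable[where f="\<lambda>x. (B' x)\<^sup>2", OF _ _ q_cont])
       (auto intro!: continuous_on_power B'_cont simp: B'_zero)
qed

text \<open>The master identity holds for \<open>u0\<close> although \<open>u0\<close> need not be differentiable; the excess is then computed
  by \<open>deficit_density\<close> and \<open>Euler_profile\<close>.\<close>

lemma deficit_total:
  assumes k1: "k \<ge> 1"
  shows "(LINT z:A|lborel. E0 z) - K_const \<theta> DIM('a) b * boundary_term H \<theta> u0
     - (b - 2)\<^sup>2 / 4 * hardy_term H A (\<lambda>_. 1) u0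
     - 1/4 * (\<Sum>i=1..<k. hardy_term H A (\<lambda>\<rho>. (Plog i \<rho>)\<^sup>2) u0)
     = (1/4 + lam / T\<^sup>2) * hardy_term H A (\<lambda>\<rho>. (Plog k \<rho>)\<^sup>2) u0"
proof -
  define IB where "IB z = (Psi p c (sn z))\<^sup>2 * (q (rad z) * (B (v (rad z)))\<^sup>2)" for z
  define IB' where "IB' z = (Psi p c (sn z))\<^sup>2 * (q (rad z) * (B' (v (rad z)))\<^sup>2)" for z
  have int: "set_integrable lborel A IB" "set_integrable lborel A IB'"
    unfolding IB_def IB'_def by (rule profile_B_integrable)+
  have h: "hardy_term H A (\<lambda>\<rho>. (Plog k \<rho>)\<^sup>2) u0 = (LINT z:A|lborel. IB z)"
    unfolding IB_def by (rule hardy_u0)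
  note mi = master_identity[OF u0_admissible, of k]
  have "(LINT z:A|lborel. IB' z - lam * IB z) = 0"
    using Euler_profile by (simp add: IB_def IB'_def algebra_simps)
  moreover have "(LINT z:A|lborel. IB' z - lam * IB z) = (LINT z:A|lborel. IB' z) - lam * (LINT z:A|lborel. IB z)"
    using set_integral_diff(2)[OF int(2) set_integrable_mult_right[of lam, OF int(1)]] by simp
  ultimately have 1: "(LINT z:A|lborel. IB' z) = lam * (LINT z:A|lborel. IB z)" by simp
  have "(LINT z:A|lborel. E0 z) = (LINT z:A|lborel. S k u0 uz uy z + (1 / T\<^sup>2) * IB' z)"
    by (rule set_lebesgue_integral_cong) (use open_A deficit_density in \<open>auto simp: IB'_def\<close>)
  also have "\<dots> = (LINT z:A|lborel. S k u0 uz uy z) + (1 / T\<^sup>2) * (LINT z:A|lborel. IB' z)"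
    using set_integral_add(2)[OF mi(1) set_integrable_mult_right[of "1 / T\<^sup>2", OF int(2)]] by simp
  finally have 2: "(LINT z:A|lborel. E0 z) = (LINT z:A|lborel. S k u0 uz uy z) + (1 / T\<^sup>2) * (lam * (LINT z:A|lborel. IB z))"
    unfolding 1 .
  show ?thesis unfolding 2 mi(2) k_sum[OF k1] h by (simp add: algebra_simps)
qed

lemma hardy_u0_pos: "hardy_term H A (\<lambda>\<rho>. (Plog k \<rho>)\<^sup>2) u0 > 0"
proof -
  have "continuous_on {r1..r2} v" by (rule continuous_on_subset[OF v_cont]) (use r1 r2D in auto)
  moreover have "v r2 \<le> 1/2" "1/2 \<le> v r1" using v_le_0[of r2] v_ge_1[of r1] r1 r12 r2D by auto
  ultimately obtain r where r: "r1 \<le> r" "r \<le> r2" "v r = 1/2" using IVT2'[of v r2 "1/2" r1] r12 by auto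
  have rD: "0 < r" "r < D" using r r1 r2D by auto
  define z where "z = (0::'a, r)"
  have rz: "rad z = r" using rD by (simp add: z_def rad_eq is_norm_zero[OF H0_norm])
  have z: "z \<in> A"
    using ball_U[of z] rz r r1 rD r2_pos by (simp add: A_def z_def cone_iff is_norm_zero[OF H0_norm])
  have q0: "q r \<ge> 0" if "0 < r" "r < D" for r using q_eq[OF that] by (metis zero_le_divide_iff zero_le_mult_iff zero_le_power2)
  have qp: "q r > 0" using rho[OF rD] Plog_pos[of "r / D" k] rD by (simp add: q_def)
  show ?thesis unfolding hardy_u0
  proof (rule set_integral_pos[OF open_A profile_B_integrable(1) _ _ z])
    show "continuous_on A (\<lambda>z. (Psi p c (sn z))\<^sup>2 * (q (rad z) * (B (v (rad z)))\<^sup>2))"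
      by (rule BC_cont, rule BC_profile[where f="\<lambda>x. (B x)\<^sup>2", OF q_cont])
         (auto intro!: continuous_on_power B_cont simp: B_zero)
    show "0 \<le> (Psi p c (sn z))\<^sup>2 * (q (rad z) * (B (v (rad z)))\<^sup>2)" if "z \<in> A" for z
      using q0[of "rad z"] on_cone(1,2)[OF that] by simp
    have "Psi p c (sn z) > 0" by (rule Psi_pos[OF p_pos c_pos sn_gt[OF z]])
    then show "0 < (Psi p c (sn z))\<^sup>2 * (q (rad z) * (B (v (rad z)))\<^sup>2)"
      using qp B_pos[of "1/2"] by (simp add: rz r(3))
  qed
qed

text \<open>Replacing \<open>H\<^sub>0\<close> by a smooth \<open>M\<close> turns the profile into a test function. Since the gradient of \<open>M\<close> has \<open>H\<close>-norm at most
  1, its energy density is at most that of the profile at \<open>(M x, y)\<close>.\<close>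

lemma approximant:
  assumes M: "smooth_on UNIV M" "\<And>x. (1 - \<eta>) * H0 x - \<eta> \<le> M x"
    "\<And>x. \<exists>d. GDERIV M x :> d \<and> H d \<le> 1" and \<eta>: "0 < \<eta>" "\<eta> \<le> 1/4" "\<eta> \<le> r2 / 2"
  defines "u \<equiv> \<lambda>z. g (M (fst z), snd z)"
  shows "u \<in> test_functions U" "\<And>z. u z \<noteq> 0 \<Longrightarrow> e \<le> snd z \<and> rad z \<le> 3 * r2"
    "\<And>z. (Phi H (grad u z))\<^sup>2 \<le> (gr (M (fst z), snd z))\<^sup>2 + (gy (M (fst z), snd z))\<^sup>2"
proof -
  have "smooth_on UNIV (\<lambda>z::'a \<times> real. M (fst z))"
    unfolding smooth_on_def
  proof
    fix m
    show "Ck_on m (\<lambda>z::'a \<times> real. M (fst z)) UNIV"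
    proof (rule Ck_on_compose[where f=fst and h=M, OF open_UNIV open_UNIV])
      show "Ck_on m M UNIV" using M(1) by (simp add: smooth_on_def)
      fix i :: 'a
      show "Ck_on m (\<lambda>x::'a \<times> real. fst x \<bullet> i) UNIV"
        by (intro Ck_on_bounded_linear bounded_linear_compose[OF bounded_linear_inner_left bounded_linear_fst])
    qed simp
  qed
  from smooth_on_compose2[OF open_UNIV open_UNIV _ smooth_g this smooth_on_bounded_linear[OF bounded_linear_snd]]
  have sm: "smooth_on UNIV u" unfolding u_def by simp
  show supp: "e \<le> snd z \<and> rad z \<le> 3 * r2" if nz: "u z \<noteq> 0" for z
  proof -
    have 1: "(M (fst z))\<^sup>2 + (snd z)\<^sup>2 < r2\<^sup>2" and 2: "e < snd z"
      using nz g_zero[of "(M (fst z), snd z)"] by (auto simp: u_def not_less[symmetric])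
    have "\<bar>M (fst z)\<bar>\<^sup>2 < r2\<^sup>2" "\<bar>snd z\<bar>\<^sup>2 < r2\<^sup>2"
      using 1 zero_le_power2[of "snd z"] zero_le_power2[of "M (fst z)"] unfolding power2_abs by linarith+
    then have "\<bar>M (fst z)\<bar> < r2" "\<bar>snd z\<bar> < r2" using power2_less_imp_less[OF _ less_imp_le[OF r2_pos]] by blast+
    then have 3: "M (fst z) \<le> r2" "\<bar>snd z\<bar> \<le> r2" by auto
    have "(3/4) * H0 (fst z) \<le> (1 - \<eta>) * H0 (fst z)"
      using \<eta>(2) is_norm_nonneg[OF H0_norm, of "fst z"] by (intro mult_right_mono) auto
    then have 4: "H0 (fst z) \<le> 2 * r2" using M(2)[of "fst z"] 3(1) \<eta>(3) by linarith
    have "(rad z)\<^sup>2 \<le> (2 * r2)\<^sup>2 + r2\<^sup>2"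
      unfolding rad_sq using power_mono[OF 4 is_norm_nonneg[OF H0_norm], of 2] power_mono[OF 3(2) abs_ge_zero, of 2] by simp
    also have "\<dots> \<le> (3 * r2)\<^sup>2" using r2_pos by (simp add: power_mult_distrib)
    finally have "rad z \<le> 3 * r2" by (rule power2_le_imp_le) (use r2_pos in simp)
    then show ?thesis using 2 by simp
  qed
  have cl: "closure {z. u z \<noteq> 0} \<subseteq> {z. rad z \<le> 3 * r2}"
    by (rule closure_minimal) (use supp compact_imp_closed[OF compact_rad_le] in auto)
  then have "compact (closure {z. u z \<noteq> 0})"
    using compact_rad_le[of "3 * r2"] by (metis closed_closure closed_subset compact_Int_closed inf.absorb_iff2)
  then show "u \<in> test_functions U"
    using sm cl ball_U unfolding test_functions_def smooth_on_def by auto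
  fix z :: "'a \<times> real"
  obtain d where d: "GDERIV M (fst z) :> d" "H d \<le> 1" using M(3) by blast
  let ?gr = "gr (M (fst z), snd z)" and ?gy = "gy (M (fst z), snd z)"
  have "(M has_derivative (\<lambda>h. h \<bullet> d)) (at (fst z))" using d(1) by (simp add: gderiv_def)
  from has_derivative_compose[OF has_derivative_fst[OF has_derivative_ident] this]
  have "((\<lambda>z. M (fst z)) has_derivative (\<lambda>h. fst h \<bullet> d)) (at z)" by simp
  from has_derivative_compose[OF has_derivative_Pair[OF this has_derivative_snd[OF has_derivative_ident]] g_has_derivative]
  have "(u has_derivative (\<lambda>h. fst h \<bullet> d * ?gr + snd h * ?gy)) (at z)" by (simp add: u_def)
  moreover have "(\<lambda>h. fst h \<bullet> d * ?gr + snd h * ?gy) = (\<lambda>h. h \<bullet> (?gr *\<^sub>R d, ?gy))"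
    by (rule ext) (simp add: inner_prod_def)
  ultimately have "GDERIV u z :> (?gr *\<^sub>R d, ?gy)" by (simp add: gderiv_def)
  then have "grad u z = (?gr *\<^sub>R d, ?gy)" by (rule grad_eq)
  then have "(Phi H (grad u z))\<^sup>2 = ?gr\<^sup>2 * (H d)\<^sup>2 + ?gy\<^sup>2"
    by (simp add: Phi_def is_norm_scale[OF H] power_mult_distrib)
  moreover have "?gr\<^sup>2 * (H d)\<^sup>2 \<le> ?gr\<^sup>2 * 1"
    using d(2) is_norm_nonneg[OF H, of d] by (intro mult_left_mono) (auto simp: power_le_one)
  ultimately show "(Phi H (grad u z))\<^sup>2 \<le> ?gr\<^sup>2 + ?gy\<^sup>2" by simp
qed

lemma plane_bounded:
  fixes f :: "real \<times> real \<Rightarrow> real"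
  assumes "continuous_on UNIV f" "\<And>z. (fst z)\<^sup>2 + (snd z)\<^sup>2 > r2\<^sup>2 \<Longrightarrow> f z = 0"
  obtains C where "\<And>z. \<bar>f z\<bar> \<le> C"
proof -
  have "compact (f ` cball 0 r2)"
    by (rule compact_continuous_image[OF continuous_on_subset[OF assms(1)] compact_cball]) simp
  from compact_imp_bounded[OF this] obtain C where C: "\<forall>y\<in>f ` cball 0 r2. norm y \<le> C"
    unfolding bounded_iff by (elim exE)
  have "\<bar>f z\<bar> \<le> max C 0" for z
  proof (cases "z \<in> cball 0 r2")
    case True
    then show ?thesis using bspec[OF C imageI[OF True]] by simp
  next
    case False
    then have "norm z > r2" by simp
    then have "(norm z)\<^sup>2 > r2\<^sup>2" using r2_pos by (intro power_strict_mono) auto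
    then have "f z = 0" by (intro assms(2)) (simp add: norm_prod_def)
    then show ?thesis by simp
  qed
  then show thesis by (rule that)
qed

text \<open>Smooth approximations of \<open>H\<^sub>0\<close> give test functions whose Hardy and boundary terms converge to those of \<open>u0\<close>
  and whose energies are at most integrals that converge to the integral of \<open>E0\<close>. Since \<open>lam / T\<^sup>2 < \<epsilon>\<close>, the
  desired strict inequality for \<open>u0\<close> passes to some approximation.\<close>

lemma near_optimal_function:
  assumes k1: "k \<ge> 1" and \<epsilon>: "lam / T\<^sup>2 < \<epsilon>"
  obtains u where "u \<in> test_functions U" "\<And>z. u z \<noteq> 0 \<Longrightarrow> e \<le> snd z \<and> rad z \<le> 3 * r2"
    "hardy_term H A (\<lambda>\<rho>. (Plog k \<rho>)\<^sup>2) u > 0"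
    "I_functional H \<theta> b A k u \<le> (1/4 + \<epsilon>) * hardy_term H A (\<lambda>\<rho>. (Plog k \<rho>)\<^sup>2) u"
proof -
  define m where "m = min (1/4) (r2 / 2)"
  define \<eta> where "\<eta> = (\<lambda>j. m * inverse (real (Suc j)))"
  have m: "0 < m" "m \<le> 1/4" "m \<le> r2 / 2" using r2_pos by (simp_all add: m_def)
  have \<eta>: "0 < \<eta> j" "\<eta> j \<le> 1/4" "\<eta> j \<le> r2 / 2" for j
  proof -
    show "0 < \<eta> j" using m(1) by (simp add: \<eta>_def)
    have "inverse (real (Suc j)) \<le> 1" by (simp add: inverse_le_1_iff)
    from mult_left_mono[OF this, of m] have "\<eta> j \<le> m" using m(1) by (simp add: \<eta>_def)
    then show "\<eta> j \<le> 1/4" "\<eta> j \<le> r2 / 2" using m by auto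
  qed
  have \<eta>_lim: "\<eta> \<longlonglongrightarrow> 0"
    using tendsto_mult_left[OF LIMSEQ_inverse_real_of_nat, of m] by (simp add: \<eta>_def del: of_nat_Suc)
  have "\<forall>j. \<exists>M. smooth_on UNIV M \<and> (\<forall>x. (1 - \<eta> j) * H0 x - \<eta> j \<le> M x) \<and> (\<forall>x. M x \<le> H0 x) \<and>
      (\<forall>x. \<exists>d. GDERIV M x :> d \<and> H d \<le> 1)"
  proof
    fix j
    show "\<exists>M. smooth_on UNIV M \<and> (\<forall>x. (1 - \<eta> j) * H0 x - \<eta> j \<le> M x) \<and> (\<forall>x. M x \<le> H0 x) \<and>
      (\<forall>x. \<exists>d. GDERIV M x :> d \<and> H d \<le> 1)"
      by (rule smooth_norm_approximation[OF H \<eta>(1)[of j]]) blast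
  qed
  then obtain M where M0: "\<forall>j. smooth_on UNIV (M j) \<and> (\<forall>x. (1 - \<eta> j) * H0 x - \<eta> j \<le> M j x) \<and> (\<forall>x. M j x \<le> H0 x) \<and>
      (\<forall>x. \<exists>d. GDERIV (M j) x :> d \<and> H d \<le> 1)" by (rule choice[THEN exE])
  have M: "smooth_on UNIV (M j)" "(1 - \<eta> j) * H0 x - \<eta> j \<le> M j x" "M j x \<le> H0 x"
    "\<exists>d. GDERIV (M j) x :> d \<and> H d \<le> 1" for j x using M0 by blast+
  have M_lim: "(\<lambda>j. M j x) \<longlonglongrightarrow> H0 x" for x
  proof (rule tendsto_sandwich[OF always_eventually always_eventually])
    show "\<forall>j. (1 - \<eta> j) * H0 x - \<eta> j \<le> M j x" "\<forall>j. M j x \<le> H0 x" using M(2,3) by auto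
    show "(\<lambda>j. (1 - \<eta> j) * H0 x - \<eta> j) \<longlonglongrightarrow> H0 x"
      using tendsto_diff[OF tendsto_mult_right[OF tendsto_diff[OF tendsto_const[of 1] \<eta>_lim], of "H0 x"] \<eta>_lim] by simp
  qed simp
  define u where "u = (\<lambda>j z. g (M j (fst z), snd z))"
  define E where "E = (\<lambda>j z. (gr (M j (fst z), snd z))\<^sup>2 + (gy (M j (fst z), snd z))\<^sup>2)"
  note ap = approximant[OF M(1,2,4) \<eta>]
  have u_test: "u j \<in> test_functions U" for j unfolding u_def by (rule ap(1))
  have u_supp: "e \<le> snd z \<and> rad z \<le> 3 * r2" if "u j z \<noteq> 0" for j z
    using ap(2)[of j z] that by (simp add: u_def)
  have u_grad: "(Phi H (grad (u j) z))\<^sup>2 \<le> E j z" for j z unfolding u_def E_def by (rule ap(3))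
  have u_cont: "continuous_on UNIV (u j)" for j by (rule test_function_grad(3)[OF u_test])
  have lim2: "(\<lambda>j. f (M j (fst z), snd z)) \<longlonglongrightarrow> f (H0 (fst z), snd z)"
    if "continuous_on UNIV f" for f :: "real \<times> real \<Rightarrow> real" and z :: "'a \<times> real"
  proof -
    have 1: "isCont f (H0 (fst z), snd z)" using that by (simp add: continuous_on_eq_continuous_at)
    have 2: "(\<lambda>j. (M j (fst z), snd z)) \<longlonglongrightarrow> (H0 (fst z), snd z)" by (intro tendsto_Pair M_lim tendsto_const)
    show ?thesis by (rule isCont_tendsto_compose[OF 1 2])
  qed
  have u_lim: "(\<lambda>j. u j z) \<longlonglongrightarrow> u0 z" for z unfolding u_def u0_def by (rule lim2[OF g_cont])
  obtain Cg where Cg: "\<And>z. \<bar>g z\<bar> \<le> Cg" by (rule plane_bounded[OF g_cont g_zero(1)]) auto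
  obtain Cr where Cr: "\<And>z. \<bar>gr z\<bar> \<le> Cr" by (rule plane_bounded[OF gr_cont gr_gy_zero(1)]) auto
  obtain Cy where Cy: "\<And>z. \<bar>gy z\<bar> \<le> Cy" by (rule plane_bounded[OF gy_cont gr_gy_zero(2)]) auto
  have u_bound: "\<bar>u j z\<bar> \<le> Cg" for j z unfolding u_def by (rule Cg)
  have hardy_lim: "(\<lambda>j. hardy_term H A w (u j)) \<longlonglongrightarrow> hardy_term H A w u0" if "BC (\<lambda>z. w (rad z / D))" for w
  proof (rule hardy_term_tendsto[OF u_cont _ that e0 _ u_bound u_lim])
    show "continuous_on UNIV u0" using u0_admissible by (simp add: admissible_def)
    show "e \<le> rad z" if "u j z \<noteq> 0" for j z using u_supp[OF that] abs_snd_le_rad[of z] by linarith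
  qed
  have P_lim: "(\<lambda>j. hardy_term H A (\<lambda>\<rho>. (Plog i \<rho>)\<^sup>2) (u j)) \<longlonglongrightarrow> hardy_term H A (\<lambda>\<rho>. (Plog i \<rho>)\<^sup>2) u0" for i
    by (intro hardy_lim BC_power BC_Plog)
  have M_cont: "continuous_on UNIV (M j)" for j
  proof -
    have "Ck_on 0 (M j) UNIV" using M(1) unfolding smooth_on_def by blast
    then show ?thesis by simp
  qed
  have E_cont: "continuous_on UNIV (E j)" for j
    unfolding E_def
    by (intro continuous_on_add continuous_on_power continuous_on_compose2[OF gr_cont] continuous_on_compose2[OF gy_cont]
        continuous_on_Pair continuous_on_compose2[OF M_cont] continuous_on_fst continuous_on_snd continuous_on_id) auto
  have mA: "set_borel_measurable lborel A f" if "continuous_on UNIV f" for f :: "'a \<times> real \<Rightarrow> real"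
  proof -
    have "(\<lambda>z. indicator A z *\<^sub>R f z) \<in> borel_measurable borel"
      by (rule borel_measurable_continuous_on_indicator[OF _ continuous_on_subset[OF that]]) (use open_A in auto)
    then show ?thesis unfolding set_borel_measurable_def by (simp only: measurable_cong_sets[OF sets_lborel refl])
  qed
  have E_bound: "\<bar>E j z\<bar> \<le> Cr\<^sup>2 + Cy\<^sup>2" for j z
    unfolding E_def using power_mono[OF Cr abs_ge_zero, of "(M j (fst z), snd z)" 2] power_mono[OF Cy abs_ge_zero, of "(M j (fst z), snd z)" 2]
    by simp
  have A_sets: "A \<in> sets borel" using open_A by simp
  have E_lim: "(\<lambda>j. LINT z:A|lborel. E j z) \<longlonglongrightarrow> (LINT z:A|lborel. E0 z)"
  proof (rule set_integral_tendsto_bounded[OF A_sets bounded_A mA[OF E_cont] mA[OF E0_cont] _ E_bound])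
    show "(\<lambda>j. E j z) \<longlonglongrightarrow> E0 z" for z
      unfolding E_def E0_def by (intro tendsto_add tendsto_power lim2 gr_cont gy_cont)
  qed
  have E_ge: "energy H A (u j) \<le> (LINT z:A|lborel. E j z)" for j
    unfolding energy_def
  proof (rule set_integral_mono[OF energy_integrable[OF u_test]])
    have "set_integrable lborel A (\<lambda>z. Cr\<^sup>2 + Cy\<^sup>2)"
      unfolding set_integrable_def using A_sets emeasure_bounded_finite[OF bounded_A]
      by (intro integrable_scaleR_left integrable_real_indicator) simp_all
    then show "set_integrable lborel A (E j)"
    proof (rule set_integrable_bound)
      show "AE z in lborel. z \<in> A \<longrightarrow> norm (E j z) \<le> norm (Cr\<^sup>2 + Cy\<^sup>2)" using E_bound[of j] by (intro AE_I2) simp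
    qed (rule mA[OF E_cont])
  qed (rule u_grad)
  have bd_lim: "(\<lambda>j. boundary_term H \<theta> (u j)) \<longlonglongrightarrow> boundary_term H \<theta> u0"
  proof -
    define Q where "Q = {x. H0 x \<le> 3 * r2}"
    have Qm: "Q \<in> sets borel" unfolding Q_def
      by (intro borel_closed closed_Collect_le is_norm_continuous[OF H0_norm] continuous_on_const)
    obtain c0 where c0: "c0 > 0" "\<And>x. c0 * norm x \<le> H0 x" using is_norm_ge_norm[OF H0_norm] by blast
    have "norm x \<le> 3 * r2 / c0" if "x \<in> Q" for x
      using order_trans[OF c0(2)[of x], of "3 * r2"] that c0(1) by (simp add: Q_def field_simps)
    then have Qb: "bounded Q" unfolding bounded_iff by blast
    have meas: "(\<lambda>x. (f (x, tan \<theta> * H0 x))\<^sup>2 / H0 x) \<in> borel_measurable lborel"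
      if "continuous_on UNIV f" for f :: "'a \<times> real \<Rightarrow> real"
    proof -
      have "continuous_on UNIV (\<lambda>x. f (x, tan \<theta> * H0 x))"
        by (intro continuous_on_compose2[OF that] continuous_on_Pair continuous_on_id continuous_on_mult continuous_on_const
            is_norm_continuous[OF H0_norm]) auto
      then have "(\<lambda>x. (f (x, tan \<theta> * H0 x))\<^sup>2 / H0 x) \<in> borel_measurable borel"
        by (intro borel_measurable_divide borel_measurable_power borel_measurable_continuous_onI is_norm_continuous[OF H0_norm])
      then show ?thesis by (simp only: measurable_cong_sets[OF sets_lborel refl])
    qed
    show ?thesis unfolding boundary_term_def
    proof (rule integral_dominated_convergence[where w="\<lambda>x. indicator Q x * (Cg\<^sup>2 / (e / tan \<theta>))"])
      show "(\<lambda>x. (u0 (x, tan \<theta> * H0 x))\<^sup>2 / H0 x) \<in> borel_measurable lborel"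
        by (rule meas) (use u0_admissible in \<open>simp add: admissible_def\<close>)
      show "(\<lambda>x. (u j (x, tan \<theta> * H0 x))\<^sup>2 / H0 x) \<in> borel_measurable lborel" for j by (rule meas[OF u_cont])
      show "integrable lborel (\<lambda>x. indicator Q x * (Cg\<^sup>2 / (e / tan \<theta>)))"
        using Qm emeasure_bounded_finite[OF Qb] by (intro integrable_mult_left integrable_real_indicator) simp_all
      show "AE x in lborel. (\<lambda>j. (u j (x, tan \<theta> * H0 x))\<^sup>2 / H0 x) \<longlonglongrightarrow> (u0 (x, tan \<theta> * H0 x))\<^sup>2 / H0 x"
        unfolding divide_inverse by (intro AE_I2 tendsto_mult_right tendsto_power u_lim)
      show "AE x in lborel. norm ((u j (x, tan \<theta> * H0 x))\<^sup>2 / H0 x) \<le> indicator Q x * (Cg\<^sup>2 / (e / tan \<theta>))" for j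
      proof (rule AE_I2)
        fix x
        have Cp: "0 \<le> Cg\<^sup>2 / (e / tan \<theta>)" using e0 tan_pos by simp
        show "norm ((u j (x, tan \<theta> * H0 x))\<^sup>2 / H0 x) \<le> indicator Q x * (Cg\<^sup>2 / (e / tan \<theta>))"
        proof (cases "u j (x, tan \<theta> * H0 x) = 0")
          case True
          then show ?thesis using Cp by (cases "x \<in> Q") simp_all
        next
          case False
          from u_supp[OF this] have s: "e \<le> tan \<theta> * H0 x" "rad (x, tan \<theta> * H0 x) \<le> 3 * r2" by simp_all
          have "(H0 x)\<^sup>2 \<le> (rad (x, tan \<theta> * H0 x))\<^sup>2" unfolding rad_sq by simp
          then have "H0 x \<le> rad (x, tan \<theta> * H0 x)"
            by (rule power2_le_imp_le) (rule is_norm_nonneg[OF rad_norm])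
          then have "x \<in> Q" using s(2) by (simp add: Q_def)
          moreover have "e / tan \<theta> \<le> H0 x" using s(1) tan_pos by (simp add: field_simps)
          moreover have "(u j (x, tan \<theta> * H0 x))\<^sup>2 \<le> Cg\<^sup>2"
            using power_mono[OF u_bound abs_ge_zero, of j _ 2] by simp
          ultimately have "(u j (x, tan \<theta> * H0 x))\<^sup>2 / H0 x \<le> Cg\<^sup>2 / (e / tan \<theta>)"
            using e0 tan_pos by (intro frac_le) auto
          then show ?thesis using \<open>x \<in> Q\<close> is_norm_nonneg[OF H0_norm, of x] by simp
        qed
      qed
    qed
  qed
  let ?h = "\<lambda>v. hardy_term H A (\<lambda>\<rho>. (Plog k \<rho>)\<^sup>2) v"
  define J where "J = (\<lambda>j. (LINT z:A|lborel. E j z) - K_const \<theta> DIM('a) b * boundary_term H \<theta> (u j)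
     - (b - 2)\<^sup>2 / 4 * hardy_term H A (\<lambda>_. 1) (u j)
     - 1/4 * (\<Sum>i=1..<k. hardy_term H A (\<lambda>\<rho>. (Plog i \<rho>)\<^sup>2) (u j)))"
  have "J \<longlonglongrightarrow> (LINT z:A|lborel. E0 z) - K_const \<theta> DIM('a) b * boundary_term H \<theta> u0
     - (b - 2)\<^sup>2 / 4 * hardy_term H A (\<lambda>_. 1) u0
     - 1/4 * (\<Sum>i=1..<k. hardy_term H A (\<lambda>\<rho>. (Plog i \<rho>)\<^sup>2) u0)"
    unfolding J_def by (intro tendsto_diff tendsto_mult tendsto_const tendsto_sum E_lim bd_lim hardy_lim BC_const BC_power BC_Plog)
  then have J_lim: "J \<longlonglongrightarrow> (1/4 + lam / T\<^sup>2) * ?h u0" unfolding deficit_total[OF k1] .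
  have "(\<lambda>j. (1/4 + \<epsilon>) * ?h (u j) - J j) \<longlonglongrightarrow> (1/4 + \<epsilon>) * ?h u0 - (1/4 + lam / T\<^sup>2) * ?h u0"
    by (intro tendsto_diff tendsto_mult tendsto_const P_lim J_lim)
  moreover have "(1/4 + \<epsilon>) * ?h u0 - (1/4 + lam / T\<^sup>2) * ?h u0 > 0"
    using mult_strict_right_mono[OF \<epsilon> hardy_u0_pos] by (simp add: algebra_simps)
  ultimately have "\<forall>\<^sub>F j in sequentially. 0 < (1/4 + \<epsilon>) * ?h (u j) - J j" by (rule order_tendstoD(1))
  moreover have "\<forall>\<^sub>F j in sequentially. 0 < ?h (u j)" by (rule order_tendstoD(1)[OF P_lim hardy_u0_pos])
  ultimately have "\<forall>\<^sub>F j in sequentially. 0 < (1/4 + \<epsilon>) * ?h (u j) - J j \<and> 0 < ?h (u j)" by (rule eventually_conj)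
  then obtain j where j: "0 < (1/4 + \<epsilon>) * ?h (u j) - J j" "0 < ?h (u j)"
    using eventually_happens'[OF sequentially_bot] by blast
  have "I_functional H \<theta> b A k (u j) \<le> J j" unfolding I_functional_def J_def using E_ge[of j] by simp
  then have "I_functional H \<theta> b A k (u j) \<le> (1/4 + \<epsilon>) * ?h (u j)" using j(1) by linarith
  from that[OF u_test u_supp j(2) this] show thesis .
qed

end

section \<open>Sharpness of the constant and of the weight\<close>

lemma eventually_at_right_0D:
  assumes "\<forall>\<^sub>F x in at_right (0::real). P x"
  shows "\<exists>d>0. \<forall>x. 0 < x \<longrightarrow> x < d \<longrightarrow> P x"
  using assms unfolding eventually_at_right_field .

context hardy_setting begin

text \<open>The iterated logarithm tends to zero at the vertex, so there is room for an arbitrarily long interval of length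
  \<open>T\<close> in the variable \<open>1 / X\<^sub>k\<^sub>+\<^sub>1\<close> within any neighbourhood of the vertex.\<close>

lemma near_optimal:
  assumes k1: "k \<ge> 1" and \<epsilon>: "\<epsilon> > 0" and \<delta>: "\<delta> > 0"
  obtains u e where "u \<in> test_functions U" "e > 0" "\<And>z. u z \<noteq> 0 \<Longrightarrow> e \<le> rad z \<and> rad z \<le> \<delta>"
    "hardy_term H A (\<lambda>\<rho>. (Plog k \<rho>)\<^sup>2) u > 0"
    "I_functional H \<theta> b A k u \<le> (1/4 + \<epsilon>) * hardy_term H A (\<lambda>\<rho>. (Plog k \<rho>)\<^sup>2) u"
proof -
  obtain d0 where d0: "d0 > 0" "ball 0 d0 \<subseteq> U" by (rule openE[OF U_open U0])
  obtain c0 where c0: "c0 > 0" "\<And>z. c0 * norm z \<le> rad z" using is_norm_ge_norm[OF rad_norm] by blast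
  \<comment> \<open>The approximants live in \<open>rad z \<le> 3 * r2\<close>, slightly more than the profile itself.\<close>
  define r2 where "r2 = min (min (c0 * d0) \<delta>) D / 4"
  have r2: "r2 > 0" "3 * r2 < c0 * d0" "3 * r2 < \<delta>" "r2 < D"
    using c0(1) d0(1) \<delta> D_pos by (auto simp: r2_def min_def)
  have in_U: "z \<in> U" if "rad z \<le> 3 * r2" for z
  proof -
    have "c0 * norm z < c0 * d0" using c0(2)[of z] that r2(2) by linarith
    then have "z \<in> ball 0 d0" using c0(1) by simp
    then show ?thesis using d0(2) by blast
  qed
  obtain B B' F :: "real \<Rightarrow> real" and lam :: real where B:
    "smooth_on UNIV B" "\<And>x. (B has_real_derivative B' x) (at x)" "continuous_on UNIV B'"
    "\<And>x. x \<in> {0<..<1} \<Longrightarrow> B x > 0" "\<And>x. x \<notin> {0<..<1} \<Longrightarrow> B x = 0" "\<And>x. x \<notin> {0<..<1} \<Longrightarrow> B' x = 0"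
    "\<And>x. (F has_real_derivative (B' x)\<^sup>2 - lam * (B x)\<^sup>2) (at x)" "\<And>x. x \<notin> {0<..<1} \<Longrightarrow> F x = 0"
    by (rule bump_exists) (rule that)
  \<comment> \<open>The summand 1 makes \<open>lam / T\<^sup>2 < \<epsilon>\<close> strict and \<open>T\<close> positive.\<close>
  define T where "T = sqrt (\<bar>lam\<bar> / \<epsilon>) + 1"
  have T: "T > 0" using \<epsilon> by (simp add: T_def add_nonneg_pos)
  have "lam / T\<^sup>2 < \<epsilon>"
  proof -
    have "0 \<le> sqrt (\<bar>lam\<bar> / \<epsilon>)" using \<epsilon> by simp
    then have "(sqrt (\<bar>lam\<bar> / \<epsilon>))\<^sup>2 < T\<^sup>2" unfolding T_def by (intro power_strict_mono) auto
    then have "\<bar>lam\<bar> / \<epsilon> < T\<^sup>2" using \<epsilon> by simp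
    then have "\<bar>lam\<bar> < \<epsilon> * T\<^sup>2" using \<epsilon> by (simp add: field_simps)
    then show ?thesis using T by (simp add: divide_less_eq)
  qed
  define l0 where "l0 = 1 / Xlog (Suc k) (r2 / D)"
  have l0: "l0 > 0" unfolding l0_def using r2 D_pos by (intro divide_pos_pos Xlog_pos) auto
  have "0 < 1 / (l0 + T)" using l0 T by simp
  from eventually_at_right_0D[OF order_tendstoD(2)[OF Xlog_tendsto_0[of "Suc k"] this]]
  obtain d1 where d1: "d1 > 0" "\<And>x. 0 < x \<Longrightarrow> x < d1 \<Longrightarrow> Xlog (Suc k) x < 1 / (l0 + T)"
    by blast
  define r1 where "r1 = min (d1 * D) r2 / 2"
  have r1: "0 < r1" "r1 < r2" "r1 < d1 * D" using d1(1) D_pos r2(1) by (auto simp: r1_def min_def)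
  have v1: "l0 + T \<le> 1 / Xlog (Suc k) (r1 / D)"
  proof -
    have rD: "0 < r1 / D" "r1 / D < d1" "r1 / D \<le> 1" using r1 r2 D_pos by (auto simp: field_simps)
    have "0 < Xlog (Suc k) (r1 / D)" by (rule Xlog_pos[OF rD(1,3)])
    moreover have "Xlog (Suc k) (r1 / D) < 1 / (l0 + T)" by (rule d1(2)[OF rD(1,2)])
    ultimately show ?thesis using l0 T by (simp add: field_simps del: Xlog.simps)
  qed
  define e where "e = sin \<theta> * r1 / 2"
  have e: "e > 0" "2 * e \<le> sin \<theta> * r1" using sin_pos r1 by (simp_all add: e_def)
  obtain cut where cut: "smooth_on UNIV cut" "\<And>y. y \<le> e \<Longrightarrow> cut y = 0" "\<And>y. y \<ge> 2 * e \<Longrightarrow> cut y = (1::real)"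
    using smooth_step[OF e(1)] by metis
  interpret near_optimizer H b \<theta> U k r1 r2 T l0 lam e B B' F cut
    by unfold_locales (use r1 r2 in_U T v1 l0_def B e cut in auto)
  obtain u where u: "u \<in> test_functions U" "\<And>z. u z \<noteq> 0 \<Longrightarrow> e \<le> snd z \<and> rad z \<le> 3 * r2"
    "hardy_term H A (\<lambda>\<rho>. (Plog k \<rho>)\<^sup>2) u > 0"
    "I_functional H \<theta> b A k u \<le> (1/4 + \<epsilon>) * hardy_term H A (\<lambda>\<rho>. (Plog k \<rho>)\<^sup>2) u"
    using near_optimal_function[OF k1 \<open>lam / T\<^sup>2 < \<epsilon>\<close>] by blast
  show thesis
  proof (rule that[OF u(1) e(1) _ u(3,4)])
    fix z assume "u z \<noteq> 0"
    from u(2)[OF this] show "e \<le> rad z \<and> rad z \<le> \<delta>" using abs_snd_le_rad[of z] r2(3) by linarith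
  qed
qed

lemma I_functional_ge:
  assumes u: "u \<in> test_functions U" and k1: "k \<ge> 1"
  shows "1/4 * hardy_term H A (\<lambda>\<rho>. (Plog k \<rho>)\<^sup>2) u \<le> I_functional H \<theta> b A k u"
proof -
  have "{1..k} = insert k {1..<k}" using k1 by auto
  then have eq: "(\<Sum>i=1..k. hardy_term H A (\<lambda>\<rho>. (Plog i \<rho>)\<^sup>2) u) =
    (\<Sum>i=1..<k. hardy_term H A (\<lambda>\<rho>. (Plog i \<rho>)\<^sup>2) u) + hardy_term H A (\<lambda>\<rho>. (Plog k \<rho>)\<^sup>2) u" by simp
  show ?thesis using hardy_inequality[OF u, of k] unfolding eq I_functional_def by (simp add: algebra_simps)
qed

lemma best_constant:
  assumes k1: "k \<ge> 1"
  shows "(INF u \<in> {u \<in> test_functions U. hardy_term H A (\<lambda>\<rho>. (Plog k \<rho>)\<^sup>2) u \<noteq> 0}.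
      ereal (I_functional H \<theta> b A k u / hardy_term H A (\<lambda>\<rho>. (Plog k \<rho>)\<^sup>2) u)) = ereal (1/4)"
proof (rule antisym)
  let ?h = "\<lambda>u. hardy_term H A (\<lambda>\<rho>. (Plog k \<rho>)\<^sup>2) u"
  show "ereal (1/4) \<le> (INF u \<in> {u \<in> test_functions U. ?h u \<noteq> 0}. ereal (I_functional H \<theta> b A k u / ?h u))"
  proof (rule INF_greatest)
    fix u assume "u \<in> {u \<in> test_functions U. ?h u \<noteq> 0}"
    then have u: "u \<in> test_functions U" "?h u > 0"
      using hardy_term_nonneg[of "\<lambda>\<rho>. (Plog k \<rho>)\<^sup>2" u] by auto
    show "ereal (1/4) \<le> ereal (I_functional H \<theta> b A k u / ?h u)"
      using I_functional_ge[OF u(1) k1] u(2) by (simp add: field_simps)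
  qed
  show "(INF u \<in> {u \<in> test_functions U. ?h u \<noteq> 0}. ereal (I_functional H \<theta> b A k u / ?h u)) \<le> ereal (1/4)"
  proof (rule ereal_le_epsilon2)
    fix \<epsilon> :: real assume \<epsilon>: "0 < \<epsilon>"
    obtain u e where u: "u \<in> test_functions U" "?h u > 0" "I_functional H \<theta> b A k u \<le> (1/4 + \<epsilon>) * ?h u"
      by (rule near_optimal[OF k1 \<epsilon> zero_less_one]) blast
    have "I_functional H \<theta> b A k u / ?h u \<le> 1/4 + \<epsilon>" using u(2,3) by (simp add: divide_le_eq)
    then show "(INF u \<in> {u \<in> test_functions U. ?h u \<noteq> 0}. ereal (I_functional H \<theta> b A k u / ?h u)) \<le> ereal (1/4) + ereal \<epsilon>"
      by (intro INF_lower2[of u]) (use u in simp_all)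
  qed
qed

text \<open>Near the vertex \<open>X\<^sub>k\<close> to the power \<open>2 - s\<close> is at most \<open>C\<close>, so on a function supported there the modified
  weight dominates the \<open>k\<close>-th Hardy weight with constant 1, while \<open>near_optimal\<close> keeps
  the functional below one half of the \<open>k\<close>-th Hardy term.\<close>

lemma no_smaller_power:
  assumes k1: "k \<ge> 1" and s: "s < 2" and C: "C > 0"
  shows "\<exists>u\<in>test_functions U. \<not> C * hardy_term H A (\<lambda>\<rho>. (Plog (k - 1) \<rho>)\<^sup>2 * Xlog k \<rho> powr s) u
            \<le> I_functional H \<theta> b A k u"
proof -
  let ?w = "\<lambda>\<rho>. (Plog (k - 1) \<rho>)\<^sup>2 * Xlog k \<rho> powr s"
  have "0 < C powr (1 / (2 - s))" using C by simp
  from eventually_at_right_0D[OF order_tendstoD(2)[OF Xlog_tendsto_0[of k] this]]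
  obtain d where d: "d > 0" "\<And>x. 0 < x \<Longrightarrow> x < d \<Longrightarrow> Xlog k x < C powr (1 / (2 - s))"
    by blast
  define \<delta> where "\<delta> = d * D / 2"
  have \<delta>: "\<delta> > 0" using d(1) D_pos by (simp add: \<delta>_def)
  obtain u e where u: "u \<in> test_functions U" "e > 0" "\<And>z. u z \<noteq> 0 \<Longrightarrow> e \<le> rad z \<and> rad z \<le> \<delta>"
    "hardy_term H A (\<lambda>\<rho>. (Plog k \<rho>)\<^sup>2) u > 0"
    "I_functional H \<theta> b A k u \<le> (1/4 + 1/4) * hardy_term H A (\<lambda>\<rho>. (Plog k \<rho>)\<^sup>2) u"
    by (rule near_optimal[OF k1 _ \<delta>, of "1/4"]) simp_all
  have XC: "Xlog k (rad z / D) powr (2 - s) \<le> C" if z: "z \<in> A" "u z \<noteq> 0" for z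
  proof -
    have r: "rad z / D < d" using u(3)[OF z(2)] mult_pos_pos[OF d(1) D_pos] D_pos by (simp add: \<delta>_def field_simps)
    have "Xlog k (rad z / D) powr (2 - s) \<le> (C powr (1 / (2 - s))) powr (2 - s)"
    proof (rule powr_mono2)
      show "0 \<le> Xlog k (rad z / D)" using Xlog_pos[of "rad z / D" k] rho_bounds[OF z(1)] by simp
      show "Xlog k (rad z / D) \<le> C powr (1 / (2 - s))" using d(2)[OF rho_bounds(1)[OF z(1)] r] by simp
    qed (use s in simp)
    also have "\<dots> = C" using C s by (simp add: powr_powr)
    finally show ?thesis .
  qed
  have adm: "BC u" using admissible_BC(1)[OF test_function_admissible[OF u(1)]] .
  have cont_u: "continuous_on UNIV u" by (rule test_function_grad(3)[OF u(1)])
  have Xcont: "continuous_on A (\<lambda>z. Xlog k (rad z / D) powr s)"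
  proof (rule continuous_on_powr)
    have "continuous_on {0<..<1} (Xlog k)"
      by (intro continuous_at_imp_continuous_on ballI DERIV_isCont[OF DERIV_Xlog]) auto
    then show "continuous_on A (\<lambda>z. Xlog k (rad z / D))"
      by (rule continuous_on_compose2)
         (use rho_bounds D_pos in \<open>auto intro!: continuous_on_divide BC_cont[OF BC_rad] continuous_on_const\<close>)
    show "\<forall>z\<in>A. Xlog k (rad z / D) \<noteq> 0"
    proof
      fix z assume "z \<in> A"
      then show "Xlog k (rad z / D) \<noteq> 0" using Xlog_pos[of "rad z / D" k] rho_bounds[of z] by simp
    qed
  qed (rule continuous_on_const)
  obtain Cu where Cu: "\<And>z. z \<in> A \<Longrightarrow> \<bar>(u z)\<^sup>2\<bar> \<le> Cu" using BC_power[OF adm, of 2] unfolding BC_def by blast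
  have wBC: "BC (\<lambda>z. ?w (rad z / D) * (u z)\<^sup>2)"
  proof (rule BC_I)
    show "continuous_on A (\<lambda>z. ?w (rad z / D) * (u z)\<^sup>2)"
      by (intro continuous_on_mult continuous_on_power Xcont BC_cont[OF BC_Plog] BC_cont[OF adm])
    fix z assume z: "z \<in> A"
    let ?X = "Xlog k (rad z / D)"
    show "\<bar>?w (rad z / D) * (u z)\<^sup>2\<bar> \<le> (1 * Xlog k (e / D) powr (- \<bar>s\<bar>)) * Cu"
    proof (cases "u z = 0")
      case True
      then show ?thesis using Cu[OF z] by simp
    next
      case False
      have rz: "0 < rad z / D" "rad z / D \<le> 1" using rho_bounds[OF z] by auto
      have eD: "0 < e / D" "e / D \<le> rad z / D" using u(2) u(3)[OF False] D_pos by (auto simp: divide_right_mono)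
      have X: "0 < Xlog k (e / D)" "0 < ?X" "?X \<le> 1"
        using Xlog_pos[of "e / D" k] Xlog_pos[OF rz, of k] Xlog_le_1[OF rz, of k] eD rz(2) by auto
      have le: "Xlog k (e / D) \<le> ?X"
      proof (cases "e / D = rad z / D")
        case False
        then have "e / D < rad z / D" using eD(2) by (simp only: less_le simp_thms)
        from Xlog_strict_mono[OF eD(1) this rz(2), of k] show ?thesis by simp
      qed (simp only: order_refl)
      have "?X powr s \<le> ?X powr (- \<bar>s\<bar>)" using X by (intro powr_mono') auto
      also have "\<dots> \<le> Xlog k (e / D) powr (- \<bar>s\<bar>)" using X le by (intro powr_mono2') auto
      finally have "?X powr s \<le> Xlog k (e / D) powr (- \<bar>s\<bar>)" .
      moreover have "(Plog (k - 1) (rad z / D))\<^sup>2 \<le> 1"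
        using Plog_pos[OF rz, of "k - 1"] Plog_le_1[OF rz, of "k - 1"] by (intro power_le_one) auto
      ultimately have "\<bar>?w (rad z / D)\<bar> \<le> 1 * Xlog k (e / D) powr (- \<bar>s\<bar>)"
        unfolding abs_mult by (intro mult_mono) auto
      then show ?thesis unfolding abs_mult[of _ "(u z)\<^sup>2"] using Cu[OF z] by (intro mult_mono) auto
    qed
  qed
  have wi: "set_integrable lborel A (\<lambda>z. ?w (rad z / D) / (rad z)\<^sup>2 * (u z)\<^sup>2)"
  proof (rule integrable_of_BC, rule BC_cong[OF _ wBC])
    fix z assume "z \<in> A"
    then have "rad z > 0" by (intro cone_rad_pos A_cone)
    then show "?w (rad z / D) / (rad z)\<^sup>2 * (u z)\<^sup>2 * (rad z)\<^sup>2 = ?w (rad z / D) * (u z)\<^sup>2" by simp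
  qed
  have "hardy_term H A (\<lambda>\<rho>. (Plog k \<rho>)\<^sup>2) u \<le> (LINT z:A|lborel. C * (?w (rad z / D) / (rad z)\<^sup>2 * (u z)\<^sup>2))"
    unfolding hardy_term_eq
  proof (rule set_integral_mono)
    show "set_integrable lborel A (\<lambda>z. (Plog k (rad z / D))\<^sup>2 / (rad z)\<^sup>2 * (u z)\<^sup>2)"
      by (intro hardy_term_integrable adm BC_power BC_Plog)
    show "set_integrable lborel A (\<lambda>z. C * (?w (rad z / D) / (rad z)\<^sup>2 * (u z)\<^sup>2))"
      by (rule set_integrable_mult_right) (rule wi)
    fix z assume z: "z \<in> A"
    show "(Plog k (rad z / D))\<^sup>2 / (rad z)\<^sup>2 * (u z)\<^sup>2 \<le> C * (?w (rad z / D) / (rad z)\<^sup>2 * (u z)\<^sup>2)"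
    proof (cases "u z = 0")
      case False
      let ?X = "Xlog k (rad z / D)" and ?P = "Plog (k - 1) (rad z / D)"
      have X: "?X > 0" using Xlog_pos[of "rad z / D" k] rho_bounds[OF z] by simp
      have "Plog k (rad z / D) = ?P * ?X" using Plog_Suc[of "k - 1"] k1 by simp
      moreover have "?X\<^sup>2 = ?X powr s * ?X powr (2 - s)" using X by (simp flip: powr_add)
      ultimately have "(Plog k (rad z / D))\<^sup>2 = ?w (rad z / D) * ?X powr (2 - s)"
        by (simp add: power_mult_distrib mult.assoc)
      also have "\<dots> \<le> ?w (rad z / D) * C" using XC[OF z False] by (intro mult_left_mono) auto
      finally have "(Plog k (rad z / D))\<^sup>2 * ((u z)\<^sup>2 / (rad z)\<^sup>2) \<le> (?w (rad z / D) * C) * ((u z)\<^sup>2 / (rad z)\<^sup>2)"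
        by (rule mult_right_mono) simp
      then show ?thesis by (simp add: mult_ac)
    qed simp
  qed
  also have "\<dots> = C * hardy_term H A ?w u" unfolding hardy_term_eq by (rule set_integral_mult_right)
  finally have "hardy_term H A (\<lambda>\<rho>. (Plog k \<rho>)\<^sup>2) u \<le> C * hardy_term H A ?w u" .
  moreover have "\<not> y \<le> z" if "x \<le> y" "0 < x" "z \<le> (1/4 + 1/4) * x" for x y z :: real
  proof -
    have "(1/4 + 1/4) * x = x / 2" by simp
    then show ?thesis using that by simp
  qed
  ultimately have "\<not> C * hardy_term H A ?w u \<le> I_functional H \<theta> b A k u" using u(4,5) by blast
  then show ?thesis using u(1) by blast
qed

end

theorem theorem3:
  fixes H :: "real ^ 'n \<Rightarrow> real" and b \<theta> :: real and U U\<theta> :: "((real ^ 'n) \<times> real) set"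
  assumes "is_norm H" and "Ck_on 2 H (- {0})" and "strictly_convex (\<lambda>\<xi>. (H \<xi>)\<^sup>2)"
    and "2 \<le> b" and "b < real CARD('n) + 1"
    and "0 < \<theta>" and "\<theta> < pi / 2"
    and "open U" and "connected U" and "bounded U" and "0 \<in> U"
    and "U\<theta> = U \<inter> Finsler_cone H \<theta>"
  shows
    "(\<forall>u\<in>test_functions U.
        summable (\<lambda>i. hardy_term H U\<theta> (\<lambda>\<rho>. (Plog (Suc i) \<rho>)\<^sup>2) u) \<and>
        K_const \<theta> CARD('n) b * boundary_term H \<theta> u
          + (b - 2)\<^sup>2 / 4 * hardy_term H U\<theta> (\<lambda>_. 1) u
          + 1/4 * (\<Sum>i. hardy_term H U\<theta> (\<lambda>\<rho>. (Plog (Suc i) \<rho>)\<^sup>2) u)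
        \<le> energy H U\<theta> u)
     \<and> (\<forall>k\<ge>1.
        (INF u \<in> {u \<in> test_functions U. hardy_term H U\<theta> (\<lambda>\<rho>. (Plog k \<rho>)\<^sup>2) u \<noteq> 0}.
           ereal (I_functional H \<theta> b U\<theta> k u / hardy_term H U\<theta> (\<lambda>\<rho>. (Plog k \<rho>)\<^sup>2) u))
        = ereal (1/4))
     \<and> (\<forall>k\<ge>1. \<forall>s<2. \<forall>C>0. \<exists>u\<in>test_functions U.
        \<not> C * hardy_term H U\<theta> (\<lambda>\<rho>. (Plog (k - 1) \<rho>)\<^sup>2 * Xlog k \<rho> powr s) u
            \<le> I_functional H \<theta> b U\<theta> k u)"
proof -
  interpret hardy_setting H b \<theta> U
    by unfold_locales (use assms in simp_all)
  have A: "U\<theta> = A" using assms(12) by (simp add: A_def)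
  have n: "CARD('n) = DIM(real ^ 'n)" by simp
  show ?thesis unfolding A n
    by (intro conjI ballI allI impI; (rule hardy_series best_constant no_smaller_power; assumption))
qed

end
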